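(* Let $T$ be a $U_q$-tilting module. The (cellular) algebra $\mathrm{End}_{U_q}(T)$ is semisimple if and only if $T$ is a semisimple $U_q$-module.
   Context: Setting. $\mathbb K$ is a field, $\mathbb K^*=\mathbb K\setminus\{0,-1\}$ if $\mathrm{char}(\mathbb K)>2$ and $\mathbb K^*=\mathbb K\setminus\{0\}$ otherwise, and $q\in\mathbb K^*$. $U_q$ is the quantum enveloping algebra over $\mathbb K$ attached to the Cartan matrix of a finite root system (Lusztig's divided power form specialized at $v=q$), with dominant integral weights $X^+$. The values $q=\pm1$ do not count as roots of unity; if $q$ is a root of unity it is assumed primitive of odd order $l$, with $l$ prime to $3$ in type $G_2$. All $U_q$-modules are finite-dimensional of type $1$. $\Delta_q(\lambda)$ and $\nabla_q(\lambda)$ ($\lambda\in X^+$) are the Weyl and dual Weyl modules of highest weight $\lambda$. A $U_q$-tilting module is a module having both a finite filtration with subquotients Weyl modules and a finite filtration with subquotients dual Weyl modules. *)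

theory Defs
  imports
    "HOL-Analysis.Euclidean_Space"
    "HOL-Library.Poly_Mapping"
    "HOL-Computational_Algebra.Polynomial_Factorial"
    "HOL-Algebra.QuotRing"
    "HOL-Algebra.Module"
    "HOL-Algebra.Generated_Rings"
begin

section \<open>Modules over a not necessarily commutative ring\<close>

text \<open>The library locale \<open>module\<close> requires a commutative ring of scalars. The record type and
  the locale \<open>submodule\<close> are reused; the record fields \<open>mult\<close> and \<open>one\<close> play no role for modules.\<close>

locale left_module = R?: ring R + M?: abelian_group M
  for R :: "('r, 's) ring_scheme" (structure) and M :: "('r, 'm, 't) module_scheme" (structure) +
  assumes smult_closed:
      "\<lbrakk>a \<in> carrier R; x \<in> carrier M\<rbrakk> \<Longrightarrow> a \<odot>\<^bsub>M\<^esub> x \<in> carrier M"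
    and smult_l_distr:
      "\<lbrakk>a \<in> carrier R; b \<in> carrier R; x \<in> carrier M\<rbrakk>
        \<Longrightarrow> (a \<oplus>\<^bsub>R\<^esub> b) \<odot>\<^bsub>M\<^esub> x = a \<odot>\<^bsub>M\<^esub> x \<oplus>\<^bsub>M\<^esub> b \<odot>\<^bsub>M\<^esub> x"
    and smult_r_distr:
      "\<lbrakk>a \<in> carrier R; x \<in> carrier M; y \<in> carrier M\<rbrakk>
        \<Longrightarrow> a \<odot>\<^bsub>M\<^esub> (x \<oplus>\<^bsub>M\<^esub> y) = a \<odot>\<^bsub>M\<^esub> x \<oplus>\<^bsub>M\<^esub> a \<odot>\<^bsub>M\<^esub> y"
    and smult_assoc:
      "\<lbrakk>a \<in> carrier R; b \<in> carrier R; x \<in> carrier M\<rbrakk>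
        \<Longrightarrow> (a \<otimes>\<^bsub>R\<^esub> b) \<odot>\<^bsub>M\<^esub> x = a \<odot>\<^bsub>M\<^esub> (b \<odot>\<^bsub>M\<^esub> x)"
    and smult_one:
      "x \<in> carrier M \<Longrightarrow> \<one>\<^bsub>R\<^esub> \<odot>\<^bsub>M\<^esub> x = x"

definition module_hom_set ::
  "('r, 's) ring_scheme \<Rightarrow> ('r, 'm) module \<Rightarrow> ('r, 'n) module \<Rightarrow> ('m \<Rightarrow> 'n) set" where
  "module_hom_set R M N =
     {h \<in> carrier M \<rightarrow>\<^sub>E carrier N.
        (\<forall>x\<in>carrier M. \<forall>y\<in>carrier M. h (x \<oplus>\<^bsub>M\<^esub> y) = h x \<oplus>\<^bsub>N\<^esub> h y) \<and>
        (\<forall>a\<in>carrier R. \<forall>x\<in>carrier M. h (a \<odot>\<^bsub>M\<^esub> x) = a \<odot>\<^bsub>N\<^esub> h x)}"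

definition isomorphic_modules ::
  "('r, 's) ring_scheme \<Rightarrow> ('r, 'm) module \<Rightarrow> ('r, 'n) module \<Rightarrow> bool" where
  "isomorphic_modules R M N \<longleftrightarrow> (\<exists>h\<in>module_hom_set R M N. bij_betw h (carrier M) (carrier N))"

definition endomorphism_ring :: "('r, 's) ring_scheme \<Rightarrow> ('r, 'm) module \<Rightarrow> ('m \<Rightarrow> 'm) ring" where
  "endomorphism_ring R M =
     \<lparr>carrier = module_hom_set R M M,
      mult = (\<lambda>f g. compose (carrier M) f g),
      one = (\<lambda>x\<in>carrier M. x),
      zero = (\<lambda>x\<in>carrier M. \<zero>\<^bsub>M\<^esub>),
      add = (\<lambda>f g. \<lambda>x\<in>carrier M. f x \<oplus>\<^bsub>M\<^esub> g x)\<rparr>"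

definition quotient_module :: "('r, 'm) module \<Rightarrow> 'm set \<Rightarrow> ('r, 'm set) module" where
  "quotient_module M N =
     \<lparr>carrier = a_rcosets\<^bsub>M\<^esub> N, mult = undefined, one = undefined,
      zero = N, add = set_add M,
      smult = (\<lambda>a X. \<Union>x\<in>X. N +>\<^bsub>M\<^esub> (a \<odot>\<^bsub>M\<^esub> x))\<rparr>"

text \<open>A finite filtration all of whose subquotients satisfy \<open>P\<close>.\<close>

definition has_filtration ::
  "('r, 's) ring_scheme \<Rightarrow> ('r, 'm) module \<Rightarrow> (('r, 'm set) module \<Rightarrow> bool) \<Rightarrow> bool" where
  "has_filtration R M P \<longleftrightarrow>
     (\<exists>(k::nat) N. N 0 = {\<zero>\<^bsub>M\<^esub>} \<and> N k = carrier M \<and>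
        (\<forall>j\<le>k. submodule (N j) R M) \<and>
        (\<forall>j<k. N j \<subseteq> N (Suc j) \<and> P (quotient_module (M\<lparr>carrier := N (Suc j)\<rparr>) (N j))))"

definition simple_submodule :: "('r, 's) ring_scheme \<Rightarrow> ('r, 'm) module \<Rightarrow> 'm set \<Rightarrow> bool" where
  "simple_submodule R M N \<longleftrightarrow>
     submodule N R M \<and> N \<noteq> {\<zero>\<^bsub>M\<^esub>} \<and>
     (\<forall>N'. submodule N' R M \<and> N' \<subseteq> N \<longrightarrow> N' = {\<zero>\<^bsub>M\<^esub>} \<or> N' = N)"

definition internal_direct_sum :: "('r, 'm) module \<Rightarrow> 'j set \<Rightarrow> ('j \<Rightarrow> 'm set) \<Rightarrow> bool" where
  "internal_direct_sum M J N \<longleftrightarrow>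
     (\<forall>j\<in>J. subgroup (N j) (add_monoid M)) \<and>
     (\<forall>m\<in>carrier M. \<exists>!f. (\<forall>j\<in>J. f j \<in> N j) \<and> (\<forall>j. j \<notin> J \<longrightarrow> f j = \<zero>\<^bsub>M\<^esub>) \<and>
        finite {j. f j \<noteq> \<zero>\<^bsub>M\<^esub>} \<and> m = (\<Oplus>\<^bsub>M\<^esub>j\<in>{j. f j \<noteq> \<zero>\<^bsub>M\<^esub>}. f j))"

definition semisimple_module :: "('r, 's) ring_scheme \<Rightarrow> ('r, 'm) module \<Rightarrow> bool" where
  "semisimple_module R M \<longleftrightarrow>
     (\<exists>S. (\<forall>N\<in>S. simple_submodule R M N) \<and> internal_direct_sum M S (\<lambda>N. N))"

definition regular_module :: "'r ring \<Rightarrow> ('r, 'r) module" where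
  "regular_module A =
     \<lparr>carrier = carrier A, mult = mult A, one = one A, zero = zero A, add = add A, smult = mult A\<rparr>"

definition semisimple_ring :: "'r ring \<Rightarrow> bool" where
  "semisimple_ring A \<longleftrightarrow> semisimple_module A (regular_module A)"


section \<open>Root systems and weights\<close>

definition coroot_pairing :: "'e::euclidean_space \<Rightarrow> 'e \<Rightarrow> real" where
  "coroot_pairing x \<beta> = 2 * inner x \<beta> / inner \<beta> \<beta>"

definition root_system :: "'e::euclidean_space set \<Rightarrow> bool" where
  "root_system \<Phi> \<longleftrightarrow>
     finite \<Phi> \<and> span \<Phi> = UNIV \<and> 0 \<notin> \<Phi> \<and>
     (\<forall>\<beta>\<in>\<Phi>. \<forall>\<gamma>\<in>\<Phi>. \<gamma> - coroot_pairing \<gamma> \<beta> *\<^sub>R \<beta> \<in> \<Phi>) \<and>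
     (\<forall>\<beta>\<in>\<Phi>. \<forall>\<gamma>\<in>\<Phi>. coroot_pairing \<gamma> \<beta> \<in> \<int>) \<and>
     (\<forall>\<beta>\<in>\<Phi>. \<forall>c. c *\<^sub>R \<beta> \<in> \<Phi> \<longrightarrow> c = 1 \<or> c = -1)"

definition simple_roots :: "'e::euclidean_space set \<Rightarrow> ('i::finite \<Rightarrow> 'e) \<Rightarrow> bool" where
  "simple_roots \<Phi> \<alpha> \<longleftrightarrow>
     inj \<alpha> \<and> range \<alpha> \<subseteq> \<Phi> \<and> independent (range \<alpha>) \<and>
     (\<forall>\<beta>\<in>\<Phi>. \<exists>c::'i \<Rightarrow> nat. \<beta> = (\<Sum>i\<in>UNIV. real (c i) *\<^sub>R \<alpha> i) \<or>
                              \<beta> = - (\<Sum>i\<in>UNIV. real (c i) *\<^sub>R \<alpha> i))"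

text \<open>The floor only converts the (integral) real pairing to type \<open>int\<close>. The index order is the
  one for which \<open>d\<^sub>i a\<^sub>i\<^sub>j\<close> is symmetric with \<open>d\<^sub>i\<close> proportional to \<open>(\<alpha>\<^sub>i, \<alpha>\<^sub>i)\<close>.\<close>

definition weight_coeff :: "('i \<Rightarrow> 'e::euclidean_space) \<Rightarrow> 'e \<Rightarrow> 'i \<Rightarrow> int" where
  "weight_coeff \<alpha> \<mu> i = \<lfloor>coroot_pairing \<mu> (\<alpha> i)\<rfloor>"

definition cartan_matrix :: "('i \<Rightarrow> 'e::euclidean_space) \<Rightarrow> 'i \<Rightarrow> 'i \<Rightarrow> int" where
  "cartan_matrix \<alpha> i j = weight_coeff \<alpha> (\<alpha> j) i"

text \<open>The symmetrizers of a finite Cartan matrix are, on each connected component, the positive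
  integer multiples of one of them; hence the pointwise minimum is the minimal symmetrizer.\<close>

definition symmetrizer :: "('i \<Rightarrow> 'e::euclidean_space) \<Rightarrow> 'i \<Rightarrow> nat" where
  "symmetrizer \<alpha> i =
     (LEAST m. \<exists>d::'i \<Rightarrow> nat. (\<forall>j. d j > 0) \<and>
        (\<forall>j k. int (d j) * cartan_matrix \<alpha> j k = int (d k) * cartan_matrix \<alpha> k j) \<and> d i = m)"

definition weights :: "('i \<Rightarrow> 'e::euclidean_space) \<Rightarrow> 'e set" where
  "weights \<alpha> = {\<mu>. \<forall>i. coroot_pairing \<mu> (\<alpha> i) \<in> \<int>}"

definition dominant_weights :: "('i \<Rightarrow> 'e::euclidean_space) \<Rightarrow> 'e set" where
  "dominant_weights \<alpha> = {\<mu>\<in>weights \<alpha>. \<forall>i. coroot_pairing \<mu> (\<alpha> i) \<ge> 0}"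


section \<open>Monoid algebras\<close>

definition monoid_algebra :: "('a, 'b) monoid_scheme \<Rightarrow> ('a \<Rightarrow>\<^sub>0 'k::comm_ring_1) ring" where
  "monoid_algebra G =
     \<lparr>carrier = {f. Poly_Mapping.keys f \<subseteq> carrier G},
      mult = (\<lambda>f g. \<Sum>x\<in>Poly_Mapping.keys f. \<Sum>y\<in>Poly_Mapping.keys g.
         Poly_Mapping.single (x \<otimes>\<^bsub>G\<^esub> y) (Poly_Mapping.lookup f x * Poly_Mapping.lookup g y)),
      one = Poly_Mapping.single \<one>\<^bsub>G\<^esub> 1,
      zero = 0,
      add = (+)\<rparr>"

text \<open>The linear extension of a map between basis elements.\<close>

definition linear_ext :: "('a \<Rightarrow> 'b) \<Rightarrow> ('a \<Rightarrow>\<^sub>0 'k::comm_ring_1) \<Rightarrow> ('b \<Rightarrow>\<^sub>0 'k)" where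
  "linear_ext g f = (\<Sum>x\<in>Poly_Mapping.keys f. Poly_Mapping.single (g x) (Poly_Mapping.lookup f x))"


section \<open>The quantum enveloping algebra over \<open>\<rat>(v)\<close>\<close>

type_synonym Qv = "rat poly fract"

definition vv :: Qv where
  "vv = to_fract [:0, 1:]"

definition v_at :: "('i \<Rightarrow> 'e::euclidean_space) \<Rightarrow> 'i \<Rightarrow> Qv" where
  "v_at \<alpha> i = vv ^ symmetrizer \<alpha> i"

definition qint :: "('i \<Rightarrow> 'e::euclidean_space) \<Rightarrow> 'i \<Rightarrow> int \<Rightarrow> Qv" where
  "qint \<alpha> i a = (v_at \<alpha> i powi a - v_at \<alpha> i powi (- a)) / (v_at \<alpha> i - inverse (v_at \<alpha> i))"

definition qfact :: "('i \<Rightarrow> 'e::euclidean_space) \<Rightarrow> 'i \<Rightarrow> nat \<Rightarrow> Qv" where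
  "qfact \<alpha> i r = (\<Prod>s=1..r. qint \<alpha> i (int s))"

definition qbinom :: "('i \<Rightarrow> 'e::euclidean_space) \<Rightarrow> 'i \<Rightarrow> int \<Rightarrow> nat \<Rightarrow> Qv" where
  "qbinom \<alpha> i a t = (\<Prod>s=1..t. qint \<alpha> i (a - int s + 1) / qint \<alpha> i (int s))"

datatype 'i gen = GE 'i | GF 'i | GK 'i | GKinv 'i

abbreviation free_algebra :: "('i gen list \<Rightarrow>\<^sub>0 Qv) ring" where
  "free_algebra \<equiv> monoid_algebra \<lparr>carrier = UNIV, mult = (@), one = []\<rparr>"

abbreviation word :: "Qv \<Rightarrow> 'i gen list \<Rightarrow> ('i gen list \<Rightarrow>\<^sub>0 Qv)" where
  "word c w \<equiv> Poly_Mapping.single w c"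

definition serre :: "('i \<Rightarrow> 'i gen) \<Rightarrow> ('i \<Rightarrow> 'e::euclidean_space) \<Rightarrow> 'i \<Rightarrow> 'i \<Rightarrow> ('i gen list \<Rightarrow>\<^sub>0 Qv)" where
  "serre X \<alpha> i j =
     (let n = nat (1 - cartan_matrix \<alpha> i j) in
      \<Sum>s\<le>n. word ((-1) ^ s * qbinom \<alpha> i (int n) s)
                  (replicate (n - s) (X i) @ [X j] @ replicate s (X i)))"

definition uv_relations :: "('i \<Rightarrow> 'e::euclidean_space) \<Rightarrow> ('i gen list \<Rightarrow>\<^sub>0 Qv) set" where
  "uv_relations \<alpha> =
     (\<Union>i. \<Union>j.
       {word 1 [GK i, GK j] - word 1 [GK j, GK i],
        word 1 [GK i, GKinv i] - word 1 [],
        word 1 [GKinv i, GK i] - word 1 [],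
        word 1 [GK i, GE j]
          - word (vv powi (int (symmetrizer \<alpha> i) * cartan_matrix \<alpha> i j)) [GE j, GK i],
        word 1 [GK i, GF j]
          - word (vv powi (- (int (symmetrizer \<alpha> i) * cartan_matrix \<alpha> i j))) [GF j, GK i],
        word 1 [GE i, GF j] - word 1 [GF j, GE i]
          - (if i = j
             then word (1 / (v_at \<alpha> i - inverse (v_at \<alpha> i))) [GK i]
                  - word (1 / (v_at \<alpha> i - inverse (v_at \<alpha> i))) [GKinv i]
             else 0)}) \<union>
     {serre X \<alpha> i j | X i j. X \<in> {GE, GF} \<and> i \<noteq> j}"

definition uv_ideal :: "('i \<Rightarrow> 'e::euclidean_space) \<Rightarrow> ('i gen list \<Rightarrow>\<^sub>0 Qv) set" where
  "uv_ideal \<alpha> = Idl\<^bsub>free_algebra\<^esub> (uv_relations \<alpha>)"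

type_synonym 'i uv_elem = "('i gen list \<Rightarrow>\<^sub>0 Qv) set"

definition uv :: "('i \<Rightarrow> 'e::euclidean_space) \<Rightarrow> 'i uv_elem ring" where
  "uv \<alpha> = free_algebra Quot (uv_ideal \<alpha>)"

definition uv_class :: "('i \<Rightarrow> 'e::euclidean_space) \<Rightarrow> ('i gen list \<Rightarrow>\<^sub>0 Qv) \<Rightarrow> 'i uv_elem" where
  "uv_class \<alpha> x = uv_ideal \<alpha> +>\<^bsub>free_algebra\<^esub> x"

definition uv_scalar :: "('i \<Rightarrow> 'e::euclidean_space) \<Rightarrow> Qv \<Rightarrow> 'i uv_elem" where
  "uv_scalar \<alpha> c = uv_class \<alpha> (word c [])"

definition uv_K :: "('i \<Rightarrow> 'e::euclidean_space) \<Rightarrow> 'i \<Rightarrow> 'i uv_elem" where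
  "uv_K \<alpha> i = uv_class \<alpha> (word 1 [GK i])"

definition uv_Kinv :: "('i \<Rightarrow> 'e::euclidean_space) \<Rightarrow> 'i \<Rightarrow> 'i uv_elem" where
  "uv_Kinv \<alpha> i = uv_class \<alpha> (word 1 [GKinv i])"

text \<open>The divided powers \<open>E\<^sub>i\<^sup>r / [r]\<^sub>i!\<close> and \<open>F\<^sub>i\<^sup>r / [r]\<^sub>i!\<close>.\<close>

definition uv_E :: "('i \<Rightarrow> 'e::euclidean_space) \<Rightarrow> 'i \<Rightarrow> nat \<Rightarrow> 'i uv_elem" where
  "uv_E \<alpha> i r = uv_class \<alpha> (word (1 / qfact \<alpha> i r) (replicate r (GE i)))"

definition uv_F :: "('i \<Rightarrow> 'e::euclidean_space) \<Rightarrow> 'i \<Rightarrow> nat \<Rightarrow> 'i uv_elem" where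
  "uv_F \<alpha> i r = uv_class \<alpha> (word (1 / qfact \<alpha> i r) (replicate r (GF i)))"

text \<open>The element \<open>\<Prod>\<^sub>s\<^sub>=\<^sub>1\<^sub>.\<^sub>.\<^sub>t (K\<^sub>i v\<^sub>i\<^sup>1\<^sup>-\<^sup>s - K\<^sub>i\<^sup>-\<^sup>1 v\<^sub>i\<^sup>s\<^sup>-\<^sup>1) / (v\<^sub>i\<^sup>s - v\<^sub>i\<^sup>-\<^sup>s)\<close>, which lies in the
  integral form.\<close>

primrec uv_Kbinom :: "('i \<Rightarrow> 'e::euclidean_space) \<Rightarrow> 'i \<Rightarrow> nat \<Rightarrow> 'i uv_elem" where
  "uv_Kbinom \<alpha> i 0 = \<one>\<^bsub>uv \<alpha>\<^esub>"
| "uv_Kbinom \<alpha> i (Suc t) = uv_Kbinom \<alpha> i t \<otimes>\<^bsub>uv \<alpha>\<^esub>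
     (let w = v_at \<alpha> i; c = w powi (int t + 1) - w powi (- (int t + 1)) in
      uv_class \<alpha> (word (w powi (- int t) / c) [GK i] - word (w powi (int t) / c) [GKinv i]))"


section \<open>Lusztig's integral form and its specialization\<close>

text \<open>The Laurent polynomial \<open>p / v\<^sup>n\<close> with \<open>p \<in> \<int>[v]\<close>.\<close>

definition laurent :: "int poly \<Rightarrow> nat \<Rightarrow> Qv" where
  "laurent p n = to_fract (map_poly of_int p) / vv ^ n"

definition laurent_ring :: "Qv set" where
  "laurent_ring = {laurent p n | p n. True}"

text \<open>The ring homomorphism from \<open>\<int>[v, v\<^sup>-\<^sup>1]\<close> to \<open>\<bbbK>\<close> with \<open>v \<mapsto> q\<close>, for \<open>q \<noteq> 0\<close>.\<close>

definition specialize :: "'k::field \<Rightarrow> Qv \<Rightarrow> 'k" where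
  "specialize q a =
     (THE c. \<exists>p n. a = laurent p n \<and> c = poly (map_poly of_int p) q / q ^ n)"

definition ua :: "('i \<Rightarrow> 'e::euclidean_space) \<Rightarrow> 'i uv_elem ring" where
  "ua \<alpha> = (uv \<alpha>)\<lparr>carrier := generate_ring (uv \<alpha>)
     (uv_scalar \<alpha> ` laurent_ring \<union> range (uv_K \<alpha>) \<union> range (uv_Kinv \<alpha>)
      \<union> {uv_E \<alpha> i r | i r. True} \<union> {uv_F \<alpha> i r | i r. True})\<rparr>"

text \<open>The tensor product \<open>U\<^sub>\<A> \<otimes>\<^sub>\<A> \<bbbK>\<close>: the \<open>\<bbbK>\<close>-vector space with basis \<open>U\<^sub>\<A>\<close>, i.e. the monoid algebra
  of the multiplicative monoid of \<open>U\<^sub>\<A>\<close>, modulo the relations that make \<open>x \<mapsto> [x]\<close>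
  additive and \<open>\<A>\<close>-linear. The linear span of these relations is already a two-sided ideal.\<close>

type_synonym ('i, 'k) uq_elem = "('i uv_elem \<Rightarrow>\<^sub>0 'k) set"

definition uq_ideal ::
  "('i \<Rightarrow> 'e::euclidean_space) \<Rightarrow> 'k::field \<Rightarrow> ('i uv_elem \<Rightarrow>\<^sub>0 'k) set" where
  "uq_ideal \<alpha> q = Idl\<^bsub>monoid_algebra (ua \<alpha>)\<^esub>
     ({Poly_Mapping.single (x \<oplus>\<^bsub>ua \<alpha>\<^esub> y) 1 - Poly_Mapping.single x 1 - Poly_Mapping.single y 1
        | x y. x \<in> carrier (ua \<alpha>) \<and> y \<in> carrier (ua \<alpha>)} \<union>
      {Poly_Mapping.single (uv_scalar \<alpha> a \<otimes>\<^bsub>ua \<alpha>\<^esub> x) 1 - Poly_Mapping.single x (specialize q a)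
        | a x. a \<in> laurent_ring \<and> x \<in> carrier (ua \<alpha>)})"

definition uq :: "('i \<Rightarrow> 'e::euclidean_space) \<Rightarrow> 'k::field \<Rightarrow> ('i, 'k) uq_elem ring" where
  "uq \<alpha> q = monoid_algebra (ua \<alpha>) Quot (uq_ideal \<alpha> q)"

text \<open>The pure tensor \<open>x \<otimes> c\<close>.\<close>

definition uq_tensor ::
  "('i \<Rightarrow> 'e::euclidean_space) \<Rightarrow> 'k::field \<Rightarrow> 'i uv_elem \<Rightarrow> 'k \<Rightarrow> ('i, 'k) uq_elem" where
  "uq_tensor \<alpha> q x c = uq_ideal \<alpha> q +>\<^bsub>monoid_algebra (ua \<alpha>)\<^esub> Poly_Mapping.single x c"

definition uq_scalar ::
  "('i \<Rightarrow> 'e::euclidean_space) \<Rightarrow> 'k::field \<Rightarrow> 'k \<Rightarrow> ('i, 'k) uq_elem" where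
  "uq_scalar \<alpha> q c = uq_tensor \<alpha> q \<one>\<^bsub>ua \<alpha>\<^esub> c"

definition uq_K where "uq_K \<alpha> q i = uq_tensor \<alpha> q (uv_K \<alpha> i) 1"
definition uq_Kinv where "uq_Kinv \<alpha> q i = uq_tensor \<alpha> q (uv_Kinv \<alpha> i) 1"
definition uq_E where "uq_E \<alpha> q i r = uq_tensor \<alpha> q (uv_E \<alpha> i r) 1"
definition uq_F where "uq_F \<alpha> q i r = uq_tensor \<alpha> q (uv_F \<alpha> i r) 1"
definition uq_Kbinom where "uq_Kbinom \<alpha> q i t = uq_tensor \<alpha> q (uv_Kbinom \<alpha> i t) 1"

text \<open>The parameter \<open>q\<close> lies in \<open>\<bbbK>\<^sup>*\<close>; if it is a root of unity (other than \<open>\<plusminus>1\<close>), its order is odd,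
  and prime to 3 if there is a component of type \<open>G\<^sub>2\<close>.\<close>

definition admissible_parameter :: "('i \<Rightarrow> 'e::euclidean_space) \<Rightarrow> 'k::field \<Rightarrow> bool" where
  "admissible_parameter \<alpha> q \<longleftrightarrow>
     q \<noteq> 0 \<and> (CHAR('k) > 2 \<longrightarrow> q \<noteq> -1) \<and>
     (\<forall>l>0. q \<noteq> 1 \<and> q \<noteq> -1 \<and> q ^ l = 1 \<and> (\<forall>m. 0 < m \<and> m < l \<longrightarrow> q ^ m \<noteq> 1) \<longrightarrow>
        odd l \<and> ((\<exists>i j. cartan_matrix \<alpha> i j = -3) \<longrightarrow> coprime l 3))"


section \<open>Finite-dimensional modules of type 1\<close>

type_synonym ('i, 'k, 'm) uq_module = "(('i, 'k) uq_elem, 'm) module"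

definition finite_dimensional ::
  "('i \<Rightarrow> 'e::euclidean_space) \<Rightarrow> 'k::field \<Rightarrow> ('i, 'k, 'm) uq_module \<Rightarrow> bool" where
  "finite_dimensional \<alpha> q M \<longleftrightarrow>
     (\<exists>B. finite B \<and> B \<subseteq> carrier M \<and>
        (\<forall>m\<in>carrier M. \<exists>c. m = (\<Oplus>\<^bsub>M\<^esub>b\<in>B. uq_scalar \<alpha> q (c b) \<odot>\<^bsub>M\<^esub> b)))"

text \<open>The values of the character of \<open>U\<^sub>q\<^sup>0\<close> attached to the weight \<open>\<mu>\<close>.\<close>

definition K_value ::
  "('i \<Rightarrow> 'e::euclidean_space) \<Rightarrow> 'k::field \<Rightarrow> 'e \<Rightarrow> 'i \<Rightarrow> 'k" where
  "K_value \<alpha> q \<mu> i = q powi (int (symmetrizer \<alpha> i) * weight_coeff \<alpha> \<mu> i)"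

definition Kbinom_value ::
  "('i \<Rightarrow> 'e::euclidean_space) \<Rightarrow> 'k::field \<Rightarrow> 'e \<Rightarrow> 'i \<Rightarrow> nat \<Rightarrow> 'k" where
  "Kbinom_value \<alpha> q \<mu> i t = specialize q (qbinom \<alpha> i (weight_coeff \<alpha> \<mu> i) t)"

definition weight_space ::
  "('i \<Rightarrow> 'e::euclidean_space) \<Rightarrow> 'k::field \<Rightarrow> ('i, 'k, 'm) uq_module \<Rightarrow> 'e \<Rightarrow> 'm set" where
  "weight_space \<alpha> q M \<mu> =
     {m \<in> carrier M. \<forall>i.
        uq_K \<alpha> q i \<odot>\<^bsub>M\<^esub> m = uq_scalar \<alpha> q (K_value \<alpha> q \<mu> i) \<odot>\<^bsub>M\<^esub> m \<and>
        uq_Kinv \<alpha> q i \<odot>\<^bsub>M\<^esub> m = uq_scalar \<alpha> q (inverse (K_value \<alpha> q \<mu> i)) \<odot>\<^bsub>M\<^esub> m \<and>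
        (\<forall>t. uq_Kbinom \<alpha> q i t \<odot>\<^bsub>M\<^esub> m = uq_scalar \<alpha> q (Kbinom_value \<alpha> q \<mu> i t) \<odot>\<^bsub>M\<^esub> m)}"

definition type_one ::
  "('i \<Rightarrow> 'e::euclidean_space) \<Rightarrow> 'k::field \<Rightarrow> ('i, 'k, 'm) uq_module \<Rightarrow> bool" where
  "type_one \<alpha> q M \<longleftrightarrow> internal_direct_sum M (weights \<alpha>) (weight_space \<alpha> q M)"


section \<open>Dual Weyl, Weyl and tilting modules\<close>

text \<open>The coinduced module \<open>Hom\<^sub>B(U\<^sub>q, \<bbbK>\<^sub>\<mu>)\<close>, where \<open>B = U\<^sub>q\<^sup>-U\<^sub>q\<^sup>0\<close> acts on \<open>\<bbbK>\<^sub>\<mu>\<close> through the character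
  with \<open>F\<^sub>i\<^sup>(\<^sup>r\<^sup>) \<mapsto> 0\<close> for \<open>r > 0\<close>; it suffices to test equivariance on algebra generators of \<open>B\<close>.
  The action is \<open>(u f)(x) = f(x u)\<close>. Functions on a carrier are extended by 0.\<close>

definition coinduced_module ::
  "('i \<Rightarrow> 'e::euclidean_space) \<Rightarrow> 'k::field \<Rightarrow> 'e \<Rightarrow> ('i, 'k, ('i, 'k) uq_elem \<Rightarrow> 'k) uq_module" where
  "coinduced_module \<alpha> q \<mu> = (let U = uq \<alpha> q in
     \<lparr>carrier = {f.
        (\<forall>x. x \<notin> carrier U \<longrightarrow> f x = 0) \<and>
        (\<forall>x\<in>carrier U. \<forall>y\<in>carrier U. f (x \<oplus>\<^bsub>U\<^esub> y) = f x + f y) \<and>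
        (\<forall>c. \<forall>x\<in>carrier U. f (uq_scalar \<alpha> q c \<otimes>\<^bsub>U\<^esub> x) = c * f x) \<and>
        (\<forall>i. \<forall>x\<in>carrier U.
           (\<forall>r>0. f (uq_F \<alpha> q i r \<otimes>\<^bsub>U\<^esub> x) = 0) \<and>
           f (uq_K \<alpha> q i \<otimes>\<^bsub>U\<^esub> x) = K_value \<alpha> q \<mu> i * f x \<and>
           f (uq_Kinv \<alpha> q i \<otimes>\<^bsub>U\<^esub> x) = inverse (K_value \<alpha> q \<mu> i) * f x \<and>
           (\<forall>t. f (uq_Kbinom \<alpha> q i t \<otimes>\<^bsub>U\<^esub> x) = Kbinom_value \<alpha> q \<mu> i t * f x))},
      mult = undefined, one = undefined,
      zero = (\<lambda>x. 0),
      add = (\<lambda>f g x. f x + g x),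
      smult = (\<lambda>u f x. if x \<in> carrier U then f (x \<otimes>\<^bsub>U\<^esub> u) else 0)\<rparr>)"

text \<open>The largest integrable submodule: sums of weight vectors killed by all high divided
  powers.\<close>

definition integrable_part ::
  "('i \<Rightarrow> 'e::euclidean_space) \<Rightarrow> 'k::field \<Rightarrow> ('i, 'k, 'm) uq_module \<Rightarrow> ('i, 'k, 'm) uq_module" where
  "integrable_part \<alpha> q M = M\<lparr>carrier := {m \<in> carrier M.
     (\<exists>S f. finite S \<and> S \<subseteq> weights \<alpha> \<and> (\<forall>\<mu>\<in>S. f \<mu> \<in> weight_space \<alpha> q M \<mu>) \<and>
        m = (\<Oplus>\<^bsub>M\<^esub>\<mu>\<in>S. f \<mu>)) \<and>
     (\<forall>i. \<exists>r0. \<forall>r\<ge>r0. uq_E \<alpha> q i r \<odot>\<^bsub>M\<^esub> m = \<zero>\<^bsub>M\<^esub> \<and> uq_F \<alpha> q i r \<odot>\<^bsub>M\<^esub> m = \<zero>\<^bsub>M\<^esub>)}\<rparr>"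

definition dual_weyl ::
  "('i \<Rightarrow> 'e::euclidean_space) \<Rightarrow> 'k::field \<Rightarrow> 'e \<Rightarrow> ('i, 'k, ('i, 'k) uq_elem \<Rightarrow> 'k) uq_module" where
  "dual_weyl \<alpha> q \<mu> = integrable_part \<alpha> q (coinduced_module \<alpha> q \<mu>)"

text \<open>The anti-automorphism of \<open>U\<^sub>q\<close> interchanging \<open>E\<^sub>i\<^sup>(\<^sup>r\<^sup>)\<close> and \<open>F\<^sub>i\<^sup>(\<^sup>r\<^sup>)\<close> and fixing \<open>K\<^sub>i\<close>, induced by
  reversing words; on quotients it is taken cosetwise.\<close>

primrec swap_gen :: "'i gen \<Rightarrow> 'i gen" where
  "swap_gen (GE i) = GF i"
| "swap_gen (GF i) = GE i"
| "swap_gen (GK i) = GK i"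
| "swap_gen (GKinv i) = GKinv i"

definition uv_tau :: "'i uv_elem \<Rightarrow> 'i uv_elem" where
  "uv_tau X = linear_ext (\<lambda>w. rev (map swap_gen w)) ` X"

definition uq_tau :: "('i, 'k::field) uq_elem \<Rightarrow> ('i, 'k) uq_elem" where
  "uq_tau X = linear_ext uv_tau ` X"

text \<open>The character-preserving contravariant duality. Twisting instead by the antipode
  (\<open>E\<^sub>i \<mapsto> -K\<^sub>i\<^sup>-\<^sup>1 E\<^sub>i\<close>, \<open>F\<^sub>i \<mapsto> -F\<^sub>i K\<^sub>i\<close>) followed by the automorphism \<open>E\<^sub>i \<leftrightarrow> F\<^sub>i\<close>, \<open>K\<^sub>i \<mapsto> K\<^sub>i\<^sup>-\<^sup>1\<close> gives
  an isomorphic module: the two twists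
  differ by \<open>E\<^sub>i \<mapsto> -E\<^sub>i K\<^sub>i\<close>, \<open>F\<^sub>i \<mapsto> -K\<^sub>i\<^sup>-\<^sup>1 F\<^sub>i\<close>, which on a weight module is realized by rescaling
  the weight spaces.\<close>

definition contravariant_dual ::
  "('i \<Rightarrow> 'e::euclidean_space) \<Rightarrow> 'k::field \<Rightarrow> ('i, 'k, 'm) uq_module \<Rightarrow> ('i, 'k, 'm \<Rightarrow> 'k) uq_module" where
  "contravariant_dual \<alpha> q M =
     \<lparr>carrier = {f.
        (\<forall>x. x \<notin> carrier M \<longrightarrow> f x = 0) \<and>
        (\<forall>x\<in>carrier M. \<forall>y\<in>carrier M. f (x \<oplus>\<^bsub>M\<^esub> y) = f x + f y) \<and>
        (\<forall>c. \<forall>x\<in>carrier M. f (uq_scalar \<alpha> q c \<odot>\<^bsub>M\<^esub> x) = c * f x)},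
      mult = undefined, one = undefined,
      zero = (\<lambda>x. 0),
      add = (\<lambda>f g x. f x + g x),
      smult = (\<lambda>u f x. if x \<in> carrier M then f (uq_tau u \<odot>\<^bsub>M\<^esub> x) else 0)\<rparr>"

definition weyl ::
  "('i \<Rightarrow> 'e::euclidean_space) \<Rightarrow> 'k::field \<Rightarrow> 'e \<Rightarrow> ('i, 'k, (('i, 'k) uq_elem \<Rightarrow> 'k) \<Rightarrow> 'k) uq_module" where
  "weyl \<alpha> q \<mu> = contravariant_dual \<alpha> q (dual_weyl \<alpha> q \<mu>)"

definition tilting_module ::
  "('i \<Rightarrow> 'e::euclidean_space) \<Rightarrow> 'k::field \<Rightarrow> ('i, 'k, 'm) uq_module \<Rightarrow> bool" where
  "tilting_module \<alpha> q T \<longleftrightarrow>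
     left_module (uq \<alpha> q) T \<and> finite_dimensional \<alpha> q T \<and> type_one \<alpha> q T \<and>
     has_filtration (uq \<alpha> q) T
       (\<lambda>Q. \<exists>\<mu>\<in>dominant_weights \<alpha>. isomorphic_modules (uq \<alpha> q) Q (weyl \<alpha> q \<mu>)) \<and>
     has_filtration (uq \<alpha> q) T
       (\<lambda>Q. \<exists>\<mu>\<in>dominant_weights \<alpha>. isomorphic_modules (uq \<alpha> q) Q (dual_weyl \<alpha> q \<mu>))"

end

theory Submission
  imports Defs
begin

text \<open>One direction is general: if \<open>T\<close> is a finite direct sum of simple modules \<open>N\<close>, the left ideals of its endomorphism
  ring generated by the projections \<open>p\<^sub>N\<close> are simple and add up to the ring (\<open>semisimple_End\<close>).

  For the converse, let \<open>S\<close> be the contravariant dual of the tilting module \<open>T\<close>. By Frobenius reciprocity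
  (\<open>rep_dual_weyl\<close>), a homomorphism from \<open>T\<close> to the dual Weyl module \<open>\<nabla>(\<nu>)\<close> is a linear
  functional of weight \<open>\<nu>\<close> on \<open>T\<close> that vanishes on the images of all \<open>F\<^sub>i\<^sup>(\<^sup>r\<^sup>)\<close> with \<open>r > 0\<close>, here called a
  covector; this is also the same thing as a highest weight vector of weight \<open>\<nu>\<close> in \<open>S\<close>. Both \<open>T\<close> and
  \<open>S\<close> have filtrations by dual Weyl modules: that of \<open>S\<close> is dual to the filtration of \<open>T\<close> by Weyl modules
  (\<open>factor_dual\<close>). In a module with such a filtration, the weights of the highest weight vectors are exactly the labels of
  the factors, because a highest weight vector of one factor can be corrected by vectors of the lower ones
  (\<open>factor_lift\<close>). Finally \<open>T\<close> and \<open>S\<close> have the same character, hence the same labels (\<open>labels_determined\<close>).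
  Together: there is a nonzero homomorphism from \<open>T\<close> to \<open>\<nabla>(\<nu>)\<close> if and only if \<open>\<nu>\<close> is a label of \<open>T\<close>.

  Now let the endomorphism ring be semisimple; then every endomorphism \<open>\<phi>\<close> has a quasi-inverse, \<open>\<phi> \<psi> \<phi> = \<phi>\<close>
  (\<open>semisimple_ring_regular\<close>). Going up the filtration, suppose that the first steps split off, so that the next
  factor \<open>\<nabla>(\<nu>)\<close> embeds into a complement as \<open>D\<close>. A nonzero homomorphism from \<open>T\<close> to \<open>\<nabla>(\<nu>)\<close> is then an
  endomorphism with values in \<open>D\<close>, its quasi-inverse makes it a projection to a summand of \<open>D\<close>, and \<open>D\<close>
  is indecomposable since its socle is simple. So \<open>D\<close> splits off as well (\<open>filtration_splits\<close>). Each \<open>D\<close> is simple: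
  a proper nonzero submodule would be killed by some nonzero homomorphism from \<open>D\<close> to some \<open>\<nabla>(\<kappa>)\<close>. Then \<open>\<kappa>\<close> is
  a label, \<open>\<nabla>(\<kappa>)\<close> is itself a summand of \<open>T\<close>, and a quasi-inverse again decomposes \<open>D\<close> (\<open>split_simple\<close>).

  The facts about \<open>U\<^sub>q\<close> that enter are its generation by the divided powers and the \<open>K\<^sub>i\<close>, the anti-involution, the
  effect of the generators on weights, and the commutation formula for \<open>E\<^sub>i\<^sup>(\<^sup>r\<^sup>)\<close> and \<open>F\<^sub>i\<^sup>(\<^sup>s\<^sup>)\<close>. They are derived
  from the presentation over \<open>\<rat>(v)\<close>, restricted to the integral form and specialized. Weights are
  separated by the values of the \<open>K\<^sub>i\<close> and their Gaussian binomials, also at roots of unity (\<open>chi_inj\<close>).\<close>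

section \<open>Rings with central scalars\<close>

locale central_scalars = ring R for R :: "('r, 's) ring_scheme" (structure) +
  fixes \<rho> :: "'a::field \<Rightarrow> 'r"
  assumes scalar_closed [simp, intro]: "\<rho> a \<in> carrier R"
    and scalar_add: "\<rho> (a + b) = \<rho> a \<oplus> \<rho> b"
    and scalar_mult: "\<rho> (a * b) = \<rho> a \<otimes> \<rho> b"
    and scalar_one: "\<rho> 1 = \<one>"
    and scalar_central: "x \<in> carrier R \<Longrightarrow> x \<otimes> \<rho> a = \<rho> a \<otimes> x"
begin

definition scl :: "'a \<Rightarrow> 'r \<Rightarrow> 'r" where "scl a x = \<rho> a \<otimes> x"

lemma scl_closed [simp, intro]: "x \<in> carrier R \<Longrightarrow> scl a x \<in> carrier R"
  by (simp add: scl_def)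

lemma scalar_zero [simp]: "\<rho> 0 = \<zero>"
  using scalar_add[of 0 0] by (metis add.l_cancel_one' add_0 scalar_closed)

lemma scl_zero [simp]: "x \<in> carrier R \<Longrightarrow> scl 0 x = \<zero>"
  by (simp add: scl_def)

lemma scl_one [simp]: "x \<in> carrier R \<Longrightarrow> scl 1 x = x"
  by (simp add: scl_def scalar_one)

lemma scl_of_one [simp]: "scl a \<one> = \<rho> a"
  by (simp add: scl_def)

lemma scl_scalar [simp]: "scl a (\<rho> b) = \<rho> (a * b)"
  by (simp add: scl_def scalar_mult)

lemma scl_of_zero [simp]: "scl a \<zero> = \<zero>"
  by (simp add: scl_def)

lemma scl_scl [simp]: "x \<in> carrier R \<Longrightarrow> scl a (scl b x) = scl (a * b) x"
  by (simp add: scl_def scalar_mult m_assoc)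

lemma scl_distrib: "x \<in> carrier R \<Longrightarrow> y \<in> carrier R \<Longrightarrow> scl a (x \<oplus> y) = scl a x \<oplus> scl a y"
  by (simp add: scl_def r_distr)

lemma scl_add: "x \<in> carrier R \<Longrightarrow> scl (a + b) x = scl a x \<oplus> scl b x"
  by (simp add: scl_def l_distr scalar_add)

lemma scl_mult_left: "x \<in> carrier R \<Longrightarrow> y \<in> carrier R \<Longrightarrow> scl a x \<otimes> y = scl a (x \<otimes> y)"
  by (simp add: scl_def m_assoc)

lemma scl_mult_right: "x \<in> carrier R \<Longrightarrow> y \<in> carrier R \<Longrightarrow> x \<otimes> scl a y = scl a (x \<otimes> y)"
  by (simp add: scl_def m_assoc[symmetric] scalar_central)

lemma scl_uminus: "x \<in> carrier R \<Longrightarrow> scl (- a) x = \<ominus> scl a x"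
proof -
  assume x: "x \<in> carrier R"
  have "scl (- a) x \<oplus> scl a x = \<zero>"
    using scl_add[OF x, of "- a" a] x by simp
  thus ?thesis using x minus_equality[of "scl (- a) x" "scl a x"] by simp
qed

lemma scl_cancel:
  assumes "a \<noteq> 0" "x \<in> carrier R" "y \<in> carrier R" "scl a x = scl a y" shows "x = y"
proof -
  have "scl (1 / a) (scl a x) = scl (1 / a) (scl a y)" using assms(4) by argo
  thus ?thesis using assms(1-3) by simp
qed

lemma scl_finsum:
  "finite I \<Longrightarrow> g \<in> I \<rightarrow> carrier R \<Longrightarrow> scl a (finsum R g I) = (\<Oplus>i\<in>I. scl a (g i))"
  by (simp add: scl_def finsum_rdistr)

end

section \<open>The rank one commutation formula\<close>

definition qnum :: "'a::field \<Rightarrow> int \<Rightarrow> 'a" where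
  "qnum v n = (v powi n - v powi (- n)) / (v - inverse v)"

locale rank_one = central_scalars R \<rho>
  for R :: "('r, 's) ring_scheme" (structure) and \<rho> :: "'a::field \<Rightarrow> 'r" +
  fixes e f k k' :: 'r and v :: 'a
  assumes efk [simp, intro]:
      "e \<in> carrier R" "f \<in> carrier R" "k \<in> carrier R" "k' \<in> carrier R"
    and v_nonzero: "v \<noteq> 0"
    and v_generic: "n > 0 \<Longrightarrow> v powi (int n) - v powi (- int n) \<noteq> 0"
    and k_inverse: "k \<otimes> k' = \<one>" "k' \<otimes> k = \<one>"
    and k_e: "k \<otimes> e = scl (v powi 2) (e \<otimes> k)"
    and k_f: "k \<otimes> f = scl (v powi (- 2)) (f \<otimes> k)"
    and e_f: "e \<otimes> f = f \<otimes> e \<oplus> (scl (1 / (v - inverse v)) k \<oplus> scl (- (1 / (v - inverse v))) k')"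
begin

text \<open>Commutation with \<open>e\<close> and \<open>f\<close> preserves this span of \<open>k\<close>
  and its inverse, so all identities below reduce to identities between two coefficients.\<close>

definition lin :: "'a \<Rightarrow> 'a \<Rightarrow> 'r" where "lin a b = scl a k \<oplus> scl b k'"

lemma lin_closed [simp, intro]: "lin a b \<in> carrier R"
  by (simp add: lin_def)

lemma scl_lin: "scl c (lin a b) = lin (c * a) (c * b)"
  by (simp add: lin_def scl_distrib)

lemma lin_add: "lin a b \<oplus> lin a' b' = lin (a + a') (b + b')"
proof -
  have "(scl a k \<oplus> scl b k') \<oplus> (scl a' k \<oplus> scl b' k')
      = (scl a k \<oplus> scl a' k) \<oplus> (scl b k' \<oplus> scl b' k')"
    by (simp add: a_ac)
  thus ?thesis by (simp add: lin_def scl_add)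
qed

lemma lin_comm: "lin a b \<otimes> lin a' b' = lin a' b' \<otimes> lin a b"
  by (simp add: lin_def l_distr r_distr scl_mult_left scl_mult_right scl_distrib k_inverse
      mult.commute[of a'] mult.commute[of b'])
    (simp add: a_ac)

lemma k'_commute:
  assumes x: "x \<in> carrier R" and kx: "k \<otimes> x = scl a (x \<otimes> k)" and a: "a \<noteq> 0"
  shows "k' \<otimes> x = scl (inverse a) (x \<otimes> k')"
proof -
  have "x \<otimes> k' = k' \<otimes> (k \<otimes> x) \<otimes> k'"
    using x by (simp add: m_assoc[symmetric] k_inverse)
  also have "\<dots> = scl a (k' \<otimes> x)"
    using x by (simp add: kx scl_mult_left scl_mult_right m_assoc k_inverse)
  finally show ?thesis using a x by simp
qed

definition vdiff :: 'a where "vdiff = v - inverse v"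

lemma vdiff_nonzero: "vdiff \<noteq> 0"
  using v_generic[of 1] by (simp add: vdiff_def power_int_minus)

text \<open>The element \<open>[K; c]\<close> of the literature, \<open>(K v\<^sup>c - K\<^sup>-\<^sup>1
  v\<^sup>-\<^sup>c) / (v - v\<^sup>-\<^sup>1)\<close>.\<close>

definition khat :: "int \<Rightarrow> 'r" where "khat c = lin (v powi c / vdiff) (- (v powi (- c) / vdiff))"

lemma v_powi_nonzero [simp]: "v powi i \<noteq> 0"
  using v_nonzero by simp

lemma qnum_vdiff: "qnum v n = (v powi n - inverse (v powi n)) / vdiff"
  by (simp add: qnum_def vdiff_def power_int_minus)

lemma khat_alt: "khat c = lin (v powi c / vdiff) (- (inverse (v powi c) / vdiff))"
  by (simp add: khat_def power_int_minus)

lemma v_powi_add: "v powi (a + b) = v powi a * v powi b"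
  using v_nonzero by (simp add: power_int_add)

lemma v_powi_diff: "v powi (a - b) = v powi a / v powi b"
  using v_nonzero by (simp add: power_int_diff)

lemma khat_closed [simp, intro]: "khat c \<in> carrier R"
  by (simp add: khat_def)

lemma khat_comm: "khat c \<otimes> khat d = khat d \<otimes> khat c"
  by (simp add: khat_def lin_comm)

lemma khat_commute:
  assumes x: "x \<in> carrier R" and kx: "k \<otimes> x = scl (v powi m) (x \<otimes> k)"
  shows "khat c \<otimes> x = x \<otimes> khat (c + m)"
  using x by (simp add: khat_alt lin_def l_distr r_distr scl_mult_left scl_mult_right kx
      k'_commute[OF x kx v_powi_nonzero] v_powi_add)

lemma khat_f: "khat c \<otimes> f = f \<otimes> khat (c - 2)"
  using khat_commute[OF _ k_f, of c] by simp

lemma e_f': "e \<otimes> f = f \<otimes> e \<oplus> khat 0"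
  by (simp add: e_f khat_def lin_def vdiff_def)

lemma field_quotient_identity:
  fixes a b c d :: 'a assumes "a \<noteq> 0" "b \<noteq> 0" "c \<noteq> 0" "d \<noteq> 0"
  shows "(a / b - inverse (a / b)) / d * (c / b / d) + (b - inverse b) / d * (c * a / b / d)
      = (a - inverse a) / d * (c / d)"
  using assms by (simp add: field_simps)

text \<open>The quantum number identity \<open>[m-u][y-u] + [u][y+m-u] = [m][y]\<close>, with \<open>K
  v\<^sup>y\<close> in place of \<open>v\<^sup>y\<close>.\<close>

lemma khat_identity:
  "scl (qnum v (m - u)) (khat (y - u)) \<oplus> scl (qnum v u) (khat (y + m - u)) = scl (qnum v m) (khat y)"
proof -
  have nz: "v powi m \<noteq> 0" "v powi u \<noteq> 0" "v powi y \<noteq> 0" "inverse (v powi m) \<noteq> 0"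
    "inverse (v powi u) \<noteq> 0" "inverse (v powi y) \<noteq> 0"
    using v_nonzero by auto
  show ?thesis
    unfolding khat_alt scl_lin lin_add qnum_vdiff v_powi_add v_powi_diff
    using field_quotient_identity[OF nz(1-3) vdiff_nonzero] field_quotient_identity[OF nz(4-6) vdiff_nonzero]
    by (intro arg_cong2[where f = lin]) (simp_all add: algebra_simps divide_inverse)
qed

lemma qnum_nonzero: "qnum v (int (Suc n)) \<noteq> 0"
  using v_generic[of "Suc n"] vdiff_nonzero by (simp add: qnum_def vdiff_def)

definition qfac :: "nat \<Rightarrow> 'a" where "qfac r = (\<Prod>s=1..r. qnum v (int s))"

lemma qnum_cancel:
  "x \<in> carrier R \<Longrightarrow> y \<in> carrier R \<Longrightarrow>
    scl (qnum v (int (Suc n))) x = scl (qnum v (int (Suc n))) y \<Longrightarrow> x = y"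
  by (rule scl_cancel[OF qnum_nonzero])

lemma qfac_Suc: "qfac (Suc r) = qfac r * qnum v (int (Suc r))"
  by (simp add: qfac_def)

lemma qfac_nonzero: "qfac r \<noteq> 0"
  by (induction r) (simp_all only: qfac_Suc, simp_all add: qfac_def qnum_nonzero del: of_nat_Suc)

definition ed :: "nat \<Rightarrow> 'r" where "ed r = scl (1 / qfac r) (e [^] r)"
definition fd :: "nat \<Rightarrow> 'r" where "fd r = scl (1 / qfac r) (f [^] r)"

lemma ed_closed [simp, intro]: "ed r \<in> carrier R" and fd_closed [simp, intro]: "fd r \<in> carrier R"
  by (simp_all add: ed_def fd_def)

lemma ed_0 [simp]: "ed 0 = \<one>" and fd_0 [simp]: "fd 0 = \<one>"
  by (simp_all add: ed_def fd_def qfac_def scalar_one)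

lemma e_ed: "e \<otimes> ed r = scl (qnum v (int (Suc r))) (ed (Suc r))"
  using qnum_nonzero[of r] qfac_nonzero[of r] nat_pow_Suc2[of e r]
  by (simp add: ed_def scl_mult_right qfac_Suc del: of_nat_Suc nat_pow_Suc)

lemma f_fd: "f \<otimes> fd r = scl (qnum v (int (Suc r))) (fd (Suc r))"
  using qnum_nonzero[of r] qfac_nonzero[of r] nat_pow_Suc2[of f r]
  by (simp add: fd_def scl_mult_right qfac_Suc del: of_nat_Suc nat_pow_Suc)

lemma khat_fd: "khat c \<otimes> fd r = fd r \<otimes> khat (c - 2 * int r)"
proof (induction r arbitrary: c)
  case (Suc r)
  have "scl (qnum v (int (Suc r))) (khat c \<otimes> fd (Suc r)) = khat c \<otimes> (f \<otimes> fd r)"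
    by (simp add: f_fd scl_mult_right del: of_nat_Suc)
  also have "\<dots> = f \<otimes> (khat (c - 2) \<otimes> fd r)"
    by (simp add: m_assoc[symmetric] khat_f)
  also have "\<dots> = f \<otimes> fd r \<otimes> khat (c - 2 - 2 * int r)"
    by (simp add: Suc.IH m_assoc)
  also have "\<dots> = scl (qnum v (int (Suc r))) (fd (Suc r) \<otimes> khat (c - 2 * int (Suc r)))"
    by (simp add: f_fd scl_mult_left algebra_simps)
  finally show ?case by (rule qnum_cancel[rotated 2]) auto
qed simp

lemma e_fd: "e \<otimes> fd (Suc s) = fd (Suc s) \<otimes> e \<oplus> fd s \<otimes> khat (- int s)"
proof (induction s)
  case 0
  have "fd (Suc 0) = f" using vdiff_nonzero by (simp add: fd_def qfac_def qnum_def vdiff_def power_int_minus)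
  thus ?case using e_f' by simp
next
  case (Suc s)
  let ?n = "qnum v (int (Suc (Suc s)))" and ?m = "qnum v (int (Suc s))"
  have "scl ?n (e \<otimes> fd (Suc (Suc s))) = e \<otimes> (f \<otimes> fd (Suc s))"
    by (simp add: f_fd scl_mult_right del: of_nat_Suc)
  also have "\<dots> = f \<otimes> (e \<otimes> fd (Suc s)) \<oplus> khat 0 \<otimes> fd (Suc s)"
    by (simp add: m_assoc[symmetric] e_f' l_distr)
  also have "\<dots> = f \<otimes> fd (Suc s) \<otimes> e \<oplus> (f \<otimes> fd s \<otimes> khat (- int s)
      \<oplus> fd (Suc s) \<otimes> khat (- 2 * int (Suc s)))"
    by (simp add: Suc.IH khat_fd r_distr m_assoc a_assoc)
  also have "\<dots> = scl ?n (fd (Suc (Suc s)) \<otimes> e) \<oplus> fd (Suc s) \<otimes>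
      (scl ?m (khat (- int s)) \<oplus> khat (- 2 * int (Suc s)))"
    by (simp add: f_fd r_distr scl_mult_left scl_mult_right del: of_nat_Suc)
  also have "scl ?m (khat (- int s)) \<oplus> khat (- 2 * int (Suc s)) = scl ?n (khat (- int (Suc s)))"
  proof -
    have "qnum v 1 = 1" using vdiff_nonzero by (simp add: qnum_def vdiff_def power_int_minus)
    thus ?thesis
      using khat_identity[of "int (Suc (Suc s))" 1 "- int (Suc s)"]
        khat_identity[of "int (Suc (Suc s))" "int (Suc s)" "- int (Suc s)"]
        add.m_comm[of "khat (- 2 * int (Suc s))"]
      by (simp add: algebra_simps)
  qed
  also have "scl ?n (fd (Suc (Suc s)) \<otimes> e) \<oplus> fd (Suc s) \<otimes> scl ?n (khat (- int (Suc s)))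
     = scl ?n (fd (Suc (Suc s)) \<otimes> e \<oplus> fd (Suc s) \<otimes> khat (- int (Suc s)))"
    by (simp add: scl_mult_right scl_distrib del: of_nat_Suc)
  finally show ?case by (rule qnum_cancel[rotated 2]) auto
qed

text \<open>The Gaussian binomial \<open>[K; c over t]\<close>. The shift \<open>c\<close> is a separate
  argument because moving it past \<open>e\<close> or \<open>f\<close> changes \<open>c\<close>
  only.\<close>

primrec kbin :: "int \<Rightarrow> nat \<Rightarrow> 'r" where
  "kbin c 0 = \<one>"
| "kbin c (Suc t) = kbin c t \<otimes> scl (1 / qnum v (int (Suc t))) (khat (c - int t))"

lemma kbin_closed [simp, intro]: "kbin c t \<in> carrier R"
  by (induction t) auto

lemma khat_kbin: "khat d \<otimes> kbin c t = kbin c t \<otimes> khat d"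
proof (induction t)
  case (Suc t)
  have "khat d \<otimes> kbin c (Suc t) = kbin c t \<otimes> (khat d \<otimes> scl (1 / qnum v (int (Suc t))) (khat (c - int t)))"
    by (simp add: m_assoc[symmetric] Suc.IH del: of_nat_Suc)
  also have "khat d \<otimes> scl (1 / qnum v (int (Suc t))) (khat (c - int t))
    = scl (1 / qnum v (int (Suc t))) (khat (c - int t)) \<otimes> khat d"
    by (simp add: scl_mult_left scl_mult_right khat_comm[of d] del: of_nat_Suc)
  finally show ?case by (simp add: m_assoc del: of_nat_Suc)
qed simp

lemma kbin_front: "kbin c (Suc t) = scl (1 / qnum v (int (Suc t))) (khat c \<otimes> kbin (c - 1) t)"
proof (induction t)
  case (Suc t)
  have "kbin c (Suc (Suc t)) = scl (1 / qnum v (int (Suc t))) (khat c \<otimes> kbin (c - 1) t) \<otimes>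
     scl (1 / qnum v (int (Suc (Suc t)))) (khat (c - int (Suc t)))"
    using Suc.IH by simp
  also have "\<dots> = scl (1 / qnum v (int (Suc (Suc t)))) (khat c \<otimes> (kbin (c - 1) t \<otimes>
     scl (1 / qnum v (int (Suc t))) (khat (c - 1 - int t))))"
    by (simp add: scl_mult_left scl_mult_right m_assoc mult.commute diff_diff_eq del: of_nat_Suc)
      (simp add: algebra_simps)
  finally show ?case by simp
qed simp

lemma kbin_commute:
  assumes x: "x \<in> carrier R" and kx: "k \<otimes> x = scl (v powi m) (x \<otimes> k)"
  shows "kbin c t \<otimes> x = x \<otimes> kbin (c + m) t"
proof (induction t)
  case (Suc t)
  have "kbin c (Suc t) \<otimes> x = kbin c t \<otimes> (scl (1 / qnum v (int (Suc t))) (khat (c - int t)) \<otimes> x)"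
    using x by (simp add: m_assoc del: of_nat_Suc)
  also have "scl (1 / qnum v (int (Suc t))) (khat (c - int t)) \<otimes> x
     = x \<otimes> scl (1 / qnum v (int (Suc t))) (khat (c + m - int t))"
    using x khat_commute[OF x kx, of "c - int t"]
    by (simp add: scl_mult_left scl_mult_right algebra_simps del: of_nat_Suc)
  also have "kbin c t \<otimes> (x \<otimes> scl (1 / qnum v (int (Suc t))) (khat (c + m - int t)))
     = x \<otimes> kbin (c + m) (Suc t)"
    using x by (simp add: m_assoc[symmetric] Suc.IH del: of_nat_Suc)
  finally show ?case .
qed (use x in simp)

lemma e_kbin: "e \<otimes> kbin c t = kbin (c - 2) t \<otimes> e"
  using kbin_commute[OF _ k_e, of "c - 2"] by simp

lemma kbin_identity:
  "scl (qnum v (m - int (Suc t))) (kbin (y - 1) (Suc t)) \<oplus> khat (y + m - int (Suc t)) \<otimes> kbin (y - 1) t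
    = scl (qnum v m) (kbin y (Suc t))"
proof -
  let ?n = "qnum v (int (Suc t))"
  have nz: "?n \<noteq> 0" by (rule qnum_nonzero)
  have 1: "khat (y + m - int (Suc t)) = scl (1 / ?n) (scl ?n (khat (y + m - int (Suc t))))"
    using nz by (simp del: of_nat_Suc)
  have 2: "scl (qnum v (m - int (Suc t))) (kbin (y - 1) (Suc t))
     = kbin (y - 1) t \<otimes> scl (1 / ?n) (scl (qnum v (m - int (Suc t))) (khat (y - int (Suc t))))"
    by (simp add: scl_mult_right mult.commute diff_diff_eq del: of_nat_Suc) (simp add: algebra_simps)
  have "scl (qnum v (m - int (Suc t))) (kbin (y - 1) (Suc t)) \<oplus> khat (y + m - int (Suc t)) \<otimes> kbin (y - 1) t
   = kbin (y - 1) t \<otimes> scl (1 / ?n) (scl (qnum v (m - int (Suc t))) (khat (y - int (Suc t)))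
        \<oplus> scl ?n (khat (y + m - int (Suc t))))"
    unfolding 2 khat_kbin by (subst 1) (simp add: scl_distrib r_distr del: of_nat_Suc scl_scl)
  also have "\<dots> = kbin (y - 1) t \<otimes> scl (1 / ?n) (scl (qnum v m) (khat y))"
    using khat_identity[of m "int (Suc t)" y] by simp
  also have "\<dots> = scl (qnum v m) (kbin y (Suc t))"
    by (simp add: kbin_front scl_mult_right khat_kbin mult.commute del: of_nat_Suc kbin.simps)
  finally show ?thesis .
qed

text \<open>This recurrence, read in both directions, expresses every \<open>kbin c t\<close> through the
  unshifted ones, with integral Laurent polynomials in \<open>v\<close> and powers of \<open>k'\<close> as
  coefficients; the same recurrence holds for the values on weight vectors.\<close>

lemma kbin_pascal:
  "kbin (c + 1) (Suc t) = scl (v powi (int t + 1)) (kbin c (Suc t)) \<oplus> scl (v powi (int t - c)) (k' \<otimes> kbin c t)"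
proof -
  let ?n = "qnum v (int (Suc t))"
  have nz: "?n \<noteq> 0" by (rule qnum_nonzero)
  have "khat (c + 1) = scl (v powi (int t + 1)) (khat (c - int t)) \<oplus> scl (?n * v powi (int t - c)) (lin 0 1)"
  proof -
    have "- (inverse (v powi (c + 1)) / vdiff) =
      v powi (int t + 1) * - (inverse (v powi (c - int t)) / vdiff) + ?n * v powi (int t - c)"
    proof -
      have "- (inverse (a * v) / d) = b * v * - (inverse (a / b) / d) + (v * b - inverse (v * b)) / d * (b / a)"
        if "a \<noteq> 0" "b \<noteq> 0" "d \<noteq> 0" for a b d :: 'a
        using that v_nonzero by (simp add: field_simps)
      from this[of "v powi c" "v powi int t" vdiff] show ?thesis
        using vdiff_nonzero v_nonzero by (simp add: qnum_vdiff v_powi_add v_powi_diff)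
    qed
    moreover have "v powi (c + 1) / vdiff = v powi (int t + 1) * (v powi (c - int t) / vdiff)"
      by (simp add: v_powi_add v_powi_diff)
    ultimately show ?thesis
      unfolding khat_alt scl_lin lin_add using vdiff_nonzero by simp
  qed
  moreover have "lin 0 1 = k'" by (simp add: lin_def)
  moreover have "kbin c (Suc t) = scl (1 / ?n) (khat (c - int t) \<otimes> kbin c t)"
    by (simp add: khat_kbin scl_mult_right del: of_nat_Suc)
  ultimately show ?thesis
    using nz kbin_front[of "c + 1" t]
    by (simp add: l_distr scl_distrib scl_mult_left mult.commute[of "v powi _"] del: of_nat_Suc kbin.simps)
qed

text \<open>The divided power \<open>f\<^sup>(\<^sup>s\<^sup>-\<^sup>t\<^sup>)\<close>, with the convention
  that negative divided powers vanish; this makes the sum in the commutation formula run over all \<open>t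
  \<le> r\<close>.\<close>

definition fdm :: "nat \<Rightarrow> nat \<Rightarrow> 'r" where "fdm s t = (if t \<le> s then fd (s - t) else \<zero>)"

lemma fdm_closed [simp, intro]: "fdm s t \<in> carrier R"
  by (simp add: fdm_def)

lemma e_fdm: "e \<otimes> fdm s t = fdm s t \<otimes> e \<oplus> fdm s (Suc t) \<otimes> khat (int (Suc t) - int s)"
proof (cases "t < s")
  case True
  from less_imp_Suc_add[OF True] obtain d where d: "s = Suc (t + d)" by blast
  hence "s - t = Suc d" "s - Suc t = d" "int (Suc t) - int s = - int d" by auto
  thus ?thesis using e_fd[of d] True by (simp add: fdm_def del: of_nat_Suc)
qed (auto simp: fdm_def)

text \<open>Kac's formula, by induction on \<open>r\<close>: multiplying a summand by \<open>e\<close> from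
  the left gives a contribution to the summands \<open>t\<close> and \<open>t + 1\<close>, and the two
  contributions to one summand add up by \<open>kbin_identity\<close>.\<close>

theorem ed_fd:
  "ed r \<otimes> fd s = (\<Oplus>t\<in>{..r}. fdm s t \<otimes> kbin (2 * int t - int r - int s) t \<otimes> ed (r - t))"
proof (induction r)
  case 0
  show ?case by (simp add: fdm_def)
next
  case (Suc r)
  let ?q = "\<lambda>n. qnum v (int n)"
  let ?c = "\<lambda>t. 2 * int t - int r - int s"
  let ?A = "\<lambda>t. scl (qnum v (int (Suc r) - int t)) (fdm s t \<otimes> kbin (?c t - 2) t \<otimes> ed (Suc r - t))"
  let ?B = "\<lambda>t. fdm s (Suc t) \<otimes> (khat (int (Suc t) - int s) \<otimes> kbin (?c t) t) \<otimes> ed (r - t)"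
  let ?B' = "\<lambda>u. if u = 0 then \<zero> else ?B (u - 1)"
  let ?G = "\<lambda>u. fdm s u \<otimes> kbin (2 * int u - int (Suc r) - int s) u \<otimes> ed (Suc r - u)"
  have step: "e \<otimes> (fdm s t \<otimes> kbin (?c t) t \<otimes> ed (r - t)) = ?A t \<oplus> ?B t" if "t \<le> r" for t
  proof -
    have 1: "e \<otimes> ed (r - t) = scl (qnum v (int (Suc r) - int t)) (ed (Suc r - t))"
      using that e_ed[of "r - t"] by (simp add: Suc_diff_le of_nat_diff algebra_simps)
    have "e \<otimes> (fdm s t \<otimes> kbin (?c t) t \<otimes> ed (r - t))
       = (e \<otimes> fdm s t) \<otimes> kbin (?c t) t \<otimes> ed (r - t)" by (simp add: m_assoc)
    also have "\<dots> = fdm s t \<otimes> (e \<otimes> kbin (?c t) t) \<otimes> ed (r - t) \<oplus> ?B t"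
      by (simp add: e_fdm l_distr m_assoc del: of_nat_Suc)
    also have "fdm s t \<otimes> (e \<otimes> kbin (?c t) t) \<otimes> ed (r - t) = ?A t"
      by (simp add: e_kbin m_assoc 1 scl_mult_right)
    finally show ?thesis .
  qed
  have sum: "?A u \<oplus> ?B' u = scl (?q (Suc r)) (?G u)" if "u \<le> Suc r" for u
  proof (cases u)
    case 0
    thus ?thesis by simp
  next
    case (Suc t)
    have a: "?c u - 2 = 2 * int u - int (Suc r) - int s - 1" "?c t = 2 * int u - int (Suc r) - int s - 1"
      using Suc by auto
    have b: "int (Suc t) - int s = (2 * int u - int (Suc r) - int s) + int (Suc r) - int (Suc t)"
      using Suc by auto
    have B': "?B' u = ?B t" using Suc by simp
    have "?A u \<oplus> ?B' u = fdm s u \<otimes> (scl (qnum v (int (Suc r) - int (Suc t)))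
         (kbin (2 * int u - int (Suc r) - int s - 1) (Suc t)) \<oplus>
         khat ((2 * int u - int (Suc r) - int s) + int (Suc r) - int (Suc t)) \<otimes>
           kbin (2 * int u - int (Suc r) - int s - 1) t) \<otimes> ed (Suc r - u)"
      unfolding B' a b using Suc
      by (simp add: r_distr l_distr scl_mult_left scl_mult_right m_assoc del: of_nat_Suc kbin.simps)
    also have "\<dots> = scl (?q (Suc r)) (?G u)"
      unfolding kbin_identity using Suc
      by (simp add: scl_mult_left scl_mult_right del: of_nat_Suc kbin.simps)
    finally show ?thesis .
  qed
  have "scl (?q (Suc r)) (ed (Suc r) \<otimes> fd s) = e \<otimes> (ed r \<otimes> fd s)"
    by (simp add: m_assoc[symmetric] e_ed scl_mult_left del: of_nat_Suc)
  also have "\<dots> = (\<Oplus>t\<in>{..r}. e \<otimes> (fdm s t \<otimes> kbin (?c t) t \<otimes> ed (r - t)))"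
    unfolding Suc.IH by (rule finsum_rdistr) auto
  also have "\<dots> = (\<Oplus>t\<in>{..r}. ?A t \<oplus> ?B t)"
    by (rule finsum_cong') (auto simp: step)
  also have "\<dots> = (\<Oplus>t\<in>{..r}. ?A t) \<oplus> (\<Oplus>t\<in>{..r}. ?B t)"
    by (rule finsum_addf) auto
  also have "(\<Oplus>t\<in>{..r}. ?A t) = (\<Oplus>t\<in>{..Suc r}. ?A t)"
    by (subst finsum_Suc) (auto simp: qnum_def)
  also have "(\<Oplus>t\<in>{..r}. ?B t) = (\<Oplus>t\<in>{..Suc r}. ?B' t)"
    by (subst finsum_Suc2) (auto)
  also have "(\<Oplus>t\<in>{..Suc r}. ?A t) \<oplus> (\<Oplus>t\<in>{..Suc r}. ?B' t) = (\<Oplus>t\<in>{..Suc r}. ?A t \<oplus> ?B' t)"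
    by (rule finsum_addf[symmetric]) auto
  also have "\<dots> = (\<Oplus>t\<in>{..Suc r}. scl (?q (Suc r)) (?G t))"
    by (rule finsum_cong') (use sum in auto)
  also have "\<dots> = scl (?q (Suc r)) (\<Oplus>t\<in>{..Suc r}. ?G t)"
    by (rule scl_finsum[symmetric]) auto
  finally show ?case by (rule qnum_cancel[rotated 2]) auto
qed

end

section \<open>Monoid algebras, their quotients, and anti-involutions\<close>

lemma poly_mapping_keys_induct [consumes 1, case_names zero add]:
  fixes f :: "'a \<Rightarrow>\<^sub>0 'k::comm_ring_1"
  assumes "Poly_Mapping.keys f \<subseteq> C" and "P 0"
    and step: "\<And>f x a. Poly_Mapping.keys f \<subseteq> C \<Longrightarrow> x \<in> C \<Longrightarrow> P f \<Longrightarrow> P (Poly_Mapping.single x a + f)"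
  shows "P f"
proof -
  have "P (\<Sum>x\<in>S. Poly_Mapping.single x (Poly_Mapping.lookup f x))
     \<and> Poly_Mapping.keys (\<Sum>x\<in>S. Poly_Mapping.single x (Poly_Mapping.lookup f x)) \<subseteq> C"
    if "finite S" "S \<subseteq> C" for S
    using that
  proof (induction S rule: finite_induct)
    case (insert x S)
    have "Poly_Mapping.keys (Poly_Mapping.single x (Poly_Mapping.lookup f x)) \<subseteq> C"
      using insert by simp
    thus ?case using insert step
      by (simp, meson Un_least keys_add order_trans)
  qed (simp add: \<open>P 0\<close>)
  moreover have "(\<Sum>x\<in>Poly_Mapping.keys f. Poly_Mapping.single x (Poly_Mapping.lookup f x)) = f"
    by (rule poly_mapping_eqI)
      (auto simp: lookup_sum lookup_single when_def in_keys_iff sum.If_cases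
        intro!: trans[OF sum.mono_neutral_right[where S = "{_}"]] split: if_splits)
  ultimately show ?thesis using assms(1) by (metis finite_keys)
qed

lemma linear_ext_superset:
  assumes "finite S" "Poly_Mapping.keys f \<subseteq> S"
  shows "linear_ext g f = (\<Sum>x\<in>S. Poly_Mapping.single (g x) (Poly_Mapping.lookup f x))"
  unfolding linear_ext_def
  by (rule sum.mono_neutral_left) (use assms in \<open>auto simp: in_keys_iff\<close>)

lemma linear_ext_add: "linear_ext g (f + h) = linear_ext g f + linear_ext g h"
proof -
  let ?S = "Poly_Mapping.keys f \<union> Poly_Mapping.keys h"
  have "Poly_Mapping.keys (f + h) \<subseteq> ?S" by (rule keys_add)
  thus ?thesis
    by (simp add: linear_ext_superset[of ?S] lookup_add single_add sum.distrib)
qed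

lemma linear_ext_single [simp]: "linear_ext g (Poly_Mapping.single x a) = Poly_Mapping.single (g x) a"
  by (cases "a = 0") (simp_all add: linear_ext_def)

lemma linear_ext_zero [simp]: "linear_ext g 0 = 0"
  by (simp add: linear_ext_def)

lemma linear_ext_diff: "linear_ext g (f - h) = linear_ext g f - linear_ext g h"
  using linear_ext_add[of g "f - h" h] by simp

lemma linear_ext_sum: "linear_ext g (sum F S) = (\<Sum>i\<in>S. linear_ext g (F i))"
  by (induction S rule: infinite_finite_induct) (simp_all add: linear_ext_add)

locale monoid_ring = G?: monoid G for G :: "('g, 'x) monoid_scheme" (structure) +
  fixes K :: "'k::field itself"
begin

definition A :: "('g \<Rightarrow>\<^sub>0 'k) ring" where "A = monoid_algebra G"

lemma A_simps [simp]:
  "f \<in> carrier A \<longleftrightarrow> Poly_Mapping.keys f \<subseteq> carrier G"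
  "zero A = 0" "add A f g = f + g" "one A = Poly_Mapping.single \<one> 1"
  by (simp_all add: A_def monoid_algebra_def)

lemma mult_A_superset:
  assumes "finite S" "Poly_Mapping.keys f \<subseteq> S" "finite S'" "Poly_Mapping.keys g \<subseteq> S'"
  shows "f \<otimes>\<^bsub>A\<^esub> g = (\<Sum>x\<in>S. \<Sum>y\<in>S'. Poly_Mapping.single (x \<otimes> y)
     (Poly_Mapping.lookup f x * Poly_Mapping.lookup g y))"
proof -
  have "f \<otimes>\<^bsub>A\<^esub> g = (\<Sum>x\<in>Poly_Mapping.keys f. \<Sum>y\<in>S'. Poly_Mapping.single (x \<otimes> y)
     (Poly_Mapping.lookup f x * Poly_Mapping.lookup g y))"
    unfolding A_def monoid_algebra_def
    by (simp, intro sum.cong refl sum.mono_neutral_left) (use assms in \<open>auto simp: in_keys_iff\<close>)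
  also have "\<dots> = (\<Sum>x\<in>S. \<Sum>y\<in>S'. Poly_Mapping.single (x \<otimes> y)
     (Poly_Mapping.lookup f x * Poly_Mapping.lookup g y))"
    by (rule sum.mono_neutral_left) (use assms in \<open>auto simp: in_keys_iff\<close>)
  finally show ?thesis .
qed

lemma mult_A_distrib_left: "(f + f') \<otimes>\<^bsub>A\<^esub> g = f \<otimes>\<^bsub>A\<^esub> g + f' \<otimes>\<^bsub>A\<^esub> g"
proof -
  let ?S = "Poly_Mapping.keys f \<union> Poly_Mapping.keys f'"
  have "Poly_Mapping.keys (f + f') \<subseteq> ?S" by (rule keys_add)
  thus ?thesis
    by (simp add: mult_A_superset[of ?S _ "Poly_Mapping.keys g"] lookup_add distrib_right single_add
        sum.distrib)
qed

lemma mult_A_distrib_right: "g \<otimes>\<^bsub>A\<^esub> (f + f') = g \<otimes>\<^bsub>A\<^esub> f + g \<otimes>\<^bsub>A\<^esub> f'"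
proof -
  let ?S = "Poly_Mapping.keys f \<union> Poly_Mapping.keys f'"
  have "Poly_Mapping.keys (f + f') \<subseteq> ?S" by (rule keys_add)
  thus ?thesis
    by (simp add: mult_A_superset[of "Poly_Mapping.keys g" _ ?S] lookup_add distrib_left single_add
        sum.distrib)
qed

lemma mult_A_diff_right: "g \<otimes>\<^bsub>A\<^esub> (f - f') = g \<otimes>\<^bsub>A\<^esub> f - g \<otimes>\<^bsub>A\<^esub> f'"
  using mult_A_distrib_right[of g "f - f'" f'] by simp

lemma mult_A_zero [simp]: "0 \<otimes>\<^bsub>A\<^esub> f = 0" "f \<otimes>\<^bsub>A\<^esub> 0 = 0"
  by (simp_all add: A_def monoid_algebra_def)

lemma mult_A_sum_right: "g \<otimes>\<^bsub>A\<^esub> (\<Sum>i\<in>S. F i) = (\<Sum>i\<in>S. g \<otimes>\<^bsub>A\<^esub> F i)"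
  by (induction S rule: infinite_finite_induct) (simp_all add: mult_A_distrib_right)

lemma mult_A_single [simp]:
  "Poly_Mapping.single x a \<otimes>\<^bsub>A\<^esub> Poly_Mapping.single y b = Poly_Mapping.single (x \<otimes> y) (a * b)"
  using mult_A_superset[of "{x}" "Poly_Mapping.single x a" "{y}" "Poly_Mapping.single y b"] by simp

lemma keys_add_sub: "Poly_Mapping.keys f \<subseteq> C \<Longrightarrow> Poly_Mapping.keys g \<subseteq> C \<Longrightarrow> Poly_Mapping.keys (f + g) \<subseteq> C"
  for f g :: "'g \<Rightarrow>\<^sub>0 'k"
  using keys_add[of f g] by blast

lemma mult_A_closed:
  assumes "f \<in> carrier A" "g \<in> carrier A" shows "f \<otimes>\<^bsub>A\<^esub> g \<in> carrier A"
proof -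
  have 1: "Poly_Mapping.keys (Poly_Mapping.single x a \<otimes>\<^bsub>A\<^esub> g) \<subseteq> carrier G" if "x \<in> carrier G" for x a
    using assms(2)[unfolded A_simps]
  proof (induction g rule: poly_mapping_keys_induct)
    case (add h y b)
    thus ?case using that by (simp add: mult_A_distrib_right keys_add_sub)
  qed simp
  show ?thesis
    using assms(1)[unfolded A_simps]
  proof (induction f rule: poly_mapping_keys_induct)
    case (add h y b)
    thus ?case using 1 by (simp add: mult_A_distrib_left keys_add_sub)
  qed simp
qed

lemma mult_A_assoc:
  assumes "f \<in> carrier A" "g \<in> carrier A" "h \<in> carrier A"
  shows "f \<otimes>\<^bsub>A\<^esub> g \<otimes>\<^bsub>A\<^esub> h = f \<otimes>\<^bsub>A\<^esub> (g \<otimes>\<^bsub>A\<^esub> h)"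
proof -
  have 1: "Poly_Mapping.single x a \<otimes>\<^bsub>A\<^esub> Poly_Mapping.single y b \<otimes>\<^bsub>A\<^esub> h
     = Poly_Mapping.single x a \<otimes>\<^bsub>A\<^esub> (Poly_Mapping.single y b \<otimes>\<^bsub>A\<^esub> h)"
    if "x \<in> carrier G" "y \<in> carrier G" for x a y b
    using assms(3)[unfolded A_simps]
    by (induction h rule: poly_mapping_keys_induct)
      (use that in \<open>simp_all add: mult_A_distrib_right m_assoc mult.assoc\<close>)
  have 2: "Poly_Mapping.single x a \<otimes>\<^bsub>A\<^esub> g \<otimes>\<^bsub>A\<^esub> h = Poly_Mapping.single x a \<otimes>\<^bsub>A\<^esub> (g \<otimes>\<^bsub>A\<^esub> h)"
    if "x \<in> carrier G" for x a
    using assms(2)[unfolded A_simps]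
    by (induction g rule: poly_mapping_keys_induct)
      (use that 1 in \<open>simp_all add: mult_A_distrib_right mult_A_distrib_left del: mult_A_single\<close>)
  show ?thesis
    using assms(1)[unfolded A_simps]
    by (induction f rule: poly_mapping_keys_induct)
      (use 2 in \<open>simp_all add: mult_A_distrib_left\<close>)
qed

lemma mult_A_one:
  assumes "f \<in> carrier A" shows "\<one>\<^bsub>A\<^esub> \<otimes>\<^bsub>A\<^esub> f = f" "f \<otimes>\<^bsub>A\<^esub> \<one>\<^bsub>A\<^esub> = f"
proof -
  show "\<one>\<^bsub>A\<^esub> \<otimes>\<^bsub>A\<^esub> f = f"
    using assms[unfolded A_simps]
    by (induction f rule: poly_mapping_keys_induct) (simp_all add: mult_A_distrib_right)
  show "f \<otimes>\<^bsub>A\<^esub> \<one>\<^bsub>A\<^esub> = f"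
    using assms[unfolded A_simps]
    by (induction f rule: poly_mapping_keys_induct) (simp_all add: mult_A_distrib_left)
qed

lemma ring_A: "ring A"
proof (rule ringI)
  show "abelian_group A"
  proof (rule abelian_groupI)
    fix x assume "x \<in> carrier A"
    hence "- x \<in> carrier A" by (simp add: keys_def)
    thus "\<exists>y\<in>carrier A. y \<oplus>\<^bsub>A\<^esub> x = \<zero>\<^bsub>A\<^esub>" by (intro bexI[of _ "- x"]) auto
  qed (auto simp: keys_add_sub add.assoc add.commute)
  show "Group.monoid A"
    by (rule Group.monoidI) (use mult_A_closed mult_A_assoc mult_A_one in \<open>simp_all del: A_simps(4)\<close>, simp)
qed (simp_all add: mult_A_distrib_left mult_A_distrib_right)

sublocale A: ring A by (rule ring_A)

lemma a_minus_A: "f \<in> carrier A \<Longrightarrow> g \<in> carrier A \<Longrightarrow> f \<ominus>\<^bsub>A\<^esub> g = f - g"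
proof -
  assume f: "f \<in> carrier A" and g: "g \<in> carrier A"
  have "(- g) \<oplus>\<^bsub>A\<^esub> g = \<zero>\<^bsub>A\<^esub>" "- g \<in> carrier A" using g by (auto simp: keys_def)
  hence "\<ominus>\<^bsub>A\<^esub> g = - g" using g A.minus_equality by blast
  thus ?thesis by (simp add: a_minus_def)
qed

end

text \<open>Both the algebra over \<open>\<rat>(v)\<close> and its specialization are of this form: for the
  monoid of words, and for the multiplicative monoid of the integral form.\<close>

locale monoid_ring_quotient = monoid_ring G K
  for G :: "('g, 'x) monoid_scheme" (structure) and K :: "'k::field itself" +
  fixes I :: "('g \<Rightarrow>\<^sub>0 'k) set"
  assumes ideal: "ideal I A"
begin

sublocale I: ideal I A by (rule ideal)

definition Q :: "('g \<Rightarrow>\<^sub>0 'k) set ring" where "Q = A Quot I"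

definition cls :: "('g \<Rightarrow>\<^sub>0 'k) \<Rightarrow> ('g \<Rightarrow>\<^sub>0 'k) set" where "cls f = I +>\<^bsub>A\<^esub> f"

sublocale Q: ring Q unfolding Q_def by (rule I.quotient_is_ring)

lemma cls_hom: "ring_hom_ring A Q cls"
  unfolding Q_def cls_def using I.rcos_ring_hom_ring by simp

sublocale cls: ring_hom_ring A Q cls by (rule cls_hom)

lemma carrier_Q: "X \<in> carrier Q \<longleftrightarrow> (\<exists>f\<in>carrier A. X = cls f)"
  by (auto simp: Q_def FactRing_def A_RCOSETS_def' cls_def)

lemma cls_eq: "f \<in> carrier A \<Longrightarrow> g \<in> carrier A \<Longrightarrow> cls f = cls g \<longleftrightarrow> f - g \<in> I"
  unfolding cls_def using A.quotient_eq_iff_same_a_r_cos[OF ideal, of f g] by (simp add: a_minus_A)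

lemma cls_add: "f \<in> carrier A \<Longrightarrow> g \<in> carrier A \<Longrightarrow> cls (f + g) = cls f \<oplus>\<^bsub>Q\<^esub> cls g"
  using cls.hom_add[of f g] by simp

lemma cls_zero [simp]: "cls 0 = \<zero>\<^bsub>Q\<^esub>"
  using cls.hom_zero by simp

definition scalar :: "'k \<Rightarrow> ('g \<Rightarrow>\<^sub>0 'k) set" where "scalar c = cls (Poly_Mapping.single \<one> c)"

lemma cls_single: "x \<in> carrier G \<Longrightarrow> cls (Poly_Mapping.single x c) = scalar c \<otimes>\<^bsub>Q\<^esub> cls (Poly_Mapping.single x 1)"
  using cls.hom_mult[of "Poly_Mapping.single \<one> c" "Poly_Mapping.single x 1"]
  by (simp add: scalar_def)

lemma Q_induct [consumes 1, case_names zero add]: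
  assumes "X \<in> carrier Q" and zero: "P \<zero>\<^bsub>Q\<^esub>"
    and step: "\<And>X x c. X \<in> carrier Q \<Longrightarrow> x \<in> carrier G \<Longrightarrow> P X \<Longrightarrow>
       P (scalar c \<otimes>\<^bsub>Q\<^esub> cls (Poly_Mapping.single x 1) \<oplus>\<^bsub>Q\<^esub> X)"
  shows "P X"
proof -
  obtain f where f: "Poly_Mapping.keys f \<subseteq> carrier G" "X = cls f" using assms(1) carrier_Q by auto
  have "P (cls f)" using f(1)
  proof (induction f rule: poly_mapping_keys_induct)
    case (add h x a)
    have "cls (Poly_Mapping.single x a + h) = scalar a \<otimes>\<^bsub>Q\<^esub> cls (Poly_Mapping.single x 1) \<oplus>\<^bsub>Q\<^esub> cls h"
      using add.hyps cls_add[of "Poly_Mapping.single x a" h] by (simp add: cls_single[of x a])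
    thus ?case using step add by simp
  qed (simp add: zero)
  thus ?thesis by (simp add: f)
qed

lemma central_scalars_Q: "central_scalars Q scalar"
proof (unfold_locales)
  show "scalar a \<in> carrier Q" for a by (simp add: scalar_def)
  show "scalar (a + b) = scalar a \<oplus>\<^bsub>Q\<^esub> scalar b" for a b
    using cls_add[of "Poly_Mapping.single \<one> a" "Poly_Mapping.single \<one> b"]
    by (simp add: scalar_def single_add)
  show "scalar (a * b) = scalar a \<otimes>\<^bsub>Q\<^esub> scalar b" for a b
    using cls.hom_mult[of "Poly_Mapping.single \<one> a" "Poly_Mapping.single \<one> b"]
    by (simp add: scalar_def)
  show "scalar 1 = \<one>\<^bsub>Q\<^esub>" using cls.hom_one by (simp add: scalar_def)
  fix X a assume "X \<in> carrier Q"
  then obtain f where f: "Poly_Mapping.keys f \<subseteq> carrier G" "X = cls f" using carrier_Q by auto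
  have "Poly_Mapping.single \<one> a \<otimes>\<^bsub>A\<^esub> f = f \<otimes>\<^bsub>A\<^esub> Poly_Mapping.single \<one> a"
    using f(1) by (induction f rule: poly_mapping_keys_induct)
      (simp_all add: mult_A_distrib_right mult_A_distrib_left mult.commute)
  thus "X \<otimes>\<^bsub>Q\<^esub> scalar a = scalar a \<otimes>\<^bsub>Q\<^esub> X"
    using f by (simp add: scalar_def flip: cls.hom_mult)
qed

sublocale Q: central_scalars Q scalar by (rule central_scalars_Q)

end

text \<open>An anti-involution of the monoid that respects the defining relations induces one of the
  quotient. It acts on cosets as sets, which is the form in which the contravariant duality is
  defined.\<close>

locale monoid_ring_anti = monoid_ring_quotient G K I
  for G :: "('g, 'x) monoid_scheme" (structure) and K :: "'k::field itself" and I +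
  fixes \<theta> :: "'g \<Rightarrow> 'g" and Rel :: "('g \<Rightarrow>\<^sub>0 'k) set"
  assumes theta_closed [simp]: "x \<in> carrier G \<Longrightarrow> \<theta> x \<in> carrier G"
    and theta_mult: "x \<in> carrier G \<Longrightarrow> y \<in> carrier G \<Longrightarrow> \<theta> (x \<otimes> y) = \<theta> y \<otimes> \<theta> x"
    and theta_one [simp]: "\<theta> \<one> = \<one>"
    and theta_theta [simp]: "x \<in> carrier G \<Longrightarrow> \<theta> (\<theta> x) = x"
    and Rel: "Rel \<subseteq> carrier A" and I_Rel: "I = genideal A Rel"
    and theta_Rel: "r \<in> Rel \<Longrightarrow> linear_ext \<theta> r \<in> I"
begin

abbreviation L where "L \<equiv> linear_ext \<theta> :: ('g \<Rightarrow>\<^sub>0 'k) \<Rightarrow> _"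

lemma L_closed: "f \<in> carrier A \<Longrightarrow> L f \<in> carrier A"
  unfolding A_simps
  by (induction f rule: poly_mapping_keys_induct) (simp_all add: linear_ext_add keys_add_sub)

lemma L_L: "f \<in> carrier A \<Longrightarrow> L (L f) = f"
  unfolding A_simps
  by (induction f rule: poly_mapping_keys_induct) (auto simp: linear_ext_add)

lemma L_mult:
  assumes "f \<in> carrier A" "g \<in> carrier A"
  shows "L (f \<otimes>\<^bsub>A\<^esub> g) = L g \<otimes>\<^bsub>A\<^esub> L f"
proof -
  have 1: "L (Poly_Mapping.single x a \<otimes>\<^bsub>A\<^esub> g) = L g \<otimes>\<^bsub>A\<^esub> Poly_Mapping.single (\<theta> x) a" if "x \<in> carrier G" for x a
    using assms(2)[unfolded A_simps]
    by (induction g rule: poly_mapping_keys_induct)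
      (use that in \<open>auto simp: linear_ext_add mult_A_distrib_right mult_A_distrib_left theta_mult mult.commute\<close>)
  show ?thesis
    using assms(1)[unfolded A_simps]
    by (induction f rule: poly_mapping_keys_induct)
      (auto simp: linear_ext_add mult_A_distrib_right mult_A_distrib_left 1)
qed

lemma L_I: assumes "f \<in> I" shows "L f \<in> I"
proof -
  let ?J = "{f \<in> carrier A. L f \<in> I}"
  have "ideal ?J A"
  proof (rule idealI)
    show "ring A" by (rule ring_A)
    show "subgroup ?J (add_monoid A)"
    proof (rule A.add.subgroupI)
      fix f assume f: "f \<in> ?J"
      have m: "\<ominus>\<^bsub>A\<^esub> f = - f"
        using a_minus_A[of 0 f] f A.zero_closed by (simp add: a_minus_def)
      have "L (- f) = - L f" using linear_ext_diff[of \<theta> 0 f] by simp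
      moreover have "- L f = \<ominus>\<^bsub>A\<^esub> L f"
        using a_minus_A[of 0 "L f"] f A.zero_closed L_closed by (simp add: a_minus_def)
      ultimately show "\<ominus>\<^bsub>A\<^esub> f \<in> ?J" using m f A.a_inv_closed I.a_inv_closed by auto
    next
      show "?J \<noteq> {}" using I.zero_closed by (auto intro!: exI[of _ 0])
    qed (use I.a_closed in \<open>auto simp: linear_ext_add keys_add_sub\<close>)
  next
    fix f x assume f: "f \<in> ?J" and x: "x \<in> carrier A"
    show "x \<otimes>\<^bsub>A\<^esub> f \<in> ?J" "f \<otimes>\<^bsub>A\<^esub> x \<in> ?J"
      using f x L_mult L_closed I.I_l_closed I.I_r_closed mult_A_closed by auto
  qed
  moreover have "Rel \<subseteq> ?J" using Rel theta_Rel by blast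
  ultimately have "I \<subseteq> ?J" using A.genideal_minimal I_Rel by blast
  thus ?thesis using assms by blast
qed

lemma image_cls: assumes "f \<in> carrier A" shows "L ` cls f = cls (L f)"
proof -
  have c: "cls g = (\<lambda>h. h + g) ` I" for g by (auto simp: cls_def a_r_coset_def')
  have "L ` I = I"
  proof
    show "I \<subseteq> L ` I" using L_I L_L I.Icarr by (metis image_eqI subsetI)
  qed (use L_I in auto)
  hence "cls (L f) = (\<lambda>h. h + L f) ` L ` I" using c by simp
  thus ?thesis by (simp add: c image_image linear_ext_add)
qed

definition Th :: "('g \<Rightarrow>\<^sub>0 'k) set \<Rightarrow> ('g \<Rightarrow>\<^sub>0 'k) set" where "Th X = L ` X"

lemma Th_cls: "f \<in> carrier A \<Longrightarrow> Th (cls f) = cls (L f)"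
  by (simp add: Th_def image_cls)

lemma Th_closed: "X \<in> carrier Q \<Longrightarrow> Th X \<in> carrier Q"
  by (metis carrier_Q Th_cls L_closed)

lemma Th_Th: "X \<in> carrier Q \<Longrightarrow> Th (Th X) = X"
  by (metis carrier_Q Th_cls L_closed L_L)

lemma Th_add: "X \<in> carrier Q \<Longrightarrow> Y \<in> carrier Q \<Longrightarrow> Th (X \<oplus>\<^bsub>Q\<^esub> Y) = Th X \<oplus>\<^bsub>Q\<^esub> Th Y"
proof -
  assume "X \<in> carrier Q" "Y \<in> carrier Q"
  then obtain f g where f: "f \<in> carrier A" "X = cls f" and g: "g \<in> carrier A" "Y = cls g"
    using carrier_Q by auto
  have "Th (X \<oplus>\<^bsub>Q\<^esub> Y) = Th (cls (f \<oplus>\<^bsub>A\<^esub> g))" using f g cls.hom_add by simp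
  also have "\<dots> = cls (L f \<oplus>\<^bsub>A\<^esub> L g)"
    using f(1) g(1) Th_cls[OF A.a_closed] linear_ext_add[of \<theta> f g] by simp
  also have "\<dots> = Th X \<oplus>\<^bsub>Q\<^esub> Th Y" using f g Th_cls L_closed cls.hom_add by metis
  finally show ?thesis .
qed

lemma Th_mult: "X \<in> carrier Q \<Longrightarrow> Y \<in> carrier Q \<Longrightarrow> Th (X \<otimes>\<^bsub>Q\<^esub> Y) = Th Y \<otimes>\<^bsub>Q\<^esub> Th X"
proof -
  assume "X \<in> carrier Q" "Y \<in> carrier Q"
  then obtain f g where f: "f \<in> carrier A" "X = cls f" and g: "g \<in> carrier A" "Y = cls g"
    using carrier_Q by auto
  have "Th (X \<otimes>\<^bsub>Q\<^esub> Y) = Th (cls (f \<otimes>\<^bsub>A\<^esub> g))" using f g cls.hom_mult by simp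
  also have "\<dots> = cls (L g \<otimes>\<^bsub>A\<^esub> L f)" using f(1) g(1) Th_cls[OF mult_A_closed] L_mult by metis
  also have "\<dots> = Th Y \<otimes>\<^bsub>Q\<^esub> Th X" using f g Th_cls L_closed cls.hom_mult by metis
  finally show ?thesis .
qed

lemma Th_scalar: "Th (scalar c) = scalar c"
  by (simp add: scalar_def Th_cls)

end

section \<open>Laurent polynomials, Gaussian binomials and roots\<close>

lemma vv_power: "vv ^ n = to_fract (Polynomial.monom 1 n)"
proof (induction n)
  case (Suc n)
  have "Polynomial.monom 1 (Suc n) = [:0, 1:] * Polynomial.monom (1::rat) n" by (simp add: monom_Suc)
  thus ?case using Suc by (metis power_Suc to_fract_mult vv_def)
qed simp

lemma vv_nonzero [simp]: "vv \<noteq> 0"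
  by (simp add: vv_def)

lemma vv_power_neq_1: "n > 0 \<Longrightarrow> vv ^ n \<noteq> 1"
  unfolding vv_power to_fract_1[symmetric] to_fract_eq_iff
  by (metis degree_1 degree_monom_eq less_numeral_extra(3) zero_neq_one)

definition ev :: "'k::comm_ring_1 \<Rightarrow> int poly \<Rightarrow> 'k" where "ev x p = poly (map_poly of_int p) x"

lemma map_poly_of_int_mult:
  "map_poly (of_int :: int \<Rightarrow> 'k::comm_ring_1) (p * r) = map_poly of_int p * map_poly of_int r"
  by (rule poly_eqI) (simp add: coeff_map_poly coeff_mult)

lemma map_poly_of_int_add:
  "map_poly (of_int :: int \<Rightarrow> 'k::comm_ring_1) (p + r) = map_poly of_int p + map_poly of_int r"
  by (rule poly_eqI) (simp add: coeff_map_poly)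

lemma map_poly_of_int_uminus:
  "map_poly (of_int :: int \<Rightarrow> 'k::comm_ring_1) (- p) = - map_poly of_int p"
  by (rule poly_eqI) (simp add: coeff_map_poly)

lemma map_poly_of_int_monom: "map_poly (of_int :: int \<Rightarrow> 'k::comm_ring_1) (Polynomial.monom 1 n) = Polynomial.monom 1 n"
  by (rule poly_eqI) (simp add: coeff_map_poly coeff_monom)

lemma laurent_alt: "laurent p n = to_fract (map_poly of_int p) / to_fract (Polynomial.monom 1 n)"
  by (simp add: laurent_def vv_power)

lemma laurent_eq: "laurent p n = laurent p' n' \<longleftrightarrow> p * Polynomial.monom 1 n' = p' * Polynomial.monom 1 n"
proof -
  have nz: "to_fract (Polynomial.monom (1::rat) k) \<noteq> 0" for k by (simp add: monom_eq_0_iff)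
  have "laurent p n = laurent p' n' \<longleftrightarrow>
     to_fract (map_poly rat_of_int (p * Polynomial.monom 1 n')) = to_fract (map_poly of_int (p' * Polynomial.monom 1 n))"
    using nz[of n] nz[of n'] unfolding laurent_alt map_poly_of_int_mult map_poly_of_int_monom
    by (subst frac_eq_eq) (simp_all only: to_fract_mult, simp_all)
  also have "\<dots> \<longleftrightarrow> p * Polynomial.monom 1 n' = p' * Polynomial.monom 1 n"
    unfolding to_fract_eq_iff by (auto simp: poly_eq_iff coeff_map_poly)
  finally show ?thesis .
qed

lemma specialize_laurent:
  fixes q :: "'k::field" assumes "q \<noteq> 0"
  shows "specialize q (laurent p n) = ev q p / q ^ n"
  unfolding specialize_def
proof (rule the_equality)
  show "\<exists>p' n'. laurent p n = laurent p' n' \<and> ev q p / q ^ n = poly (map_poly of_int p') q / q ^ n'"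
    by (auto simp: ev_def)
next
  fix c assume "\<exists>p' n'. laurent p n = laurent p' n' \<and> c = poly (map_poly of_int p') q / q ^ n'"
  then obtain p' n' where *: "p * Polynomial.monom 1 n' = p' * Polynomial.monom 1 n" and c: "c = ev q p' / q ^ n'"
    by (auto simp: laurent_eq ev_def)
  have m: "ev q (r * Polynomial.monom 1 k) = ev q r * q ^ k" for r k
    by (simp add: ev_def map_poly_of_int_mult map_poly_of_int_monom poly_monom)
  have "ev q p * q ^ n' = ev q p' * q ^ n" using * m by metis
  moreover have "q ^ n \<noteq> 0" "q ^ n' \<noteq> 0" using assms by auto
  ultimately show "c = ev q p / q ^ n" using c by (metis frac_eq_eq)
qed

lemma laurent_mult: "laurent p n * laurent p' n' = laurent (p * p') (n + n')"
  by (simp add: laurent_def map_poly_of_int_mult power_add)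

lemma laurent_add: "laurent p n + laurent p' n' = laurent (p * Polynomial.monom 1 n' + p' * Polynomial.monom 1 n) (n + n')"
  by (simp add: laurent_def map_poly_of_int_mult map_poly_of_int_add map_poly_of_int_monom power_add
      vv_power[symmetric] field_simps)

lemma laurent_ringE: assumes "a \<in> laurent_ring" obtains p n where "a = laurent p n"
  using assms by (auto simp: laurent_ring_def)

lemma laurent_ringI [intro]: "laurent p n \<in> laurent_ring"
  by (auto simp: laurent_ring_def)

lemma laurent_ring_mult [intro]: "a \<in> laurent_ring \<Longrightarrow> b \<in> laurent_ring \<Longrightarrow> a * b \<in> laurent_ring"
  by (elim laurent_ringE) (auto simp: laurent_mult)

lemma laurent_ring_add [intro]: "a \<in> laurent_ring \<Longrightarrow> b \<in> laurent_ring \<Longrightarrow> a + b \<in> laurent_ring"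
  by (elim laurent_ringE) (auto simp: laurent_add)

lemma laurent_0: "laurent 0 0 = 0" and laurent_1: "laurent 1 0 = 1"
  and laurent_vv: "laurent (Polynomial.monom 1 n) 0 = vv ^ n" and laurent_inverse_vv: "laurent 1 n = inverse (vv ^ n)"
  and laurent_minus_1: "laurent (- 1) 0 = - 1"
  using map_poly_of_int_monom[where 'k = rat, of 0] map_poly_of_int_uminus[where 'k = rat, of "Polynomial.monom 1 0"]
  by (simp_all add: laurent_def map_poly_of_int_monom vv_power divide_inverse del: of_int_minus)

lemma laurent_ring_0 [simp, intro]: "0 \<in> laurent_ring" and laurent_ring_1 [simp, intro]: "1 \<in> laurent_ring"
  and laurent_ring_minus_1 [simp, intro]: "-1 \<in> laurent_ring"
  using laurent_ringI[of 0 0] laurent_ringI[of 1 0] laurent_ringI[of "-1" 0]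
  by (simp_all add: laurent_0 laurent_1 laurent_minus_1)

lemma laurent_ring_powi [simp, intro]: "vv powi m \<in> laurent_ring"
  using laurent_ringI[of "Polynomial.monom 1 (nat m)" 0] laurent_ringI[of 1 "nat (- m)"]
  by (cases "m \<ge> 0") (simp_all add: power_int_def laurent_vv laurent_inverse_vv flip: power_inverse)

context
  fixes q :: "'k::field" assumes q: "q \<noteq> 0"
begin

lemma specialize_mult:
  "a \<in> laurent_ring \<Longrightarrow> b \<in> laurent_ring \<Longrightarrow> specialize q (a * b) = specialize q a * specialize q b"
  by (elim laurent_ringE)
    (simp add: laurent_mult specialize_laurent[OF q] ev_def map_poly_of_int_mult power_add)

lemma specialize_add:
  "a \<in> laurent_ring \<Longrightarrow> b \<in> laurent_ring \<Longrightarrow> specialize q (a + b) = specialize q a + specialize q b"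
  using q by (elim laurent_ringE)
    (simp add: laurent_add specialize_laurent[OF q] ev_def map_poly_of_int_mult map_poly_of_int_add
      map_poly_of_int_monom poly_monom power_add field_simps)

lemma specialize_0: "specialize q 0 = 0" and specialize_1: "specialize q 1 = 1"
  using specialize_laurent[OF q, of 0 0] specialize_laurent[OF q, of 1 0]
    map_poly_of_int_monom[where 'k = 'k, of 0]
  by (simp_all add: laurent_0 laurent_1 ev_def)

lemma specialize_powi: "specialize q (vv powi m) = q powi m"
  using specialize_laurent[OF q, of "Polynomial.monom 1 (nat m)" 0] specialize_laurent[OF q, of 1 "nat (- m)"]
    map_poly_of_int_monom[where 'k = 'k, of 0]
  by (cases "m \<ge> 0")
    (simp_all add: power_int_def laurent_vv laurent_inverse_vv ev_def map_poly_of_int_monom poly_monom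
      divide_inverse flip: power_inverse)

end

text \<open>The two Pascal recurrences reach every pair of indices from the pairs with first entry 0.\<close>

lemma pascal_induct:
  fixes P :: "int \<Rightarrow> nat \<Rightarrow> bool"
  assumes base: "\<And>t. P 0 t" and zero: "\<And>c. P c 0"
    and up: "\<And>c t. P c (Suc t) \<Longrightarrow> P c t \<Longrightarrow> P (c + 1) (Suc t)"
    and down: "\<And>c t. P (c + 1) (Suc t) \<Longrightarrow> P c t \<Longrightarrow> P c (Suc t)"
  shows "P c t"
proof -
  have "\<forall>t. P c t"
  proof (induction c rule: int_induct[where k = 0])
    case base thus ?case using assms(1) by blast
  next
    case (step1 c)
    show ?case
    proof
      fix t show "P (c + 1) t" using step1 zero up by (cases t) auto
    qed
  next
    case (step2 c)
    show ?case
    proof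
      fix t show "P (c - 1) t"
      proof (induction t)
        case (Suc t) thus ?case using step2 down[of "c - 1" t] by simp
      qed (rule zero)
    qed
  qed
  thus ?thesis ..
qed

locale quantum_data =
  fixes \<Phi> :: "'e::euclidean_space set" and \<alpha> :: "'i::finite \<Rightarrow> 'e" and q :: "'k::field"
  assumes roots: "root_system \<Phi>" and simple: "simple_roots \<Phi> \<alpha>" and q_nonzero: "q \<noteq> 0"
begin

lemma alpha_nonzero: "\<alpha> i \<noteq> 0"
  using roots simple unfolding root_system_def simple_roots_def by (metis range_subsetD)

lemma pairing_add: "coroot_pairing (x + y) \<beta> = coroot_pairing x \<beta> + coroot_pairing y \<beta>"
  by (simp add: coroot_pairing_def inner_add_left add_divide_distrib distrib_left)

lemma pairing_scale: "coroot_pairing (c *\<^sub>R x) \<beta> = c * coroot_pairing x \<beta>"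
  by (simp add: coroot_pairing_def)

lemma pairing_self: "coroot_pairing (\<alpha> i) (\<alpha> i) = 2"
  using alpha_nonzero[of i] by (simp add: coroot_pairing_def)

lemma cartan_real: "of_int (cartan_matrix \<alpha> i j) = coroot_pairing (\<alpha> j) (\<alpha> i)"
proof -
  have "coroot_pairing (\<alpha> j) (\<alpha> i) \<in> \<int>"
    using roots simple unfolding root_system_def simple_roots_def by (meson range_subsetD)
  thus ?thesis by (auto simp: cartan_matrix_def weight_coeff_def elim: Ints_cases)
qed

lemma cartan_self [simp]: "cartan_matrix \<alpha> i i = 2"
  by (simp add: cartan_matrix_def weight_coeff_def pairing_self)

lemma weight_coeff_real: "\<mu> \<in> weights \<alpha> \<Longrightarrow> of_int (weight_coeff \<alpha> \<mu> i) = coroot_pairing \<mu> (\<alpha> i)"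
  by (auto simp: weights_def weight_coeff_def elim!: allE[of _ i] Ints_cases)

lemma weight_shift:
  assumes "\<mu> \<in> weights \<alpha>"
  shows "\<mu> + of_int r *\<^sub>R \<alpha> j \<in> weights \<alpha>"
    and "weight_coeff \<alpha> (\<mu> + of_int r *\<^sub>R \<alpha> j) i = weight_coeff \<alpha> \<mu> i + r * cartan_matrix \<alpha> i j"
proof -
  have *: "coroot_pairing (\<mu> + of_int r *\<^sub>R \<alpha> j) (\<alpha> i)
      = of_int (weight_coeff \<alpha> \<mu> i + r * cartan_matrix \<alpha> i j)" for i
    using assms by (simp add: pairing_add pairing_scale cartan_real weight_coeff_real)
  show "\<mu> + of_int r *\<^sub>R \<alpha> j \<in> weights \<alpha>" unfolding weights_def mem_Collect_eq * by simp
  show "weight_coeff \<alpha> (\<mu> + of_int r *\<^sub>R \<alpha> j) i = weight_coeff \<alpha> \<mu> i + r * cartan_matrix \<alpha> i j"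
    unfolding weight_coeff_def[of _ "\<mu> + _"] * by (rule floor_of_int)
qed

lemma weights_eqI:
  assumes "\<mu> \<in> weights \<alpha>" "\<nu> \<in> weights \<alpha>" "\<And>i. weight_coeff \<alpha> \<mu> i = weight_coeff \<alpha> \<nu> i"
  shows "\<mu> = \<nu>"
proof -
  have orth: "inner (\<mu> - \<nu>) (\<alpha> i) = 0" for i
  proof -
    have "coroot_pairing \<mu> (\<alpha> i) = coroot_pairing \<nu> (\<alpha> i)"
      using assms by (metis weight_coeff_real)
    thus ?thesis using alpha_nonzero[of i] by (simp add: coroot_pairing_def inner_diff_left)
  qed
  have o: "inner (\<mu> - \<nu>) x = 0" if "x \<in> span (range \<alpha>)" for x
    using that by (induction rule: span_induct_alt) (auto simp: inner_add_right orth)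
  have "\<Phi> \<subseteq> span (range \<alpha>)"
  proof
    fix \<beta> assume "\<beta> \<in> \<Phi>"
    then obtain c :: "'i \<Rightarrow> nat" where "\<beta> = (\<Sum>i\<in>UNIV. real (c i) *\<^sub>R \<alpha> i) \<or> \<beta> = - (\<Sum>i\<in>UNIV. real (c i) *\<^sub>R \<alpha> i)"
      using simple by (auto simp: simple_roots_def)
    moreover have "(\<Sum>i\<in>UNIV. real (c i) *\<^sub>R \<alpha> i) \<in> span (range \<alpha>)"
      by (intro span_sum span_scale span_base) auto
    ultimately show "\<beta> \<in> span (range \<alpha>)" by (metis span_neg)
  qed
  hence "span (range \<alpha>) = UNIV" using roots
    by (metis root_system_def span_mono span_span top.extremum_uniqueI)
  hence "inner (\<mu> - \<nu>) (\<mu> - \<nu>) = 0" using o by blast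
  thus ?thesis by simp
qed

text \<open>The height, as a linear functional on the whole space.\<close>

definition ht :: "'e \<Rightarrow> real" where "ht = (SOME h. linear h \<and> (\<forall>i. h (\<alpha> i) = 1))"

lemma ht: "linear ht" "ht (\<alpha> i) = 1"
proof -
  have "\<exists>h::'e \<Rightarrow> real. linear h \<and> (\<forall>i. h (\<alpha> i) = 1)"
    using simple linear_independent_extend[of "range \<alpha>" "\<lambda>_. 1 :: real"]
    by (auto simp: simple_roots_def)
  hence "linear ht \<and> (\<forall>i. ht (\<alpha> i) = 1)" unfolding ht_def by (rule someI_ex)
  thus "linear ht" "ht (\<alpha> i) = 1" by auto
qed

lemma ht_shift [simp]: "ht (\<mu> + c *\<^sub>R \<alpha> i) = ht \<mu> + c" "ht (\<mu> - c *\<^sub>R \<alpha> i) = ht \<mu> - c"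
  using ht(1) ht(2)[of i] by (simp_all add: linear_add linear_diff linear_scale)

text \<open>On a connected component the squared lengths of the simple roots have rational ratios,
  so that dividing by the squared length of one of them and clearing denominators gives an
  integral symmetrizer.\<close>

lemma symmetrizer_exists:
  "\<exists>d::'i \<Rightarrow> nat. (\<forall>j. d j > 0) \<and>
    (\<forall>j k. int (d j) * cartan_matrix \<alpha> j k = int (d k) * cartan_matrix \<alpha> k j)"
proof -
  define n where "n i = inner (\<alpha> i) (\<alpha> i)" for i
  have n: "n i > 0" for i using alpha_nonzero[of i] by (simp add: n_def)
  have sym: "n j * of_int (cartan_matrix \<alpha> j k) = n k * of_int (cartan_matrix \<alpha> k j)" for j k
    using n[of j] n[of k] unfolding cartan_real by (simp add: coroot_pairing_def n_def inner_commute)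
  define rep where "rep i = (SOME j. n j / n i \<in> \<rat>)" for i
  have rep: "n (rep i) / n i \<in> \<rat>" for i
    unfolding rep_def by (rule someI[of _ i]) (use n[of i] in auto)
  have rep_eq: "rep j = rep k" if "cartan_matrix \<alpha> j k \<noteq> 0" for j k
  proof -
    have "of_int (cartan_matrix \<alpha> k j) \<noteq> (0::real)" using that sym[of j k] n[of j] n[of k] by auto
    hence "n k / n j = of_int (cartan_matrix \<alpha> j k) / of_int (cartan_matrix \<alpha> k j)"
      using sym[of j k] n[of j] by (simp add: field_simps)
    hence r: "n k / n j \<in> \<rat>" by simp
    have "n l / n j \<in> \<rat> \<longleftrightarrow> n l / n k \<in> \<rat>" for l
    proof
      assume "n l / n j \<in> \<rat>"
      hence "(n l / n j) / (n k / n j) \<in> \<rat>" using r by (rule Rats_divide)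
      thus "n l / n k \<in> \<rat>" using n[of j] by simp
    next
      assume "n l / n k \<in> \<rat>"
      hence "(n l / n k) * (n k / n j) \<in> \<rat>" using r by (rule Rats_mult)
      thus "n l / n j \<in> \<rat>" using n[of k] by simp
    qed
    thus ?thesis by (simp add: rep_def)
  qed
  define x where "x i = n i / n (rep i)" for i
  have x: "x i > 0" "x i \<in> \<rat>" for i
    using n[of i] n[of "rep i"] rep[of i] Rats_inverse[OF rep[of i]] by (auto simp: x_def)
  have "\<exists>a b::nat. b > 0 \<and> x i = real a / real b" for i
    using x[of i] by (metis Rats_abs_nat_div_natE abs_of_pos neq0_conv)
  then obtain a b :: "'i \<Rightarrow> nat" where ab: "\<And>i. b i > 0" "\<And>i. x i = real (a i) / real (b i)" by metis
  define d where "d i = a i * (\<Prod>j\<in>UNIV - {i}. b j)" for i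
  have d: "real (d i) = x i * real (\<Prod>j\<in>UNIV. b j)" for i
    using ab(1)[of i] by (simp add: d_def ab(2) prod.remove[of UNIV i])
  have B: "(\<Prod>j\<in>UNIV. b j) > 0" using ab(1) by (simp add: prod_pos)
  have "d i > 0" for i using d[of i] x(1)[of i] B by (metis mult_pos_pos of_nat_0_less_iff)
  moreover have "int (d j) * cartan_matrix \<alpha> j k = int (d k) * cartan_matrix \<alpha> k j" for j k
  proof (cases "cartan_matrix \<alpha> j k = 0")
    case True
    hence "cartan_matrix \<alpha> k j = 0" using sym[of j k] n[of k] by auto
    thus ?thesis using True by simp
  next
    case False
    have "real (d j) * of_int (cartan_matrix \<alpha> j k) = real (d k) * of_int (cartan_matrix \<alpha> k j)"
      using sym[of j k] unfolding d x_def rep_eq[OF False] by (simp add: mult_ac)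
    thus ?thesis by (metis of_int_eq_iff of_int_mult of_int_of_nat_eq)
  qed
  ultimately show ?thesis by blast
qed

lemma symmetrizer_pos: "symmetrizer \<alpha> i > 0"
proof -
  obtain d :: "'i \<Rightarrow> nat" where "(\<forall>j. d j > 0) \<and>
    (\<forall>j k. int (d j) * cartan_matrix \<alpha> j k = int (d k) * cartan_matrix \<alpha> k j)"
    using symmetrizer_exists by blast
  hence "\<exists>d. (\<forall>j. d j > 0) \<and>
    (\<forall>j k. int (d j) * cartan_matrix \<alpha> j k = int (d k) * cartan_matrix \<alpha> k j) \<and> d i = symmetrizer \<alpha> i"
    unfolding symmetrizer_def by - (rule LeastI[of _ "d i"], blast)
  thus ?thesis by metis
qed

lemma v_at_nonzero [simp]: "v_at \<alpha> i \<noteq> 0"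
  by (simp add: v_at_def)

lemma v_at_powi: "v_at \<alpha> i powi m = vv powi (int (symmetrizer \<alpha> i) * m)"
  by (simp add: v_at_def power_int_mult)

lemma v_at_generic: "n > 0 \<Longrightarrow> v_at \<alpha> i powi (int n) - v_at \<alpha> i powi (- int n) \<noteq> 0"
proof
  assume n: "n > 0" and "v_at \<alpha> i powi (int n) - v_at \<alpha> i powi (- int n) = 0"
  hence "v_at \<alpha> i ^ n * v_at \<alpha> i ^ n = 1" by (simp add: power_int_minus field_simps)
  hence "vv ^ (symmetrizer \<alpha> i * n + symmetrizer \<alpha> i * n) = 1"
    unfolding v_at_def power_add power_mult .
  moreover have "symmetrizer \<alpha> i * n + symmetrizer \<alpha> i * n > 0" by (rule add_pos_pos; rule mult_pos_pos[OF symmetrizer_pos n])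
  ultimately show False using vv_power_neq_1[of "symmetrizer \<alpha> i * n + symmetrizer \<alpha> i * n"] by argo
qed

lemma qint_qnum: "qint \<alpha> i = qnum (v_at \<alpha> i)"
  by (simp add: fun_eq_iff qint_def qnum_def)

lemma v_at_diff: "v_at \<alpha> i - inverse (v_at \<alpha> i) \<noteq> 0"
  using v_at_generic[of 1 i] by (simp add: power_int_minus)

lemma qint_nonzero: "qint \<alpha> i (int (Suc n)) \<noteq> 0"
  using v_at_generic[of "Suc n" i] v_at_diff[of i] by (simp add: qint_def)

lemma qint_0 [simp]: "qint \<alpha> i 0 = 0" and qint_1 [simp]: "qint \<alpha> i 1 = 1"
  using v_at_diff[of i] by (simp_all add: qint_def power_int_minus)

lemma qbinom_0 [simp]: "qbinom \<alpha> i a 0 = 1"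
  by (simp add: qbinom_def)

lemma qbinom_Suc: "qbinom \<alpha> i a (Suc t) = qbinom \<alpha> i a t * qint \<alpha> i (a - int t) / qint \<alpha> i (int (Suc t))"
  by (simp add: qbinom_def)

lemma qbinom_front: "qbinom \<alpha> i a (Suc t) = qint \<alpha> i a / qint \<alpha> i (int (Suc t)) * qbinom \<alpha> i (a - 1) t"
proof (induction t)
  case (Suc t)
  have "qbinom \<alpha> i a (Suc (Suc t)) = qint \<alpha> i a / qint \<alpha> i (int (Suc t)) * qbinom \<alpha> i (a - 1) t
     * qint \<alpha> i (a - int (Suc t)) / qint \<alpha> i (int (Suc (Suc t)))"
    using Suc.IH qbinom_Suc[of i a "Suc t"] by simp
  thus ?case by (simp add: qbinom_Suc[of i "a - 1"] mult_ac diff_diff_eq)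
qed (simp add: qbinom_Suc)

lemma qbinom_pascal:
  "qbinom \<alpha> i (a + 1) (Suc t) = v_at \<alpha> i powi (int t + 1) * qbinom \<alpha> i a (Suc t)
     + v_at \<alpha> i powi (int t - a) * qbinom \<alpha> i a t"
proof -
  let ?v = "v_at \<alpha> i"
  have "qint \<alpha> i (a + 1) = ?v powi (int t + 1) * qint \<alpha> i (a - int t) + qint \<alpha> i (int (Suc t)) * ?v powi (int t - a)"
  proof -
    have *: "(b * v - 1 / (b * v)) / d = c * v * ((b / c - 1 / (b / c)) / d) + (c * v - 1 / (c * v)) / d * (c / b)"
      if "b \<noteq> 0" "c \<noteq> 0" "v \<noteq> 0" "d \<noteq> 0" for b c d v :: Qv using that by (simp add: field_simps)
    show ?thesis
      using *[of "?v powi a" "?v powi int t" ?v "?v - inverse ?v"] v_at_diff[of i]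
      by (simp add: qint_def power_int_add power_int_diff power_int_minus inverse_eq_divide mult.commute[of ?v])
  qed
  thus ?thesis using qint_nonzero[of i t]
    unfolding qbinom_front[of i "a + 1"] qbinom_Suc[of i a] by (simp add: field_simps)
qed

lemma qbinom_0_Suc [simp]: "qbinom \<alpha> i 0 (Suc t) = 0"
  by (simp add: qbinom_front)

lemma qbinom_self: "qbinom \<alpha> i (int n) n = 1"
proof (induction n)
  case (Suc n)
  have "qbinom \<alpha> i (int n) (Suc n) = 0" by (simp add: qbinom_Suc)
  thus ?case using qbinom_pascal[of i "int n" n] Suc by (simp add: add.commute)
qed simp

lemma qbinom_laurent [simp, intro]: "qbinom \<alpha> i a t \<in> laurent_ring"
proof (induction a t rule: pascal_induct)
  case (1 t) thus ?case by (cases t) auto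
next
  case (3 c t)
  thus ?case unfolding qbinom_pascal v_at_powi by (intro laurent_ring_add laurent_ring_mult laurent_ring_powi)
next
  case (4 c t)
  let ?v = "v_at \<alpha> i"
  have "qbinom \<alpha> i c (Suc t) = ?v powi (- (int t + 1)) * (qbinom \<alpha> i (c + 1) (Suc t)
     + (- 1) * (?v powi (int t - c) * qbinom \<alpha> i c t))"
    unfolding qbinom_pascal by (simp only: power_int_minus) simp
  also have "\<dots> \<in> laurent_ring" unfolding v_at_powi
    by (intro laurent_ring_add laurent_ring_mult laurent_ring_powi laurent_ring_minus_1 4)
  finally show ?case .
qed simp

lemma qbinom_qfact: "s \<le> n \<Longrightarrow> qbinom \<alpha> i (int n) s * qfact \<alpha> i s * qfact \<alpha> i (n - s) = qfact \<alpha> i n"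
proof (induction s)
  case (Suc s)
  have 1: "qfact \<alpha> i (Suc s) = qfact \<alpha> i s * qint \<alpha> i (int (Suc s))" by (simp add: qfact_def)
  have "n - s = Suc (n - Suc s)" using Suc.prems by simp
  hence 2: "qfact \<alpha> i (n - s) = qfact \<alpha> i (n - Suc s) * qint \<alpha> i (int n - int s)"
    using Suc.prems by (simp add: qfact_def of_nat_diff)
  show ?case using Suc.IH Suc.prems qint_nonzero[of i s] unfolding 1 2 qbinom_Suc by (simp add: mult_ac)
qed (simp add: qfact_def)

lemma qfact_nonzero: "qfact \<alpha> i n \<noteq> 0"
proof (induction n)
  case (Suc n)
  have "qfact \<alpha> i (Suc n) = qfact \<alpha> i n * qint \<alpha> i (int (Suc n))" by (simp add: qfact_def)
  thus ?case using Suc qint_nonzero[of i n] by simp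
qed (simp add: qfact_def)

lemma qbinom_symmetric:
  assumes "s \<le> n" shows "qbinom \<alpha> i (int n) s = qbinom \<alpha> i (int n) (n - s)"
proof -
  have "qbinom \<alpha> i (int n) s * (qfact \<alpha> i s * qfact \<alpha> i (n - s))
     = qbinom \<alpha> i (int n) (n - s) * (qfact \<alpha> i s * qfact \<alpha> i (n - s))"
    using qbinom_qfact[of s n i] qbinom_qfact[of "n - s" n i] assms by (simp add: mult_ac)
  moreover have "qfact \<alpha> i s * qfact \<alpha> i (n - s) \<noteq> 0" using qfact_nonzero by simp
  ultimately show ?thesis by (metis mult_right_cancel)
qed

definition chi :: "'i \<Rightarrow> int \<Rightarrow> nat \<Rightarrow> 'k" where "chi i a t = specialize q (qbinom \<alpha> i a t)"

lemma chi_pascal: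
  "chi i (a + 1) (Suc t) = q powi (int (symmetrizer \<alpha> i) * (int t + 1)) * chi i a (Suc t)
     + q powi (int (symmetrizer \<alpha> i) * (int t - a)) * chi i a t"
  unfolding chi_def qbinom_pascal v_at_powi
  by (simp add: specialize_add specialize_mult specialize_powi laurent_ring_mult q_nonzero)

lemma chi_0 [simp]: "chi i a 0 = 1"
  by (simp add: chi_def specialize_1 q_nonzero)

text \<open>By the Pascal recurrence the character values at \<open>a\<close> determine those at \<open>a +
  c\<close> for all \<open>c\<close>, and \<open>0\<close> and \<open>n > 0\<close> are told apart by the
  \<open>n\<close>-th binomial.\<close>

lemma chi_inj:
  assumes K: "q powi (int (symmetrizer \<alpha> i) * a) = q powi (int (symmetrizer \<alpha> i) * b)"
    and chi: "\<And>t. chi i a t = chi i b t"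
  shows "a = b"
proof -
  have shifted: "chi i (a + c) t = chi i (b + c) t" for c t
  proof (induction c t rule: pascal_induct)
    case (3 c t)
    have "q powi (int (symmetrizer \<alpha> i) * (int t - (a + c))) = q powi (int (symmetrizer \<alpha> i) * (int t - (b + c)))"
      using K q_nonzero by (simp add: right_diff_distrib distrib_left power_int_diff power_int_add)
    thus ?case using 3 chi_pascal[of i "a + c" t] chi_pascal[of i "b + c" t] by (simp add: add.assoc)
  next
    case (4 c t)
    have "q powi (int (symmetrizer \<alpha> i) * (int t - (a + c))) = q powi (int (symmetrizer \<alpha> i) * (int t - (b + c)))"
      using K q_nonzero by (simp add: right_diff_distrib distrib_left power_int_diff power_int_add)
    thus ?case using 4 chi_pascal[of i "a + c" t] chi_pascal[of i "b + c" t] q_nonzero by (simp add: add.assoc)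
  qed (use chi in auto)
  have False if "chi i 0 n = chi i (int n) n" "n > 0" for n
    using that qbinom_self[of i n] by (cases n) (auto simp: chi_def specialize_0 specialize_1 q_nonzero)
  from this[of "nat (b - a)"] this[of "nat (a - b)"] shifted[of "- a" "nat (b - a)"] shifted[of "- b" "nat (a - b)"]
  show ?thesis by (cases a b rule: linorder_cases) auto
qed

end

section \<open>The quantum enveloping algebra over the field of rational functions\<close>

abbreviation word_monoid :: "'i gen list monoid" where
  "word_monoid \<equiv> \<lparr>carrier = UNIV, mult = (@), one = []\<rparr>"

abbreviation reversal :: "'i gen list \<Rightarrow> 'i gen list" where
  "reversal w \<equiv> rev (map swap_gen w)"

lemma swap_gen_swap_gen [simp]: "swap_gen (swap_gen x) = x"
  by (cases x) auto

lemma reversal_reversal [simp]: "reversal (reversal w) = w"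
  by (induction w) auto

context quantum_data
begin

lemma uv_anti: "monoid_ring_anti word_monoid (uv_ideal \<alpha>) reversal (uv_relations \<alpha>)"
proof -
  interpret m: monoid_ring word_monoid "TYPE(Qv)" by unfold_locales auto
  have A: "m.A = free_algebra" by (simp add: m.A_def)
  have I: "uv_ideal \<alpha> = genideal m.A (uv_relations \<alpha>)" by (simp add: uv_ideal_def A)
  have car: "x \<in> carrier m.A" for x by simp
  interpret q: monoid_ring_quotient word_monoid "TYPE(Qv)" "uv_ideal \<alpha>"
    by (intro monoid_ring_quotient.intro monoid_ring_quotient_axioms.intro m.monoid_ring_axioms, unfold I,
      rule m.A.genideal_ideal, use car in blast)
  have Rel: "uv_relations \<alpha> \<subseteq> uv_ideal \<alpha>" unfolding I by (rule m.A.genideal_self) (use car in blast)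
  have sc: "Poly_Mapping.single [] c \<otimes>\<^bsub>m.A\<^esub> r \<in> uv_ideal \<alpha>" if "r \<in> uv_ideal \<alpha>" for r c
    using that car by (rule q.I.I_l_closed)
  have mem: "word 1 [GK i, GK j] - word 1 [GK j, GK i] \<in> uv_ideal \<alpha>"
     "word 1 [GK i, GKinv i] - word 1 [] \<in> uv_ideal \<alpha>"
     "word 1 [GKinv i, GK i] - word 1 [] \<in> uv_ideal \<alpha>"
     "word 1 [GK i, GE j] - word (vv powi (int (symmetrizer \<alpha> i) * cartan_matrix \<alpha> i j)) [GE j, GK i] \<in> uv_ideal \<alpha>"
     "word 1 [GK i, GF j] - word (vv powi (- (int (symmetrizer \<alpha> i) * cartan_matrix \<alpha> i j))) [GF j, GK i] \<in> uv_ideal \<alpha>"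
     "word 1 [GE i, GF j] - word 1 [GF j, GE i]
          - (if i = j
             then word (1 / (v_at \<alpha> i - inverse (v_at \<alpha> i))) [GK i]
                  - word (1 / (v_at \<alpha> i - inverse (v_at \<alpha> i))) [GKinv i]
             else 0) \<in> uv_ideal \<alpha>" for i j
    by (rule subsetD[OF Rel], unfold uv_relations_def, blast)+
  have KX: "word 1 [x, GK i] - word c [GK i, x] \<in> uv_ideal \<alpha>"
    if "word 1 [GK i, x] - word d [x, GK i] \<in> uv_ideal \<alpha>" "c * d = 1" for i x c d
  proof -
    have "Poly_Mapping.single [] (- c) \<otimes>\<^bsub>m.A\<^esub> (word 1 [GK i, x] - word d [x, GK i])
        = word (- c) [GK i, x] - word (- 1) [x, GK i]"
      using that(2) by (simp add: m.mult_A_diff_right)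
    also have "\<dots> = word 1 [x, GK i] - word c [GK i, x]" by (simp add: single_uminus)
    finally show ?thesis using sc[OF that(1), of "- c"] by simp
  qed
  have serre: "linear_ext reversal (serre X \<alpha> i j) \<in> uv_ideal \<alpha>"
    if X: "X \<in> {GE, GF}" and ij: "i \<noteq> j" for X i j
  proof -
    define X' :: "'i \<Rightarrow> 'i gen" where "X' i = swap_gen (X i)" for i
    have X'mem: "X' \<in> {GE, GF}" using X by (auto simp: X'_def fun_eq_iff)
    define n where "n = nat (1 - cartan_matrix \<alpha> i j)"
    have serre: "serre Y \<alpha> i j = (\<Sum>s\<le>n. word ((-1) ^ s * qbinom \<alpha> i (int n) s)
        (replicate (n - s) (Y i) @ [Y j] @ replicate s (Y i)))" for Y
      by (simp add: serre_def n_def Let_def)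
    have "linear_ext reversal (serre X \<alpha> i j) = (\<Sum>s\<le>n. word ((-1) ^ s * qbinom \<alpha> i (int n) s)
        (replicate s (X' i) @ [X' j] @ replicate (n - s) (X' i)))"
      by (simp add: serre linear_ext_sum X'_def rev_map[symmetric])
    also have "\<dots> = (\<Sum>s\<le>n. word ((-1) ^ (n - s) * qbinom \<alpha> i (int n) (n - s))
        (replicate (n - s) (X' i) @ [X' j] @ replicate s (X' i)))"
      by (rule sum.reindex_bij_witness[of _ "\<lambda>s. n - s" "\<lambda>s. n - s"]) auto
    also have "\<dots> = Poly_Mapping.single [] ((-1) ^ n) \<otimes>\<^bsub>m.A\<^esub> serre X' \<alpha> i j"
    proof -
      have "(-1) ^ (n - s) = (-1) ^ n * (-1 :: Qv) ^ s" if "s \<le> n" for s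
        using that by (simp add: minus_one_power_iff)
      thus ?thesis
        unfolding serre m.mult_A_sum_right
        by (intro sum.cong refl) (simp add: qbinom_symmetric[symmetric] mult.assoc)
    qed
    also have "\<dots> \<in> uv_ideal \<alpha>"
      by (rule sc, rule subsetD[OF Rel]) (use X'mem ij in \<open>unfold uv_relations_def, blast\<close>)
    finally show ?thesis .
  qed
  show ?thesis
  proof (intro monoid_ring_anti.intro q.monoid_ring_quotient_axioms monoid_ring_anti_axioms.intro)
    fix r assume "r \<in> uv_relations \<alpha>"
    then consider i j where "r \<in> {word 1 [GK i, GK j] - word 1 [GK j, GK i],
        word 1 [GK i, GKinv i] - word 1 [],
        word 1 [GKinv i, GK i] - word 1 [],
        word 1 [GK i, GE j]
          - word (vv powi (int (symmetrizer \<alpha> i) * cartan_matrix \<alpha> i j)) [GE j, GK i],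
        word 1 [GK i, GF j]
          - word (vv powi (- (int (symmetrizer \<alpha> i) * cartan_matrix \<alpha> i j))) [GF j, GK i],
        word 1 [GE i, GF j] - word 1 [GF j, GE i]
          - (if i = j
             then word (1 / (v_at \<alpha> i - inverse (v_at \<alpha> i))) [GK i]
                  - word (1 / (v_at \<alpha> i - inverse (v_at \<alpha> i))) [GKinv i]
             else 0)}"
      | X i j where "r = serre X \<alpha> i j" "X \<in> {GE, GF}" "i \<noteq> j"
      unfolding uv_relations_def by blast
    thus "linear_ext reversal r \<in> uv_ideal \<alpha>"
    proof cases
      case (1 i j)
      have c: "vv powi (int (symmetrizer \<alpha> i) * cartan_matrix \<alpha> i j) *
          vv powi (- (int (symmetrizer \<alpha> i) * cartan_matrix \<alpha> i j)) = 1"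
        by (simp add: power_int_minus)
      from 1 mem(1)[of j i] mem(2,3)[of i] mem(6)[of j i] KX[OF mem(4)[of i j], of "vv powi (- (int (symmetrizer \<alpha> i) * cartan_matrix \<alpha> i j))"]
        KX[OF mem(5)[of i j], of "vv powi (int (symmetrizer \<alpha> i) * cartan_matrix \<alpha> i j)"] c
      show ?thesis
        by (elim insertE emptyE) (simp_all add: linear_ext_diff mult.commute split: if_splits)
    next
      case 2
      thus ?thesis using serre by blast
    qed
  qed (use car I in \<open>auto simp del: rev_map\<close>)
qed

sublocale V: monoid_ring_anti word_monoid "TYPE(Qv)" "uv_ideal \<alpha>" reversal "uv_relations \<alpha>"
  rewrites Q_uv: "V.Q = uv \<alpha>" and cls_uv: "V.cls = uv_class \<alpha>" and scalar_uv: "V.scalar = uv_scalar \<alpha>"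
    and Th_uv: "V.Th = uv_tau"
proof -
  show v: "monoid_ring_anti word_monoid (uv_ideal \<alpha>) reversal (uv_relations \<alpha>)"
    by (rule uv_anti)
  interpret monoid_ring_anti word_monoid "TYPE(Qv)" "uv_ideal \<alpha>" reversal "uv_relations \<alpha>" by (rule v)
  show "Q = uv \<alpha>" by (simp add: Q_def uv_def A_def)
  show c: "cls = uv_class \<alpha>" by (simp add: fun_eq_iff cls_def uv_class_def A_def)
  show "scalar = uv_scalar \<alpha>" by (simp add: fun_eq_iff scalar_def c uv_scalar_def)
  show "Th = uv_tau" by (simp add: fun_eq_iff Th_def uv_tau_def)
qed


abbreviation uvg :: "'i gen \<Rightarrow> 'i uv_elem" where "uvg x \<equiv> uv_class \<alpha> (word 1 [x])"

abbreviation UV :: "'i uv_elem ring" where "UV \<equiv> uv \<alpha>"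
abbreviation vscl where "vscl \<equiv> V.Q.scl"

lemma uv_class_closed [simp, intro]: "uv_class \<alpha> f \<in> carrier UV"
  using V.cls.hom_closed[of f] by simp

lemma uv_class_mult:
  "uv_class \<alpha> (word a w) \<otimes>\<^bsub>UV\<^esub> uv_class \<alpha> (word b w') = uv_class \<alpha> (word (a * b) (w @ w'))"
  using V.cls.hom_mult[of "word a w" "word b w'"] by simp

lemma uv_class_scl: "vscl c (uv_class \<alpha> (word a w)) = uv_class \<alpha> (word (c * a) w)"
  using uv_class_mult[where a = c and w = "[]" and b = a and w' = w] by (simp add: V.Q.scl_def uv_scalar_def)

lemma uvg_power: "uvg x [^]\<^bsub>UV\<^esub> (n::nat) = uv_class \<alpha> (word 1 (replicate n x))"
proof (induction n)
  case 0
  show ?case using V.cls.hom_one by simp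
next
  case (Suc n)
  thus ?case by (simp add: uv_class_mult replicate_append_same)
qed

lemma uv_E_power: "uv_E \<alpha> i r = vscl (1 / qfact \<alpha> i r) (uvg (GE i) [^]\<^bsub>UV\<^esub> r)"
  and uv_F_power: "uv_F \<alpha> i r = vscl (1 / qfact \<alpha> i r) (uvg (GF i) [^]\<^bsub>UV\<^esub> r)"
  by (simp_all add: uvg_power uv_class_scl uv_E_def uv_F_def)

lemma uv_gens_closed [simp, intro]:
  "uv_E \<alpha> i r \<in> carrier UV" "uv_F \<alpha> i r \<in> carrier UV"
  "uv_K \<alpha> i \<in> carrier UV" "uv_Kinv \<alpha> i \<in> carrier UV"
  by (simp_all add: uv_E_def uv_F_def uv_K_def uv_Kinv_def)

lemma uv_relation: "f - g \<in> uv_relations \<alpha> \<Longrightarrow> uv_class \<alpha> f = uv_class \<alpha> g"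
proof -
  assume "f - g \<in> uv_relations \<alpha>"
  hence "f - g \<in> uv_ideal \<alpha>" using V.A.genideal_self[OF V.Rel] V.I_Rel by blast
  thus ?thesis using V.cls_eq[of f g] by simp
qed

lemma uv_K_comm:
  "uv_K \<alpha> i \<otimes>\<^bsub>UV\<^esub> uvg (GE j) = vscl (v_at \<alpha> i powi cartan_matrix \<alpha> i j) (uvg (GE j) \<otimes>\<^bsub>UV\<^esub> uv_K \<alpha> i)"
  "uv_K \<alpha> i \<otimes>\<^bsub>UV\<^esub> uvg (GF j) = vscl (v_at \<alpha> i powi (- cartan_matrix \<alpha> i j)) (uvg (GF j) \<otimes>\<^bsub>UV\<^esub> uv_K \<alpha> i)"
  unfolding uv_K_def uv_class_mult uv_class_scl v_at_powi
  by (rule uv_relation, unfold uv_relations_def, rule UnI1, rule UN_I[of i], blast, rule UN_I[of j], blast, simp)+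

lemma uv_K_inverse:
  "uv_K \<alpha> i \<otimes>\<^bsub>UV\<^esub> uv_Kinv \<alpha> i = \<one>\<^bsub>UV\<^esub>" "uv_Kinv \<alpha> i \<otimes>\<^bsub>UV\<^esub> uv_K \<alpha> i = \<one>\<^bsub>UV\<^esub>"
proof -
  have 1: "\<one>\<^bsub>UV\<^esub> = uv_class \<alpha> (word 1 [])" using V.cls.hom_one by simp
  show "uv_K \<alpha> i \<otimes>\<^bsub>UV\<^esub> uv_Kinv \<alpha> i = \<one>\<^bsub>UV\<^esub>" "uv_Kinv \<alpha> i \<otimes>\<^bsub>UV\<^esub> uv_K \<alpha> i = \<one>\<^bsub>UV\<^esub>"
    unfolding 1 uv_K_def uv_Kinv_def uv_class_mult
    by (rule uv_relation, unfold uv_relations_def, rule UnI1, rule UN_I[of i], blast, rule UN_I[of i], blast, simp)+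
qed

lemma uv_E_F:
  "uvg (GE i) \<otimes>\<^bsub>UV\<^esub> uvg (GF j) = uvg (GF j) \<otimes>\<^bsub>UV\<^esub> uvg (GE i) \<oplus>\<^bsub>UV\<^esub>
    (if i = j then vscl (1 / (v_at \<alpha> i - inverse (v_at \<alpha> i))) (uv_K \<alpha> i) \<oplus>\<^bsub>UV\<^esub>
       vscl (- (1 / (v_at \<alpha> i - inverse (v_at \<alpha> i)))) (uv_Kinv \<alpha> i) else \<zero>\<^bsub>UV\<^esub>)"
proof -
  let ?d = "1 / (v_at \<alpha> i - inverse (v_at \<alpha> i))"
  let ?k = "if i = j then word ?d [GK i] - word ?d [GKinv i] else 0"
  have "uvg (GE i) \<otimes>\<^bsub>UV\<^esub> uvg (GF j) = uv_class \<alpha> (word 1 [GF j, GE i] + ?k)"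
    unfolding uv_class_mult
    by (rule uv_relation, unfold uv_relations_def, rule UnI1, rule UN_I[of i], blast, rule UN_I[of j], blast,
        simp add: algebra_simps)
  also have "\<dots> = uvg (GF j) \<otimes>\<^bsub>UV\<^esub> uvg (GE i) \<oplus>\<^bsub>UV\<^esub> uv_class \<alpha> ?k"
    unfolding uv_class_mult by (subst V.cls_add) simp_all
  finally have eq: "uvg (GE i) \<otimes>\<^bsub>UV\<^esub> uvg (GF j) = uvg (GF j) \<otimes>\<^bsub>UV\<^esub> uvg (GE i) \<oplus>\<^bsub>UV\<^esub> uv_class \<alpha> ?k" .
  have "uv_class \<alpha> (word ?d [GK i] - word ?d [GKinv i])
      = vscl ?d (uv_K \<alpha> i) \<oplus>\<^bsub>UV\<^esub> vscl (- ?d) (uv_Kinv \<alpha> i)"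
    using V.cls_add[of "word ?d [GK i]" "word (- ?d) [GKinv i]"]
    by (simp add: uv_K_def uv_Kinv_def uv_class_scl single_uminus)
  hence k: "uv_class \<alpha> ?k = (if i = j then vscl ?d (uv_K \<alpha> i) \<oplus>\<^bsub>UV\<^esub> vscl (- ?d) (uv_Kinv \<alpha> i) else \<zero>\<^bsub>UV\<^esub>)"
    by (cases "i = j") (simp_all only: if_True if_False refl simp_thms V.cls_zero)
  show ?thesis unfolding eq k ..
qed

text \<open>The generators with index \<open>i\<close> satisfy the rank one relations, so Kac's formula and
  the Pascal recurrence apply to them.\<close>

lemma uv_rank_one:
  "rank_one UV (uv_scalar \<alpha>) (uvg (GE i)) (uvg (GF i)) (uv_K \<alpha> i) (uv_Kinv \<alpha> i) (v_at \<alpha> i)"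
  using uv_K_comm[of i i] uv_K_inverse[of i] uv_E_F[of i i] v_at_generic[of _ i]
  by (intro rank_one.intro V.Q.central_scalars_axioms rank_one_axioms.intro) auto

text \<open>The shifted Gaussian binomials of \<open>K\<^sub>i\<close>.\<close>

definition KB :: "'i \<Rightarrow> int \<Rightarrow> nat \<Rightarrow> 'i uv_elem" where
  "KB i = rank_one.kbin UV (uv_scalar \<alpha>) (uv_K \<alpha> i) (uv_Kinv \<alpha> i) (v_at \<alpha> i)"

lemma uv_divided_powers:
  "uv_E \<alpha> i r = rank_one.ed UV (uv_scalar \<alpha>) (uvg (GE i)) (v_at \<alpha> i) r"
  "uv_F \<alpha> i r = rank_one.fd UV (uv_scalar \<alpha>) (uvg (GF i)) (v_at \<alpha> i) r"
proof -
  interpret r: rank_one UV "uv_scalar \<alpha>" "uvg (GE i)" "uvg (GF i)" "uv_K \<alpha> i" "uv_Kinv \<alpha> i" "v_at \<alpha> i"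
    by (rule uv_rank_one)
  have "qfact \<alpha> i r = r.qfac r" by (simp add: qfact_def r.qfac_def qint_qnum)
  thus "uv_E \<alpha> i r = r.ed r" "uv_F \<alpha> i r = r.fd r"
    by (simp_all add: uv_E_power uv_F_power r.ed_def r.fd_def)
qed

lemma KB_closed [simp, intro]: "KB i c t \<in> carrier UV"
  using rank_one.kbin_closed[OF uv_rank_one] by (simp add: KB_def)

lemma KB_0 [simp]: "KB i c 0 = \<one>\<^bsub>UV\<^esub>"
  using rank_one.kbin.simps(1)[OF uv_rank_one] by (simp add: KB_def)

lemma KB_pascal:
  "KB i (c + 1) (Suc t) = vscl (v_at \<alpha> i powi (int t + 1)) (KB i c (Suc t)) \<oplus>\<^bsub>UV\<^esub>
     vscl (v_at \<alpha> i powi (int t - c)) (uv_Kinv \<alpha> i \<otimes>\<^bsub>UV\<^esub> KB i c t)"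
  using rank_one.kbin_pascal[OF uv_rank_one] by (simp add: KB_def)

lemma KB_commute:
  assumes "x \<in> carrier UV" "uv_K \<alpha> i \<otimes>\<^bsub>UV\<^esub> x = vscl (v_at \<alpha> i powi m) (x \<otimes>\<^bsub>UV\<^esub> uv_K \<alpha> i)"
  shows "KB i c t \<otimes>\<^bsub>UV\<^esub> x = x \<otimes>\<^bsub>UV\<^esub> KB i (c + m) t"
  using rank_one.kbin_commute[OF uv_rank_one assms] by (simp add: KB_def)

lemma uv_Kac:
  "uv_E \<alpha> i r \<otimes>\<^bsub>UV\<^esub> uv_F \<alpha> i s = (\<Oplus>\<^bsub>UV\<^esub>t\<in>{..r}. (if t \<le> s then uv_F \<alpha> i (s - t) else \<zero>\<^bsub>UV\<^esub>)
     \<otimes>\<^bsub>UV\<^esub> KB i (2 * int t - int r - int s) t \<otimes>\<^bsub>UV\<^esub> uv_E \<alpha> i (r - t))"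
proof -
  interpret r: rank_one UV "uv_scalar \<alpha>" "uvg (GE i)" "uvg (GF i)" "uv_K \<alpha> i" "uv_Kinv \<alpha> i" "v_at \<alpha> i"
    by (rule uv_rank_one)
  show ?thesis unfolding uv_divided_powers KB_def using r.ed_fd[of r s] by (simp add: r.fdm_def cong: if_cong)
qed

lemma KB_uv_Kbinom: "KB i 0 t = uv_Kbinom \<alpha> i t"
proof (induction t)
  case (Suc t)
  interpret r: rank_one UV "uv_scalar \<alpha>" "uvg (GE i)" "uvg (GF i)" "uv_K \<alpha> i" "uv_Kinv \<alpha> i" "v_at \<alpha> i"
    by (rule uv_rank_one)
  let ?w = "v_at \<alpha> i"
  define c where "c = ?w powi (int t + 1) - ?w powi (- (int t + 1))"
  have n: "qnum ?w (int (Suc t)) = c / r.vdiff" by (simp add: qnum_def c_def r.vdiff_def add.commute)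
  have nz: "r.vdiff \<noteq> 0" by (rule r.vdiff_nonzero)
  have "vscl (1 / qnum ?w (int (Suc t))) (r.khat (0 - int t))
     = vscl (?w powi (- int t) / c) (uv_K \<alpha> i) \<oplus>\<^bsub>UV\<^esub> vscl (- (?w powi (int t) / c)) (uv_Kinv \<alpha> i)"
    unfolding n r.khat_def r.scl_lin unfolding r.lin_def using nz by (simp add: field_simps)
  also have "\<dots> = uv_class \<alpha> (word (?w powi (- int t) / c) [GK i] - word (?w powi (int t) / c) [GKinv i])"
    using V.cls_add[of "word (?w powi (- int t) / c) [GK i]" "word (- (?w powi (int t) / c)) [GKinv i]"]
    by (simp add: uv_K_def uv_Kinv_def uv_class_scl single_uminus)
  finally show ?case using Suc unfolding KB_def
    by (simp add: Let_def c_def del: of_nat_Suc)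
qed simp

lemma uv_K_power:
  assumes x: "x \<in> carrier UV" and kx: "uv_K \<alpha> i \<otimes>\<^bsub>UV\<^esub> x = vscl (v_at \<alpha> i powi m) (x \<otimes>\<^bsub>UV\<^esub> uv_K \<alpha> i)"
  shows "uv_K \<alpha> i \<otimes>\<^bsub>UV\<^esub> x [^]\<^bsub>UV\<^esub> (r::nat) = vscl (v_at \<alpha> i powi (int r * m)) (x [^]\<^bsub>UV\<^esub> r \<otimes>\<^bsub>UV\<^esub> uv_K \<alpha> i)"
proof (induction r)
  case (Suc r)
  have "uv_K \<alpha> i \<otimes>\<^bsub>UV\<^esub> x [^]\<^bsub>UV\<^esub> Suc r = (uv_K \<alpha> i \<otimes>\<^bsub>UV\<^esub> x [^]\<^bsub>UV\<^esub> r) \<otimes>\<^bsub>UV\<^esub> x"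
    using x by (simp add: V.Q.m_assoc)
  also have "\<dots> = vscl (v_at \<alpha> i powi (int r * m)) (x [^]\<^bsub>UV\<^esub> r \<otimes>\<^bsub>UV\<^esub> (uv_K \<alpha> i \<otimes>\<^bsub>UV\<^esub> x))"
    using x by (simp add: Suc.IH V.Q.scl_mult_left V.Q.m_assoc)
  also have "\<dots> = vscl (v_at \<alpha> i powi (int (Suc r) * m)) (x [^]\<^bsub>UV\<^esub> Suc r \<otimes>\<^bsub>UV\<^esub> uv_K \<alpha> i)"
  proof -
    have "v_at \<alpha> i powi (int (Suc r) * m) = v_at \<alpha> i powi (int r * m) * v_at \<alpha> i powi m"
      using power_int_add[of "v_at \<alpha> i" "int r * m" m] by (simp add: algebra_simps)
    thus ?thesis using x by (simp add: kx V.Q.scl_mult_right V.Q.m_assoc)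
  qed
  finally show ?case .
qed simp

lemma uv_K_E: "uv_K \<alpha> i \<otimes>\<^bsub>UV\<^esub> uv_E \<alpha> j r =
     vscl (v_at \<alpha> i powi (int r * cartan_matrix \<alpha> i j)) (uv_E \<alpha> j r \<otimes>\<^bsub>UV\<^esub> uv_K \<alpha> i)"
  and uv_K_F: "uv_K \<alpha> i \<otimes>\<^bsub>UV\<^esub> uv_F \<alpha> j r =
     vscl (v_at \<alpha> i powi (- (int r * cartan_matrix \<alpha> i j))) (uv_F \<alpha> j r \<otimes>\<^bsub>UV\<^esub> uv_K \<alpha> i)"
  using uv_K_power[OF uv_class_closed uv_K_comm(1)[of i j], of r]
    uv_K_power[OF uv_class_closed uv_K_comm(2)[of i j], of r]
  by (simp_all add: uv_E_power uv_F_power V.Q.scl_mult_left V.Q.scl_mult_right mult.commute)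

lemma uv_E_F_commute:
  assumes "i \<noteq> j"
  shows "uv_E \<alpha> i r \<otimes>\<^bsub>UV\<^esub> uv_F \<alpha> j s = uv_F \<alpha> j s \<otimes>\<^bsub>UV\<^esub> uv_E \<alpha> i r"
proof -
  have pow: "x \<otimes>\<^bsub>UV\<^esub> y [^]\<^bsub>UV\<^esub> n = y [^]\<^bsub>UV\<^esub> n \<otimes>\<^bsub>UV\<^esub> x"
    if "x \<in> carrier UV" "y \<in> carrier UV" "x \<otimes>\<^bsub>UV\<^esub> y = y \<otimes>\<^bsub>UV\<^esub> x" for x y and n :: nat
  proof (induction n)
    case (Suc n)
    have "x \<otimes>\<^bsub>UV\<^esub> y [^]\<^bsub>UV\<^esub> Suc n = (x \<otimes>\<^bsub>UV\<^esub> y [^]\<^bsub>UV\<^esub> n) \<otimes>\<^bsub>UV\<^esub> y"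
      using that by (simp add: V.Q.m_assoc)
    also have "\<dots> = y [^]\<^bsub>UV\<^esub> n \<otimes>\<^bsub>UV\<^esub> (x \<otimes>\<^bsub>UV\<^esub> y)"
      unfolding Suc.IH using that by (simp add: V.Q.m_assoc)
    also have "\<dots> = y [^]\<^bsub>UV\<^esub> Suc n \<otimes>\<^bsub>UV\<^esub> x"
      unfolding that(3) using that(1,2) by (simp add: V.Q.m_assoc)
    finally show ?case .
  qed (use that in simp)
  have "uvg (GE i) \<otimes>\<^bsub>UV\<^esub> uvg (GF j) = uvg (GF j) \<otimes>\<^bsub>UV\<^esub> uvg (GE i)"
    using uv_E_F[of i j] assms by simp
  hence "uvg (GE i) \<otimes>\<^bsub>UV\<^esub> uvg (GF j) [^]\<^bsub>UV\<^esub> s = uvg (GF j) [^]\<^bsub>UV\<^esub> s \<otimes>\<^bsub>UV\<^esub> uvg (GE i)"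
    by (intro pow) auto
  hence "uvg (GF j) [^]\<^bsub>UV\<^esub> s \<otimes>\<^bsub>UV\<^esub> uvg (GE i) [^]\<^bsub>UV\<^esub> r = uvg (GE i) [^]\<^bsub>UV\<^esub> r \<otimes>\<^bsub>UV\<^esub> uvg (GF j) [^]\<^bsub>UV\<^esub> s"
    by (intro pow) auto
  thus ?thesis
    by (simp add: uv_E_power uv_F_power V.Q.scl_mult_left V.Q.scl_mult_right mult.commute)
qed

lemma uv_tau_gens:
  "uv_tau (uv_E \<alpha> i r) = uv_F \<alpha> i r" "uv_tau (uv_F \<alpha> i r) = uv_E \<alpha> i r"
  "uv_tau (uv_K \<alpha> i) = uv_K \<alpha> i" "uv_tau (uv_Kinv \<alpha> i) = uv_Kinv \<alpha> i"
  "uv_tau (uv_scalar \<alpha> c) = uv_scalar \<alpha> c"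
proof -
  have t: "uv_tau (uv_class \<alpha> (word c w)) = uv_class \<alpha> (word c (reversal w))" for c w
    using V.Th_cls[of "word c w"] by (simp del: rev_map)
  show "uv_tau (uv_E \<alpha> i r) = uv_F \<alpha> i r" "uv_tau (uv_F \<alpha> i r) = uv_E \<alpha> i r"
    "uv_tau (uv_K \<alpha> i) = uv_K \<alpha> i" "uv_tau (uv_Kinv \<alpha> i) = uv_Kinv \<alpha> i"
    "uv_tau (uv_scalar \<alpha> c) = uv_scalar \<alpha> c"
    by (simp_all add: uv_E_def uv_F_def uv_K_def uv_Kinv_def uv_scalar_def t)
qed

end

section \<open>The integral form\<close>

context quantum_data
begin

definition ua_gens :: "'i uv_elem set" where
  "ua_gens = uv_scalar \<alpha> ` laurent_ring \<union> range (uv_K \<alpha>) \<union> range (uv_Kinv \<alpha>)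
      \<union> {uv_E \<alpha> i r | i r. True} \<union> {uv_F \<alpha> i r | i r. True}"

lemma ua_alt: "ua \<alpha> = UV\<lparr>carrier := generate_ring UV ua_gens\<rparr>"
  by (simp add: ua_def ua_gens_def)

lemma ua_ops [simp]:
  "mult (ua \<alpha>) = mult UV" "one (ua \<alpha>) = one UV" "add (ua \<alpha>) = add UV" "zero (ua \<alpha>) = zero UV"
  by (simp_all add: ua_alt)

lemma ua_gens_sub: "ua_gens \<subseteq> carrier UV"
  by (auto simp: ua_gens_def)

lemma ua_sub [simp, intro]: "x \<in> carrier (ua \<alpha>) \<Longrightarrow> x \<in> carrier UV"
  using V.Q.generate_ring_incl[OF ua_gens_sub] by (auto simp: ua_alt)

lemma ua_ring: "ring (ua \<alpha>)"
  using V.Q.generate_ring_is_ring[OF ua_gens_sub] by (simp add: ua_alt)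

lemma ua_closed [simp, intro]:
  "\<one>\<^bsub>UV\<^esub> \<in> carrier (ua \<alpha>)" "\<zero>\<^bsub>UV\<^esub> \<in> carrier (ua \<alpha>)"
  "x \<in> carrier (ua \<alpha>) \<Longrightarrow> y \<in> carrier (ua \<alpha>) \<Longrightarrow> x \<oplus>\<^bsub>UV\<^esub> y \<in> carrier (ua \<alpha>)"
  "x \<in> carrier (ua \<alpha>) \<Longrightarrow> y \<in> carrier (ua \<alpha>) \<Longrightarrow> x \<otimes>\<^bsub>UV\<^esub> y \<in> carrier (ua \<alpha>)"
  "x \<in> carrier (ua \<alpha>) \<Longrightarrow> \<ominus>\<^bsub>UV\<^esub> x \<in> carrier (ua \<alpha>)"
  "a \<in> laurent_ring \<Longrightarrow> uv_scalar \<alpha> a \<in> carrier (ua \<alpha>)"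
  "uv_K \<alpha> i \<in> carrier (ua \<alpha>)" "uv_Kinv \<alpha> i \<in> carrier (ua \<alpha>)"
  "uv_E \<alpha> i r \<in> carrier (ua \<alpha>)" "uv_F \<alpha> i r \<in> carrier (ua \<alpha>)"
  using V.Q.zero_in_generate
  by (auto simp: ua_alt ua_gens_def intro: generate_ring.intros) (rule generate_ring.incl, blast)+

lemma ua_scl [simp, intro]: "a \<in> laurent_ring \<Longrightarrow> x \<in> carrier (ua \<alpha>) \<Longrightarrow> vscl a x \<in> carrier (ua \<alpha>)"
  by (simp add: V.Q.scl_def)

lemma ua_finsum: "finite S \<Longrightarrow> g \<in> S \<rightarrow> carrier (ua \<alpha>) \<Longrightarrow> finsum UV g S \<in> carrier (ua \<alpha>)"
proof (induction S rule: finite_induct)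
  case (insert x S)
  hence "g \<in> S \<rightarrow> carrier UV" "g x \<in> carrier UV" by auto
  thus ?case using insert by (simp add: V.Q.finsum_insert)
qed simp

text \<open>The Pascal recurrence can be solved for the term with the smaller \<open>c\<close>, because its
  coefficient is a power of \<open>v\<close>.\<close>

lemma KB_cancel:
  assumes "KB i (c + 1) (Suc t) \<in> carrier (ua \<alpha>)" "KB i c t \<in> carrier (ua \<alpha>)"
  shows "KB i c (Suc t) \<in> carrier (ua \<alpha>)"
proof -
  let ?v = "v_at \<alpha> i"
  have "vscl (?v powi (- (int t + 1))) (KB i (c + 1) (Suc t) \<oplus>\<^bsub>UV\<^esub>
      vscl (- 1) (vscl (?v powi (int t - c)) (uv_Kinv \<alpha> i \<otimes>\<^bsub>UV\<^esub> KB i c t)))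
    = vscl (?v powi (- (int t + 1))) (vscl (?v powi (int t + 1)) (KB i c (Suc t)))"
    unfolding KB_pascal V.Q.scl_uminus[of _ 1, simplified]
    by (subst V.Q.scl_uminus) (simp_all add: V.Q.a_assoc V.Q.r_neg)
  also have "\<dots> = KB i c (Suc t)"
    by (simp add: power_int_minus del: minus_add_distrib)
  finally have "KB i c (Suc t) = vscl (?v powi (- (int t + 1))) (KB i (c + 1) (Suc t) \<oplus>\<^bsub>UV\<^esub>
      vscl (- 1) (vscl (?v powi (int t - c)) (uv_Kinv \<alpha> i \<otimes>\<^bsub>UV\<^esub> KB i c t)))" ..
  also have "\<dots> \<in> carrier (ua \<alpha>)"
    unfolding v_at_powi by (intro ua_closed ua_scl laurent_ring_powi laurent_ring_minus_1 assms)
  finally show ?thesis .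
qed

text \<open>The coefficient at \<open>t = r\<close> in the commutation formula for \<open>E\<^sup>(\<^sup>r\<^sup>) F\<^sup>(\<^sup>r\<^sup>)\<close> is the Gaussian binomial
  of \<open>K\<close>; the other coefficients are in the integral form by induction.\<close>

lemma KB_in_ua: "KB i c t \<in> carrier (ua \<alpha>)"
proof -
  have base: "KB i 0 t \<in> carrier (ua \<alpha>)" for t
  proof (induction t rule: less_induct)
    case (less r)
    have below: "u < r \<longrightarrow> KB i c u \<in> carrier (ua \<alpha>)" for c u
    proof (induction c u rule: pascal_induct)
      case (3 c t)
      show ?case
      proof
        assume "Suc t < r"
        thus "KB i (c + 1) (Suc t) \<in> carrier (ua \<alpha>)"
          unfolding KB_pascal v_at_powi using 3 by (intro ua_closed ua_scl laurent_ring_powi) auto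
      qed
    next
      case (4 c t)
      thus ?case using KB_cancel by auto
    qed (use less in auto)
    let ?T = "\<lambda>t. (if t \<le> r then uv_F \<alpha> i (r - t) else \<zero>\<^bsub>UV\<^esub>)
       \<otimes>\<^bsub>UV\<^esub> KB i (2 * int t - int r - int r) t \<otimes>\<^bsub>UV\<^esub> uv_E \<alpha> i (r - t)"
    have E0: "uv_E \<alpha> i 0 = \<one>\<^bsub>UV\<^esub>" "uv_F \<alpha> i 0 = \<one>\<^bsub>UV\<^esub>"
      by (simp_all add: uv_E_power uv_F_power qfact_def V.Q.scalar_one)
    let ?S = "finsum UV ?T {..<r}"
    have S: "?S \<in> carrier (ua \<alpha>)"
      by (rule ua_finsum) (use below in \<open>auto intro!: ua_closed\<close>)
    have "uv_E \<alpha> i r \<otimes>\<^bsub>UV\<^esub> uv_F \<alpha> i r = finsum UV ?T (insert r {..<r})"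
      unfolding uv_Kac by (rule arg_cong[of _ _ "finsum UV ?T"]) auto
    also have "\<dots> = KB i 0 r \<oplus>\<^bsub>UV\<^esub> ?S"
      by (subst V.Q.finsum_insert) (auto simp: E0)
    finally have "KB i 0 r = uv_E \<alpha> i r \<otimes>\<^bsub>UV\<^esub> uv_F \<alpha> i r \<oplus>\<^bsub>UV\<^esub> \<ominus>\<^bsub>UV\<^esub> ?S"
      using ua_sub[OF S] by (simp add: V.Q.a_assoc V.Q.r_neg)
    thus ?case using S by (simp add: ua_closed)
  qed
  show ?thesis
  proof (induction c t rule: pascal_induct)
    case (3 c t)
    thus ?case unfolding KB_pascal v_at_powi by (intro ua_closed ua_scl laurent_ring_powi)
  qed (use base KB_cancel in auto)
qed

lemma uv_tau_ua: assumes "x \<in> carrier (ua \<alpha>)" shows "uv_tau x \<in> carrier (ua \<alpha>)"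
proof -
  have "x \<in> generate_ring UV ua_gens" using assms by (simp add: ua_alt)
  thus ?thesis
  proof (induction rule: generate_ring.induct)
    case one
    show ?case using uv_tau_gens(5)[of 1] by (simp add: V.Q.scalar_one)
  next
    case (incl h) thus ?case by (auto simp: ua_gens_def uv_tau_gens)
  next
    case (a_inv h)
    hence h: "h \<in> carrier (ua \<alpha>)" by (simp add: ua_alt)
    hence "\<ominus>\<^bsub>UV\<^esub> h = uv_scalar \<alpha> (- 1) \<otimes>\<^bsub>UV\<^esub> h"
      using V.Q.scl_uminus[of h 1] by (simp add: V.Q.scl_def V.Q.scalar_one)
    thus ?case using h a_inv by (simp add: V.Th_mult uv_tau_gens ua_closed)
  next
    case (eng_add h1 h2)
    hence "h1 \<in> carrier (ua \<alpha>)" "h2 \<in> carrier (ua \<alpha>)" by (simp_all add: ua_alt)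
    thus ?case using eng_add by (simp add: V.Th_add)
  next
    case (eng_mult h1 h2)
    hence "h1 \<in> carrier (ua \<alpha>)" "h2 \<in> carrier (ua \<alpha>)" by (simp_all add: ua_alt)
    thus ?case using eng_mult by (simp add: V.Th_mult)
  qed
qed

section \<open>Specialization\<close>

definition uq_rel :: "('i uv_elem \<Rightarrow>\<^sub>0 'k) set" where
  "uq_rel = {Poly_Mapping.single (x \<oplus>\<^bsub>ua \<alpha>\<^esub> y) 1 - Poly_Mapping.single x 1 - Poly_Mapping.single y 1
        | x y. x \<in> carrier (ua \<alpha>) \<and> y \<in> carrier (ua \<alpha>)} \<union>
      {Poly_Mapping.single (uv_scalar \<alpha> a \<otimes>\<^bsub>ua \<alpha>\<^esub> x) 1 - Poly_Mapping.single x (specialize q a)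
        | a x. a \<in> laurent_ring \<and> x \<in> carrier (ua \<alpha>)}"

text \<open>The defining relations of the specialization are mapped to such relations, as the
  anti-involution is additive and fixes the scalars.\<close>

lemma uq_anti: "monoid_ring_anti (ua \<alpha>) (uq_ideal \<alpha> q) uv_tau uq_rel"
proof -
  interpret ring "ua \<alpha>" by (rule ua_ring)
  interpret m: monoid_ring "ua \<alpha>" "TYPE('k)" by unfold_locales
  have I: "uq_ideal \<alpha> q = genideal m.A uq_rel" by (simp add: uq_ideal_def uq_rel_def m.A_def)
  have minus: "f - g \<in> carrier m.A" if "f \<in> carrier m.A" "g \<in> carrier m.A" for f g
    using m.A.minus_closed[OF that] m.a_minus_A[OF that] by simp
  have Rel: "uq_rel \<subseteq> carrier m.A"
    unfolding uq_rel_def by (auto simp del: m.A_simps(1) intro!: minus) (auto simp: ua_closed)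
  interpret q: monoid_ring_quotient "ua \<alpha>" "TYPE('k)" "uq_ideal \<alpha> q"
    by (intro monoid_ring_quotient.intro monoid_ring_quotient_axioms.intro m.monoid_ring_axioms, unfold I,
      rule m.A.genideal_ideal, rule Rel)
  have sub: "uq_rel \<subseteq> uq_ideal \<alpha> q" unfolding I by (rule m.A.genideal_self[OF Rel])
  show ?thesis
  proof (intro monoid_ring_anti.intro q.monoid_ring_quotient_axioms monoid_ring_anti_axioms.intro)
    fix r assume "r \<in> uq_rel"
    then consider x y where "x \<in> carrier (ua \<alpha>)" "y \<in> carrier (ua \<alpha>)"
        "r = Poly_Mapping.single (x \<oplus>\<^bsub>ua \<alpha>\<^esub> y) 1 - Poly_Mapping.single x 1 - Poly_Mapping.single y 1"
      | a x where "a \<in> laurent_ring" "x \<in> carrier (ua \<alpha>)"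
        "r = Poly_Mapping.single (uv_scalar \<alpha> a \<otimes>\<^bsub>ua \<alpha>\<^esub> x) 1 - Poly_Mapping.single x (specialize q a)"
      unfolding uq_rel_def by blast
    hence "linear_ext uv_tau r \<in> uq_rel"
    proof cases
      case 1
      thus ?thesis unfolding uq_rel_def using uv_tau_ua
        by (intro UnI1 CollectI exI[of _ "uv_tau x"] exI[of _ "uv_tau y"])
          (simp add: linear_ext_diff V.Th_add)
    next
      case 2
      thus ?thesis unfolding uq_rel_def using uv_tau_ua
        by (intro UnI2 CollectI exI[of _ a] exI[of _ "uv_tau x"])
          (simp add: linear_ext_diff V.Th_mult uv_tau_gens V.Q.scalar_central)
    qed
    thus "linear_ext uv_tau r \<in> uq_ideal \<alpha> q" using sub by blast
  next
    show "uv_tau \<one>\<^bsub>ua \<alpha>\<^esub> = \<one>\<^bsub>ua \<alpha>\<^esub>" using uv_tau_gens(5)[of 1] by (simp add: V.Q.scalar_one)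
  qed (use uv_tau_ua Rel I in \<open>simp_all add: V.Th_mult V.Th_Th\<close>)
qed

sublocale W: monoid_ring_anti "ua \<alpha>" "TYPE('k)" "uq_ideal \<alpha> q" uv_tau uq_rel
  rewrites Q_uq: "W.Q = uq \<alpha> q" and scalar_uq: "W.scalar = uq_scalar \<alpha> q" and Th_uq: "W.Th = uq_tau"
proof -
  show v: "monoid_ring_anti (ua \<alpha>) (uq_ideal \<alpha> q) uv_tau uq_rel"
    by (rule uq_anti)
  interpret monoid_ring_anti "ua \<alpha>" "TYPE('k)" "uq_ideal \<alpha> q" uv_tau uq_rel by (rule v)
  show "Q = uq \<alpha> q" by (simp add: Q_def uq_def A_def)
  show "scalar = uq_scalar \<alpha> q" by (simp add: fun_eq_iff scalar_def cls_def uq_scalar_def uq_tensor_def A_def)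
  show "Th = uq_tau" by (simp add: fun_eq_iff Th_def uq_tau_def)
qed

abbreviation U :: "('i, 'k) uq_elem ring" where "U \<equiv> uq \<alpha> q"
abbreviation uscl where "uscl \<equiv> W.Q.scl"

text \<open>The canonical map of the integral form into its specialization; identities are transported along
  it.\<close>

definition psi :: "'i uv_elem \<Rightarrow> ('i, 'k) uq_elem" where "psi x = uq_tensor \<alpha> q x 1"

lemma psi_cls: "psi x = W.cls (Poly_Mapping.single x 1)"
  by (simp add: psi_def uq_tensor_def W.cls_def W.A_def)

lemma psi_closed [simp, intro]: "x \<in> carrier (ua \<alpha>) \<Longrightarrow> psi x \<in> carrier U"
  using W.cls.hom_closed[of "Poly_Mapping.single x 1"] by (simp add: psi_cls)

lemma psi_mult: "x \<in> carrier (ua \<alpha>) \<Longrightarrow> y \<in> carrier (ua \<alpha>) \<Longrightarrow> psi (x \<otimes>\<^bsub>UV\<^esub> y) = psi x \<otimes>\<^bsub>U\<^esub> psi y"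
  using W.cls.hom_mult[of "Poly_Mapping.single x 1" "Poly_Mapping.single y 1"] by (simp add: psi_cls)

lemma psi_one [simp]: "psi \<one>\<^bsub>UV\<^esub> = \<one>\<^bsub>U\<^esub>"
  using W.cls.hom_one by (simp add: psi_cls)

lemma uq_rel_ideal: "r \<in> uq_rel \<Longrightarrow> r \<in> uq_ideal \<alpha> q"
  using W.A.genideal_self[OF W.Rel] W.I_Rel by blast

lemma psi_add:
  assumes x: "x \<in> carrier (ua \<alpha>)" and y: "y \<in> carrier (ua \<alpha>)"
  shows "psi (x \<oplus>\<^bsub>UV\<^esub> y) = psi x \<oplus>\<^bsub>U\<^esub> psi y"
proof -
  let ?s = "\<lambda>x. Poly_Mapping.single x (1::'k)"
  have "?s (x \<oplus>\<^bsub>UV\<^esub> y) - ?s x - ?s y \<in> uq_ideal \<alpha> q"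
    by (rule uq_rel_ideal) (use x y in \<open>auto simp: uq_rel_def\<close>)
  hence "?s (x \<oplus>\<^bsub>UV\<^esub> y) - (?s x + ?s y) \<in> uq_ideal \<alpha> q" by (simp add: diff_diff_eq)
  hence "psi (x \<oplus>\<^bsub>UV\<^esub> y) = W.cls (?s x + ?s y)"
    unfolding psi_cls using x y W.keys_add_sub[of "?s x" _ "?s y"]
    by (subst W.cls_eq) (auto simp: ua_closed)
  thus ?thesis using W.cls_add[of "?s x" "?s y"] x y by (simp add: psi_cls)
qed

lemma psi_zero [simp]: "psi \<zero>\<^bsub>UV\<^esub> = \<zero>\<^bsub>U\<^esub>"
proof -
  have "psi \<zero>\<^bsub>UV\<^esub> \<oplus>\<^bsub>U\<^esub> psi \<zero>\<^bsub>UV\<^esub> = psi \<zero>\<^bsub>UV\<^esub>"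
    using psi_add[of "\<zero>\<^bsub>UV\<^esub>" "\<zero>\<^bsub>UV\<^esub>"] by (simp add: ua_closed)
  thus ?thesis by (simp add: ua_closed)
qed

lemma psi_scl:
  assumes a: "a \<in> laurent_ring" and x: "x \<in> carrier (ua \<alpha>)"
  shows "psi (vscl a x) = uscl (specialize q a) (psi x)"
proof -
  have "psi (vscl a x) = W.cls (Poly_Mapping.single x (specialize q a))"
    unfolding psi_cls
  proof (subst W.cls_eq)
    show "Poly_Mapping.single (vscl a x) 1 - Poly_Mapping.single x (specialize q a) \<in> uq_ideal \<alpha> q"
      by (rule uq_rel_ideal) (use a x in \<open>auto simp: uq_rel_def V.Q.scl_def\<close>)
  qed (use a x ua_scl in auto)
  thus ?thesis using W.cls_single[OF x, of "specialize q a"] unfolding psi_cls W.Q.scl_def by argo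
qed

lemma psi_finsum:
  "finite S \<Longrightarrow> g \<in> S \<rightarrow> carrier (ua \<alpha>) \<Longrightarrow> psi (finsum UV g S) = (\<Oplus>\<^bsub>U\<^esub>i\<in>S. psi (g i))"
proof (induction S rule: finite_induct)
  case (insert x S)
  hence 1: "g \<in> S \<rightarrow> carrier UV" "g x \<in> carrier UV" "(\<lambda>i. psi (g i)) \<in> S \<rightarrow> carrier U" by auto
  have 2: "finsum UV g S \<in> carrier (ua \<alpha>)" using insert by (intro ua_finsum) auto
  show ?case using insert 1 2 by (simp add: V.Q.finsum_insert W.Q.finsum_insert psi_add)
qed simp

lemma uq_gens: "uq_E \<alpha> q i r = psi (uv_E \<alpha> i r)" "uq_F \<alpha> q i r = psi (uv_F \<alpha> i r)"
  "uq_K \<alpha> q i = psi (uv_K \<alpha> i)" "uq_Kinv \<alpha> q i = psi (uv_Kinv \<alpha> i)"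
  "uq_Kbinom \<alpha> q i t = psi (KB i 0 t)"
  by (simp_all add: uq_E_def uq_F_def uq_K_def uq_Kinv_def uq_Kbinom_def psi_def KB_uv_Kbinom)

definition UKB :: "'i \<Rightarrow> int \<Rightarrow> nat \<Rightarrow> ('i, 'k) uq_elem" where "UKB i c t = psi (KB i c t)"

lemma U_ring: "ring U" by (rule W.Q.ring_axioms)

lemma U_closed [simp, intro]:
  "uq_E \<alpha> q i r \<in> carrier U" "uq_F \<alpha> q i r \<in> carrier U" "uq_K \<alpha> q i \<in> carrier U"
  "uq_Kinv \<alpha> q i \<in> carrier U" "uq_Kbinom \<alpha> q i t \<in> carrier U" "UKB i c t \<in> carrier U"
  "uq_scalar \<alpha> q a \<in> carrier U"
  by (simp_all add: uq_gens UKB_def KB_in_ua)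

lemma UKB_simps: "UKB i 0 t = uq_Kbinom \<alpha> q i t" "UKB i c 0 = \<one>\<^bsub>U\<^esub>"
  by (simp_all add: UKB_def uq_gens)

lemma U_K_E: "uq_K \<alpha> q i \<otimes>\<^bsub>U\<^esub> uq_E \<alpha> q j r =
    uscl (q powi (int (symmetrizer \<alpha> i) * (int r * cartan_matrix \<alpha> i j))) (uq_E \<alpha> q j r \<otimes>\<^bsub>U\<^esub> uq_K \<alpha> q i)"
  and U_K_F: "uq_K \<alpha> q i \<otimes>\<^bsub>U\<^esub> uq_F \<alpha> q j r =
    uscl (q powi (int (symmetrizer \<alpha> i) * - (int r * cartan_matrix \<alpha> i j))) (uq_F \<alpha> q j r \<otimes>\<^bsub>U\<^esub> uq_K \<alpha> q i)"
  unfolding uq_gens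
  by (simp_all only: psi_mult[symmetric] ua_closed uv_K_E uv_K_F v_at_powi psi_scl laurent_ring_powi
      specialize_powi[OF q_nonzero])

lemma U_K_inverse: "uq_K \<alpha> q i \<otimes>\<^bsub>U\<^esub> uq_Kinv \<alpha> q i = \<one>\<^bsub>U\<^esub>" "uq_Kinv \<alpha> q i \<otimes>\<^bsub>U\<^esub> uq_K \<alpha> q i = \<one>\<^bsub>U\<^esub>"
  unfolding uq_gens by (simp_all only: psi_mult[symmetric] ua_closed uv_K_inverse psi_one)

lemma U_KB_E: "UKB i c t \<otimes>\<^bsub>U\<^esub> uq_E \<alpha> q j r = uq_E \<alpha> q j r \<otimes>\<^bsub>U\<^esub> UKB i (c + int r * cartan_matrix \<alpha> i j) t"
  and U_KB_F: "UKB i c t \<otimes>\<^bsub>U\<^esub> uq_F \<alpha> q j r = uq_F \<alpha> q j r \<otimes>\<^bsub>U\<^esub> UKB i (c - int r * cartan_matrix \<alpha> i j) t"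
  unfolding uq_gens UKB_def
  using KB_commute[OF _ uv_K_E, of j r i c t] KB_commute[OF _ uv_K_F, of j r i c t]
  by (simp_all add: psi_mult[symmetric] KB_in_ua)

lemma UKB_pascal:
  "UKB i (c + 1) (Suc t) = uscl (q powi (int (symmetrizer \<alpha> i) * (int t + 1))) (UKB i c (Suc t)) \<oplus>\<^bsub>U\<^esub>
     uscl (q powi (int (symmetrizer \<alpha> i) * (int t - c))) (uq_Kinv \<alpha> q i \<otimes>\<^bsub>U\<^esub> UKB i c t)"
  unfolding UKB_def KB_pascal v_at_powi uq_gens
  by (simp only: psi_add psi_scl psi_mult ua_closed ua_scl laurent_ring_powi KB_in_ua specialize_powi[OF q_nonzero])

lemma U_E_F_commute: "i \<noteq> j \<Longrightarrow> uq_E \<alpha> q i r \<otimes>\<^bsub>U\<^esub> uq_F \<alpha> q j s = uq_F \<alpha> q j s \<otimes>\<^bsub>U\<^esub> uq_E \<alpha> q i r"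
  unfolding uq_gens by (metis psi_mult ua_closed(9,10) uv_E_F_commute)

lemma U_Kac:
  "uq_E \<alpha> q i r \<otimes>\<^bsub>U\<^esub> uq_F \<alpha> q i s = (\<Oplus>\<^bsub>U\<^esub>t\<in>{..r}. (if t \<le> s then uq_F \<alpha> q i (s - t) else \<zero>\<^bsub>U\<^esub>)
     \<otimes>\<^bsub>U\<^esub> UKB i (2 * int t - int r - int s) t \<otimes>\<^bsub>U\<^esub> uq_E \<alpha> q i (r - t))"
proof -
  have "uq_E \<alpha> q i r \<otimes>\<^bsub>U\<^esub> uq_F \<alpha> q i s = psi (uv_E \<alpha> i r \<otimes>\<^bsub>UV\<^esub> uv_F \<alpha> i s)"
    by (simp add: uq_gens psi_mult)
  also have "\<dots> = (\<Oplus>\<^bsub>U\<^esub>t\<in>{..r}. psi ((if t \<le> s then uv_F \<alpha> i (s - t) else \<zero>\<^bsub>UV\<^esub>)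
     \<otimes>\<^bsub>UV\<^esub> KB i (2 * int t - int r - int s) t \<otimes>\<^bsub>UV\<^esub> uv_E \<alpha> i (r - t)))"
    unfolding uv_Kac by (rule psi_finsum) (auto simp: KB_in_ua)
  also have "\<dots> = (\<Oplus>\<^bsub>U\<^esub>t\<in>{..r}. (if t \<le> s then uq_F \<alpha> q i (s - t) else \<zero>\<^bsub>U\<^esub>)
     \<otimes>\<^bsub>U\<^esub> UKB i (2 * int t - int r - int s) t \<otimes>\<^bsub>U\<^esub> uq_E \<alpha> q i (r - t))"
    by (rule W.Q.finsum_cong') (auto simp: uq_gens UKB_def psi_mult KB_in_ua)
  finally show ?thesis .
qed

lemma E_0 [simp]: "uq_E \<alpha> q i 0 = \<one>\<^bsub>U\<^esub>" and F_0 [simp]: "uq_F \<alpha> q i 0 = \<one>\<^bsub>U\<^esub>"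
proof -
  have "uv_E \<alpha> i 0 = \<one>\<^bsub>UV\<^esub>" "uv_F \<alpha> i 0 = \<one>\<^bsub>UV\<^esub>"
    by (simp_all add: uv_E_power uv_F_power qfact_def V.Q.scalar_one)
  thus "uq_E \<alpha> q i 0 = \<one>\<^bsub>U\<^esub>" "uq_F \<alpha> q i 0 = \<one>\<^bsub>U\<^esub>" by (simp_all add: uq_gens)
qed

lemma tau_psi: "x \<in> carrier (ua \<alpha>) \<Longrightarrow> uq_tau (psi x) = psi (uv_tau x)"
  using W.Th_cls[of "Poly_Mapping.single x 1"] by (simp add: psi_cls)

text \<open>The Gaussian binomials of the \<open>K\<^sub>i\<close> do not occur among the generators, so
  that stability of a subspace has to be tested on the divided powers and the \<open>K\<^sub>i\<close>
  only.\<close>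

lemma U_generated [consumes 1, case_names add mult scalar E F K Kinv]:
  assumes "u \<in> carrier U"
    and add: "\<And>u w. u \<in> carrier U \<Longrightarrow> w \<in> carrier U \<Longrightarrow> P u \<Longrightarrow> P w \<Longrightarrow> P (u \<oplus>\<^bsub>U\<^esub> w)"
    and mult: "\<And>u w. u \<in> carrier U \<Longrightarrow> w \<in> carrier U \<Longrightarrow> P u \<Longrightarrow> P w \<Longrightarrow> P (u \<otimes>\<^bsub>U\<^esub> w)"
    and gens: "\<And>c. P (uq_scalar \<alpha> q c)" "\<And>i r. P (uq_E \<alpha> q i r)" "\<And>i r. P (uq_F \<alpha> q i r)"
      "\<And>i. P (uq_K \<alpha> q i)" "\<And>i. P (uq_Kinv \<alpha> q i)"
  shows "P u"
proof -
  have psi: "P (psi x)" if "x \<in> carrier (ua \<alpha>)" for x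
  proof -
    have "x \<in> generate_ring UV ua_gens" using that by (simp add: ua_alt)
    thus ?thesis
    proof (induction rule: generate_ring.induct)
      case one
      show ?case using gens(1)[of 1] by (simp add: W.Q.scalar_one)
    next
      case (incl h)
      have "P (psi (uv_scalar \<alpha> a))" if "a \<in> laurent_ring" for a
        using gens(1)[of "specialize q a"] psi_scl[OF that ua_closed(1)] by simp
      thus ?case using incl gens(2-5) unfolding uq_gens ua_gens_def by blast
    next
      case (a_inv h)
      hence h: "h \<in> carrier (ua \<alpha>)" by (simp add: ua_alt)
      hence "psi (\<ominus>\<^bsub>UV\<^esub> h) = uq_scalar \<alpha> q (specialize q (- 1)) \<otimes>\<^bsub>U\<^esub> psi h"
        using V.Q.scl_uminus[of h 1] psi_scl[OF laurent_ring_minus_1 h] by (simp add: W.Q.scl_def)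
      thus ?case using mult gens(1) a_inv h by simp
    next
      case (eng_add h1 h2)
      hence "h1 \<in> carrier (ua \<alpha>)" "h2 \<in> carrier (ua \<alpha>)" by (simp_all add: ua_alt)
      thus ?case using eng_add add by (simp add: psi_add)
    next
      case (eng_mult h1 h2)
      hence "h1 \<in> carrier (ua \<alpha>)" "h2 \<in> carrier (ua \<alpha>)" by (simp_all add: ua_alt)
      thus ?case using eng_mult mult by (simp add: psi_mult)
    qed
  qed
  show ?thesis using assms(1)
  proof (induction u rule: W.Q_induct)
    case zero
    show ?case using gens(1)[of 0] by simp
  next
    case (add X x c)
    thus ?case unfolding psi_cls[symmetric] using psi[of x] gens(1)[of c]
      by (intro assms(2) mult) auto
  qed
qed

lemma tau_gens [simp]:
  "uq_tau (uq_E \<alpha> q i r) = uq_F \<alpha> q i r" "uq_tau (uq_F \<alpha> q i r) = uq_E \<alpha> q i r"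
  "uq_tau (uq_K \<alpha> q i) = uq_K \<alpha> q i" "uq_tau (uq_Kinv \<alpha> q i) = uq_Kinv \<alpha> q i"
  by (simp_all add: uq_gens tau_psi uv_tau_gens)

lemma uv_tau_KB: "uv_tau (KB i 0 t) = KB i 0 t"
proof (induction t)
  case (Suc t)
  interpret r: rank_one UV "uv_scalar \<alpha>" "uvg (GE i)" "uvg (GF i)" "uv_K \<alpha> i" "uv_Kinv \<alpha> i" "v_at \<alpha> i"
    by (rule uv_rank_one)
  let ?x = "vscl (1 / qnum (v_at \<alpha> i) (int (Suc t))) (r.khat (0 - int t))"
  have s: "uv_tau (vscl c y) = vscl c (uv_tau y)" if "y \<in> carrier UV" for c y
    using that by (simp add: V.Q.scl_def V.Th_mult uv_tau_gens V.Q.scalar_central V.Th_closed)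
  have "uv_tau (r.khat c) = r.khat c" for c
    by (simp add: r.khat_def r.lin_def V.Th_add s uv_tau_gens)
  hence x: "uv_tau ?x = ?x" by (simp add: s del: of_nat_Suc)
  have KB: "KB i 0 (Suc t) = KB i 0 t \<otimes>\<^bsub>UV\<^esub> ?x" by (simp add: KB_def)
  have "uv_tau (KB i 0 (Suc t)) = ?x \<otimes>\<^bsub>UV\<^esub> KB i 0 t"
    unfolding KB by (subst V.Th_mult) (simp_all only: x Suc.IH V.Q.scl_closed r.khat_closed KB_closed)
  also have "\<dots> = KB i 0 (Suc t)"
    unfolding KB unfolding KB_def by (simp add: V.Q.scl_mult_left V.Q.scl_mult_right r.khat_kbin del: of_nat_Suc)
  finally show ?case .
qed (use uv_tau_gens(5)[of 1] in \<open>simp add: V.Q.scalar_one\<close>)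

lemma tau_Kbinom [simp]: "uq_tau (uq_Kbinom \<alpha> q i t) = uq_Kbinom \<alpha> q i t"
  by (simp add: uq_gens tau_psi KB_in_ua uv_tau_KB)

end

section \<open>Finite-dimensional vector spaces\<close>

locale kspace = abelian_group M for M :: "('m, 's) ring_scheme" (structure) +
  fixes sc :: "'k::field \<Rightarrow> 'm \<Rightarrow> 'm"
  assumes sc_closed [simp, intro]: "x \<in> carrier M \<Longrightarrow> sc a x \<in> carrier M"
    and sc_add_left: "x \<in> carrier M \<Longrightarrow> sc (a + b) x = sc a x \<oplus> sc b x"
    and sc_add_right: "x \<in> carrier M \<Longrightarrow> y \<in> carrier M \<Longrightarrow> sc a (x \<oplus> y) = sc a x \<oplus> sc a y"
    and sc_sc: "x \<in> carrier M \<Longrightarrow> sc a (sc b x) = sc (a * b) x"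
    and sc_one [simp]: "x \<in> carrier M \<Longrightarrow> sc 1 x = x"
begin

lemma sc_zero [simp]: "x \<in> carrier M \<Longrightarrow> sc 0 x = \<zero>"
  using sc_add_left[of x 0 0] by (metis add.l_cancel_one' add_0 sc_closed)

lemma sc_of_zero [simp]: "sc a \<zero> = \<zero>"
  using sc_add_right[of \<zero> \<zero> a] by (metis add.l_cancel_one' l_zero sc_closed zero_closed)

lemma sc_uminus: "x \<in> carrier M \<Longrightarrow> sc (- 1) x = \<ominus> x"
proof -
  assume x: "x \<in> carrier M"
  have "sc (- 1) x \<oplus> sc 1 x = \<zero>" using sc_add_left[OF x, of "- 1" 1] x by simp
  thus ?thesis using x minus_equality[of "sc (- 1) x" x] by simp
qed

lemma sc_cancel:
  assumes "a \<noteq> 0" "x \<in> carrier M" "y \<in> carrier M" "sc a x = sc a y" shows "x = y"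
proof -
  have "sc (1 / a) (sc a x) = sc (1 / a) (sc a y)" using assms(4) by argo
  thus ?thesis using assms(1-3) by (simp add: sc_sc)
qed

definition ksub :: "'m set \<Rightarrow> bool" where
  "ksub V \<longleftrightarrow> V \<subseteq> carrier M \<and> \<zero> \<in> V \<and> (\<forall>x\<in>V. \<forall>y\<in>V. x \<oplus> y \<in> V) \<and> (\<forall>x\<in>V. \<forall>c. sc c x \<in> V)"

lemma ksubD: assumes "ksub V"
  shows "x \<in> V \<Longrightarrow> x \<in> carrier M" "\<zero> \<in> V" "x \<in> V \<Longrightarrow> y \<in> V \<Longrightarrow> x \<oplus> y \<in> V" "x \<in> V \<Longrightarrow> sc c x \<in> V"
    "x \<in> V \<Longrightarrow> \<ominus> x \<in> V" "x \<in> V \<Longrightarrow> y \<in> V \<Longrightarrow> x \<ominus> y \<in> V"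
proof -
  show a: "x \<in> V \<Longrightarrow> x \<in> carrier M" "\<zero> \<in> V" "x \<in> V \<Longrightarrow> y \<in> V \<Longrightarrow> x \<oplus> y \<in> V" "x \<in> V \<Longrightarrow> sc c x \<in> V" for x y c
    using assms unfolding ksub_def by blast+
  show b: "x \<in> V \<Longrightarrow> \<ominus> x \<in> V" for x using a(1,4)[of x] sc_uminus by metis
  show "x \<in> V \<Longrightarrow> y \<in> V \<Longrightarrow> x \<ominus> y \<in> V" using a b by (simp add: a_minus_def)
qed

lemma ksub_carrier: "ksub (carrier M)"
  by (auto simp: ksub_def)

lemma ksub_zero: "ksub {\<zero>}"
  by (auto simp: ksub_def)

lemma ksub_Int: "ksub V \<Longrightarrow> ksub W \<Longrightarrow> ksub (V \<inter> W)"
  by (auto simp: ksub_def)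

definition adjoin :: "'m set \<Rightarrow> 'm \<Rightarrow> 'm set" where
  "adjoin W x = {w \<oplus> sc c x | w c. w \<in> W}"

lemma ksub_adjoin: assumes W: "ksub W" and x: "x \<in> carrier M" shows "ksub (adjoin W x)"
  unfolding ksub_def
proof (intro conjI ballI allI)
  show "adjoin W x \<subseteq> carrier M" using ksubD[OF W] x by (auto simp: adjoin_def)
  show "\<zero> \<in> adjoin W x"
    using ksubD(2)[OF W] x by (auto simp: adjoin_def intro!: exI[of _ \<zero>] exI[of _ 0])
next
  fix a b assume "a \<in> adjoin W x" "b \<in> adjoin W x"
  then obtain w c w' c' where *: "w \<in> W" "a = w \<oplus> sc c x" "w' \<in> W" "b = w' \<oplus> sc c' x"
    by (auto simp: adjoin_def)
  hence "a \<oplus> b = (w \<oplus> w') \<oplus> sc (c + c') x"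
    using ksubD(1)[OF W] x by (simp add: sc_add_left a_ac)
  thus "a \<oplus> b \<in> adjoin W x" using * ksubD(3)[OF W] by (auto simp: adjoin_def)
next
  fix a d assume "a \<in> adjoin W x"
  then obtain w c where *: "w \<in> W" "a = w \<oplus> sc c x" by (auto simp: adjoin_def)
  hence "sc d a = sc d w \<oplus> sc (d * c) x" using ksubD(1)[OF W] x by (simp add: sc_add_right sc_sc)
  thus "sc d a \<in> adjoin W x" using * ksubD(4)[OF W] by (auto simp: adjoin_def)
qed

lemma adjoin_subset: assumes "ksub W" "x \<in> carrier M" shows "W \<subseteq> adjoin W x" "x \<in> adjoin W x"
proof -
  show "W \<subseteq> adjoin W x"
  proof
    fix w assume "w \<in> W"
    thus "w \<in> adjoin W x" using ksubD(1)[OF assms(1)] assms(2)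
      by (auto simp: adjoin_def intro!: exI[of _ w] exI[of _ 0])
  qed
  show "x \<in> adjoin W x"
    using ksubD(2)[OF assms(1)] assms(2) by (auto simp: adjoin_def intro!: exI[of _ \<zero>] exI[of _ 1])
qed

lemma adjoin_least: assumes V: "ksub V" and "W \<subseteq> V" "x \<in> V" shows "adjoin W x \<subseteq> V"
  unfolding adjoin_def using ksubD(3,4)[OF V] assms(2,3) by blast

text \<open>The exchange step: in the span of \<open>W\<close> and one more vector, a subspace either lies
  in \<open>W\<close> or meets it in a hyperplane of itself.\<close>

lemma adjoin_exchange:
  assumes W: "ksub W" and x: "x \<in> carrier M" and D: "ksub D" "D \<subseteq> adjoin W x" and w: "w \<in> D" "w \<notin> W"
  shows "D = adjoin (D \<inter> W) w"
proof
  show "adjoin (D \<inter> W) w \<subseteq> D" using D w by (intro adjoin_least) auto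
  obtain w0 c where c: "w0 \<in> W" "w = w0 \<oplus> sc c x" using D w by (auto simp: adjoin_def)
  have c0: "c \<noteq> 0" using c w ksubD(1)[OF W] x by auto
  show "D \<subseteq> adjoin (D \<inter> W) w"
  proof
    fix z assume z: "z \<in> D"
    then obtain z0 d where d: "z0 \<in> W" "z = z0 \<oplus> sc d x" using D by (auto simp: adjoin_def)
    let ?y = "z \<oplus> sc (- (d / c)) w"
    have cs: "z \<in> carrier M" "w \<in> carrier M" "z0 \<in> carrier M" "w0 \<in> carrier M"
      using z w c d ksubD(1)[OF D(1)] ksubD(1)[OF W] by auto
    have "?y = z0 \<oplus> sc (- (d / c)) w0 \<oplus> (sc d x \<oplus> sc (- d) x)"
      using c d c0 cs x by (simp add: sc_add_right sc_sc a_ac)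
    also have "sc d x \<oplus> sc (- d) x = \<zero>" using sc_add_left[OF x, of d "- d"] x by simp
    finally have "?y \<in> W" using c d cs ksubD[OF W] by simp
    moreover have "?y \<in> D" using z w ksubD[OF D(1)] by simp
    moreover have "z = ?y \<oplus> sc (d / c) w"
      using cs sc_add_left[of w "- (d / c)" "d / c"] by (simp add: a_assoc)
    ultimately show "z \<in> adjoin (D \<inter> W) w" by (auto simp: adjoin_def)
  qed
qed

text \<open>Flags are used instead of bases: the intersections with a subspace form a flag again, while a
  basis does not restrict to a basis.\<close>

inductive kdim :: "'m set \<Rightarrow> nat \<Rightarrow> bool" where
  kdim_zero: "kdim {\<zero>} 0"
| kdim_Suc: "kdim W n \<Longrightarrow> x \<in> carrier M \<Longrightarrow> x \<notin> W \<Longrightarrow> kdim (adjoin W x) (Suc n)"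

lemma kdim_ksub: "kdim V n \<Longrightarrow> ksub V"
  by (induction rule: kdim.induct) (auto simp: ksub_zero ksub_adjoin)

lemma kdim_adjoin: "kdim W n \<Longrightarrow> x \<in> carrier M \<Longrightarrow> \<exists>m. kdim (adjoin W x) m"
proof (cases "x \<in> W")
  case True
  assume "kdim W n" "x \<in> carrier M"
  hence "adjoin W x = W" using True kdim_ksub adjoin_least[of W W x] adjoin_subset[of W x] by blast
  thus ?thesis using \<open>kdim W n\<close> by auto
qed (auto intro: kdim_Suc)

text \<open>Intersect the flag with the subspace; each step of the intersection is trivial or a hyperplane,
  by exchange.\<close>

lemma kdim_subspace:
  "kdim V n \<Longrightarrow> ksub W \<Longrightarrow> W \<subseteq> V \<Longrightarrow> \<exists>m\<le>n. kdim W m \<and> (m = n \<longrightarrow> W = V)"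
proof (induction arbitrary: W rule: kdim.induct)
  case kdim_zero
  hence "W = {\<zero>}" using ksubD(2) by blast
  thus ?case using kdim.kdim_zero by auto
next
  case (kdim_Suc V n x)
  have V: "ksub V" using kdim_Suc kdim_ksub by blast
  obtain m where m: "m \<le> n" "kdim (W \<inter> V) m" "m = n \<longrightarrow> W \<inter> V = V"
    using kdim_Suc.IH[of "W \<inter> V"] ksub_Int kdim_Suc.prems V by auto
  show ?case
  proof (cases "W \<subseteq> V")
    case True
    hence "W \<inter> V = W" by blast
    thus ?thesis using m by (intro exI[of _ m]) auto
  next
    case False
    then obtain w where w: "w \<in> W" "w \<notin> V" by blast
    have eq: "W = adjoin (W \<inter> V) w"
      using adjoin_exchange[OF V kdim_Suc.hyps(2) kdim_Suc.prems w] .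
    have "w \<in> carrier M" using w ksubD(1) kdim_Suc.prems by blast
    hence k: "kdim W (Suc m)" using kdim.kdim_Suc[OF m(2), of w] w eq by simp
    have "W = adjoin V x" if "m = n"
    proof -
      have "V \<subseteq> W" using that m by blast
      have "adjoin V x = adjoin (adjoin V x \<inter> V) w"
        by (rule adjoin_exchange[OF V kdim_Suc.hyps(2) ksub_adjoin[OF V kdim_Suc.hyps(2)] subset_refl])
          (use w kdim_Suc.prems in auto)
      also have "\<dots> \<subseteq> W" using \<open>V \<subseteq> W\<close> w kdim_Suc.prems by (intro adjoin_least) auto
      finally show ?thesis using kdim_Suc.prems by blast
    qed
    thus ?thesis using k m by (intro exI[of _ "Suc m"]) auto
  qed
qed

text \<open>The hyperplanes at the end of two flags coincide or intersect in a common hyperplane of both, so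
  their dimensions agree by induction.\<close>

lemma kdim_unique: "kdim V n \<Longrightarrow> kdim V m \<Longrightarrow> n = m"
proof (induction n arbitrary: V m)
  case 0
  hence V: "V = {\<zero>}" by (cases rule: kdim.cases) auto
  show ?case using 0(2)
  proof (cases rule: kdim.cases)
    case (kdim_Suc W n x)
    hence "x \<in> V" "\<zero> \<in> W" using adjoin_subset[of W x] kdim_ksub ksubD(2) by blast+
    thus ?thesis using V kdim_Suc by auto
  qed simp
next
  case (Suc n)
  from Suc.prems(1) obtain V0 x where 0: "V = adjoin V0 x" "kdim V0 n" "x \<in> carrier M" "x \<notin> V0"
    by (cases rule: kdim.cases) auto
  have s0: "ksub V0" using 0 kdim_ksub by blast
  from Suc.prems(2) show ?case
  proof (cases rule: kdim.cases)
    case kdim_zero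
    thus ?thesis using 0 adjoin_subset[OF s0 0(3)] ksubD(2)[OF s0] by auto
  next
    case (kdim_Suc V1 m' y)
    note 1 = this
    have s1: "ksub V1" using 1 kdim_ksub by blast
    show ?thesis
    proof (cases "V0 \<subseteq> V1")
      case True
      have "V1 \<subseteq> V0"
      proof (rule ccontr)
        assume "\<not> V1 \<subseteq> V0"
        then obtain w where w: "w \<in> V1" "w \<notin> V0" by blast
        hence wV: "w \<in> V" using 1 adjoin_subset[OF s1] by blast
        have "V = adjoin (V \<inter> V0) w"
          using adjoin_exchange[OF s0 0(3) ksub_adjoin[OF s0 0(3)] subset_refl, of w] w wV 0(1) by simp
        also have "\<dots> \<subseteq> V1" using True w by (intro adjoin_least[OF s1]) auto
        finally show False using 1 adjoin_subset[OF s1] by blast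
      qed
      hence "V0 = V1" using True by blast
      thus ?thesis using Suc.IH[of V0 m'] 0 1 by simp
    next
      case False
      then obtain w where w: "w \<in> V0" "w \<notin> V1" by blast
      have V0: "V0 = adjoin (V0 \<inter> V1) w"
        by (rule adjoin_exchange[OF s1 1(4) s0 _ w]) (use 0 1 adjoin_subset[OF s0] in blast)
      obtain d where d: "kdim (V0 \<inter> V1) d"
        using kdim_subspace[OF 0(2) ksub_Int[OF s0 s1]] by auto
      have "kdim V0 (Suc d)" using kdim.kdim_Suc[OF d, of w] V0 w ksubD(1)[OF s0] by auto
      hence nd: "n = Suc d" using Suc.IH 0(2) by blast
      have "\<not> V1 \<subseteq> V0"
      proof
        assume "V1 \<subseteq> V0"
        have "V = adjoin (V \<inter> V1) w"
          using adjoin_exchange[OF s1 1(4) ksub_adjoin[OF s1 1(4)] subset_refl, of w] w 0 1 adjoin_subset[OF s0]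
          by auto
        also have "\<dots> \<subseteq> V0" using \<open>V1 \<subseteq> V0\<close> w by (intro adjoin_least[OF s0]) auto
        finally show False using 0 adjoin_subset[OF s0] by blast
      qed
      then obtain w' where w': "w' \<in> V1" "w' \<notin> V0" by blast
      have V1: "V1 = adjoin (V1 \<inter> V0) w'"
        by (rule adjoin_exchange[OF s0 0(3) s1 _ w']) (use 0 1 adjoin_subset[OF s1] in blast)
      have "kdim V1 (Suc d)"
        using kdim.kdim_Suc[of "V1 \<inter> V0" d w'] d V1 w' ksubD(1)[OF s1] by (auto simp: Int_commute)
      thus ?thesis using Suc.IH[of V1 m'] nd 1 by simp
    qed
  qed
qed

definition klin :: "'m set \<Rightarrow> ('m \<Rightarrow> 'k) \<Rightarrow> bool" where
  "klin V \<xi> \<longleftrightarrow> (\<forall>x\<in>V. \<forall>y\<in>V. \<xi> (x \<oplus> y) = \<xi> x + \<xi> y) \<and> (\<forall>x\<in>V. \<forall>c. \<xi> (sc c x) = c * \<xi> x)"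

lemma klinD: assumes "klin V \<xi>"
  shows "x \<in> V \<Longrightarrow> y \<in> V \<Longrightarrow> \<xi> (x \<oplus> y) = \<xi> x + \<xi> y" "x \<in> V \<Longrightarrow> \<xi> (sc c x) = c * \<xi> x"
  using assms by (auto simp: klin_def)

lemma klin_zero: "ksub V \<Longrightarrow> klin V \<xi> \<Longrightarrow> \<xi> \<zero> = 0"
  using klinD(2)[of V \<xi> \<zero> 0] ksubD(2)[of V] by simp

lemma klin_uminus: "ksub V \<Longrightarrow> klin V \<xi> \<Longrightarrow> x \<in> V \<Longrightarrow> \<xi> (\<ominus> x) = - \<xi> x"
  using klinD(2)[of V \<xi> x "- 1"] ksubD(1)[of V x] by (simp add: sc_uminus)

lemma klin_minus: "ksub V \<Longrightarrow> klin V \<xi> \<Longrightarrow> x \<in> V \<Longrightarrow> y \<in> V \<Longrightarrow> \<xi> (x \<ominus> y) = \<xi> x - \<xi> y"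
  using klinD(1)[of V \<xi> x "\<ominus> y"] klin_uminus[of V \<xi> y] ksubD(5)[of V y] by (simp add: a_minus_def)

lemma klin_extend_one:
  assumes W: "ksub W" and x: "x \<in> carrier M" "x \<notin> W" and \<xi>: "klin W \<xi>"
  obtains \<xi>' where "klin (adjoin W x) \<xi>'" "\<And>w. w \<in> W \<Longrightarrow> \<xi>' w = \<xi> w" "\<xi>' x = a"
proof -
  have unique: "w = w' \<and> c = c'" if "w \<in> W" "w' \<in> W" and eq: "w \<oplus> sc c x = w' \<oplus> sc c' x" for w w' c c'
  proof -
    have cs: "w \<in> carrier M" "w' \<in> carrier M" using that ksubD(1)[OF W] by auto
    have "sc (c - c') x = w' \<ominus> w"
    proof -
      have "sc (c - c') x \<oplus> sc c' x = sc c x" using sc_add_left[OF x(1), of "c - c'" c'] by simp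
      hence "w \<oplus> (sc (c - c') x \<oplus> sc c' x) = w' \<oplus> sc c' x" using eq by simp
      hence "(w \<oplus> sc (c - c') x) \<oplus> sc c' x = w' \<oplus> sc c' x" using cs x by (simp add: a_assoc)
      hence "w \<oplus> sc (c - c') x = w'" using cs x by simp
      hence "w' \<ominus> w = w \<oplus> sc (c - c') x \<oplus> \<ominus> w" by (simp add: a_minus_def)
      also have "\<dots> = sc (c - c') x" using cs x by (simp add: a_ac r_neg2)
      finally show ?thesis by simp
    qed
    hence m: "sc (c - c') x \<in> W" using ksubD(6)[OF W] that by simp
    have "c = c'"
    proof (rule ccontr)
      assume "c \<noteq> c'"
      hence "x = sc (1 / (c - c')) (sc (c - c') x)" using x by (simp add: sc_sc)
      thus False using ksubD(4)[OF W m] x by metis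
    qed
    thus ?thesis using eq cs x by simp
  qed
  define \<xi>' where "\<xi>' z = (let p = (SOME p. fst p \<in> W \<and> z = fst p \<oplus> sc (snd p) x) in \<xi> (fst p) + snd p * a)" for z
  have val: "\<xi>' (w \<oplus> sc c x) = \<xi> w + c * a" if "w \<in> W" for w c
  proof -
    let ?P = "\<lambda>p. fst p \<in> W \<and> w \<oplus> sc c x = fst p \<oplus> sc (snd p) x"
    have "?P (SOME p. ?P p)" by (rule someI[of ?P "(w, c)"]) (use that in auto)
    hence "w = fst (SOME p. ?P p) \<and> c = snd (SOME p. ?P p)" using unique that by blast
    thus ?thesis unfolding \<xi>'_def Let_def by simp
  qed
  have w: "\<xi>' w = \<xi> w" if "w \<in> W" for w
    using val[OF that, of 0] that ksubD(1)[OF W] x by simp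
  have "\<xi>' x = a" using val[OF ksubD(2)[OF W], of 1] x klin_zero[OF W \<xi>] by simp
  moreover have "klin (adjoin W x) \<xi>'"
    unfolding klin_def
  proof (intro conjI ballI allI)
    fix y z assume "y \<in> adjoin W x" "z \<in> adjoin W x"
    then obtain w c w' c' where *: "w \<in> W" "y = w \<oplus> sc c x" "w' \<in> W" "z = w' \<oplus> sc c' x"
      by (auto simp: adjoin_def)
    hence "y \<oplus> z = (w \<oplus> w') \<oplus> sc (c + c') x"
      using ksubD(1)[OF W] x by (simp add: sc_add_left a_ac)
    thus "\<xi>' (y \<oplus> z) = \<xi>' y + \<xi>' z"
      using * val ksubD(3)[OF W] klinD(1)[OF \<xi>] by (simp add: algebra_simps)
  next
    fix y d assume "y \<in> adjoin W x"
    then obtain w c where *: "w \<in> W" "y = w \<oplus> sc c x" by (auto simp: adjoin_def)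
    hence "sc d y = sc d w \<oplus> sc (d * c) x" using ksubD(1)[OF W] x by (simp add: sc_add_right sc_sc)
    thus "\<xi>' (sc d y) = d * \<xi>' y"
      using * val ksubD(4)[OF W] klinD(2)[OF \<xi>] by (simp add: algebra_simps)
  qed
  ultimately show ?thesis using that w by blast
qed

lemma klin_sub: "klin V \<xi> \<Longrightarrow> W \<subseteq> V \<Longrightarrow> klin W \<xi>"
  unfolding klin_def by blast

text \<open>Extend along a flag, one dimension at a time.\<close>

lemma klin_extend:
  "kdim V n \<Longrightarrow> ksub N \<Longrightarrow> N \<subseteq> V \<Longrightarrow> klin N \<xi> \<Longrightarrow> \<exists>\<xi>'. klin V \<xi>' \<and> (\<forall>x\<in>N. \<xi>' x = \<xi> x)"
proof (induction arbitrary: N rule: kdim.induct)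
  case kdim_zero
  hence "N = {\<zero>}" using ksubD(2) by blast
  thus ?case using kdim_zero by blast
next
  case (kdim_Suc V n x)
  have V: "ksub V" using kdim_Suc kdim_ksub by blast
  obtain \<xi>0 where \<xi>0: "klin V \<xi>0" "\<And>y. y \<in> N \<inter> V \<Longrightarrow> \<xi>0 y = \<xi> y"
    using kdim_Suc.IH[of "N \<inter> V"] ksub_Int[OF kdim_Suc.prems(1) V] klin_sub[OF kdim_Suc.prems(3)] by blast
  show ?case
  proof (cases "N \<subseteq> V")
    case True
    obtain \<xi>' where "klin (adjoin V x) \<xi>'" "\<And>w. w \<in> V \<Longrightarrow> \<xi>' w = \<xi>0 w"
      using klin_extend_one[OF V kdim_Suc.hyps(2,3) \<xi>0(1), of 0] by blast
    thus ?thesis using \<xi>0 True by (metis IntI subsetD)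
  next
    case False
    then obtain w where w: "w \<in> N" "w \<notin> V" by blast
    have wc: "w \<in> carrier M" using w ksubD(1)[OF kdim_Suc.prems(1)] by blast
    obtain \<xi>' where \<xi>': "klin (adjoin V w) \<xi>'" "\<And>y. y \<in> V \<Longrightarrow> \<xi>' y = \<xi>0 y" "\<xi>' w = \<xi> w"
      using klin_extend_one[OF V wc w(2) \<xi>0(1), of "\<xi> w"] by blast
    have "adjoin V x = adjoin (adjoin V x \<inter> V) w"
      by (rule adjoin_exchange[OF V kdim_Suc.hyps(2) ksub_adjoin[OF V kdim_Suc.hyps(2)] subset_refl])
        (use w kdim_Suc.prems in auto)
    also have "adjoin V x \<inter> V = V" using adjoin_subset[OF V kdim_Suc.hyps(2)] by blast
    finally have eq: "adjoin V x = adjoin V w" .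
    have "\<xi>' y = \<xi> y" if y: "y \<in> N" for y
    proof -
      have "N = adjoin (N \<inter> V) w"
        using adjoin_exchange[OF V kdim_Suc.hyps(2) kdim_Suc.prems(1,2) w] .
      then obtain z c where z: "z \<in> N" "z \<in> V" "y = z \<oplus> sc c w" using y unfolding adjoin_def by blast
      have "\<xi>' y = \<xi>' z + c * \<xi>' w"
        using z adjoin_subset[OF V wc] klinD[OF \<xi>'(1)] ksubD(4)[OF ksub_adjoin[OF V wc]] by (metis subsetD)
      also have "\<dots> = \<xi> y"
        using z \<xi>' \<xi>0(2)[of z] w klinD[OF kdim_Suc.prems(3)] ksubD(4)[OF kdim_Suc.prems(1)] by auto
      finally show ?thesis .
    qed
    thus ?thesis using \<xi>' eq by auto
  qed
qed

lemma klin_separate: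
  assumes "kdim (carrier M) n" "ksub N" "x \<in> carrier M" "x \<notin> N"
  obtains \<xi> where "klin (carrier M) \<xi>" "\<And>y. y \<in> N \<Longrightarrow> \<xi> y = 0" "\<xi> x = 1"
proof -
  have "klin N (\<lambda>_. 0)" by (simp add: klin_def)
  then obtain \<xi> where \<xi>: "klin (adjoin N x) \<xi>" "\<And>w. w \<in> N \<Longrightarrow> \<xi> w = 0" "\<xi> x = 1"
    using klin_extend_one[OF assms(2-4), of "\<lambda>_. 0" 1] by auto
  obtain \<xi>' where \<xi>': "klin (carrier M) \<xi>'" "\<forall>y\<in>adjoin N x. \<xi>' y = \<xi> y"
    using klin_extend[OF assms(1) ksub_adjoin[OF assms(2,3)] _ \<xi>(1)] ksubD(1)[OF ksub_adjoin[OF assms(2,3)]]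
    by blast
  show ?thesis
  proof (rule that[OF \<xi>'(1)])
    show "\<xi>' y = 0" if "y \<in> N" for y using that \<xi> \<xi>' adjoin_subset[OF assms(2,3)] by auto
  qed (use \<xi> \<xi>' adjoin_subset[OF assms(2,3)] in auto)
qed

lemma kdim_spanned:
  assumes "finite B" "B \<subseteq> carrier M"
    and span: "\<And>m. m \<in> carrier M \<Longrightarrow> \<exists>c. m = (\<Oplus>b\<in>B. sc (c b) b)"
  shows "\<exists>n. kdim (carrier M) n"
proof -
  have "\<exists>n W. kdim W n \<and> B \<subseteq> W" using assms(1,2)
  proof (induction B rule: finite_induct)
    case empty
    thus ?case using kdim_zero by blast
  next
    case (insert b B)
    then obtain n W where W: "kdim W n" "B \<subseteq> W" by auto
    have b: "b \<in> carrier M" using insert by simp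
    obtain m where "kdim (adjoin W b) m" using kdim_adjoin[OF W(1) b] by auto
    moreover have "insert b B \<subseteq> adjoin W b" using W adjoin_subset[OF kdim_ksub[OF W(1)] b] by auto
    ultimately show ?case by blast
  qed
  then obtain n W where W: "kdim W n" "B \<subseteq> W" by auto
  have s: "ksub W" by (rule kdim_ksub[OF W(1)])
  have "(\<Oplus>b\<in>B'. sc (c b) b) \<in> W" if "B' \<subseteq> B" for B' c
    using finite_subset[OF that assms(1)] that
  proof (induction B' rule: finite_induct)
    case (insert b F)
    hence "(\<lambda>b. sc (c b) b) \<in> F \<rightarrow> carrier M" "b \<in> carrier M" using assms(2) by auto
    moreover have "sc (c b) b \<in> W" using insert W ksubD(4)[OF s] by blast
    ultimately show ?case using insert ksubD(3)[OF s] by (simp add: finsum_insert)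
  qed (use ksubD(2)[OF s] in simp)
  hence "carrier M \<subseteq> W" using span by (metis subsetI subset_refl)
  hence "carrier M = W" using ksubD(1)[OF s] by blast
  thus ?thesis using W by auto
qed

end

text \<open>Start with a flag of the kernel and continue it by lifting a flag of the image.\<close>

lemma kdim_preimage:
  assumes M: "kspace M sc" and N: "kspace N sd"
    and V: "kspace.ksub M sc V" and g: "\<And>x. x \<in> V \<Longrightarrow> g x \<in> carrier N"
    "\<And>x y. x \<in> V \<Longrightarrow> y \<in> V \<Longrightarrow> g (x \<oplus>\<^bsub>M\<^esub> y) = g x \<oplus>\<^bsub>N\<^esub> g y"
    "\<And>x c. x \<in> V \<Longrightarrow> g (sc c x) = sd c (g x)"
    and ker: "kspace.kdim M sc {x\<in>V. g x = \<zero>\<^bsub>N\<^esub>} k"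
    and W: "kspace.kdim N sd W m" "W \<subseteq> g ` V"
  shows "kspace.kdim M sc {x\<in>V. g x \<in> W} (k + m)"
proof -
  interpret M: kspace M sc by (rule M)
  interpret N: kspace N sd by (rule N)
  show ?thesis using W
  proof (induction rule: N.kdim.induct)
    case kdim_zero thus ?case using ker by simp
  next
    case (kdim_Suc W m y)
    have sW: "N.ksub W" using kdim_Suc N.kdim_ksub by blast
    have sub: "W \<subseteq> N.adjoin W y" "y \<in> N.adjoin W y" using N.adjoin_subset[OF sW kdim_Suc.hyps(2)] by auto
    obtain x where x: "x \<in> V" "g x = y" using sub kdim_Suc.prems by blast
    let ?P = "{x\<in>V. g x \<in> W}"
    have P: "M.kdim ?P (k + m)" using kdim_Suc.IH kdim_Suc.prems sub by blast
    have xc: "x \<in> carrier M" using x M.ksubD(1)[OF V] by blast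
    have "M.adjoin ?P x = {x\<in>V. g x \<in> N.adjoin W y}"
    proof (intro equalityI subsetI)
      fix z assume "z \<in> M.adjoin ?P x"
      then obtain w c where w: "w \<in> V" "g w \<in> W" "z = w \<oplus>\<^bsub>M\<^esub> sc c x" by (auto simp: M.adjoin_def)
      thus "z \<in> {x\<in>V. g x \<in> N.adjoin W y}"
        using x g M.ksubD[OF V] by (auto simp: N.adjoin_def)
    next
      fix z assume "z \<in> {x\<in>V. g x \<in> N.adjoin W y}"
      then obtain w c where z: "z \<in> V" and w: "w \<in> W" "g z = w \<oplus>\<^bsub>N\<^esub> sd c y" by (auto simp: N.adjoin_def)
      let ?w = "z \<oplus>\<^bsub>M\<^esub> sc (- c) x"
      have wc: "w \<in> carrier N" using w N.ksubD(1)[OF sW] by blast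
      have "g ?w = w \<oplus>\<^bsub>N\<^esub> (sd c y \<oplus>\<^bsub>N\<^esub> sd (- c) y)"
        using w z x g M.ksubD(4)[OF V] wc kdim_Suc.hyps(2) by (simp add: N.a_assoc)
      also have "\<dots> = w" using N.sc_add_left[OF kdim_Suc.hyps(2), of c "- c"] wc kdim_Suc.hyps(2) by simp
      finally have "?w \<in> ?P" using w z x M.ksubD[OF V] by auto
      moreover have "z = ?w \<oplus>\<^bsub>M\<^esub> sc c x"
        using M.sc_add_left[OF xc, of "- c" c] xc M.ksubD(1)[OF V z] by (simp add: M.a_assoc)
      ultimately show "z \<in> M.adjoin ?P x" unfolding M.adjoin_def by blast
    qed
    moreover have "x \<notin> ?P" using x kdim_Suc.hyps(3) by auto
    ultimately show ?case using M.kdim_Suc[OF P xc] by simp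
  qed
qed

text \<open>Double annihilators: on the kernel of the last functional of a flag of \<open>D\<close> the
  induction hypothesis applies, and a multiple of that functional corrects the result.\<close>

lemma (in kspace) functional_in_span:
  fixes F :: "('f, 's') ring_scheme" and sd and ev :: "'f \<Rightarrow> 'm \<Rightarrow> 'k"
  assumes F: "kspace F sd" and D0: "kspace.ksub F sd D0" and D: "kspace.kdim F sd D n" "D \<subseteq> D0"
    and lin: "\<And>\<delta>. \<delta> \<in> D0 \<Longrightarrow> klin V (ev \<delta>)"
    and add: "\<And>\<delta> \<epsilon> x. \<delta> \<in> D0 \<Longrightarrow> \<epsilon> \<in> D0 \<Longrightarrow> x \<in> V \<Longrightarrow> ev (\<delta> \<oplus>\<^bsub>F\<^esub> \<epsilon>) x = ev \<delta> x + ev \<epsilon> x"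
    and scale: "\<And>\<delta> c x. \<delta> \<in> D0 \<Longrightarrow> x \<in> V \<Longrightarrow> ev (sd c \<delta>) x = c * ev \<delta> x"
    and X: "ksub X" "X \<subseteq> V" "klin X \<theta>" and ker: "\<And>x. x \<in> X \<Longrightarrow> (\<forall>\<delta>\<in>D. ev \<delta> x = 0) \<Longrightarrow> \<theta> x = 0"
  shows "\<exists>\<delta>\<in>D. \<forall>x\<in>X. \<theta> x = ev \<delta> x"
proof -
  interpret F: kspace F sd by (rule F)
  have zero: "ev \<zero>\<^bsub>F\<^esub> x = 0" if "x \<in> V" for x using scale[of "\<zero>\<^bsub>F\<^esub>" x 0] that F.ksubD(2)[OF D0] by simp
  show ?thesis using D X ker
  proof (induction arbitrary: X \<theta> rule: F.kdim.induct)
    case kdim_zero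
    thus ?case using zero by auto
  next
    case (kdim_Suc D n \<eta>)
    have sD: "F.ksub D" by (rule F.kdim_ksub[OF kdim_Suc.hyps(1)])
    have sub: "D \<subseteq> D0" "\<eta> \<in> D0" using kdim_Suc.prems(1) F.adjoin_subset[OF sD kdim_Suc.hyps(2)] by auto
    let ?X0 = "{x\<in>X. ev \<eta> x = 0}"
    have l\<eta>: "klin X (ev \<eta>)" using klin_sub[OF lin[OF sub(2)]] kdim_Suc by blast
    have s0: "ksub ?X0" using kdim_Suc.prems(2) l\<eta> klin_zero[OF kdim_Suc.prems(2) l\<eta>]
      unfolding ksub_def klin_def by auto
    have "\<exists>\<delta>\<in>D. \<forall>x\<in>?X0. \<theta> x = ev \<delta> x"
    proof (rule kdim_Suc.IH[OF sub(1) s0])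
      show "?X0 \<subseteq> V" using kdim_Suc by blast
      show "klin ?X0 \<theta>" by (rule klin_sub[OF kdim_Suc.prems(4)]) auto
      fix x assume x: "x \<in> ?X0" "\<forall>\<delta>\<in>D. ev \<delta> x = 0"
      have "ev \<delta> x = 0" if d: "\<delta> \<in> F.adjoin D \<eta>" for \<delta>
      proof -
        obtain w c where w: "w \<in> D" "\<delta> = w \<oplus>\<^bsub>F\<^esub> sd c \<eta>" using d by (auto simp: F.adjoin_def)
        have xV: "x \<in> V" using x kdim_Suc.prems(3) by auto
        have "ev \<delta> x = ev w x + c * ev \<eta> x"
          unfolding w(2) using w sub xV F.ksubD(4)[OF D0] by (subst add) (auto simp: scale)
        thus ?thesis using x w by simp
      qed
      thus "\<theta> x = 0" using kdim_Suc.prems(5) x by auto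
    qed
    then obtain \<delta> where \<delta>: "\<delta> \<in> D" "\<And>x. x \<in> X \<Longrightarrow> ev \<eta> x = 0 \<Longrightarrow> \<theta> x = ev \<delta> x" by auto
    have \<delta>c: "\<delta> \<in> D0" using \<delta> sub by blast
    have l\<delta>: "klin X (ev \<delta>)" using klin_sub[OF lin[OF \<delta>c]] kdim_Suc by blast
    define c where "c = (if \<exists>x\<in>X. ev \<eta> x \<noteq> 0 then (let x = SOME x. x \<in> X \<and> ev \<eta> x \<noteq> 0 in (\<theta> x - ev \<delta> x) / ev \<eta> x) else 0)"
    have "\<theta> x = ev (\<delta> \<oplus>\<^bsub>F\<^esub> sd c \<eta>) x" if x: "x \<in> X" for x
    proof -
      have v: "ev (\<delta> \<oplus>\<^bsub>F\<^esub> sd c \<eta>) x = ev \<delta> x + c * ev \<eta> x"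
        using x kdim_Suc.prems(3) \<delta>c sub(2) F.ksubD(4)[OF D0] by (subst add) (auto simp: scale)
      show ?thesis
      proof (cases "\<exists>x\<in>X. ev \<eta> x \<noteq> 0")
        case False
        thus ?thesis using v \<delta>(2)[OF x] x by auto
      next
        case True
        define y where "y = (SOME x. x \<in> X \<and> ev \<eta> x \<noteq> 0)"
        have y: "y \<in> X \<and> ev \<eta> y \<noteq> 0" unfolding y_def by (rule someI_ex) (use True in blast)
        have c: "c = (\<theta> y - ev \<delta> y) / ev \<eta> y" using True by (simp add: c_def y_def Let_def)
        let ?z = "x \<oplus> sc (- (ev \<eta> x / ev \<eta> y)) y"
        have z: "?z \<in> X" using x y ksubD[OF kdim_Suc.prems(2)] by auto
        have val: "\<zeta> ?z = \<zeta> x - ev \<eta> x / ev \<eta> y * \<zeta> y" if "klin X \<zeta>" for \<zeta>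
          using klinD[OF that] x y ksubD(4)[OF kdim_Suc.prems(2)] by simp
        have "ev \<eta> ?z = 0" using val[OF l\<eta>] y by simp
        hence "\<theta> ?z = ev \<delta> ?z" using \<delta>(2) z by blast
        hence "\<theta> x - ev \<eta> x / ev \<eta> y * \<theta> y = ev \<delta> x - ev \<eta> x / ev \<eta> y * ev \<delta> y"
          using val[OF kdim_Suc.prems(4)] val[OF l\<delta>] by simp
        hence "\<theta> x = ev \<delta> x + (\<theta> y - ev \<delta> y) / ev \<eta> y * ev \<eta> x" using y by (simp add: field_simps)
        thus ?thesis unfolding v unfolding c .
      qed
    qed
    moreover have "\<delta> \<oplus>\<^bsub>F\<^esub> sd c \<eta> \<in> F.adjoin D \<eta>" using \<delta> by (auto simp: F.adjoin_def)
    ultimately show ?case by blast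
  qed
qed

lemma kdim_image:
  assumes M: "kspace M sc" and N: "kspace N sd" and V: "kspace.ksub M sc V"
    and g: "\<And>x. x \<in> V \<Longrightarrow> g x \<in> carrier N"
    "\<And>x y. x \<in> V \<Longrightarrow> y \<in> V \<Longrightarrow> g (x \<oplus>\<^bsub>M\<^esub> y) = g x \<oplus>\<^bsub>N\<^esub> g y"
    "\<And>x c. x \<in> V \<Longrightarrow> g (sc c x) = sd c (g x)"
    and W: "kspace.kdim M sc W n" "W \<subseteq> V"
  shows "\<exists>m. kspace.kdim N sd (g ` W) m"
proof -
  interpret M: kspace M sc by (rule M)
  interpret N: kspace N sd by (rule N)
  have z: "g \<zero>\<^bsub>M\<^esub> = \<zero>\<^bsub>N\<^esub>" using g(1,3)[of "\<zero>\<^bsub>M\<^esub>"] M.ksubD(2)[OF V] by (metis M.sc_of_zero N.sc_zero)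
  show ?thesis using W
  proof (induction rule: M.kdim.induct)
    case kdim_zero thus ?case using z N.kdim_zero by auto
  next
    case (kdim_Suc W n x)
    have sW: "M.ksub W" using kdim_Suc M.kdim_ksub by blast
    have sub: "W \<subseteq> V" "x \<in> V" using kdim_Suc.prems M.adjoin_subset[OF sW kdim_Suc.hyps(2)] by auto
    obtain m where m: "N.kdim (g ` W) m" using kdim_Suc.IH sub by auto
    have "g (w \<oplus>\<^bsub>M\<^esub> sc c x) = g w \<oplus>\<^bsub>N\<^esub> sd c (g x)" if "w \<in> W" for w c
      using that sub g M.ksubD(4)[OF V] by (simp add: subset_iff)
    hence "g ` M.adjoin W x = N.adjoin (g ` W) (g x)"
      by (auto simp: M.adjoin_def N.adjoin_def) (metis (mono_tags, lifting) image_eqI mem_Collect_eq)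
    thus ?case using N.kdim_adjoin[OF m g(1)[OF sub(2)]] by simp
  qed
qed

text \<open>The pointwise vector space of functions, and the dual space, whose members vanish outside
  the space on which they are functionals.\<close>

definition function_space :: "('m \<Rightarrow> 'k::field) ring" where
  "function_space = \<lparr>carrier = UNIV, mult = undefined, one = undefined,
     zero = (\<lambda>_. 0), add = (\<lambda>f g x. f x + g x)\<rparr>"

lemma function_space_simps:
  "carrier (function_space :: ('m \<Rightarrow> 'k::field) ring) = UNIV" "zero function_space = (\<lambda>_. 0)"
  "add function_space f g = (\<lambda>x. f x + g x)"
  by (simp_all add: function_space_def)

lemma kspace_function_space: "kspace function_space (\<lambda>(c::'k::field) f x. c * f x)"
proof -
  have "abelian_group (function_space :: ('m \<Rightarrow> 'k) ring)"
  proof (rule abelian_groupI)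
    fix f :: "'m \<Rightarrow> 'k" assume "f \<in> carrier function_space"
    show "\<exists>g\<in>carrier function_space. g \<oplus>\<^bsub>function_space\<^esub> f = \<zero>\<^bsub>function_space\<^esub>"
      by (intro bexI[of _ "\<lambda>x. - f x"]) (auto simp: function_space_simps)
  qed (auto simp: function_space_simps algebra_simps)
  then interpret abelian_group "function_space :: ('m \<Rightarrow> 'k) ring" .
  show ?thesis by unfold_locales (auto simp: function_space_simps algebra_simps)
qed

definition (in kspace) dual :: "'m set \<Rightarrow> ('m \<Rightarrow> 'k) set" where
  "dual V = {\<xi>. (\<forall>x. x \<notin> V \<longrightarrow> \<xi> x = 0) \<and> klin V \<xi>}"

lemma (in kspace) kdim_dual:
  "kdim V n \<Longrightarrow> kspace.kdim function_space (\<lambda>c f x. c * f x) (dual V) n"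
proof (induction rule: kdim.induct)
  interpret F: kspace "function_space :: ('m \<Rightarrow> 'k) ring" "\<lambda>c f x. c * f x" by (rule kspace_function_space)
  {
    case kdim_zero
    have "\<xi> = (\<lambda>_. 0)" if "\<xi> \<in> dual {\<zero>}" for \<xi>
    proof
      fix y show "\<xi> y = 0"
        using that klin_zero[OF ksub_zero, of \<xi>] by (cases "y = \<zero>") (auto simp: dual_def)
    qed
    moreover have "(\<lambda>_. 0) \<in> dual {\<zero>}" by (auto simp: dual_def klin_def)
    moreover have "\<zero>\<^bsub>function_space\<^esub> = (\<lambda>_ :: 'm. 0 :: 'k)" by (simp add: function_space_simps)
    ultimately have "dual {\<zero>} = {\<zero>\<^bsub>function_space\<^esub>}" by (metis (no_types, lifting) singletonI singletonD subsetI subset_antisym)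
    thus ?case using F.kdim_zero by metis
  next
    case (kdim_Suc W n x)
    have W: "ksub W" using kdim_Suc kdim_ksub by blast
    let ?V = "adjoin W x"
    have V: "ksub ?V" by (rule ksub_adjoin[OF W kdim_Suc.hyps(2)])
    have sub: "W \<subseteq> ?V" "x \<in> ?V" using adjoin_subset[OF W kdim_Suc.hyps(2)] by auto
    let ?g = "\<lambda>\<xi> y. if y \<in> W then \<xi> y else 0"
    have kd: "F.ksub (dual ?V)"
      unfolding F.ksub_def dual_def klin_def using ksubD[OF V]
      by (auto simp: function_space_simps algebra_simps)
    have off: "(\<lambda>y. if y \<in> A then \<xi> y else 0) \<in> dual A" if "klin A \<xi>" "ksub A" for A \<xi>
      using that ksubD[OF that(2)] unfolding dual_def klin_def by auto
    have "klin W (\<lambda>_. 0)" by (simp add: klin_def)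
    from klin_extend_one[OF W kdim_Suc.hyps(2,3) this, of 1]
    obtain \<zeta>0 where z0: "klin ?V \<zeta>0" "\<And>w. w \<in> W \<Longrightarrow> \<zeta>0 w = 0" "\<zeta>0 x = 1" by blast
    define \<zeta> where "\<zeta> = (\<lambda>y. if y \<in> ?V then \<zeta>0 y else 0)"
    have \<zeta>: "\<zeta> \<in> dual ?V" "\<And>w. w \<in> W \<Longrightarrow> \<zeta> w = 0" "\<zeta> x = 1"
      using off[OF z0(1) V] z0 sub by (auto simp: \<zeta>_def)
    have ker: "{\<xi> \<in> dual ?V. ?g \<xi> = \<zero>\<^bsub>function_space\<^esub>} = F.adjoin {\<zero>\<^bsub>function_space\<^esub>} \<zeta>"
    proof (intro equalityI subsetI)
      fix \<xi> assume x: "\<xi> \<in> {\<xi> \<in> dual ?V. ?g \<xi> = \<zero>\<^bsub>function_space\<^esub>}"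
      hence w0: "\<xi> w = 0" if "w \<in> W" for w using that by (auto simp: function_space_simps fun_eq_iff split: if_splits)
      have l: "klin ?V \<xi>" "klin ?V \<zeta>" using x \<zeta>(1) by (auto simp: dual_def)
      have "\<xi> y = \<xi> x * \<zeta> y" for y
      proof (cases "y \<in> ?V")
        case True
        then obtain w c where w: "w \<in> W" "y = w \<oplus> sc c x" by (auto simp: adjoin_def)
        have ex: "\<eta> y = \<eta> w + c * \<eta> x" if "klin ?V \<eta>" for \<eta>
          using klinD[OF that] w sub ksubD(4)[OF V] by auto
        show ?thesis using ex[OF l(1)] ex[OF l(2)] w0[OF w(1)] \<zeta>(2)[OF w(1)] \<zeta>(3) by simp
      qed (use x \<zeta>(1) in \<open>auto simp: dual_def\<close>)
      thus "\<xi> \<in> F.adjoin {\<zero>\<^bsub>function_space\<^esub>} \<zeta>"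
        by (auto simp: F.adjoin_def function_space_simps intro!: exI[of _ "\<xi> x"])
    next
      fix \<xi> assume "\<xi> \<in> F.adjoin {\<zero>\<^bsub>function_space\<^esub>} \<zeta>"
      then obtain c where c: "\<xi> = (\<lambda>y. c * \<zeta> y)" by (auto simp: F.adjoin_def function_space_simps)
      have "\<xi> \<in> dual ?V" using F.ksubD(4)[OF kd \<zeta>(1), of c] c by simp
      thus "\<xi> \<in> {\<xi> \<in> dual ?V. ?g \<xi> = \<zero>\<^bsub>function_space\<^esub>}"
        using c \<zeta>(2) by (auto simp: function_space_simps)
    qed
    have "\<zeta> \<notin> {\<zero>\<^bsub>function_space\<^esub>}" using \<zeta>(3) by (auto simp: function_space_simps fun_eq_iff intro!: exI[of _ x])
    hence k1: "F.kdim {\<xi> \<in> dual ?V. ?g \<xi> = \<zero>\<^bsub>function_space\<^esub>} 1"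
      unfolding ker using F.kdim_Suc[OF F.kdim_zero, of \<zeta>] by (simp add: function_space_simps)
    have surj: "dual W \<subseteq> ?g ` dual ?V"
    proof
      fix \<xi> assume x: "\<xi> \<in> dual W"
      then obtain \<xi>' where x': "klin ?V \<xi>'" "\<And>w. w \<in> W \<Longrightarrow> \<xi>' w = \<xi> w"
        using klin_extend_one[OF W kdim_Suc.hyps(2,3), of \<xi> 0] unfolding dual_def by blast
      have "\<xi> = ?g (\<lambda>y. if y \<in> ?V then \<xi>' y else 0)"
        using x x'(2) sub(1) by (auto simp: dual_def fun_eq_iff)
      thus "\<xi> \<in> ?g ` dual ?V" using off[OF x'(1) V] by (rule image_eqI)
    qed
    have "F.kdim {\<xi> \<in> dual ?V. ?g \<xi> \<in> dual W} (1 + n)"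
      by (rule kdim_preimage[OF F.kspace_axioms F.kspace_axioms kd _ _ _ k1 kdim_Suc.IH surj])
        (auto simp: function_space_simps)
    moreover have "?g \<xi> \<in> dual W" if "\<xi> \<in> dual ?V" for \<xi>
      using that klin_sub[OF _ sub(1)] W off by (auto simp: dual_def)
    hence "{\<xi> \<in> dual ?V. ?g \<xi> \<in> dual W} = dual ?V" by blast
    ultimately show ?case by simp
  }
qed

lemma (in kspace) kdim_spanning_set:
  "kdim V n \<Longrightarrow> \<exists>B. finite B \<and> B \<subseteq> V \<and> (\<forall>m\<in>V. \<exists>c. m = (\<Oplus>b\<in>B. sc (c b) b))"
proof (induction rule: kdim.induct)
  case kdim_zero
  show ?case by (intro exI[of _ "{}"]) auto
next
  case (kdim_Suc W n x)
  then obtain B where B: "finite B" "B \<subseteq> W" "\<forall>m\<in>W. \<exists>c. m = (\<Oplus>b\<in>B. sc (c b) b)" by blast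
  have W: "ksub W" using kdim_Suc kdim_ksub by blast
  have xB: "x \<notin> B" using B kdim_Suc by blast
  have Bc: "B \<subseteq> carrier M" using B ksubD(1)[OF W] by blast
  show ?case
  proof (intro exI[of _ "insert x B"] conjI ballI)
    show "insert x B \<subseteq> adjoin W x" using B adjoin_subset[OF W kdim_Suc.hyps(2)] by auto
    fix m assume "m \<in> adjoin W x"
    then obtain w d where w: "w \<in> W" "m = w \<oplus> sc d x" by (auto simp: adjoin_def)
    obtain c where c: "w = (\<Oplus>b\<in>B. sc (c b) b)" using B w by blast
    let ?c = "c(x := d)"
    have "(\<Oplus>b\<in>insert x B. sc (?c b) b) = sc d x \<oplus> (\<Oplus>b\<in>B. sc (?c b) b)"
      using B(1) xB Bc kdim_Suc.hyps(2) by (subst finsum_insert) auto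
    also have "(\<Oplus>b\<in>B. sc (?c b) b) = w"
      unfolding c by (rule finsum_cong') (use xB Bc in auto)
    finally show "\<exists>c. m = (\<Oplus>b\<in>insert x B. sc (c b) b)"
      using w kdim_Suc.hyps(2) ksubD(1)[OF W w(1)] by (intro exI[of _ ?c]) (simp add: a_comm)
  qed (use B in simp)
qed

section \<open>Weights of finite-dimensional modules of type one\<close>

lemma (in left_module) smult_zero_right [simp]: "a \<in> carrier R \<Longrightarrow> a \<odot>\<^bsub>M\<^esub> \<zero>\<^bsub>M\<^esub> = \<zero>\<^bsub>M\<^esub>"
  using smult_r_distr[of a "\<zero>\<^bsub>M\<^esub>" "\<zero>\<^bsub>M\<^esub>"] smult_closed[of a "\<zero>\<^bsub>M\<^esub>"]
  by (metis M.add.l_cancel_one' M.l_zero M.zero_closed)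

lemma (in left_module) smult_zero_left [simp]: "x \<in> carrier M \<Longrightarrow> \<zero>\<^bsub>R\<^esub> \<odot>\<^bsub>M\<^esub> x = \<zero>\<^bsub>M\<^esub>"
  using smult_l_distr[of "\<zero>\<^bsub>R\<^esub>" "\<zero>\<^bsub>R\<^esub>" x] smult_closed[of "\<zero>\<^bsub>R\<^esub>" x]
  by (metis M.add.l_cancel_one' R.l_zero R.zero_closed)

lemma (in left_module) smult_uminus_left:
  "a \<in> carrier R \<Longrightarrow> x \<in> carrier M \<Longrightarrow> (\<ominus>\<^bsub>R\<^esub> a) \<odot>\<^bsub>M\<^esub> x = \<ominus>\<^bsub>M\<^esub> (a \<odot>\<^bsub>M\<^esub> x)"
  using smult_l_distr[of "\<ominus>\<^bsub>R\<^esub> a" a x] smult_closed[of a x] smult_closed[of "\<ominus>\<^bsub>R\<^esub> a" x]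
  by (simp add: R.l_neg M.minus_equality)

lemma (in left_module) smult_uminus_right:
  "a \<in> carrier R \<Longrightarrow> x \<in> carrier M \<Longrightarrow> a \<odot>\<^bsub>M\<^esub> (\<ominus>\<^bsub>M\<^esub> x) = \<ominus>\<^bsub>M\<^esub> (a \<odot>\<^bsub>M\<^esub> x)"
  using smult_r_distr[of a "\<ominus>\<^bsub>M\<^esub> x" x] smult_closed[of a x] smult_closed[of a "\<ominus>\<^bsub>M\<^esub> x"]
  by (simp add: M.l_neg M.minus_equality)

lemma (in left_module) smult_minus_right:
  "a \<in> carrier R \<Longrightarrow> x \<in> carrier M \<Longrightarrow> y \<in> carrier M \<Longrightarrow> a \<odot>\<^bsub>M\<^esub> (x \<ominus>\<^bsub>M\<^esub> y) = a \<odot>\<^bsub>M\<^esub> x \<ominus>\<^bsub>M\<^esub> a \<odot>\<^bsub>M\<^esub> y"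
  by (simp add: a_minus_def smult_r_distr smult_uminus_right smult_closed)

lemma (in left_module) smult_finsum_left:
  "finite S \<Longrightarrow> g \<in> S \<rightarrow> carrier R \<Longrightarrow> x \<in> carrier M \<Longrightarrow>
    (\<Oplus>\<^bsub>R\<^esub>i\<in>S. g i) \<odot>\<^bsub>M\<^esub> x = (\<Oplus>\<^bsub>M\<^esub>i\<in>S. g i \<odot>\<^bsub>M\<^esub> x)"
proof (induction S rule: finite_induct)
  case (insert i S)
  hence "g \<in> S \<rightarrow> carrier R" "g i \<in> carrier R" "(\<lambda>i. g i \<odot>\<^bsub>M\<^esub> x) \<in> S \<rightarrow> carrier M"
    using smult_closed by auto
  thus ?case using insert smult_closed by (simp add: R.finsum_insert M.finsum_insert smult_l_distr)
qed simp

lemma (in left_module) smult_finsum_right: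
  "finite S \<Longrightarrow> g \<in> S \<rightarrow> carrier M \<Longrightarrow> a \<in> carrier R \<Longrightarrow>
    a \<odot>\<^bsub>M\<^esub> (\<Oplus>\<^bsub>M\<^esub>i\<in>S. g i) = (\<Oplus>\<^bsub>M\<^esub>i\<in>S. a \<odot>\<^bsub>M\<^esub> g i)"
proof (induction S rule: finite_induct)
  case (insert i S)
  hence "g \<in> S \<rightarrow> carrier M" "g i \<in> carrier M" "(\<lambda>i. a \<odot>\<^bsub>M\<^esub> g i) \<in> S \<rightarrow> carrier M"
    using smult_closed by auto
  thus ?case using insert smult_closed by (simp add: M.finsum_insert smult_r_distr)
qed simp

lemma (in left_module) submoduleD:
  assumes "submodule N R M"
  shows "x \<in> N \<Longrightarrow> x \<in> carrier M" "\<zero>\<^bsub>M\<^esub> \<in> N" "x \<in> N \<Longrightarrow> y \<in> N \<Longrightarrow> x \<oplus>\<^bsub>M\<^esub> y \<in> N"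
    "x \<in> N \<Longrightarrow> \<ominus>\<^bsub>M\<^esub> x \<in> N" "x \<in> N \<Longrightarrow> y \<in> N \<Longrightarrow> x \<ominus>\<^bsub>M\<^esub> y \<in> N"
    "a \<in> carrier R \<Longrightarrow> x \<in> N \<Longrightarrow> a \<odot>\<^bsub>M\<^esub> x \<in> N"
proof -
  interpret N: submodule N R M by (rule assms)
  show a: "x \<in> N \<Longrightarrow> x \<in> carrier M" "\<zero>\<^bsub>M\<^esub> \<in> N" "x \<in> N \<Longrightarrow> y \<in> N \<Longrightarrow> x \<oplus>\<^bsub>M\<^esub> y \<in> N"
     "a \<in> carrier R \<Longrightarrow> x \<in> N \<Longrightarrow> a \<odot>\<^bsub>M\<^esub> x \<in> N" for x y a
    using N.subset N.one_closed N.m_closed N.smult_closed by auto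
  show b: "x \<in> N \<Longrightarrow> \<ominus>\<^bsub>M\<^esub> x \<in> N" for x
    using N.m_inv_closed by (simp add: a_inv_def)
  show "x \<in> N \<Longrightarrow> y \<in> N \<Longrightarrow> x \<ominus>\<^bsub>M\<^esub> y \<in> N" using a b by (simp add: a_minus_def)
qed

lemma (in left_module) submoduleI:
  assumes "N \<subseteq> carrier M" "\<zero>\<^bsub>M\<^esub> \<in> N" "\<And>x y. x \<in> N \<Longrightarrow> y \<in> N \<Longrightarrow> x \<oplus>\<^bsub>M\<^esub> y \<in> N"
    "\<And>a x. a \<in> carrier R \<Longrightarrow> x \<in> N \<Longrightarrow> a \<odot>\<^bsub>M\<^esub> x \<in> N"
  shows "submodule N R M"
proof -
  have "subgroup N (add_monoid M)"
  proof (rule M.add.subgroupI)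
    fix x assume x: "x \<in> N"
    have "\<ominus>\<^bsub>M\<^esub> x = (\<ominus>\<^bsub>R\<^esub> \<one>\<^bsub>R\<^esub>) \<odot>\<^bsub>M\<^esub> x"
      using x assms(1) smult_uminus_left[of "\<one>\<^bsub>R\<^esub>" x] smult_one by auto
    thus "\<ominus>\<^bsub>M\<^esub> x \<in> N" using assms(4) x by simp
  qed (use assms in auto)
  thus ?thesis using assms(4) by (intro submodule.intro submodule_axioms.intro) auto
qed

lemma (in left_module) finsum_in_submodule:
  assumes "submodule N R M" "finite S" "\<And>i. i \<in> S \<Longrightarrow> g i \<in> N"
  shows "(\<Oplus>\<^bsub>M\<^esub>i\<in>S. g i) \<in> N"
  using assms(2,3)
proof (induction S rule: finite_induct)
  case (insert i S)
  hence "g \<in> S \<rightarrow> carrier M" "g i \<in> carrier M" using submoduleD(1)[OF assms(1)] by auto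
  thus ?case using insert submoduleD(3)[OF assms(1)] by (simp add: M.finsum_insert)
qed (use submoduleD(2)[OF assms(1)] in simp)

locale weight_module = quantum_data \<Phi> \<alpha> q + left_module "uq \<alpha> q" T
  for \<Phi> and \<alpha> :: "'i::finite \<Rightarrow> 'e::euclidean_space" and q :: "'k::field"
    and T :: "('i, 'k, 'm) uq_module" (structure)
begin

abbreviation act :: "('i, 'k) uq_elem \<Rightarrow> 'm \<Rightarrow> 'm" (infixr \<open>\<star>\<close> 75) where "u \<star> x \<equiv> u \<odot> x"
abbreviation sc :: "'k \<Rightarrow> 'm \<Rightarrow> 'm" where "sc c x \<equiv> uq_scalar \<alpha> q c \<star> x"
abbreviation Ea where "Ea i r x \<equiv> uq_E \<alpha> q i r \<star> x"
abbreviation Fa where "Fa i r x \<equiv> uq_F \<alpha> q i r \<star> x"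
abbreviation sub where "sub N \<equiv> submodule N (uq \<alpha> q) T"
abbreviation Wt where "Wt \<equiv> weight_space \<alpha> q T"

lemmas act_closed [simp, intro] = smult_closed

sublocale K: kspace T sc
proof
  show "x \<in> carrier T \<Longrightarrow> sc (a + b) x = sc a x \<oplus> sc b x" for x a b
    by (simp add: W.Q.scalar_add smult_l_distr)
  show "x \<in> carrier T \<Longrightarrow> sc a (sc b x) = sc (a * b) x" for x a b
    by (simp add: W.Q.scalar_mult smult_assoc)
  show "x \<in> carrier T \<Longrightarrow> sc 1 x = x" for x
    by (simp add: W.Q.scalar_one smult_one)
qed (auto simp: smult_r_distr)

lemma act_scl: "u \<in> carrier U \<Longrightarrow> x \<in> carrier T \<Longrightarrow> uscl c u \<star> x = sc c (u \<star> x)"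
  by (simp add: W.Q.scl_def smult_assoc)

lemma act_sc: "u \<in> carrier U \<Longrightarrow> x \<in> carrier T \<Longrightarrow> u \<star> sc c x = sc c (u \<star> x)"
  by (metis W.Q.scalar_closed W.Q.scalar_central smult_assoc)

lemmas act_sc_gens = U_closed(1-6)[THEN act_sc]

lemma sub_ksub: "sub N \<Longrightarrow> K.ksub N"
  unfolding K.ksub_def using submoduleD by auto

lemma WtD:
  assumes "x \<in> Wt \<mu>"
  shows "x \<in> carrier T" "uq_K \<alpha> q i \<star> x = sc (K_value \<alpha> q \<mu> i) x"
    "uq_Kinv \<alpha> q i \<star> x = sc (inverse (K_value \<alpha> q \<mu> i)) x"
    "uq_Kbinom \<alpha> q i t \<star> x = sc (chi i (weight_coeff \<alpha> \<mu> i) t) x"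
  using assms by (auto simp: weight_space_def Kbinom_value_def chi_def)

lemma K_value_nonzero [simp]: "K_value \<alpha> q \<mu> i \<noteq> 0"
  using q_nonzero by (simp add: K_value_def)

lemma WtI:
  assumes x: "x \<in> carrier T" and K: "\<And>i. uq_K \<alpha> q i \<star> x = sc (K_value \<alpha> q \<mu> i) x"
    and B: "\<And>i t. uq_Kbinom \<alpha> q i t \<star> x = sc (chi i (weight_coeff \<alpha> \<mu> i) t) x"
  shows "x \<in> Wt \<mu>"
proof -
  have "uq_Kinv \<alpha> q i \<star> x = sc (inverse (K_value \<alpha> q \<mu> i)) x" for i
  proof -
    have "x = uq_Kinv \<alpha> q i \<star> (uq_K \<alpha> q i \<star> x)"
      using x by (simp add: smult_assoc[symmetric] U_K_inverse smult_one)
    also have "\<dots> = sc (K_value \<alpha> q \<mu> i) (uq_Kinv \<alpha> q i \<star> x)" using x by (simp add: K act_sc_gens)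
    finally have "sc (inverse (K_value \<alpha> q \<mu> i)) x
        = sc (inverse (K_value \<alpha> q \<mu> i)) (sc (K_value \<alpha> q \<mu> i) (uq_Kinv \<alpha> q i \<star> x))" by simp
    thus ?thesis using x by (simp add: K.sc_sc)
  qed
  thus ?thesis using assms by (simp add: weight_space_def Kbinom_value_def chi_def)
qed

lemma Wt_zero [simp, intro]: "\<zero> \<in> Wt \<mu>"
  by (rule WtI) auto

lemma Wt_add: "x \<in> Wt \<mu> \<Longrightarrow> y \<in> Wt \<mu> \<Longrightarrow> x \<oplus> y \<in> Wt \<mu>"
  by (rule WtI) (auto simp: WtD smult_r_distr)

lemma Wt_sc: "x \<in> Wt \<mu> \<Longrightarrow> sc c x \<in> Wt \<mu>"
  by (rule WtI) (auto simp: WtD act_sc_gens K.sc_sc mult.commute)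

lemma Wt_ksub: "K.ksub (Wt \<mu>)"
  unfolding K.ksub_def using Wt_add Wt_sc WtD(1) by blast

text \<open>The shifted binomials act on weight vectors by the shifted character values, since both satisfy
  the Pascal recurrence.\<close>

lemma UKB_act:
  assumes x: "x \<in> Wt \<mu>"
  shows "UKB i c t \<star> x = sc (chi i (weight_coeff \<alpha> \<mu> i + c) t) x"
proof (induction c t rule: pascal_induct)
  case (1 t)
  show ?case using WtD[OF x] by (simp add: UKB_simps)
next
  case (2 c)
  show ?case using WtD(1)[OF x] by (simp add: UKB_simps smult_one)
next
  case (3 c t)
  let ?m = "weight_coeff \<alpha> \<mu> i"
  have "UKB i (c + 1) (Suc t) \<star> x = sc (q powi (int (symmetrizer \<alpha> i) * (int t + 1)) * chi i (?m + c) (Suc t)) x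
     \<oplus> sc (q powi (int (symmetrizer \<alpha> i) * (int t - c)) * (chi i (?m + c) t * inverse (K_value \<alpha> q \<mu> i))) x"
    unfolding UKB_pascal using WtD(1)[OF x] WtD(3)[OF x]
    by (simp add: smult_l_distr act_scl smult_assoc 3 K.sc_sc act_sc_gens)
  also have "\<dots> = sc (chi i (?m + c + 1) (Suc t)) x"
    using WtD(1)[OF x] q_nonzero unfolding chi_pascal K.sc_add_left[OF WtD(1)[OF x], symmetric]
    by (simp add: K_value_def right_diff_distrib distrib_left power_int_diff power_int_add field_simps)
  finally show ?case by (simp add: add.assoc)
next
  case (4 c t)
  let ?m = "weight_coeff \<alpha> \<mu> i"
  let ?a = "q powi (int (symmetrizer \<alpha> i) * (int t + 1))"
  let ?b = "q powi (int (symmetrizer \<alpha> i) * (int t - c)) * (chi i (?m + c) t * inverse (K_value \<alpha> q \<mu> i))"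
  have a: "?a \<noteq> 0" using q_nonzero by simp
  have xc: "x \<in> carrier T" by (rule WtD[OF x])
  have "sc ?a (UKB i c (Suc t) \<star> x) \<oplus> sc ?b x = UKB i (c + 1) (Suc t) \<star> x"
    unfolding UKB_pascal using xc WtD(3)[OF x]
    by (simp add: smult_l_distr act_scl smult_assoc 4 K.sc_sc act_sc_gens)
  also have "\<dots> = sc (?a * chi i (?m + c) (Suc t) + ?b) x"
  proof -
    have "?b = q powi (int (symmetrizer \<alpha> i) * (int t - (?m + c))) * chi i (?m + c) t"
      using q_nonzero
      by (simp add: K_value_def right_diff_distrib distrib_left power_int_diff power_int_add field_simps)
    hence "?a * chi i (?m + c) (Suc t) + ?b = chi i (?m + c + 1) (Suc t)" unfolding chi_pascal by simp
    thus ?thesis using 4(1) by (simp add: add.assoc)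
  qed
  also have "\<dots> = sc ?a (sc (chi i (?m + c) (Suc t)) x) \<oplus> sc ?b x"
    using xc by (simp add: K.sc_add_left K.sc_sc)
  finally have eq: "sc ?a (UKB i c (Suc t) \<star> x) = sc ?a (sc (chi i (?m + c) (Suc t)) x)"
    using xc by simp
  show ?case by (rule K.sc_cancel[OF a _ _ eq]) (use xc in auto)
qed

lemma weight_shift':
  assumes "\<mu> \<in> weights \<alpha>"
  shows "\<mu> + real r *\<^sub>R \<alpha> j \<in> weights \<alpha>" "\<mu> - real r *\<^sub>R \<alpha> j \<in> weights \<alpha>"
    "weight_coeff \<alpha> (\<mu> + real r *\<^sub>R \<alpha> j) i = weight_coeff \<alpha> \<mu> i + int r * cartan_matrix \<alpha> i j"
    "weight_coeff \<alpha> (\<mu> - real r *\<^sub>R \<alpha> j) i = weight_coeff \<alpha> \<mu> i - int r * cartan_matrix \<alpha> i j"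
  using weight_shift[OF assms, of "int r" j] weight_shift[OF assms, of "- int r" j] by auto

lemma E_Wt: "x \<in> Wt \<mu> \<Longrightarrow> \<mu> \<in> weights \<alpha> \<Longrightarrow> Ea j r x \<in> Wt (\<mu> + real r *\<^sub>R \<alpha> j)"
proof (rule WtI)
  fix i assume x: "x \<in> Wt \<mu>" and m: "\<mu> \<in> weights \<alpha>"
  note xc = WtD(1)[OF x]
  show "uq_K \<alpha> q i \<star> Ea j r x = sc (K_value \<alpha> q (\<mu> + real r *\<^sub>R \<alpha> j) i) (Ea j r x)"
    using xc m q_nonzero
    by (simp add: smult_assoc[symmetric] U_K_E act_scl)
      (simp add: smult_assoc WtD(2)[OF x] act_sc_gens K.sc_sc K_value_def weight_shift' distrib_left power_int_add mult.commute)
next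
  fix i t assume x: "x \<in> Wt \<mu>" and m: "\<mu> \<in> weights \<alpha>"
  note xc = WtD(1)[OF x]
  show "uq_Kbinom \<alpha> q i t \<star> Ea j r x = sc (chi i (weight_coeff \<alpha> (\<mu> + real r *\<^sub>R \<alpha> j) i) t) (Ea j r x)"
    using xc m by (simp add: smult_assoc[symmetric] UKB_simps(1)[symmetric] U_KB_E)
      (simp add: smult_assoc UKB_act[OF x] act_sc_gens weight_shift')
qed (use WtD in auto)

lemma F_Wt: "x \<in> Wt \<mu> \<Longrightarrow> \<mu> \<in> weights \<alpha> \<Longrightarrow> Fa j r x \<in> Wt (\<mu> - real r *\<^sub>R \<alpha> j)"
proof (rule WtI)
  fix i assume x: "x \<in> Wt \<mu>" and m: "\<mu> \<in> weights \<alpha>"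
  note xc = WtD(1)[OF x]
  show "uq_K \<alpha> q i \<star> Fa j r x = sc (K_value \<alpha> q (\<mu> - real r *\<^sub>R \<alpha> j) i) (Fa j r x)"
    using xc m q_nonzero
    by (simp add: smult_assoc[symmetric] U_K_F act_scl)
      (simp add: smult_assoc WtD(2)[OF x] act_sc_gens K.sc_sc K_value_def weight_shift' right_diff_distrib
        power_int_diff power_int_minus divide_inverse mult.commute)
next
  fix i t assume x: "x \<in> Wt \<mu>" and m: "\<mu> \<in> weights \<alpha>"
  note xc = WtD(1)[OF x]
  show "uq_Kbinom \<alpha> q i t \<star> Fa j r x = sc (chi i (weight_coeff \<alpha> (\<mu> - real r *\<^sub>R \<alpha> j) i) t) (Fa j r x)"
    using xc m by (simp add: smult_assoc[symmetric] UKB_simps(1)[symmetric] U_KB_F)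
      (simp add: smult_assoc UKB_act[OF x] act_sc_gens weight_shift')
qed (use WtD in auto)

text \<open>Kac's formula on a weight vector, where the binomial factor in the middle is a scalar.\<close>

lemma E_F_act:
  assumes x: "x \<in> Wt \<mu>" and m: "\<mu> \<in> weights \<alpha>" and P: "K.ksub P"
    and mem: "\<And>t. t \<le> r \<Longrightarrow> t \<le> s \<Longrightarrow> Fa i (s - t) (Ea i (r - t) x) \<in> P"
  shows "Ea i r (Fa i s x) \<in> P"
proof -
  note xc = WtD(1)[OF x]
  let ?T = "\<lambda>t. (if t \<le> s then uq_F \<alpha> q i (s - t) else \<zero>\<^bsub>U\<^esub>)
     \<otimes>\<^bsub>U\<^esub> UKB i (2 * int t - int r - int s) t \<otimes>\<^bsub>U\<^esub> uq_E \<alpha> q i (r - t)"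
  have "Ea i r (Fa i s x) = (\<Oplus>t\<in>{..r}. ?T t \<star> x)"
    using xc by (simp add: smult_assoc[symmetric] U_Kac smult_finsum_left)
  also have "\<dots> \<in> P"
  proof -
    have T: "?T t \<star> x \<in> P" if "t \<le> r" for t
    proof (cases "t \<le> s")
      case True
      have "?T t \<star> x = uq_F \<alpha> q i (s - t) \<star> (UKB i (2 * int t - int r - int s) t \<star> Ea i (r - t) x)"
        using True xc by (simp add: smult_assoc)
      also have "\<dots> = sc (chi i (weight_coeff \<alpha> (\<mu> + real (r - t) *\<^sub>R \<alpha> i) i + (2 * int t - int r - int s)) t)
          (Fa i (s - t) (Ea i (r - t) x))"
        using UKB_act[OF E_Wt[OF x m]] xc by (simp add: act_sc_gens)
      also have "\<dots> \<in> P" using mem[OF that True] K.ksubD(4)[OF P] by blast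
      finally show ?thesis .
    qed (use xc K.ksubD(2)[OF P] in simp)
    have "(\<Oplus>t\<in>S. ?T t \<star> x) \<in> P" if "finite S" "S \<subseteq> {..r}" for S
      using that
    proof (induction S rule: finite_induct)
      case (insert t S)
      hence "(\<lambda>t. ?T t \<star> x) \<in> S \<rightarrow> carrier T" "?T t \<star> x \<in> P" "?T t \<star> x \<in> carrier T"
        using T K.ksubD(1)[OF P] by auto
      thus ?case using insert K.ksubD(3)[OF P] by (simp add: M.finsum_insert)
    qed (use K.ksubD(2)[OF P] in simp)
    thus ?thesis by simp
  qed
  finally show ?thesis .
qed

text \<open>Distinct weights are separated by the action of \<open>U\<^sup>0\<close>, so submodules are graded.\<close>

lemma weight_graded:
  assumes N: "sub N"
  shows "finite S \<Longrightarrow> S \<subseteq> weights \<alpha> \<Longrightarrow> (\<And>\<kappa>. \<kappa> \<in> S \<Longrightarrow> f \<kappa> \<in> Wt \<kappa>) \<Longrightarrow> (\<Oplus>\<kappa>\<in>S. f \<kappa>) \<in> N \<Longrightarrow>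
    \<kappa> \<in> S \<Longrightarrow> f \<kappa> \<in> N"
proof (induction S arbitrary: f \<kappa> rule: finite_induct)
  case (insert \<mu> S)
  let ?x = "\<Oplus>\<kappa>\<in>insert \<mu> S. f \<kappa>" and ?y = "\<Oplus>\<kappa>\<in>S. f \<kappa>"
  have fc: "f \<in> S \<rightarrow> carrier T" "f \<mu> \<in> carrier T" using insert.prems(2) WtD(1) by auto
  have x: "?x = f \<mu> \<oplus> ?y" using insert fc by (simp add: M.finsum_insert)
  have y: "?y \<in> carrier T" using fc by simp
  have step: "sc (e \<kappa> - e \<mu>) (f \<kappa>) \<in> N"
    if h: "h \<in> carrier U" and e: "\<And>\<kappa>. \<kappa> \<in> insert \<mu> S \<Longrightarrow> h \<star> f \<kappa> = sc (e \<kappa>) (f \<kappa>)" and \<kappa>: "\<kappa> \<in> S" for h e \<kappa>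
  proof -
    have "h \<star> ?x \<oplus> sc (- e \<mu>) ?x = (sc (e \<mu>) (f \<mu>) \<oplus> sc (- e \<mu>) (f \<mu>)) \<oplus> (h \<star> ?y \<oplus> sc (- e \<mu>) ?y)"
      unfolding x using h fc y e[of \<mu>] by (simp add: smult_r_distr M.a_ac)
    also have "sc (e \<mu>) (f \<mu>) \<oplus> sc (- e \<mu>) (f \<mu>) = \<zero>"
      using K.sc_add_left[OF fc(2), of "e \<mu>" "- e \<mu>"] fc by simp
    also have "h \<star> ?y \<oplus> sc (- e \<mu>) ?y = (\<Oplus>\<kappa>\<in>S. h \<star> f \<kappa> \<oplus> sc (- e \<mu>) (f \<kappa>))"
      using h fc insert.hyps by (subst M.finsum_addf) (auto simp: smult_finsum_right)
    also have "\<dots> = (\<Oplus>\<kappa>\<in>S. sc (e \<kappa> - e \<mu>) (f \<kappa>))"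
      using fc e K.sc_add_left[of _ _ "- e \<mu>"] by (intro M.finsum_cong') (auto simp: Pi_iff)
    finally have "(\<Oplus>\<kappa>\<in>S. sc (e \<kappa> - e \<mu>) (f \<kappa>)) = h \<star> ?x \<oplus> sc (- e \<mu>) ?x"
      using fc by (simp add: Pi_iff)
    also have "\<dots> \<in> N" using submoduleD[OF N] insert.prems(3) h by simp
    finally show ?thesis using \<kappa> insert.prems Wt_sc
      by (intro insert.IH[of "\<lambda>\<kappa>. sc (e \<kappa> - e \<mu>) (f \<kappa>)"]) auto
  qed
  have S: "f \<kappa> \<in> N" if \<kappa>: "\<kappa> \<in> S" for \<kappa>
  proof -
    have ne: "\<kappa> \<noteq> \<mu>" using \<kappa> insert by auto
    have w: "f \<kappa>' \<in> Wt \<kappa>'" if "\<kappa>' \<in> insert \<mu> S" for \<kappa>' using insert.prems that by blast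
    have cancel: "f \<kappa> \<in> N" if "sc a (f \<kappa>) \<in> N" "a \<noteq> 0" for a
    proof -
      have "sc (1 / a) (sc a (f \<kappa>)) \<in> N" using that submoduleD(6)[OF N] by simp
      thus ?thesis using that fc \<kappa> by (simp add: K.sc_sc Pi_iff)
    qed
    have "\<exists>i. K_value \<alpha> q \<kappa> i \<noteq> K_value \<alpha> q \<mu> i \<or>
        (\<exists>t. chi i (weight_coeff \<alpha> \<kappa> i) t \<noteq> chi i (weight_coeff \<alpha> \<mu> i) t)"
    proof (rule ccontr)
      assume "\<not> ?thesis"
      hence "weight_coeff \<alpha> \<kappa> i = weight_coeff \<alpha> \<mu> i" for i
        by (intro chi_inj) (auto simp: K_value_def)
      thus False using weights_eqI[of \<kappa> \<mu>] ne insert.prems \<kappa> by auto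
    qed
    then obtain i t where "K_value \<alpha> q \<kappa> i \<noteq> K_value \<alpha> q \<mu> i \<or>
      chi i (weight_coeff \<alpha> \<kappa> i) t \<noteq> chi i (weight_coeff \<alpha> \<mu> i) t" by blast
    thus ?thesis
    proof
      assume "K_value \<alpha> q \<kappa> i \<noteq> K_value \<alpha> q \<mu> i"
      thus ?thesis using step[of "uq_K \<alpha> q i" "\<lambda>\<kappa>. K_value \<alpha> q \<kappa> i" \<kappa>] WtD(2)[OF w] \<kappa> cancel by auto
    next
      assume "chi i (weight_coeff \<alpha> \<kappa> i) t \<noteq> chi i (weight_coeff \<alpha> \<mu> i) t"
      thus ?thesis using step[of "uq_Kbinom \<alpha> q i t" "\<lambda>\<kappa>. chi i (weight_coeff \<alpha> \<kappa> i) t" \<kappa>] WtD(4)[OF w] \<kappa> cancel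
        by auto
    qed
  qed
  moreover have "f \<mu> \<in> N"
  proof -
    have "?y \<in> N" using S insert.hyps by (intro finsum_in_submodule[OF N])
    moreover have "f \<mu> = ?x \<ominus> ?y" unfolding x using fc y by (simp add: a_minus_def M.a_assoc M.r_neg)
    ultimately show ?thesis using submoduleD(5)[OF N] insert.prems(3) by simp
  qed
  ultimately show ?case using insert.prems(4) by blast
qed simp

lemma sub_zero: "sub {\<zero>}"
  by (rule submoduleI) auto

lemma sub_carrier: "sub (carrier T)"
  by (rule submoduleI) auto

lemma sub_Int: "sub N \<Longrightarrow> sub N' \<Longrightarrow> sub (N \<inter> N')"
  by (rule submoduleI) (auto dest: submoduleD)

text \<open>For a subspace it suffices to test the algebra generators.\<close>

lemma ksub_submodule:
  assumes P: "K.ksub P" and E: "\<And>i r x. x \<in> P \<Longrightarrow> Ea i r x \<in> P" and F: "\<And>i r x. x \<in> P \<Longrightarrow> Fa i r x \<in> P"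
    and Kg: "\<And>i x. x \<in> P \<Longrightarrow> uq_K \<alpha> q i \<star> x \<in> P" "\<And>i x. x \<in> P \<Longrightarrow> uq_Kinv \<alpha> q i \<star> x \<in> P"
  shows "sub P"
proof (rule submoduleI)
  show "u \<star> x \<in> P" if "u \<in> carrier U" "x \<in> P" for u x
  proof -
    have "\<forall>x\<in>P. u \<star> x \<in> P" using that(1)
    proof (induction u rule: U_generated)
      case (add u w)
      thus ?case using K.ksubD(1,3)[OF P] by (simp add: smult_l_distr)
    next
      case (mult u w)
      thus ?case using K.ksubD(1)[OF P] by (simp add: smult_assoc)
    qed (use assms K.ksubD[OF P] in auto)
    thus ?thesis using that by blast
  qed
qed (use K.ksubD[OF P] in auto)

end

lemma (in kspace) minus_zero_eq:
  assumes "x \<in> carrier M" "y \<in> carrier M" "x \<ominus> y = \<zero>" shows "x = y"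
proof -
  have "x = (x \<ominus> y) \<oplus> y" using assms(1,2) by (simp add: a_minus_def a_assoc l_neg)
  thus ?thesis using assms by simp
qed

lemma (in kspace) finsum_ksub:
  assumes V: "ksub V" and "finite S" "\<And>i. i \<in> S \<Longrightarrow> g i \<in> V"
  shows "(\<Oplus>i\<in>S. g i) \<in> V"
  using assms(2,3)
proof (induction S rule: finite_induct)
  case (insert i S)
  hence "g \<in> S \<rightarrow> carrier M" "g i \<in> carrier M" using ksubD(1)[OF V] by auto
  thus ?case using insert ksubD(3)[OF V] by (simp add: finsum_insert)
qed (use ksubD(2)[OF V] in simp)

context weight_module
begin

text \<open>The sum of finitely many weight spaces, without a claim that it is direct.\<close>

definition wsum :: "'e set \<Rightarrow> 'm set" where
  "wsum S = {m. \<exists>f. (\<forall>\<kappa>\<in>S. f \<kappa> \<in> Wt \<kappa>) \<and> m = (\<Oplus>\<kappa>\<in>S. f \<kappa>)}"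

lemma wsum_ksub: assumes "finite S" shows "K.ksub (wsum S)"
proof -
  have c: "f \<in> S \<rightarrow> carrier T" if "\<forall>\<kappa>\<in>S. f \<kappa> \<in> Wt \<kappa>" for f using that WtD(1) by auto
  show ?thesis unfolding K.ksub_def
  proof (intro conjI ballI allI)
    show "wsum S \<subseteq> carrier T" using c by (auto simp: wsum_def)
    show "\<zero> \<in> wsum S" unfolding wsum_def by (intro CollectI exI[of _ "\<lambda>_. \<zero>"]) auto
  next
    fix x y assume "x \<in> wsum S" "y \<in> wsum S"
    then obtain f g where f: "\<forall>\<kappa>\<in>S. f \<kappa> \<in> Wt \<kappa>" "x = (\<Oplus>\<kappa>\<in>S. f \<kappa>)"
      and g: "\<forall>\<kappa>\<in>S. g \<kappa> \<in> Wt \<kappa>" "y = (\<Oplus>\<kappa>\<in>S. g \<kappa>)"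
      unfolding wsum_def by blast
    have "x \<oplus> y = (\<Oplus>\<kappa>\<in>S. f \<kappa> \<oplus> g \<kappa>)"
      using c[OF f(1)] c[OF g(1)] f g by (simp add: M.finsum_addf)
    thus "x \<oplus> y \<in> wsum S" unfolding wsum_def using f g Wt_add
      by (intro CollectI exI[of _ "\<lambda>\<kappa>. f \<kappa> \<oplus> g \<kappa>"]) auto
  next
    fix x a assume "x \<in> wsum S"
    then obtain f where f: "\<forall>\<kappa>\<in>S. f \<kappa> \<in> Wt \<kappa>" "x = (\<Oplus>\<kappa>\<in>S. f \<kappa>)" unfolding wsum_def by blast
    have "sc a x = (\<Oplus>\<kappa>\<in>S. sc a (f \<kappa>))"
      unfolding f(2) using c[OF f(1)] assms by (intro smult_finsum_right) auto
    thus "sc a x \<in> wsum S" unfolding wsum_def using f Wt_sc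
      by (intro CollectI exI[of _ "\<lambda>\<kappa>. sc a (f \<kappa>)"]) auto
  qed
qed

lemma wsum_mono: assumes "finite S'" "S \<subseteq> S'" shows "wsum S \<subseteq> wsum S'"
proof
  fix m assume "m \<in> wsum S"
  then obtain f where f: "\<forall>\<kappa>\<in>S. f \<kappa> \<in> Wt \<kappa>" "m = (\<Oplus>\<kappa>\<in>S. f \<kappa>)" unfolding wsum_def by blast
  let ?g = "\<lambda>\<kappa>. if \<kappa> \<in> S then f \<kappa> else \<zero>"
  have "f \<in> S \<rightarrow> carrier T" using f(1) WtD(1) by blast
  hence "m = (\<Oplus>\<kappa>\<in>S'. ?g \<kappa>)" unfolding f(2)
    by (intro M.add.finprod_mono_neutral_cong_left) (use assms in auto)
  thus "m \<in> wsum S'" unfolding wsum_def using f by (intro CollectI exI[of _ ?g]) auto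
qed

end

locale fd_module = weight_module \<Phi> \<alpha> q T
  for \<Phi> and \<alpha> :: "'i::finite \<Rightarrow> 'e::euclidean_space" and q :: "'k::field"
    and T :: "('i, 'k, 'm) uq_module" (structure) +
  assumes fd: "finite_dimensional \<alpha> q T" and type1: "type_one \<alpha> q T"
begin

lemma kdim_T: "\<exists>n. K.kdim (carrier T) n"
proof -
  obtain B where "finite B" "B \<subseteq> carrier T"
    "\<forall>m\<in>carrier T. \<exists>c. m = (\<Oplus>b\<in>B. sc (c b) b)"
    using fd unfolding finite_dimensional_def by blast
  thus ?thesis by (intro K.kdim_spanned) auto
qed

lemma finite_weights: "\<exists>S. finite S \<and> S \<subseteq> weights \<alpha> \<and> carrier T \<subseteq> wsum S"
proof -
  obtain B where B: "finite B" "B \<subseteq> carrier T"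
    "\<forall>m\<in>carrier T. \<exists>c. m = (\<Oplus>b\<in>B. sc (c b) b)"
    using fd unfolding finite_dimensional_def by blast
  have "\<exists>S. finite S \<and> S \<subseteq> weights \<alpha> \<and> m \<in> wsum S" if m: "m \<in> carrier T" for m
  proof -
    obtain f where f: "\<forall>j\<in>weights \<alpha>. f j \<in> Wt j" "\<forall>j. j \<notin> weights \<alpha> \<longrightarrow> f j = \<zero>"
      "finite {j. f j \<noteq> \<zero>}" "m = (\<Oplus>j\<in>{j. f j \<noteq> \<zero>}. f j)"
      using type1 m unfolding type_one_def internal_direct_sum_def by metis
    have "{j. f j \<noteq> \<zero>} \<subseteq> weights \<alpha>" using f(2) by blast
    thus ?thesis using f unfolding wsum_def by (intro exI[of _ "{j. f j \<noteq> \<zero>}"]) blast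
  qed
  then obtain S where S: "\<And>m. m \<in> carrier T \<Longrightarrow> finite (S m) \<and> S m \<subseteq> weights \<alpha> \<and> m \<in> wsum (S m)" by metis
  let ?S = "\<Union>b\<in>B. S b"
  have fin: "finite ?S" "?S \<subseteq> weights \<alpha>" using B S by blast+
  have Bs: "b \<in> wsum ?S" if "b \<in> B" for b
    using wsum_mono[of ?S "S b"] S[of b] fin that B by blast
  have "m \<in> wsum ?S" if m: "m \<in> carrier T" for m
  proof -
    obtain c where "m = (\<Oplus>b\<in>B. sc (c b) b)" using B m by blast
    thus ?thesis using K.finsum_ksub[OF wsum_ksub[OF fin(1)] B(1)] Bs K.ksubD(4)[OF wsum_ksub[OF fin(1)]] by simp
  qed
  thus ?thesis using fin by blast
qed

text \<open>A finite set of weights that carries the module. It may contain weights whose weight space is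
  zero.\<close>

definition Om :: "'e set" where "Om = (SOME S. finite S \<and> S \<subseteq> weights \<alpha> \<and> carrier T \<subseteq> wsum S)"

lemma Om: "finite Om" "Om \<subseteq> weights \<alpha>" "carrier T \<subseteq> wsum Om"
  using someI_ex[OF finite_weights] unfolding Om_def by blast+

definition pr :: "'m \<Rightarrow> 'e \<Rightarrow> 'm" where
  "pr m = (SOME f. (\<forall>\<kappa>. f \<kappa> \<in> Wt \<kappa>) \<and> (\<forall>\<kappa>. \<kappa> \<notin> Om \<longrightarrow> f \<kappa> = \<zero>) \<and> m = (\<Oplus>\<kappa>\<in>Om. f \<kappa>))"

lemma pr:
  assumes "m \<in> carrier T"
  shows "pr m \<kappa> \<in> Wt \<kappa>" "\<kappa> \<notin> Om \<Longrightarrow> pr m \<kappa> = \<zero>" "(\<Oplus>\<kappa>\<in>Om. pr m \<kappa>) = m"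
proof -
  obtain f where f: "\<forall>\<kappa>\<in>Om. f \<kappa> \<in> Wt \<kappa>" "m = (\<Oplus>\<kappa>\<in>Om. f \<kappa>)"
    using Om(3) assms unfolding wsum_def by blast
  let ?g = "\<lambda>\<kappa>. if \<kappa> \<in> Om then f \<kappa> else \<zero>"
  have "m = (\<Oplus>\<kappa>\<in>Om. ?g \<kappa>)" unfolding f(2) by (rule M.finsum_cong') (use f WtD(1) in auto)
  hence "(\<forall>\<kappa>. ?g \<kappa> \<in> Wt \<kappa>) \<and> (\<forall>\<kappa>. \<kappa> \<notin> Om \<longrightarrow> ?g \<kappa> = \<zero>) \<and> m = (\<Oplus>\<kappa>\<in>Om. ?g \<kappa>)" using f by auto
  hence "(\<forall>\<kappa>. pr m \<kappa> \<in> Wt \<kappa>) \<and> (\<forall>\<kappa>. \<kappa> \<notin> Om \<longrightarrow> pr m \<kappa> = \<zero>) \<and> m = (\<Oplus>\<kappa>\<in>Om. pr m \<kappa>)"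
    unfolding pr_def
    by (rule someI[of "\<lambda>f. (\<forall>\<kappa>. f \<kappa> \<in> Wt \<kappa>) \<and> (\<forall>\<kappa>. \<kappa> \<notin> Om \<longrightarrow> f \<kappa> = \<zero>) \<and> m = (\<Oplus>\<kappa>\<in>Om. f \<kappa>)"])
  thus "pr m \<kappa> \<in> Wt \<kappa>" "\<kappa> \<notin> Om \<Longrightarrow> pr m \<kappa> = \<zero>" "(\<Oplus>\<kappa>\<in>Om. pr m \<kappa>) = m" by auto
qed

lemma pr_carrier [simp, intro]: "m \<in> carrier T \<Longrightarrow> pr m \<kappa> \<in> carrier T"
  using pr(1) WtD(1) by blast

lemma pr_sub:
  assumes N: "sub N" and x: "x \<in> N" shows "pr x \<kappa> \<in> N"
proof (cases "\<kappa> \<in> Om")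
  case True
  have "x \<in> carrier T" using submoduleD(1)[OF N x] .
  thus ?thesis using weight_graded[OF N Om(1,2), of "pr x" \<kappa>] pr[of x] x True by simp
qed (use pr(2)[of x] submoduleD[OF N] x in auto)

lemma pr_unique:
  assumes f: "\<And>\<kappa>. \<kappa> \<in> Om \<Longrightarrow> f \<kappa> \<in> Wt \<kappa>" and m: "m = (\<Oplus>\<kappa>\<in>Om. f \<kappa>)" and \<kappa>: "\<kappa> \<in> Om"
  shows "pr m \<kappa> = f \<kappa>"
proof -
  have fc: "f \<in> Om \<rightarrow> carrier T" using f WtD(1) by auto
  hence mc: "m \<in> carrier T" using m by simp
  let ?d = "\<lambda>\<kappa>. f \<kappa> \<oplus> sc (- 1) (pr m \<kappa>)"
  have "(\<Oplus>\<kappa>\<in>Om. ?d \<kappa>) = m \<oplus> (\<Oplus>\<kappa>\<in>Om. sc (- 1) (pr m \<kappa>))"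
    unfolding m by (rule M.finsum_addf) (use fc mc m in auto)
  also have "(\<Oplus>\<kappa>\<in>Om. sc (- 1) (pr m \<kappa>)) = sc (- 1) m"
    using smult_finsum_right[OF Om(1), of "pr m" "uq_scalar \<alpha> q (- 1)"] pr(3)[OF mc] mc by auto
  also have "m \<oplus> sc (- 1) m = \<zero>" using mc by (simp add: K.sc_uminus M.r_neg)
  finally have "?d \<kappa> \<in> {\<zero>}"
    using f pr(1)[OF mc] Wt_add Wt_sc \<kappa>
    by (intro weight_graded[OF sub_zero Om(1,2), of ?d]) auto
  hence "f \<kappa> \<ominus> pr m \<kappa> = \<zero>" using mc by (simp add: K.sc_uminus a_minus_def)
  from K.minus_zero_eq[OF _ _ this] show ?thesis using fc \<kappa> mc by (auto simp: Pi_iff)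
qed

lemma pr_add:
  assumes "x \<in> carrier T" "y \<in> carrier T" shows "pr (x \<oplus> y) \<kappa> = pr x \<kappa> \<oplus> pr y \<kappa>"
proof (cases "\<kappa> \<in> Om")
  case True
  have "x \<oplus> y = (\<Oplus>\<kappa>\<in>Om. pr x \<kappa> \<oplus> pr y \<kappa>)"
    using assms pr(3) by (subst M.finsum_addf) auto
  thus ?thesis using pr_unique[of "\<lambda>\<kappa>. pr x \<kappa> \<oplus> pr y \<kappa>"] True assms pr(1) Wt_add by blast
qed (use assms pr(2) in auto)

lemma pr_sc:
  assumes "x \<in> carrier T" shows "pr (sc a x) \<kappa> = sc a (pr x \<kappa>)"
proof (cases "\<kappa> \<in> Om")
  case True
  have "sc a x = (\<Oplus>\<kappa>\<in>Om. sc a (pr x \<kappa>))"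
    using assms pr(3)[OF assms] smult_finsum_right[OF Om(1), of "pr x" "uq_scalar \<alpha> q a"] by auto
  thus ?thesis using pr_unique[of "\<lambda>\<kappa>. sc a (pr x \<kappa>)"] True assms pr(1) Wt_sc by blast
qed (use assms pr(2) in auto)

lemma weight_Om: assumes x: "x \<in> Wt \<mu>" "\<mu> \<in> weights \<alpha>" "x \<noteq> \<zero>" shows "\<mu> \<in> Om"
proof (rule ccontr)
  assume n: "\<mu> \<notin> Om"
  have xc: "x \<in> carrier T" using WtD(1)[OF x(1)] .
  let ?f = "\<lambda>\<kappa>. if \<kappa> = \<mu> then x else sc (- 1) (pr x \<kappa>)"
  have "(\<Oplus>\<kappa>\<in>insert \<mu> Om. ?f \<kappa>) = x \<oplus> (\<Oplus>\<kappa>\<in>Om. ?f \<kappa>)"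
    using n Om(1) xc by (subst M.finsum_insert) auto
  also have "(\<Oplus>\<kappa>\<in>Om. ?f \<kappa>) = (\<Oplus>\<kappa>\<in>Om. sc (- 1) (pr x \<kappa>))"
    by (rule M.finsum_cong') (use n xc in auto)
  also have "\<dots> = sc (- 1) x"
    using smult_finsum_right[OF Om(1), of "pr x" "uq_scalar \<alpha> q (- 1)"] pr(3)[OF xc] xc by auto
  also have "x \<oplus> sc (- 1) x = \<zero>" using xc by (simp add: K.sc_uminus M.r_neg)
  finally have "?f \<mu> \<in> {\<zero>}"
    using Om x pr(1)[OF xc] Wt_sc by (intro weight_graded[OF sub_zero, of "insert \<mu> Om" ?f]) auto
  thus False using x by simp
qed

lemma pr_weight: assumes x: "x \<in> Wt \<mu>" "\<mu> \<in> weights \<alpha>"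
  shows "pr x \<kappa> = (if \<kappa> = \<mu> then x else \<zero>)"
proof (cases "\<kappa> \<in> Om")
  case \<kappa>: True
  have xc: "x \<in> carrier T" using WtD(1)[OF x(1)] .
  have "x = (\<Oplus>\<kappa>\<in>Om. if \<kappa> = \<mu> then x else \<zero>)"
  proof (cases "x = \<zero>")
    case False
    hence "\<mu> \<in> Om" using weight_Om x by blast
    thus ?thesis using M.finsum_singleton[OF _ Om(1), of \<mu> "\<lambda>_. x"] xc by (simp add: eq_commute[of \<mu>])
  next
    case True
    have "(\<Oplus>\<kappa>\<in>Om. if \<kappa> = \<mu> then x else \<zero>) = (\<Oplus>\<kappa>\<in>Om. \<zero>)"
      by (rule M.finsum_cong') (use True in auto)
    thus ?thesis using True by simp
  qed
  thus ?thesis using pr_unique[of "\<lambda>\<kappa>. if \<kappa> = \<mu> then x else \<zero>" x \<kappa>] x \<kappa> by auto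
next
  case False
  have xc: "x \<in> carrier T" using WtD(1)[OF x(1)] .
  have "x = \<zero>" if "\<kappa> = \<mu>" using weight_Om[OF x] False that by blast
  thus ?thesis using pr(2)[OF xc False] by auto
qed

lemma weight_induct [consumes 1, case_names add weight]:
  assumes m: "m \<in> carrier T"
    and add: "\<And>x y. x \<in> carrier T \<Longrightarrow> y \<in> carrier T \<Longrightarrow> P x \<Longrightarrow> P y \<Longrightarrow> P (x \<oplus> y)"
    and weight: "\<And>x \<kappa>. \<kappa> \<in> weights \<alpha> \<Longrightarrow> x \<in> Wt \<kappa> \<Longrightarrow> P x"
  shows "P m"
proof -
  have zero: "P \<zero>" using weight[of 0 "\<zero>"] by (simp add: weights_def coroot_pairing_def)
  have "P (\<Oplus>\<kappa>\<in>S. pr m \<kappa>)" if "finite S" "S \<subseteq> Om" for S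
    using that
  proof (induction S rule: finite_induct)
    case (insert \<kappa> S)
    have "(\<Oplus>\<kappa>\<in>insert \<kappa> S. pr m \<kappa>) = pr m \<kappa> \<oplus> (\<Oplus>\<kappa>\<in>S. pr m \<kappa>)"
      using insert m by (subst M.finsum_insert) auto
    thus ?case using insert add weight[of \<kappa> "pr m \<kappa>"] pr(1)[OF m] Om m by auto
  qed (simp add: zero)
  from this[OF Om(1) subset_refl] show ?thesis using pr(3)[OF m] by simp
qed

lemma pr_shift:
  assumes h: "h \<in> carrier U" and d: "\<And>\<mu> x. \<mu> \<in> weights \<alpha> \<Longrightarrow> x \<in> Wt \<mu> \<Longrightarrow> h \<star> x \<in> Wt (\<mu> + d) \<and> \<mu> + d \<in> weights \<alpha>"
    and x: "x \<in> carrier T"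
  shows "pr (h \<star> x) (\<kappa> + d) = h \<star> pr x \<kappa>"
  using x
proof (induction x rule: weight_induct)
  case (add x y)
  thus ?case using h by (simp add: smult_r_distr pr_add)
next
  case (weight x \<mu>)
  hence "h \<star> x \<in> Wt (\<mu> + d)" "\<mu> + d \<in> weights \<alpha>" using d by blast+
  thus ?case using pr_weight[of "h \<star> x" "\<mu> + d" "\<kappa> + d"] pr_weight[OF weight(2,1), of \<kappa>] h by auto
qed

lemma pr_E: "x \<in> carrier T \<Longrightarrow> pr (Ea i r x) (\<kappa> + real r *\<^sub>R \<alpha> i) = Ea i r (pr x \<kappa>)"
  using E_Wt weight_shift' by (intro pr_shift) auto

lemma pr_F: "x \<in> carrier T \<Longrightarrow> pr (Fa i r x) \<kappa> = Fa i r (pr x (\<kappa> + real r *\<^sub>R \<alpha> i))"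
  using F_Wt weight_shift' pr_shift[of "uq_F \<alpha> q i r" "- (real r *\<^sub>R \<alpha> i)" x "\<kappa> + real r *\<^sub>R \<alpha> i"] by simp

text \<open>High divided powers shift a weight out of the finite set of weights.\<close>

lemma nilpotent:
  assumes "x \<in> carrier T"
  shows "\<exists>r0. \<forall>r\<ge>r0. Ea i r x = \<zero> \<and> Fa i r x = \<zero>"
  using assms
proof (induction x rule: weight_induct)
  case (add x y)
  then obtain a b where "\<forall>r\<ge>a. Ea i r x = \<zero> \<and> Fa i r x = \<zero>"
    "\<forall>r\<ge>b. Ea i r y = \<zero> \<and> Fa i r y = \<zero>" by blast
  thus ?case using add by (intro exI[of _ "max a b"]) (auto simp: smult_r_distr)
next
  case (weight x \<kappa>)
  have inj: "inj (\<lambda>r. \<kappa> + real r *\<^sub>R \<alpha> i)" "inj (\<lambda>r. \<kappa> - real r *\<^sub>R \<alpha> i)"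
    using alpha_nonzero by (auto intro!: injI)
  have "finite ((\<lambda>r. \<kappa> + real r *\<^sub>R \<alpha> i) -` Om \<union> (\<lambda>r. \<kappa> - real r *\<^sub>R \<alpha> i) -` Om)"
    using finite_vimageI[OF Om(1) inj(1)] finite_vimageI[OF Om(1) inj(2)] by blast
  then obtain r0 where r0: "\<And>r. r \<in> (\<lambda>r. \<kappa> + real r *\<^sub>R \<alpha> i) -` Om \<union> (\<lambda>r. \<kappa> - real r *\<^sub>R \<alpha> i) -` Om \<Longrightarrow> r < r0"
    using finite_nat_set_iff_bounded by (metis (no_types, lifting))
  show ?case
  proof (intro exI[of _ r0] allI impI conjI)
    fix r assume r: "r \<ge> r0"
    show "Ea i r x = \<zero>" using weight_Om[OF E_Wt[OF weight(2,1)] weight_shift'(1)[OF weight(1)], of i r] r0[of r] r by auto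
    show "Fa i r x = \<zero>" using weight_Om[OF F_Wt[OF weight(2,1)] weight_shift'(2)[OF weight(1)], of i r] r0[of r] r by auto
  qed
qed

section \<open>Covectors and Frobenius reciprocity\<close>

text \<open>The functionals that are equivariant for \<open>U\<^sup>-U\<^sup>0\<close> with values in the
  one-dimensional module of weight \<open>\<nu>\<close>.\<close>

definition covec :: "'m set \<Rightarrow> 'e \<Rightarrow> ('m \<Rightarrow> 'k) \<Rightarrow> bool" where
  "covec A \<nu> \<xi> \<longleftrightarrow> K.klin A \<xi> \<and> (\<forall>x\<in>A. \<forall>i. (\<forall>r>0. \<xi> (Fa i r x) = 0) \<and>
     \<xi> (uq_K \<alpha> q i \<star> x) = K_value \<alpha> q \<nu> i * \<xi> x \<and>
     \<xi> (uq_Kinv \<alpha> q i \<star> x) = inverse (K_value \<alpha> q \<nu> i) * \<xi> x \<and>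
     (\<forall>t. \<xi> (uq_Kbinom \<alpha> q i t \<star> x) = Kbinom_value \<alpha> q \<nu> i t * \<xi> x))"

lemma covecD:
  assumes "covec A \<nu> \<xi>"
  shows "K.klin A \<xi>" "x \<in> A \<Longrightarrow> r > 0 \<Longrightarrow> \<xi> (Fa i r x) = 0"
    "x \<in> A \<Longrightarrow> \<xi> (uq_K \<alpha> q i \<star> x) = K_value \<alpha> q \<nu> i * \<xi> x"
    "x \<in> A \<Longrightarrow> \<xi> (uq_Kinv \<alpha> q i \<star> x) = inverse (K_value \<alpha> q \<nu> i) * \<xi> x"
    "x \<in> A \<Longrightarrow> \<xi> (uq_Kbinom \<alpha> q i t \<star> x) = Kbinom_value \<alpha> q \<nu> i t * \<xi> x"
  using assms unfolding covec_def by blast+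

lemma covec_weight:
  assumes c: "covec A \<nu> \<xi>" and \<nu>: "\<nu> \<in> weights \<alpha>" and x: "x \<in> A" "x \<in> Wt \<kappa>" "\<kappa> \<in> weights \<alpha>" "\<xi> x \<noteq> 0"
  shows "\<kappa> = \<nu>"
proof (rule weights_eqI[OF x(3) \<nu>])
  fix i
  have "\<xi> (sc a x) = a * \<xi> x" for a using K.klinD(2)[OF covecD(1)[OF c] x(1)] .
  thus "weight_coeff \<alpha> \<kappa> i = weight_coeff \<alpha> \<nu> i"
    using covecD(3,5)[OF c x(1)] WtD(2,4)[OF x(2)] x(4)
    by (intro chi_inj[of i]) (auto simp: K_value_def Kbinom_value_def chi_def)
qed

text \<open>The action of \<open>U\<^sup>0\<close> and of the \<open>F\<close>'s can be tested on weight
  vectors, and for the \<open>F\<close>'s only on those of the one weight that is moved to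
  \<open>\<nu>\<close>.\<close>

lemma covecI:
  assumes A: "sub A" and lin: "K.klin A \<xi>" and \<nu>: "\<nu> \<in> weights \<alpha>"
    and supp: "\<And>x \<kappa>. x \<in> A \<Longrightarrow> x \<in> Wt \<kappa> \<Longrightarrow> \<kappa> \<in> weights \<alpha> \<Longrightarrow> \<kappa> \<noteq> \<nu> \<Longrightarrow> \<xi> x = 0"
    and F: "\<And>x i r. x \<in> A \<Longrightarrow> r > 0 \<Longrightarrow> x \<in> Wt (\<nu> + real r *\<^sub>R \<alpha> i) \<Longrightarrow> \<xi> (Fa i r x) = 0"
  shows "covec A \<nu> \<xi>"
proof -
  have xi_pr: "\<xi> x = \<xi> (pr x \<nu>)" if x: "x \<in> A" for x
  proof -
    have xc: "x \<in> carrier T" using submoduleD(1)[OF A x] .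
    have "\<xi> (\<Oplus>\<kappa>\<in>S. pr x \<kappa>) = (\<Sum>\<kappa>\<in>S. \<xi> (pr x \<kappa>))" if "finite S" for S
      using that
    proof (induction S rule: finite_induct)
      case (insert \<kappa> S)
      have "(\<Oplus>\<kappa>\<in>S. pr x \<kappa>) \<in> A" using insert pr_sub[OF A x] by (intro finsum_in_submodule[OF A])
      thus ?case using insert xc K.klinD(1)[OF lin] pr_sub[OF A x] by (subst M.finsum_insert) auto
    qed (use K.klin_zero[OF sub_ksub[OF A] lin] in simp)
    from this[OF Om(1)] have "\<xi> x = (\<Sum>\<kappa>\<in>Om. \<xi> (pr x \<kappa>))" using pr(3)[OF xc] by simp
    also have "\<dots> = (\<Sum>\<kappa>\<in>Om. if \<kappa> = \<nu> then \<xi> (pr x \<nu>) else 0)"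
      using supp[OF pr_sub[OF A x] pr(1)[OF xc]] Om(2) by (intro sum.cong) auto
    also have "\<dots> = \<xi> (pr x \<nu>)"
      using Om(1) pr(2)[OF xc, of \<nu>] K.klin_zero[OF sub_ksub[OF A] lin] by auto
    finally show ?thesis .
  qed
  have h: "\<xi> (h \<star> x) = c * \<xi> x"
    if hU: "h \<in> carrier U" and hW: "\<And>\<mu> x. \<mu> \<in> weights \<alpha> \<Longrightarrow> x \<in> Wt \<mu> \<Longrightarrow> h \<star> x = sc (e \<mu>) x" and c: "e \<nu> = c" and x: "x \<in> A"
    for h e c x
  proof -
    have xc: "x \<in> carrier T" using submoduleD(1)[OF A x] .
    have "pr (h \<star> x) (\<nu> + 0) = h \<star> pr x \<nu>"
      by (rule pr_shift[OF hU _ xc]) (use hW Wt_sc in auto)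
    also have "\<dots> = sc c (pr x \<nu>)" using hW[OF \<nu> pr(1)[OF xc]] c by simp
    finally show ?thesis
      using xi_pr[OF x] xi_pr[OF submoduleD(6)[OF A hU x]] K.klinD(2)[OF lin pr_sub[OF A x]] by simp
  qed
  show ?thesis unfolding covec_def
  proof (intro conjI ballI allI impI lin)
    fix x i assume x: "x \<in> A"
    have xc: "x \<in> carrier T" using submoduleD(1)[OF A x] .
    show "\<xi> (uq_K \<alpha> q i \<star> x) = K_value \<alpha> q \<nu> i * \<xi> x"
      by (rule h[of _ "\<lambda>\<mu>. K_value \<alpha> q \<mu> i"]) (use WtD x in auto)
    show "\<xi> (uq_Kinv \<alpha> q i \<star> x) = inverse (K_value \<alpha> q \<nu> i) * \<xi> x"
      by (rule h[of _ "\<lambda>\<mu>. inverse (K_value \<alpha> q \<mu> i)"]) (use WtD x in auto)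
    show "\<xi> (uq_Kbinom \<alpha> q i t \<star> x) = Kbinom_value \<alpha> q \<nu> i t * \<xi> x" for t
      by (rule h[of _ "\<lambda>\<mu>. Kbinom_value \<alpha> q \<mu> i t"]) (use WtD x in \<open>auto simp: Kbinom_value_def chi_def\<close>)
    fix r :: nat assume r: "r > 0"
    have "\<xi> (Fa i r x) = \<xi> (Fa i r (pr x (\<nu> + real r *\<^sub>R \<alpha> i)))"
      using xi_pr[of "Fa i r x"] submoduleD(6)[OF A _ x] pr_F[OF xc] by simp
    also have "\<dots> = 0" using F[OF pr_sub[OF A x] r pr(1)[OF xc]] .
    finally show "\<xi> (Fa i r x) = 0" .
  qed
qed

text \<open>The image of \<open>x\<close> in the coinduced module under the homomorphism that belongs to the
  covector \<open>\<xi>\<close>.\<close>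

definition rep :: "('m \<Rightarrow> 'k) \<Rightarrow> 'm \<Rightarrow> ('i, 'k) uq_elem \<Rightarrow> 'k" where
  "rep \<xi> x = (\<lambda>u. if u \<in> carrier U then \<xi> (u \<star> x) else 0)"

end

lemma (in quantum_data) coinduced_simps [simp]:
  "zero (coinduced_module \<alpha> q \<nu>) = (\<lambda>x. 0)"
  "add (coinduced_module \<alpha> q \<nu>) f g = (\<lambda>x. f x + g x)"
  "smult (coinduced_module \<alpha> q \<nu>) u f = (\<lambda>x. if x \<in> carrier U then f (x \<otimes>\<^bsub>U\<^esub> u) else 0)"
  by (simp_all add: coinduced_module_def Let_def)

lemma (in quantum_data) coinduced_abelian: "abelian_group (coinduced_module \<alpha> q \<nu>)"
proof (rule abelian_groupI)
  fix f assume "f \<in> carrier (coinduced_module \<alpha> q \<nu>)"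
  thus "\<exists>g\<in>carrier (coinduced_module \<alpha> q \<nu>). g \<oplus>\<^bsub>coinduced_module \<alpha> q \<nu>\<^esub> f = \<zero>\<^bsub>coinduced_module \<alpha> q \<nu>\<^esub>"
    by (intro bexI[of _ "\<lambda>x. - f x"]) (auto simp: coinduced_module_def Let_def)
qed (auto simp: coinduced_module_def Let_def algebra_simps)

context fd_module
begin

lemma rep_coinduced:
  assumes A: "sub A" and c: "covec A \<nu> \<xi>" and x: "x \<in> A"
  shows "rep \<xi> x \<in> carrier (coinduced_module \<alpha> q \<nu>)"
proof -
  have xc: "x \<in> carrier T" using submoduleD(1)[OF A x] .
  have a: "u \<star> x \<in> A" if "u \<in> carrier U" for u using submoduleD(6)[OF A that x] .
  show ?thesis
    unfolding coinduced_module_def Let_def rep_def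
    using xc K.klinD[OF covecD(1)[OF c]] covecD(2-5)[OF c] a
    by (simp add: smult_l_distr smult_assoc)
qed

lemma rep_act: "x \<in> carrier T \<Longrightarrow> h \<in> carrier U \<Longrightarrow> h \<odot>\<^bsub>coinduced_module \<alpha> q \<nu>\<^esub> rep \<xi> x = rep \<xi> (h \<star> x)"
  by (auto simp: rep_def smult_assoc)

text \<open>Frobenius reciprocity. The equivariance of the covector puts the image into the coinduced
  module; it lies in the integrable part because \<open>T\<close> has finitely many weights.\<close>

lemma rep_dual_weyl:
  assumes A: "sub A" and c: "covec A \<nu> \<xi>" and x: "x \<in> A"
  shows "rep \<xi> x \<in> carrier (dual_weyl \<alpha> q \<nu>)"
proof -
  let ?C = "coinduced_module \<alpha> q \<nu>"
  interpret C: abelian_group ?C by (rule coinduced_abelian)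
  have xc: "x \<in> carrier T" using submoduleD(1)[OF A x] .
  note kA = sub_ksub[OF A]
  have z: "rep \<xi> \<zero> = \<zero>\<^bsub>?C\<^esub>"
    using K.klin_zero[OF kA covecD(1)[OF c]] by (auto simp: rep_def)
  have radd: "rep \<xi> (y \<oplus> z) = rep \<xi> y \<oplus>\<^bsub>?C\<^esub> rep \<xi> z" if "y \<in> A" "z \<in> A" for y z
    using that K.klinD(1)[OF covecD(1)[OF c]] submoduleD(1,6)[OF A]
    by (auto simp: rep_def smult_r_distr fun_eq_iff)
  have sum: "rep \<xi> (\<Oplus>\<kappa>\<in>S. pr x \<kappa>) = (\<Oplus>\<^bsub>?C\<^esub>\<kappa>\<in>S. rep \<xi> (pr x \<kappa>))" if "finite S" for S
    using that
  proof (induction S rule: finite_induct)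
    case (insert \<kappa> S)
    have "(\<Oplus>\<kappa>\<in>S. pr x \<kappa>) \<in> A" using insert pr_sub[OF A x] by (intro finsum_in_submodule[OF A])
    moreover have "(\<Oplus>\<kappa>\<in>insert \<kappa> S. pr x \<kappa>) = pr x \<kappa> \<oplus> (\<Oplus>\<kappa>\<in>S. pr x \<kappa>)"
      using insert xc by (subst M.finsum_insert) auto
    moreover have "(\<Oplus>\<^bsub>?C\<^esub>\<kappa>\<in>insert \<kappa> S. rep \<xi> (pr x \<kappa>)) = rep \<xi> (pr x \<kappa>) \<oplus>\<^bsub>?C\<^esub> (\<Oplus>\<^bsub>?C\<^esub>\<kappa>\<in>S. rep \<xi> (pr x \<kappa>))"
      using insert rep_coinduced[OF A c pr_sub[OF A x]] by (subst C.finsum_insert) auto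
    ultimately show ?case using radd[OF pr_sub[OF A x]] insert.IH by simp
  qed (simp add: z)
  have wt: "rep \<xi> (pr x \<kappa>) \<in> weight_space \<alpha> q ?C \<kappa>" for \<kappa>
    unfolding weight_space_def
    using rep_coinduced[OF A c pr_sub[OF A x]] WtD[OF pr(1)[OF xc, of \<kappa>]]
    by (simp add: rep_act Kbinom_value_def chi_def del: coinduced_simps)
  have 1: "\<exists>S f. finite S \<and> S \<subseteq> weights \<alpha> \<and> (\<forall>\<mu>\<in>S. f \<mu> \<in> weight_space \<alpha> q ?C \<mu>) \<and> rep \<xi> x = (\<Oplus>\<^bsub>?C\<^esub>\<mu>\<in>S. f \<mu>)"
    using sum[OF Om(1)] pr(3)[OF xc] Om wt
    by (intro exI[of _ Om] exI[of _ "\<lambda>\<kappa>. rep \<xi> (pr x \<kappa>)"]) auto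
  have 2: "\<exists>r0. \<forall>r\<ge>r0. uq_E \<alpha> q i r \<odot>\<^bsub>?C\<^esub> rep \<xi> x = \<zero>\<^bsub>?C\<^esub> \<and> uq_F \<alpha> q i r \<odot>\<^bsub>?C\<^esub> rep \<xi> x = \<zero>\<^bsub>?C\<^esub>" for i
  proof -
    obtain r0 where "\<forall>r\<ge>r0. Ea i r x = \<zero> \<and> Fa i r x = \<zero>" using nilpotent[OF xc] by blast
    thus ?thesis unfolding rep_act[OF xc U_closed(1)] rep_act[OF xc U_closed(2)] using z by (metis (no_types))
  qed
  show ?thesis
    unfolding dual_weyl_def integrable_part_def using rep_coinduced[OF A c x] 1 2 by simp
qed

end

section \<open>Dual Weyl factors of a module\<close>

context weight_module
begin

text \<open>The vectors obtained from \<open>x\<close> by words in the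
  \<open>F\<^sub>i\<^sup>(\<^sup>r\<^sup>)\<close>, with their weights.\<close>

inductive FW :: "'m \<Rightarrow> 'e \<Rightarrow> 'm \<Rightarrow> 'e \<Rightarrow> bool" for x \<kappa> where
  FW_base: "FW x \<kappa> x \<kappa>"
| FW_step: "FW x \<kappa> y \<mu> \<Longrightarrow> r > 0 \<Longrightarrow> FW x \<kappa> (Fa i r y) (\<mu> - real r *\<^sub>R \<alpha> i)"

inductive_set Fspan :: "'m set \<Rightarrow> 'm \<Rightarrow> 'e \<Rightarrow> 'm set" for N x \<kappa> where
  Fspan_N: "n \<in> N \<Longrightarrow> n \<in> Fspan N x \<kappa>"
| Fspan_FW: "FW x \<kappa> y \<mu> \<Longrightarrow> y \<in> Fspan N x \<kappa>"
| Fspan_add: "y \<in> Fspan N x \<kappa> \<Longrightarrow> z \<in> Fspan N x \<kappa> \<Longrightarrow> y \<oplus> z \<in> Fspan N x \<kappa>"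
| Fspan_sc: "y \<in> Fspan N x \<kappa> \<Longrightarrow> sc c y \<in> Fspan N x \<kappa>"

lemma FW_Wt:
  assumes "x \<in> Wt \<kappa>" "\<kappa> \<in> weights \<alpha>"
  shows "FW x \<kappa> y \<mu> \<Longrightarrow> y \<in> Wt \<mu> \<and> \<mu> \<in> weights \<alpha> \<and> ht \<mu> \<le> ht \<kappa>"
  by (induction rule: FW.induct) (use assms F_Wt weight_shift' in auto)

text \<open>By Kac's formula, \<open>E\<^sub>i\<^sup>(\<^sup>r\<^sup>)\<close> maps an \<open>F\<close>-word
  in \<open>x\<close> to a combination of such words and of vectors in \<open>N\<close>, if \<open>N\<close>
  absorbs the \<open>E\<^sub>i\<^sup>(\<^sup>r\<^sup>) x\<close> with \<open>r > 0\<close>. So modulo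
  \<open>N\<close> the vector \<open>x\<close> generates only the span of its
  \<open>F\<close>-words.\<close>

lemma Fspan_submodule:
  assumes N: "sub N" and x: "x \<in> Wt \<kappa>" "\<kappa> \<in> weights \<alpha>" and E: "\<And>i r. r > 0 \<Longrightarrow> Ea i r x \<in> N"
  shows "sub (Fspan N x \<kappa>)"
proof -
  let ?Z = "Fspan N x \<kappa>"
  have car: "y \<in> carrier T" if "y \<in> ?Z" for y
    using that by induction (use submoduleD(1)[OF N] FW_Wt[OF x] WtD(1) in \<open>blast+\<close>)
  have ks: "K.ksub ?Z"
    unfolding K.ksub_def using car Fspan_N[OF submoduleD(2)[OF N]] by (auto intro: Fspan.intros)
  have F: "Fa i r y \<in> ?Z" if "y \<in> ?Z" for i r y
    using that
  proof induction
    case (Fspan_FW y \<mu>)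
    show ?case
    proof (cases "r = 0")
      case True
      thus ?thesis using Fspan_FW FW_Wt[OF x Fspan_FW] WtD(1) by (auto simp: smult_one intro: Fspan.intros)
    qed (use Fspan_FW in \<open>auto intro: Fspan.Fspan_FW FW_step\<close>)
  qed (use car submoduleD(6)[OF N] in \<open>auto simp: smult_r_distr act_sc_gens intro: Fspan.intros\<close>)
  have EFW: "\<forall>i r. Ea i r y \<in> ?Z" if "FW x \<kappa> y \<mu>" for y \<mu>
    using that
  proof induction
    case FW_base
    have "x \<in> ?Z" by (rule Fspan_FW[OF FW.FW_base])
    thus ?case using E x WtD(1) by (metis E_0 Fspan_N not_gr0 smult_one)
  next
    case (FW_step y \<mu> s j)
    have y: "y \<in> Wt \<mu>" "\<mu> \<in> weights \<alpha>" using FW_Wt[OF x FW_step.hyps(1)] by auto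
    show ?case
    proof (intro allI)
      fix i r
      show "Ea i r (Fa j s y) \<in> ?Z"
      proof (cases "i = j")
        case True
        show ?thesis unfolding True by (rule E_F_act[OF y ks]) (use FW_step.IH F in blast)
      next
        case False
        have "Ea i r (Fa j s y) = Fa j s (Ea i r y)"
          using WtD(1)[OF y(1)] by (simp add: smult_assoc[symmetric] U_E_F_commute[OF False])
        thus ?thesis using FW_step.IH F by simp
      qed
    qed
  qed
  show ?thesis
  proof (rule ksub_submodule[OF ks])
    show "Ea i r y \<in> ?Z" if "y \<in> ?Z" for i r y
      using that
    proof induction
      case (Fspan_FW y \<mu>)
      thus ?case using EFW by blast
    qed (use car submoduleD(6)[OF N] in \<open>auto simp: smult_r_distr act_sc_gens intro: Fspan.intros\<close>)
    show "uq_K \<alpha> q i \<star> y \<in> ?Z" if "y \<in> ?Z" for i y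
      using that
    proof induction
      case (Fspan_FW y \<mu>)
      thus ?case using FW_Wt[OF x Fspan_FW] WtD(2)[of y \<mu> i] by (auto intro: Fspan.intros)
    qed (use car submoduleD(6)[OF N] in \<open>auto simp: smult_r_distr act_sc_gens intro: Fspan.intros\<close>)
    show "uq_Kinv \<alpha> q i \<star> y \<in> ?Z" if "y \<in> ?Z" for i y
      using that
    proof induction
      case (Fspan_FW y \<mu>)
      thus ?case using FW_Wt[OF x Fspan_FW] WtD(3)[of y \<mu> i] by (auto intro: Fspan.intros)
    qed (use car submoduleD(6)[OF N] in \<open>auto simp: smult_r_distr act_sc_gens intro: Fspan.intros\<close>)
  qed (use F in blast)
qed

lemma generated_by_F:
  assumes N: "sub N" and x: "x \<in> Wt \<kappa>" "\<kappa> \<in> weights \<alpha>" and E: "\<And>i r. r > 0 \<Longrightarrow> Ea i r x \<in> N"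
    and P: "K.ksub P" "N \<subseteq> P" and FW: "\<And>y \<mu>. FW x \<kappa> y \<mu> \<Longrightarrow> y \<in> P" and u: "u \<in> carrier U"
  shows "u \<star> x \<in> P"
proof -
  have "x \<in> Fspan N x \<kappa>" by (rule Fspan_FW[OF FW_base])
  hence "u \<star> x \<in> Fspan N x \<kappa>" using submoduleD(6)[OF Fspan_submodule[OF N x E] u] by blast
  thus ?thesis by induction (use P FW K.ksubD[OF P(1)] in auto)
qed

end

context fd_module
begin

text \<open>The subquotient \<open>A / N\<close> is isomorphic to the dual Weyl module of highest weight
  \<open>\<nu>\<close> by the homomorphism that belongs to \<open>\<xi>\<close>. Subquotients are handled
  through submodules of \<open>T\<close> throughout, so that all vectors have one type.\<close>

definition factor :: "'m set \<Rightarrow> 'm set \<Rightarrow> 'e \<Rightarrow> ('m \<Rightarrow> 'k) \<Rightarrow> bool" where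
  "factor N A \<nu> \<xi> \<longleftrightarrow> sub N \<and> sub A \<and> \<nu> \<in> weights \<alpha> \<and> covec A \<nu> \<xi> \<and>
     N = {x\<in>A. \<forall>u\<in>carrier U. \<xi> (u \<star> x) = 0} \<and>
     (\<forall>f\<in>carrier (dual_weyl \<alpha> q \<nu>). \<exists>x\<in>A. f = rep \<xi> x)"

lemma factorD:
  assumes "factor N A \<nu> \<xi>"
  shows "sub N" "sub A" "\<nu> \<in> weights \<alpha>" "covec A \<nu> \<xi>" "N \<subseteq> A"
    "x \<in> A \<Longrightarrow> x \<in> N \<longleftrightarrow> (\<forall>u\<in>carrier U. \<xi> (u \<star> x) = 0)"
    "f \<in> carrier (dual_weyl \<alpha> q \<nu>) \<Longrightarrow> \<exists>x\<in>A. f = rep \<xi> x"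
    "K.klin A \<xi>"
  using assms covecD(1) unfolding factor_def by blast+

lemma factor_zero: assumes f: "factor N A \<nu> \<xi>" and x: "x \<in> N" shows "\<xi> x = 0"
proof -
  have "x \<in> A" "x \<in> carrier T" using factorD[OF f] x submoduleD(1) by blast+
  thus ?thesis using factorD(6)[OF f, of x] x smult_one[of x] W.Q.one_closed by metis
qed

text \<open>If \<open>\<xi> x\<close> were zero, then \<open>\<xi>\<close> would vanish on everything
  generated by \<open>x\<close>: on \<open>N\<close>, and on proper \<open>F\<close>-words as a covector. So
  \<open>x\<close> would lie in \<open>N\<close>.\<close>

lemma factor_top:
  assumes f: "factor N A \<nu> \<xi>" and x: "x \<in> A" "x \<in> Wt \<kappa>" "\<kappa> \<in> weights \<alpha>"
    and E: "\<And>i r. r > 0 \<Longrightarrow> Ea i r x \<in> N" and xN: "x \<notin> N"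
  shows "\<xi> x \<noteq> 0" "\<kappa> = \<nu>"
proof -
  show nz: "\<xi> x \<noteq> 0"
  proof
    assume z: "\<xi> x = 0"
    let ?P = "{a\<in>A. \<xi> a = 0}"
    have P: "K.ksub ?P"
      using sub_ksub[OF factorD(2)[OF f]] K.klin_zero[OF sub_ksub[OF factorD(2)[OF f]] factorD(8)[OF f]]
        K.klinD[OF factorD(8)[OF f]] unfolding K.ksub_def by auto
    have FW: "y \<in> A \<and> \<xi> y = 0" if "FW x \<kappa> y \<mu>" for y \<mu>
      using that
    proof induction
      case (FW_step y \<mu> r i)
      thus ?case using submoduleD(6)[OF factorD(2)[OF f]] covecD(2)[OF factorD(4)[OF f]] by simp
    qed (use z x in auto)
    have "\<xi> (u \<star> x) = 0" if "u \<in> carrier U" for u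
      using generated_by_F[OF factorD(1)[OF f] x(2,3) E P _ _ that] FW factorD(5)[OF f] factor_zero[OF f] by blast
    thus False using xN factorD(6)[OF f x(1)] by blast
  qed
  show "\<kappa> = \<nu>" by (rule covec_weight[OF factorD(4,3)[OF f] x nz])
qed

text \<open>As long as some \<open>E\<^sub>i\<^sup>(\<^sup>r\<^sup>)\<close> does not push the vector into
  \<open>N\<close>, applying it raises the height; this stops at a vector of weight \<open>\<nu>\<close>, by
  \<open>factor_top\<close>.\<close>

lemma factor_climb:
  assumes f: "factor N A \<nu> \<xi>"
  shows "x \<in> A \<Longrightarrow> x \<in> Wt \<kappa> \<Longrightarrow> \<kappa> \<in> weights \<alpha> \<Longrightarrow> x \<notin> N \<Longrightarrow>
    (\<exists>y\<in>A. y \<in> Wt \<nu> \<and> \<xi> y \<noteq> 0 \<and> (\<forall>B. sub B \<longrightarrow> x \<in> B \<longrightarrow> y \<in> B)) \<and> (\<kappa> = \<nu> \<or> ht \<kappa> < ht \<nu>)"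
proof (induction "card {\<mu>\<in>Om. ht \<mu> > ht \<kappa>}" arbitrary: x \<kappa> rule: less_induct)
  case less
  show ?case
  proof (cases "\<forall>i r. r > 0 \<longrightarrow> Ea i r x \<in> N")
    case True
    thus ?thesis using factor_top[OF f less.prems(1-3) _ less.prems(4)] less.prems by blast
  next
    case False
    then obtain i r where r: "r > 0" "Ea i r x \<notin> N" by blast
    let ?y = "Ea i r x" and ?k = "\<kappa> + real r *\<^sub>R \<alpha> i"
    have y: "?y \<in> A" "?y \<in> Wt ?k" "?k \<in> weights \<alpha>"
      using submoduleD(6)[OF factorD(2)[OF f] _ less.prems(1)] E_Wt weight_shift' less.prems by auto
    have "?y \<noteq> \<zero>" using r submoduleD(2)[OF factorD(1)[OF f]] by metis
    hence "?k \<in> Om" using weight_Om y by blast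
    moreover have hk: "ht \<kappa> < ht ?k" using r(1) by simp
    ultimately have "?k \<in> {\<mu>\<in>Om. ht \<mu> > ht \<kappa>} - {\<mu>\<in>Om. ht \<mu> > ht ?k}" by blast
    moreover have "{\<mu>\<in>Om. ht \<mu> > ht ?k} \<subseteq> {\<mu>\<in>Om. ht \<mu> > ht \<kappa>}"
      using hk by (blast intro: less_trans)
    ultimately have "{\<mu>\<in>Om. ht \<mu> > ht ?k} \<subset> {\<mu>\<in>Om. ht \<mu> > ht \<kappa>}" by blast
    hence "card {\<mu>\<in>Om. ht \<mu> > ht ?k} < card {\<mu>\<in>Om. ht \<mu> > ht \<kappa>}"
      using Om(1) by (intro psubset_card_mono) auto
    from less.hyps[OF this y r(2)] obtain z where z: "z \<in> A" "z \<in> Wt \<nu>" "\<xi> z \<noteq> 0"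
      "\<forall>B. sub B \<longrightarrow> ?y \<in> B \<longrightarrow> z \<in> B" "?k = \<nu> \<or> ht ?k < ht \<nu>" by blast
    have "ht \<kappa> < ht \<nu>" using z(5) r by (auto simp: ht_shift)
    thus ?thesis using z submoduleD(6) by auto
  qed
qed

lemma factor_weights:
  "factor N A \<nu> \<xi> \<Longrightarrow> x \<in> A \<Longrightarrow> x \<in> Wt \<kappa> \<Longrightarrow> \<kappa> \<in> weights \<alpha> \<Longrightarrow> x \<notin> N \<Longrightarrow> \<kappa> = \<nu> \<or> ht \<kappa> < ht \<nu>"
  using factor_climb by blast

text \<open>Climbing stays inside a submodule, so every submodule that is not contained in \<open>N\<close>
  reaches the top weight space: \<open>A / N\<close> has simple socle.\<close>

lemma factor_socle:
  assumes f: "factor N A \<nu> \<xi>" and B: "sub B" "B \<subseteq> A" "\<not> B \<subseteq> N"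
  obtains y where "y \<in> B" "y \<in> Wt \<nu>" "\<xi> y \<noteq> 0"
proof -
  obtain b where b: "b \<in> B" "b \<notin> N" using B by blast
  have bc: "b \<in> carrier T" using submoduleD(1)[OF B(1) b(1)] .
  have "\<exists>\<kappa>\<in>Om. pr b \<kappa> \<notin> N"
  proof (rule ccontr)
    assume "\<not> ?thesis"
    hence "(\<Oplus>\<kappa>\<in>Om. pr b \<kappa>) \<in> N" by (intro finsum_in_submodule[OF factorD(1)[OF f] Om(1)]) auto
    thus False using b pr(3)[OF bc] by simp
  qed
  then obtain \<kappa> where \<kappa>: "\<kappa> \<in> weights \<alpha>" "pr b \<kappa> \<notin> N" using Om(2) by blast
  have p: "pr b \<kappa> \<in> B" by (rule pr_sub[OF B(1) b(1)])
  obtain y where "y \<in> Wt \<nu>" "\<xi> y \<noteq> 0" "\<forall>B. sub B \<longrightarrow> pr b \<kappa> \<in> B \<longrightarrow> y \<in> B"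
    using factor_climb[OF f _ pr(1)[OF bc] \<kappa>] p B(2) by blast
  thus ?thesis using that B(1) p by blast
qed

lemma factor_E_top:
  assumes f: "factor N A \<nu> \<xi>" and x: "x \<in> A" "x \<in> Wt \<nu>" and r: "r > 0"
  shows "Ea i r x \<in> N"
proof (rule ccontr)
  assume n: "Ea i r x \<notin> N"
  have "Ea i r x \<in> A" by (rule submoduleD(6)[OF factorD(2)[OF f] _ x(1)]) simp
  hence "\<nu> + real r *\<^sub>R \<alpha> i = \<nu> \<or> ht (\<nu> + real r *\<^sub>R \<alpha> i) < ht \<nu>"
    using factor_weights[OF f _ E_Wt[OF x(2) factorD(3)[OF f]] weight_shift'(1)[OF factorD(3)[OF f]] n] by blast
  thus False using r alpha_nonzero[of i] by auto
qed

lemma factor_top_line: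
  assumes f: "factor N A \<nu> \<xi>" and x: "x \<in> A" "x \<in> Wt \<nu>" "\<xi> x = 0"
  shows "x \<in> N"
proof (rule ccontr)
  assume n: "x \<notin> N"
  thus False using factor_top(1)[OF f x(1,2) factorD(3)[OF f] factor_E_top[OF f x(1,2)] n] x(3) by blast
qed

lemma factor_equal:
  assumes f: "factor N A \<nu> \<xi>" and x: "x \<in> A" and y: "y \<in> A" and eq: "\<And>u. u \<in> carrier U \<Longrightarrow> \<xi> (u \<star> x) = \<xi> (u \<star> y)"
  shows "x \<ominus> y \<in> N"
proof -
  have "x \<ominus> y \<in> A" using submoduleD(5)[OF factorD(2)[OF f] x y] .
  moreover have "\<xi> (u \<star> (x \<ominus> y)) = 0" if "u \<in> carrier U" for u
    using that x y eq submoduleD(1,6)[OF factorD(2)[OF f]]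
      K.klin_minus[OF sub_ksub[OF factorD(2)[OF f]] factorD(8)[OF f]]
    by (simp add: smult_minus_right)
  ultimately show ?thesis using factorD(6)[OF f] by blast
qed

text \<open>Removing the obstruction one factor down: this is the vanishing of the extensions of
  a Weyl module by a dual Weyl module, on the level of highest weight vectors. If the weight \<open>\<nu>\<close> is at
  least as high as \<open>\<pi>\<close> the obstruction vanishes for weight reasons; otherwise the covector of \<open>N\<close>
  extends to the submodule generated by \<open>N\<close> and \<open>x\<close>, and Frobenius reciprocity gives the correction.\<close>

lemma factor_lift:
  assumes f: "factor N0 N \<pi> \<xi>" and x: "x \<in> Wt \<nu>" "\<nu> \<in> weights \<alpha>" and E: "\<And>i r. r > 0 \<Longrightarrow> Ea i r x \<in> N"
  shows "\<exists>n\<in>N. n \<in> Wt \<nu> \<and> (\<forall>i r. r > 0 \<longrightarrow> Ea i r (x \<ominus> n) \<in> N0)"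
proof (cases "ht \<nu> < ht \<pi>")
  case False
  have xc: "x \<in> carrier T" using WtD(1)[OF x(1)] .
  have "Ea i r x \<in> N0" if r: "r > 0" for i r
  proof (rule ccontr)
    assume "Ea i r x \<notin> N0"
    hence "\<nu> + real r *\<^sub>R \<alpha> i = \<pi> \<or> ht (\<nu> + real r *\<^sub>R \<alpha> i) < ht \<pi>"
      using factor_weights[OF f E[OF r] E_Wt[OF x]] weight_shift'(1)[OF x(2)] by blast
    thus False using r False by (auto simp: ht_shift)
  qed
  thus ?thesis using submoduleD(2)[OF factorD(2)[OF f]] xc
    by (intro bexI[of _ "\<zero>"]) (auto simp: a_minus_def K.sc_uminus[symmetric])
next
  case True
  have N: "sub N" by (rule factorD(2)[OF f])
  have xc: "x \<in> carrier T" using WtD(1)[OF x(1)] .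
  let ?X = "{z\<in>carrier T. \<forall>u\<in>carrier U. \<forall>\<mu>. ht \<nu> < ht \<mu> \<longrightarrow> pr (u \<star> z) \<mu> \<in> N}"
  have X: "sub ?X"
    by (rule submoduleI) (use submoduleD[OF N] pr_weight[OF Wt_zero, of 0] in
      \<open>auto simp: smult_r_distr pr_add smult_assoc[symmetric] weights_def coroot_pairing_def\<close>)
  have NX: "N \<subseteq> ?X" using submoduleD(1,6)[OF N] pr_sub[OF N] by auto
  have xX: "x \<in> ?X"
  proof -
    let ?P = "{z\<in>carrier T. \<forall>\<mu>. ht \<nu> < ht \<mu> \<longrightarrow> pr z \<mu> \<in> N}"
    have P: "K.ksub ?P"
      unfolding K.ksub_def using submoduleD[OF N] pr_weight[OF Wt_zero, of 0]
      by (auto simp: pr_add pr_sc weights_def coroot_pairing_def)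
    have "y \<in> ?P" if "FW x \<nu> y \<mu>" for y \<mu>
      using FW_Wt[OF x that] pr_weight[of y \<mu>] WtD(1)[of y \<mu>] submoduleD(2)[OF N] by auto
    hence "u \<star> x \<in> ?P" if "u \<in> carrier U" for u
      using generated_by_F[OF N x E P _ _ that] submoduleD(1)[OF N] pr_sub[OF N] by blast
    thus ?thesis using xc by auto
  qed
  define \<Xi> where "\<Xi> z = \<xi> (pr z \<pi>)" for z
  have prX: "pr z \<mu> \<in> N" if "z \<in> ?X" "ht \<nu> < ht \<mu>" for z \<mu>
    using that smult_one[of z] W.Q.one_closed by (metis (mono_tags, lifting) mem_Collect_eq)
  have c: "covec ?X \<pi> \<Xi>"
  proof (rule covecI[OF X _ factorD(3)[OF f]])
    show "K.klin ?X \<Xi>" unfolding K.klin_def \<Xi>_def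
      using prX True K.klinD[OF factorD(8)[OF f]] by (auto simp: pr_add pr_sc)
    show "\<Xi> z = 0" if "z \<in> Wt \<kappa>" "\<kappa> \<in> weights \<alpha>" "\<kappa> \<noteq> \<pi>" for z \<kappa>
      using that pr_weight[of z \<kappa> \<pi>] factor_zero[OF f submoduleD(2)[OF factorD(1)[OF f]]] by (simp add: \<Xi>_def)
    show "\<Xi> (Fa i r z) = 0" if z: "z \<in> ?X" and r: "r > 0" and w: "z \<in> Wt (\<pi> + real r *\<^sub>R \<alpha> i)" for z i r
    proof -
      have "pr (Fa i r z) \<pi> = Fa i r (pr z (\<pi> + real r *\<^sub>R \<alpha> i))" using z pr_F by blast
      moreover have "pr z (\<pi> + real r *\<^sub>R \<alpha> i) \<in> N" using prX[OF z] True by (simp add: ht_shift)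
      ultimately show ?thesis using covecD(2)[OF factorD(4)[OF f]] r by (simp add: \<Xi>_def)
    qed
  qed
  have ext: "\<Xi> n = \<xi> n" if n: "n \<in> N" for n
  proof -
    have nc: "n \<in> carrier T" using submoduleD(1)[OF N n] .
    have "\<xi> (\<Oplus>\<kappa>\<in>S. pr n \<kappa>) = (\<Sum>\<kappa>\<in>S. \<xi> (pr n \<kappa>))" if "finite S" for S
      using that
    proof (induction S rule: finite_induct)
      case (insert \<kappa> S)
      have "(\<Oplus>\<kappa>\<in>S. pr n \<kappa>) \<in> N" using insert pr_sub[OF N n] by (intro finsum_in_submodule[OF N])
      thus ?case using insert nc K.klinD(1)[OF factorD(8)[OF f]] pr_sub[OF N n]
        by (subst M.finsum_insert) auto
    qed (use factor_zero[OF f submoduleD(2)[OF factorD(1)[OF f]]] in simp)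
    from this[OF Om(1)] have "\<xi> n = (\<Sum>\<kappa>\<in>Om. \<xi> (pr n \<kappa>))" using pr(3)[OF nc] by simp
    also have "\<dots> = (\<Sum>\<kappa>\<in>Om. if \<kappa> = \<pi> then \<xi> (pr n \<pi>) else 0)"
      using covec_weight[OF factorD(4,3)[OF f] pr_sub[OF N n] pr(1)[OF nc]] Om(2) by (intro sum.cong) auto
    also have "\<dots> = \<Xi> n"
      using Om(1) pr(2)[OF nc, of \<pi>] factor_zero[OF f submoduleD(2)[OF factorD(1)[OF f]]] by (auto simp: \<Xi>_def)
    finally show ?thesis by simp
  qed
  obtain n where n: "n \<in> N" "rep \<Xi> x = rep \<xi> n"
    using factorD(7)[OF f rep_dual_weyl[OF X c xX]] by blast
  have nc: "n \<in> carrier T" using submoduleD(1)[OF N n(1)] .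
  let ?n = "pr n \<nu>"
  have "Ea i r (x \<ominus> ?n) \<in> N0" if r: "r > 0" for i r
  proof -
    have "Ea i r x \<ominus> Ea i r n \<in> N0"
    proof (rule factor_equal[OF f E[OF r] submoduleD(6)[OF N _ n(1)]])
      fix u assume u: "u \<in> carrier U"
      have "\<xi> (u \<star> Ea i r x) = \<Xi> (u \<star> Ea i r x)" using ext submoduleD(6)[OF N u E[OF r]] by simp
      also have "\<dots> = rep \<Xi> x (u \<otimes>\<^bsub>U\<^esub> uq_E \<alpha> q i r)" using u xc by (simp add: rep_def smult_assoc)
      also have "\<dots> = \<xi> (u \<star> Ea i r n)" unfolding n(2) using u nc by (simp add: rep_def smult_assoc)
      finally show "\<xi> (u \<star> Ea i r x) = \<xi> (u \<star> Ea i r n)" .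
    qed simp
    hence "pr (Ea i r (x \<ominus> n)) (\<nu> + real r *\<^sub>R \<alpha> i) \<in> N0"
      using pr_sub[OF factorD(1)[OF f]] xc nc by (simp add: smult_minus_right)
    hence "Ea i r (pr (x \<ominus> n) \<nu>) \<in> N0" using xc nc by (simp add: pr_E)
    moreover have "pr (x \<ominus> n) \<nu> = x \<ominus> ?n"
      using xc nc pr_add[of x "\<ominus> n" \<nu>] pr_sc[OF nc, of "- 1" \<nu>] pr_weight[OF x, of \<nu>]
      by (simp add: a_minus_def K.sc_uminus)
    ultimately show ?thesis by simp
  qed
  thus ?thesis using pr_sub[OF N n(1)] pr(1)[OF nc] by blast
qed

definition filt :: "nat \<Rightarrow> (nat \<Rightarrow> 'm set) \<Rightarrow> (nat \<Rightarrow> 'e) \<Rightarrow> (nat \<Rightarrow> 'm \<Rightarrow> 'k) \<Rightarrow> bool" where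
  "filt k N \<nu> \<xi> \<longleftrightarrow> N 0 = {\<zero>} \<and> N k = carrier T \<and> (\<forall>j<k. factor (N j) (N (Suc j)) (\<nu> j) (\<xi> j))"

text \<open>Trivial steps of the filtration carry no label: the dual Weyl module that belongs to them is
  zero.\<close>

definition labels :: "nat \<Rightarrow> (nat \<Rightarrow> 'm set) \<Rightarrow> (nat \<Rightarrow> 'e) \<Rightarrow> 'e set" where
  "labels k N \<nu> = {\<nu> j | j. j < k \<and> N j \<noteq> N (Suc j)}"

lemma filt_mono: assumes "filt k N \<nu> \<xi>" shows "i \<le> j \<Longrightarrow> j \<le> k \<Longrightarrow> N i \<subseteq> N j"
proof (induction j)
  case (Suc j)
  show ?case
  proof (cases "i = Suc j")
    case False
    hence "N i \<subseteq> N j" using Suc by simp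
    also have "N j \<subseteq> N (Suc j)" using assms Suc.prems factorD(5) unfolding filt_def by (metis Suc_le_lessD)
    finally show ?thesis .
  qed simp
qed simp

text \<open>A vector on top of one factor is corrected factor by factor until it is killed by the
  \<open>E\<close>'s; conversely a highest weight vector sits on top of the first factor that it
  meets.\<close>

lemma label_highest_weight:
  assumes F: "filt k N \<nu> \<xi>" and \<kappa>: "\<kappa> \<in> labels k N \<nu>"
  obtains x where "x \<in> Wt \<kappa>" "x \<noteq> \<zero>" "\<And>i r. r > 0 \<Longrightarrow> Ea i r x = \<zero>"
proof -
  obtain j where j: "j < k" "N j \<noteq> N (Suc j)" "\<kappa> = \<nu> j" using \<kappa> by (auto simp: labels_def)
  have f: "factor (N j) (N (Suc j)) \<kappa> (\<xi> j)" using F j by (auto simp: filt_def)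
  have \<kappa>w: "\<kappa> \<in> weights \<alpha>" by (rule factorD(3)[OF f])
  have "\<not> N (Suc j) \<subseteq> N j" using factorD(5)[OF f] j by blast
  then obtain y where y: "y \<in> N (Suc j)" "y \<in> Wt \<kappa>" "\<xi> j y \<noteq> 0"
    using factor_socle[OF f factorD(2)[OF f] subset_refl] by blast
  have start: "Ea i r y \<in> N j" if r: "r > 0" for i r
    by (rule factor_E_top[OF f y(1,2) r])
  have "\<exists>x. x \<in> Wt \<kappa> \<and> x \<notin> N j \<and> (\<forall>i r. r > 0 \<longrightarrow> Ea i r x \<in> N (j - m))" if "m \<le> j" for m
    using that
  proof (induction m)
    case 0
    have "y \<notin> N j" using y factor_zero[OF f] by blast
    thus ?case using y start by auto
  next
    case (Suc m)
    then obtain x where x: "x \<in> Wt \<kappa>" "x \<notin> N j" "\<forall>i r. r > 0 \<longrightarrow> Ea i r x \<in> N (j - m)" by auto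
    have eq: "j - m = Suc (j - Suc m)" using Suc.prems by simp
    have "factor (N (j - Suc m)) (N (j - m)) (\<nu> (j - Suc m)) (\<xi> (j - Suc m))"
      using F Suc.prems j(1) unfolding eq filt_def by auto
    from factor_lift[OF this x(1) \<kappa>w] x(3) obtain n where n: "n \<in> N (j - m)" "n \<in> Wt \<kappa>"
      "\<forall>i r. r > 0 \<longrightarrow> Ea i r (x \<ominus> n) \<in> N (j - Suc m)" by blast
    have nj: "n \<in> N j" using n(1) filt_mono[OF F, of "j - m" j] j(1) by auto
    have c: "x \<in> carrier T" "n \<in> carrier T" using x(1) n(2) WtD(1) by auto
    have "x \<ominus> n \<notin> N j"
    proof
      assume "x \<ominus> n \<in> N j"
      hence "(x \<ominus> n) \<oplus> n \<in> N j" using nj submoduleD(3)[OF factorD(1)[OF f]] by blast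
      thus False using x(2) c by (simp add: a_minus_def M.a_assoc M.l_neg)
    qed
    thus ?case using n x(1) K.ksubD(6)[OF Wt_ksub] by blast
  qed
  from this[of j] obtain x where "x \<in> Wt \<kappa>" "x \<notin> N j" "\<forall>i r. r > 0 \<longrightarrow> Ea i r x \<in> N 0" by auto
  thus ?thesis using that[of x] F submoduleD(2)[OF factorD(1)[OF f]] by (auto simp: filt_def)
qed

lemma highest_weight_label:
  assumes F: "filt k N \<nu> \<xi>" and x: "x \<in> Wt \<kappa>" "\<kappa> \<in> weights \<alpha>" "x \<noteq> \<zero>"
    and E: "\<And>i r. r > 0 \<Longrightarrow> Ea i r x = \<zero>"
  shows "\<kappa> \<in> labels k N \<nu>"
proof -
  have ex: "x \<in> N k" using F WtD(1)[OF x(1)] by (simp add: filt_def)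
  define m where "m = (LEAST m. x \<in> N m)"
  have m: "x \<in> N m" "\<And>i. i < m \<Longrightarrow> x \<notin> N i" "m \<le> k"
    using LeastI[of "\<lambda>m. x \<in> N m", OF ex] not_less_Least Least_le[of "\<lambda>m. x \<in> N m", OF ex] unfolding m_def by auto
  have "m \<noteq> 0" using m(1) F x(3) by (auto simp: filt_def)
  then obtain j where j: "m = Suc j" by (cases m) auto
  have f: "factor (N j) (N (Suc j)) (\<nu> j) (\<xi> j)" using F m j by (auto simp: filt_def)
  have "\<kappa> = \<nu> j"
    using factor_top(2)[OF f _ x(1,2)] m j E submoduleD(2)[OF factorD(1)[OF f]] by simp
  thus ?thesis unfolding labels_def using m j by (intro CollectI exI[of _ j]) auto
qed

end

section \<open>Subquotients\<close>

text \<open>Homomorphisms on a quotient module are replaced by homomorphisms on the submodule above it,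
  which removes cosets from all later arguments.\<close>

lemma quotient_hom:
  fixes M :: "('r, 'm) module" (structure) and R :: "('r, 's) ring_scheme" and W :: "('r, 'n) module"
  assumes "left_module R M" and N: "submodule N R M" and A: "submodule A R M" and NA: "N \<subseteq> A"
    and h: "h \<in> module_hom_set R (quotient_module (M\<lparr>carrier := A\<rparr>) N) W"
      "bij_betw h (carrier (quotient_module (M\<lparr>carrier := A\<rparr>) N)) (carrier W)"
  obtains g where "\<And>x. x \<in> A \<Longrightarrow> g x \<in> carrier W"
    "\<And>x y. x \<in> A \<Longrightarrow> y \<in> A \<Longrightarrow> g (x \<oplus> y) = g x \<oplus>\<^bsub>W\<^esub> g y"
    "\<And>a x. a \<in> carrier R \<Longrightarrow> x \<in> A \<Longrightarrow> g (a \<odot> x) = a \<odot>\<^bsub>W\<^esub> g x"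
    "\<And>w. w \<in> carrier W \<Longrightarrow> \<exists>x\<in>A. g x = w"
    "\<And>x y. x \<in> A \<Longrightarrow> y \<in> A \<Longrightarrow> g x = g y \<longleftrightarrow> x \<ominus> y \<in> N"
proof -
  interpret left_module R M by fact
  let ?M = "M\<lparr>carrier := A\<rparr>" and ?Q = "quotient_module (M\<lparr>carrier := A\<rparr>) N"
  have aN: "additive_subgroup N M" using N by (simp add: submodule_def additive_subgroup_def)
  have sN: "abelian_subgroup N M"
    by (rule abelian_subgroupI3[OF aN M.abelian_group_axioms])
  interpret N: abelian_subgroup N M by (rule sN)
  have car: "x \<in> carrier M" if "x \<in> A" for x using submoduleD(1)[OF A that] .
  have cosets: "carrier ?Q = {N +> x | x. x \<in> A}"
    by (auto simp: quotient_module_def A_RCOSETS_def' a_r_coset_def')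
  have add: "(N +> x) \<oplus>\<^bsub>?Q\<^esub> (N +> y) = N +> (x \<oplus> y)" if "x \<in> A" "y \<in> A" for x y
  proof -
    have "(N +> x) \<oplus>\<^bsub>?Q\<^esub> (N +> y) = (N +> x) <+> (N +> y)"
      by (simp add: quotient_module_def set_add_def')
    thus ?thesis using N.a_rcos_sum car that by simp
  qed
  have eq: "N +> x = N +> y \<longleftrightarrow> x \<ominus> y \<in> N" if "x \<in> carrier M" "y \<in> carrier M" for x y
  proof
    assume "N +> x = N +> y"
    hence "x \<in> N +> y" using N.a_rcos_self[OF that(1)] by simp
    then obtain n where "n \<in> N" "x = n \<oplus> y" by (auto simp: a_r_coset_def')
    thus "x \<ominus> y \<in> N" using that N.a_Hcarr by (simp add: a_minus_def M.a_assoc M.r_neg)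
  next
    assume n: "x \<ominus> y \<in> N"
    have "x = (x \<ominus> y) \<oplus> y" using that by (simp add: a_minus_def M.a_assoc M.l_neg)
    hence "x \<in> N +> y" using n by (auto simp: a_r_coset_def')
    thus "N +> x = N +> y" using N.a_repr_independence' that by (metis N.a_subset M.a_repr_independence aN additive_subgroup.a_subgroup)
  qed
  have smult: "a \<odot>\<^bsub>?Q\<^esub> (N +> x) = N +> (a \<odot> x)" if a: "a \<in> carrier R" and x: "x \<in> A" for a x
  proof -
    have xc: "x \<in> carrier M" using car x .
    have "N +>\<^bsub>?M\<^esub> (a \<odot> y) = N +> (a \<odot> x)" if y: "y \<in> N +> x" for y
    proof -
      obtain n where n: "n \<in> N" "y = n \<oplus> x" using y by (auto simp: a_r_coset_def')
      have nc: "n \<in> carrier M" using n N.a_Hcarr by blast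
      have "a \<odot> y \<ominus> a \<odot> x = a \<odot> n"
        using n nc xc a smult_closed by (simp add: smult_r_distr a_minus_def M.a_assoc M.r_neg)
      hence "a \<odot> y \<ominus> a \<odot> x \<in> N" using submoduleD(6)[OF N a n(1)] by simp
      hence "N +> (a \<odot> y) = N +> (a \<odot> x)"
        using eq n nc xc a smult_closed by simp
      thus ?thesis by (simp add: a_r_coset_def')
    qed
    moreover have "x \<in> N +> x" by (rule N.a_rcos_self[OF xc])
    ultimately show ?thesis unfolding quotient_module_def by auto
  qed
  define g where "g x = h (N +> x)" for x
  have hQ: "\<And>X. X \<in> carrier ?Q \<Longrightarrow> h X \<in> carrier W"
    "\<And>X Y. X \<in> carrier ?Q \<Longrightarrow> Y \<in> carrier ?Q \<Longrightarrow> h (X \<oplus>\<^bsub>?Q\<^esub> Y) = h X \<oplus>\<^bsub>W\<^esub> h Y"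
    "\<And>a X. a \<in> carrier R \<Longrightarrow> X \<in> carrier ?Q \<Longrightarrow> h (a \<odot>\<^bsub>?Q\<^esub> X) = a \<odot>\<^bsub>W\<^esub> h X"
    using h(1) unfolding module_hom_set_def by auto
  have mem: "N +> x \<in> carrier ?Q" if "x \<in> A" for x using that cosets by blast
  show ?thesis
  proof (rule that[of g])
    show "g x \<in> carrier W" if "x \<in> A" for x using hQ(1)[OF mem[OF that]] by (simp add: g_def)
    show "g (x \<oplus> y) = g x \<oplus>\<^bsub>W\<^esub> g y" if "x \<in> A" "y \<in> A" for x y
      using hQ(2)[OF mem mem, of x y] add that by (simp add: g_def)
    show "g (a \<odot> x) = a \<odot>\<^bsub>W\<^esub> g x" if "a \<in> carrier R" "x \<in> A" for a x
      using hQ(3)[OF _ mem, of a x] smult that by (simp add: g_def)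
    show "\<exists>x\<in>A. g x = w" if "w \<in> carrier W" for w
    proof -
      have "w \<in> h ` {N +> x | x. x \<in> A}" using h(2) that unfolding bij_betw_def cosets by blast
      thus ?thesis unfolding g_def by blast
    qed
    show "g x = g y \<longleftrightarrow> x \<ominus> y \<in> N" if "x \<in> A" "y \<in> A" for x y
      using h(2) mem[OF that(1)] mem[OF that(2)] eq[of x y] car that
      unfolding bij_betw_def g_def by (metis inj_onD)
  qed
qed

context quantum_data
begin

lemma coinducedD:
  assumes "f \<in> carrier (coinduced_module \<alpha> q \<nu>)"
  shows "x \<notin> carrier U \<Longrightarrow> f x = 0" "x \<in> carrier U \<Longrightarrow> y \<in> carrier U \<Longrightarrow> f (x \<oplus>\<^bsub>U\<^esub> y) = f x + f y"
    "x \<in> carrier U \<Longrightarrow> f (uq_scalar \<alpha> q c \<otimes>\<^bsub>U\<^esub> x) = c * f x"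
    "x \<in> carrier U \<Longrightarrow> r > 0 \<Longrightarrow> f (uq_F \<alpha> q i r \<otimes>\<^bsub>U\<^esub> x) = 0"
    "x \<in> carrier U \<Longrightarrow> f (uq_K \<alpha> q i \<otimes>\<^bsub>U\<^esub> x) = K_value \<alpha> q \<nu> i * f x"
    "x \<in> carrier U \<Longrightarrow> f (uq_Kinv \<alpha> q i \<otimes>\<^bsub>U\<^esub> x) = inverse (K_value \<alpha> q \<nu> i) * f x"
    "x \<in> carrier U \<Longrightarrow> f (uq_Kbinom \<alpha> q i t \<otimes>\<^bsub>U\<^esub> x) = Kbinom_value \<alpha> q \<nu> i t * f x"
  using assms by (simp_all add: coinduced_module_def Let_def)

lemma coinduced_left_module: "left_module U (coinduced_module \<alpha> q \<nu>)"
proof -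
  let ?C = "coinduced_module \<alpha> q \<nu>"
  interpret C: abelian_group ?C by (rule coinduced_abelian)
  show ?thesis
  proof (intro left_module.intro left_module_axioms.intro U_ring C.abelian_group_axioms)
    fix a f assume a: "a \<in> carrier U" and f: "f \<in> carrier ?C"
    show "a \<odot>\<^bsub>?C\<^esub> f \<in> carrier ?C"
      unfolding coinduced_simps using a coinducedD[OF f]
      by (simp add: coinduced_module_def Let_def W.Q.l_distr W.Q.m_assoc)
    fix b assume b: "b \<in> carrier U"
    show "(a \<oplus>\<^bsub>U\<^esub> b) \<odot>\<^bsub>?C\<^esub> f = a \<odot>\<^bsub>?C\<^esub> f \<oplus>\<^bsub>?C\<^esub> b \<odot>\<^bsub>?C\<^esub> f"
      using a b coinducedD(2)[OF f] by (auto simp: W.Q.r_distr)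
    show "(a \<otimes>\<^bsub>U\<^esub> b) \<odot>\<^bsub>?C\<^esub> f = a \<odot>\<^bsub>?C\<^esub> (b \<odot>\<^bsub>?C\<^esub> f)"
      using a b by (auto simp: W.Q.m_assoc)
  next
    fix f assume f: "f \<in> carrier ?C"
    show "\<one>\<^bsub>U\<^esub> \<odot>\<^bsub>?C\<^esub> f = f" using coinducedD(1)[OF f] by auto
  qed auto
qed

lemma coinduced_weight_module: "weight_module \<Phi> \<alpha> q (coinduced_module \<alpha> q \<nu>)"
  by (intro weight_module.intro quantum_data_axioms coinduced_left_module)

lemma coinduced_scalar:
  assumes "f \<in> carrier (coinduced_module \<alpha> q \<nu>)"
  shows "uq_scalar \<alpha> q c \<odot>\<^bsub>coinduced_module \<alpha> q \<nu>\<^esub> f = (\<lambda>x. c * f x)"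
  using coinducedD(1,3)[OF assms] by (auto simp: W.Q.scalar_central fun_eq_iff)

lemma dual_weyl_coinduced: "f \<in> carrier (dual_weyl \<alpha> q \<nu>) \<Longrightarrow> f \<in> carrier (coinduced_module \<alpha> q \<nu>)"
  by (simp add: dual_weyl_def integrable_part_def)

lemma dual_weyl_ops [simp]:
  "zero (dual_weyl \<alpha> q \<nu>) = (\<lambda>x. 0)" "add (dual_weyl \<alpha> q \<nu>) f g = (\<lambda>x. f x + g x)"
  "smult (dual_weyl \<alpha> q \<nu>) u f = u \<odot>\<^bsub>coinduced_module \<alpha> q \<nu>\<^esub> f"
  by (simp_all add: dual_weyl_def integrable_part_def)

end

context fd_module
begin

text \<open>The covector of a factor is the isomorphism to the dual Weyl module followed by evaluation at
  the unit.\<close>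

lemma nabla_filtration:
  assumes "has_filtration U T (\<lambda>Q. \<exists>\<mu>\<in>dominant_weights \<alpha>. isomorphic_modules U Q (dual_weyl \<alpha> q \<mu>))"
  obtains k N \<nu> \<xi> where "filt k N \<nu> \<xi>"
proof -
  obtain k N where N: "N 0 = {\<zero>}" "N k = carrier T" "\<forall>j\<le>k. sub (N j)"
    "\<forall>j<k. N j \<subseteq> N (Suc j) \<and> (\<exists>\<mu>\<in>dominant_weights \<alpha>.
       isomorphic_modules U (quotient_module (T\<lparr>carrier := N (Suc j)\<rparr>) (N j)) (dual_weyl \<alpha> q \<mu>))"
    using assms unfolding has_filtration_def by blast
  have "\<exists>\<mu> \<xi>. factor (N j) (N (Suc j)) \<mu> \<xi>" if j: "j < k" for j
  proof -
    let ?A = "N (Suc j)"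
    have A: "sub ?A" and N0: "sub (N j)" and sb: "N j \<subseteq> ?A" using N j by auto
    obtain \<mu> h where \<mu>: "\<mu> \<in> dominant_weights \<alpha>" and h: "h \<in> module_hom_set U (quotient_module (T\<lparr>carrier := ?A\<rparr>) (N j)) (dual_weyl \<alpha> q \<mu>)"
      "bij_betw h (carrier (quotient_module (T\<lparr>carrier := ?A\<rparr>) (N j))) (carrier (dual_weyl \<alpha> q \<mu>))"
      using N(4) j unfolding isomorphic_modules_def by blast
    obtain g where g: "\<And>x. x \<in> ?A \<Longrightarrow> g x \<in> carrier (dual_weyl \<alpha> q \<mu>)"
      "\<And>x y. x \<in> ?A \<Longrightarrow> y \<in> ?A \<Longrightarrow> g (x \<oplus> y) = g x \<oplus>\<^bsub>dual_weyl \<alpha> q \<mu>\<^esub> g y"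
      "\<And>u x. u \<in> carrier U \<Longrightarrow> x \<in> ?A \<Longrightarrow> g (u \<star> x) = u \<odot>\<^bsub>dual_weyl \<alpha> q \<mu>\<^esub> g x"
      "\<And>w. w \<in> carrier (dual_weyl \<alpha> q \<mu>) \<Longrightarrow> \<exists>x\<in>?A. g x = w"
      "\<And>x y. x \<in> ?A \<Longrightarrow> y \<in> ?A \<Longrightarrow> g x = g y \<longleftrightarrow> x \<ominus> y \<in> N j"
      using quotient_hom[OF left_module_axioms N0 A sb h] by blast
    note gc = dual_weyl_coinduced[OF g(1)]
    define \<xi> where "\<xi> x = g x \<one>\<^bsub>U\<^esub>" for x
    have gu: "g (u \<star> x) = (\<lambda>y. if y \<in> carrier U then g x (y \<otimes>\<^bsub>U\<^esub> u) else 0)" if "u \<in> carrier U" "x \<in> ?A" for u x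
      using g(3)[OF that] by simp
    have xu: "\<xi> (u \<star> x) = g x u" if "u \<in> carrier U" "x \<in> ?A" for u x
      unfolding \<xi>_def gu[OF that] using that by simp
    have rep: "rep \<xi> x = g x" if x: "x \<in> ?A" for x
      using xu[OF _ x] coinducedD(1)[OF gc[OF x]] by (auto simp: rep_def)
    have \<mu>w: "\<mu> \<in> weights \<alpha>" using \<mu> by (simp add: dominant_weights_def)
    have one: "g x h = g x (h \<otimes>\<^bsub>U\<^esub> \<one>\<^bsub>U\<^esub>)" if "h \<in> carrier U" for x h using that by simp
    have c: "covec ?A \<mu> \<xi>"
      unfolding covec_def K.klin_def
    proof (intro conjI ballI allI impI)
      fix x y assume x: "x \<in> ?A" and y: "y \<in> ?A"
      show "\<xi> (x \<oplus> y) = \<xi> x + \<xi> y" using g(2)[OF x y] by (simp add: \<xi>_def)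
    next
      fix x c assume x: "x \<in> ?A"
      show "\<xi> (sc c x) = c * \<xi> x"
        using xu[OF U_closed(7) x, of c] coinducedD(3)[OF gc[OF x], of "\<one>\<^bsub>U\<^esub>" c] by (simp add: \<xi>_def)
    next
      fix x i assume x: "x \<in> ?A"
      show "\<xi> (Fa i r x) = 0" if "r > 0" for r
        using xu[OF U_closed(2) x] coinducedD(4)[OF gc[OF x], of "\<one>\<^bsub>U\<^esub>" r i] that by simp
      show "\<xi> (uq_K \<alpha> q i \<star> x) = K_value \<alpha> q \<mu> i * \<xi> x"
        using xu[OF U_closed(3) x] coinducedD(5)[OF gc[OF x], of "\<one>\<^bsub>U\<^esub>" i] by (simp add: \<xi>_def)
      show "\<xi> (uq_Kinv \<alpha> q i \<star> x) = inverse (K_value \<alpha> q \<mu> i) * \<xi> x"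
        using xu[OF U_closed(4) x] coinducedD(6)[OF gc[OF x], of "\<one>\<^bsub>U\<^esub>" i] by (simp add: \<xi>_def)
      show "\<xi> (uq_Kbinom \<alpha> q i t \<star> x) = Kbinom_value \<alpha> q \<mu> i t * \<xi> x" for t
        using xu[OF U_closed(5) x] coinducedD(7)[OF gc[OF x], of "\<one>\<^bsub>U\<^esub>" i t] by (simp add: \<xi>_def)
    qed
    have ker: "x \<in> N j \<longleftrightarrow> (\<forall>u\<in>carrier U. \<xi> (u \<star> x) = 0)" if x: "x \<in> ?A" for x
    proof -
      have z: "\<zero> \<in> ?A" by (rule submoduleD(2)[OF A])
      have "x \<ominus> \<zero> = x" using submoduleD(1)[OF A x] by (simp add: a_minus_def K.sc_uminus[symmetric])
      moreover have "g \<zero> = (\<lambda>_. 0)"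
        unfolding rep[OF z, symmetric] using K.klin_zero[OF sub_ksub[OF A] covecD(1)[OF c]]
        by (simp add: rep_def fun_eq_iff)
      ultimately have "x \<in> N j \<longleftrightarrow> g x = (\<lambda>_. 0)" using g(5)[OF x z] by simp
      also have "\<dots> \<longleftrightarrow> (\<forall>u\<in>carrier U. \<xi> (u \<star> x) = 0)"
        unfolding rep[OF x, symmetric] by (auto simp: rep_def fun_eq_iff)
      finally show ?thesis .
    qed
    have "\<exists>x\<in>?A. f = rep \<xi> x" if "f \<in> carrier (dual_weyl \<alpha> q \<mu>)" for f
      using g(4)[OF that] rep by metis
    hence "factor (N j) ?A \<mu> \<xi>" unfolding factor_def using A N0 \<mu>w c ker sb by blast
    thus ?thesis by blast
  qed
  then obtain \<nu> \<xi> where "\<And>j. j < k \<Longrightarrow> factor (N j) (N (Suc j)) (\<nu> j) (\<xi> j)" by metis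
  hence "filt k N \<nu> \<xi>" using N by (simp add: filt_def)
  thus ?thesis using that by blast
qed

section \<open>Multiplicities\<close>

lemma kdim_Wt: "sub N \<Longrightarrow> \<exists>n. K.kdim (N \<inter> Wt \<kappa>) n"
  using kdim_T K.kdim_subspace K.ksub_Int sub_ksub Wt_ksub K.ksubD(1) by (metis inf.coboundedI1 subsetI)

end

text \<open>The value is meaningful only if the dimension is finite; this is the case for the factors of a
  finite-dimensional module.\<close>

definition (in quantum_data) dw_dim :: "'e \<Rightarrow> 'e \<Rightarrow> nat" where
  "dw_dim \<nu> \<kappa> = (THE m. kspace.kdim (coinduced_module \<alpha> q \<nu>)
     (\<lambda>c f. uq_scalar \<alpha> q c \<odot>\<^bsub>coinduced_module \<alpha> q \<nu>\<^esub> f)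
     (carrier (dual_weyl \<alpha> q \<nu>) \<inter> weight_space \<alpha> q (coinduced_module \<alpha> q \<nu>) \<kappa>) m)"

context fd_module
begin

lemma rep_add:
  assumes A: "sub A" and c: "covec A \<nu> \<xi>" and x: "x \<in> A" "y \<in> A"
  shows "rep \<xi> (x \<oplus> y) = rep \<xi> x \<oplus>\<^bsub>coinduced_module \<alpha> q \<nu>\<^esub> rep \<xi> y"
  using x K.klinD(1)[OF covecD(1)[OF c]] submoduleD(1,6)[OF A]
  by (auto simp: rep_def smult_r_distr fun_eq_iff)

text \<open>A preimage of a weight vector need not be a weight vector, but its component of the right weight
  is again a preimage: the other components lie in \<open>N\<close>, because weights are separated by the
  action of \<open>U\<^sup>0\<close>.\<close>

lemma factor_weight_lift:
  assumes f: "factor N A \<nu> \<xi>" and \<kappa>: "\<kappa> \<in> weights \<alpha>"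
    and w: "w \<in> carrier (dual_weyl \<alpha> q \<nu>)" "w \<in> weight_space \<alpha> q (coinduced_module \<alpha> q \<nu>) \<kappa>"
  shows "\<exists>x\<in>A. x \<in> Wt \<kappa> \<and> w = rep \<xi> x"
proof -
  let ?C = "coinduced_module \<alpha> q \<nu>"
  interpret C: weight_module \<Phi> \<alpha> q ?C by (rule coinduced_weight_module)
  note A = factorD(2)[OF f] and N = factorD(1)[OF f]
  obtain x where x: "x \<in> A" "w = rep \<xi> x" using factorD(7)[OF f w(1)] by blast
  have xc: "x \<in> carrier T" using submoduleD(1)[OF A x(1)] .
  have h: "h \<star> x \<ominus> sc c x \<in> N"
    if hU: "h \<in> carrier U" and hw: "h \<odot>\<^bsub>?C\<^esub> w = uq_scalar \<alpha> q c \<odot>\<^bsub>?C\<^esub> w" for h c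
  proof (rule factor_equal[OF f submoduleD(6)[OF A hU x(1)] submoduleD(6)[OF A U_closed(7) x(1)]])
    fix u assume u: "u \<in> carrier U"
    have "rep \<xi> (h \<star> x) = rep \<xi> (sc c x)"
      using hw rep_act[OF xc hU, of \<nu> \<xi>] rep_act[OF xc U_closed(7), of \<nu> c \<xi>] x(2) by simp
    thus "\<xi> (u \<star> h \<star> x) = \<xi> (u \<star> sc c x)" using u by (auto simp: rep_def fun_eq_iff split: if_splits)
  qed
  have pN: "pr x \<mu> \<in> N" if \<mu>: "\<mu> \<in> weights \<alpha>" "\<mu> \<noteq> \<kappa>" for \<mu>
  proof -
    have hp: "pr x \<mu> \<in> N"
      if hU: "h \<in> carrier U" and hw: "h \<odot>\<^bsub>?C\<^esub> w = uq_scalar \<alpha> q (e \<kappa>) \<odot>\<^bsub>?C\<^esub> w"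
        and hT: "\<And>\<mu> y. \<mu> \<in> weights \<alpha> \<Longrightarrow> y \<in> Wt \<mu> \<Longrightarrow> h \<star> y = sc (e \<mu>) y" and ne: "e \<mu> \<noteq> e \<kappa>" for h e
    proof -
      have "pr (h \<star> x \<ominus> sc (e \<kappa>) x) \<mu> \<in> N" by (rule pr_sub[OF N h[OF hU hw]])
      moreover have "h \<star> x \<ominus> sc (e \<kappa>) x = h \<star> x \<oplus> sc (- e \<kappa>) x"
        using xc hU by (simp add: a_minus_def K.sc_uminus[symmetric] K.sc_sc)
      moreover have "pr (h \<star> x) (\<mu> + 0) = h \<star> pr x \<mu>"
        by (rule pr_shift[OF hU _ xc]) (use hT Wt_sc in auto)
      ultimately have "sc (e \<mu>) (pr x \<mu>) \<oplus> sc (- e \<kappa>) (pr x \<mu>) \<in> N"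
        using xc hU hT[OF \<mu>(1) pr(1)[OF xc]] by (simp add: pr_add pr_sc)
      hence m: "sc (e \<mu> - e \<kappa>) (pr x \<mu>) \<in> N" using K.sc_add_left[of "pr x \<mu>" "e \<mu>" "- e \<kappa>"] xc by simp
      have "sc (1 / (e \<mu> - e \<kappa>)) (sc (e \<mu> - e \<kappa>) (pr x \<mu>)) \<in> N" using submoduleD(6)[OF N _ m] by simp
      thus ?thesis using ne xc by (simp add: K.sc_sc)
    qed
    have "\<exists>i. K_value \<alpha> q \<mu> i \<noteq> K_value \<alpha> q \<kappa> i \<or>
        (\<exists>t. chi i (weight_coeff \<alpha> \<mu> i) t \<noteq> chi i (weight_coeff \<alpha> \<kappa> i) t)"
    proof (rule ccontr)
      assume "\<not> ?thesis"
      hence "weight_coeff \<alpha> \<mu> i = weight_coeff \<alpha> \<kappa> i" for i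
        by (intro chi_inj) (auto simp: K_value_def)
      thus False using weights_eqI[OF \<mu>(1) \<kappa>] \<mu>(2) by auto
    qed
    then obtain i t where "K_value \<alpha> q \<mu> i \<noteq> K_value \<alpha> q \<kappa> i \<or>
      chi i (weight_coeff \<alpha> \<mu> i) t \<noteq> chi i (weight_coeff \<alpha> \<kappa> i) t" by blast
    thus ?thesis
    proof
      assume "K_value \<alpha> q \<mu> i \<noteq> K_value \<alpha> q \<kappa> i"
      thus ?thesis using hp[of "uq_K \<alpha> q i" "\<lambda>\<mu>. K_value \<alpha> q \<mu> i"] WtD(2) C.WtD(2)[OF w(2)] by blast
    next
      assume "chi i (weight_coeff \<alpha> \<mu> i) t \<noteq> chi i (weight_coeff \<alpha> \<kappa> i) t"
      thus ?thesis using hp[of "uq_Kbinom \<alpha> q i t" "\<lambda>\<mu>. chi i (weight_coeff \<alpha> \<mu> i) t"] WtD(4) C.WtD(4)[OF w(2)]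
        by blast
    qed
  qed
  have pA: "pr x \<mu> \<in> A" for \<mu> by (rule pr_sub[OF A x(1)])
  have "x \<ominus> pr x \<kappa> \<in> N"
  proof -
    have "(\<Oplus>\<mu>\<in>Om. pr (x \<ominus> pr x \<kappa>) \<mu>) \<in> N"
    proof (rule finsum_in_submodule[OF N Om(1)])
      fix \<mu> assume "\<mu> \<in> Om"
      hence \<mu>: "\<mu> \<in> weights \<alpha>" using Om(2) by blast
      have "pr (x \<ominus> pr x \<kappa>) \<mu> = pr x \<mu> \<oplus> sc (- 1) (if \<mu> = \<kappa> then pr x \<kappa> else \<zero>)"
        using xc pr_add[of x "sc (- 1) (pr x \<kappa>)" \<mu>] pr_sc[of "pr x \<kappa>" "- 1" \<mu>] pr_weight[OF pr(1)[OF xc] \<kappa>, of \<mu>]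
        by (simp add: a_minus_def K.sc_uminus[symmetric])
      thus "pr (x \<ominus> pr x \<kappa>) \<mu> \<in> N"
        using pN[OF \<mu>] xc submoduleD(2)[OF N] by (cases "\<mu> = \<kappa>") (simp_all add: K.sc_uminus M.r_neg)
    qed
    thus ?thesis using pr(3)[of "x \<ominus> pr x \<kappa>"] xc by (simp add: a_minus_def)
  qed
  hence "\<xi> (u \<star> x) = \<xi> (u \<star> pr x \<kappa>)" if "u \<in> carrier U" for u
  proof -
    assume n: "x \<ominus> pr x \<kappa> \<in> N"
    have "\<xi> (u \<star> (x \<ominus> pr x \<kappa>)) = 0" using n factorD(5,6)[OF f] that by blast
    thus ?thesis
      using that xc submoduleD(6)[OF A that x(1)] submoduleD(6)[OF A that pA]
        K.klin_minus[OF sub_ksub[OF A] factorD(8)[OF f]] by (simp add: smult_minus_right)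
  qed
  hence "w = rep \<xi> (pr x \<kappa>)" unfolding x(2) by (auto simp: rep_def)
  thus ?thesis using pA pr(1)[OF xc] by blast
qed

text \<open>The weight space of \<open>A\<close> maps onto that of the dual Weyl module, with kernel the
  weight space of \<open>N\<close>.\<close>

lemma factor_dim:
  assumes f: "factor N A \<nu> \<xi>" and \<kappa>: "\<kappa> \<in> weights \<alpha>" and n: "K.kdim (N \<inter> Wt \<kappa>) n"
  shows "K.kdim (A \<inter> Wt \<kappa>) (n + dw_dim \<nu> \<kappa>)"
proof -
  let ?C = "coinduced_module \<alpha> q \<nu>"
  let ?V = "carrier (dual_weyl \<alpha> q \<nu>) \<inter> weight_space \<alpha> q ?C \<kappa>"
  interpret C: weight_module \<Phi> \<alpha> q ?C by (rule coinduced_weight_module)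
  note A = factorD(2)[OF f] and N = factorD(1)[OF f] and c = factorD(4)[OF f]
  have kA: "K.ksub (A \<inter> Wt \<kappa>)" using K.ksub_Int[OF sub_ksub[OF A] Wt_ksub] .
  have g: "rep \<xi> x \<in> carrier ?C" "rep \<xi> x \<in> ?V" if "x \<in> A \<inter> Wt \<kappa>" for x
  proof -
    show rc: "rep \<xi> x \<in> carrier ?C" using rep_coinduced[OF A c] that by blast
    have xc: "x \<in> carrier T" using that WtD(1) by blast
    have "rep \<xi> x \<in> weight_space \<alpha> q ?C \<kappa>"
      using that rc rep_act[OF xc, of _ \<nu> \<xi>] WtD(2,4)[of x \<kappa>] by (intro C.WtI) (simp_all del: coinduced_simps)
    thus "rep \<xi> x \<in> ?V" using rep_dual_weyl[OF A c] that by blast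
  qed
  have g3: "rep \<xi> (sc a x) = uq_scalar \<alpha> q a \<odot>\<^bsub>?C\<^esub> rep \<xi> x" if "x \<in> A \<inter> Wt \<kappa>" for a x
  proof -
    have "x \<in> carrier T" using that WtD(1) by blast
    from rep_act[OF this U_closed(7), of \<nu> a \<xi>] show ?thesis by (rule sym)
  qed
  have g2: "rep \<xi> (x \<oplus> y) = rep \<xi> x \<oplus>\<^bsub>?C\<^esub> rep \<xi> y" if "x \<in> A \<inter> Wt \<kappa>" "y \<in> A \<inter> Wt \<kappa>" for x y
    using rep_add[OF A c] that by blast
  have surj: "rep \<xi> ` (A \<inter> Wt \<kappa>) = ?V" using g(2) factor_weight_lift[OF f \<kappa>] by blast
  have ker: "{x \<in> A \<inter> Wt \<kappa>. rep \<xi> x = \<zero>\<^bsub>?C\<^esub>} = N \<inter> Wt \<kappa>"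
    using factorD(5,6)[OF f] by (auto simp: rep_def fun_eq_iff)
  obtain a where a: "K.kdim (A \<inter> Wt \<kappa>) a" using kdim_Wt[OF A] by blast
  obtain m where m: "C.K.kdim ?V m"
    using kdim_image[OF K.kspace_axioms C.K.kspace_axioms kA g(1) g2 g3 a subset_refl] surj by auto
  have "dw_dim \<nu> \<kappa> = m" unfolding dw_dim_def using m C.K.kdim_unique by (intro the_equality)
  moreover have "K.kdim {x \<in> A \<inter> Wt \<kappa>. rep \<xi> x \<in> ?V} (n + m)"
    by (rule kdim_preimage[OF K.kspace_axioms C.K.kspace_axioms kA g(1) g2 g3 _ m])
      (use ker n surj in auto)
  moreover have "{x \<in> A \<inter> Wt \<kappa>. rep \<xi> x \<in> ?V} = A \<inter> Wt \<kappa>" using g(2) by blast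
  ultimately show ?thesis by simp
qed

lemma dw_dim_bound:
  assumes f: "factor N A \<nu> \<xi>" and \<kappa>: "\<kappa> \<in> weights \<alpha>" and d: "dw_dim \<nu> \<kappa> \<noteq> 0"
  shows "\<kappa> = \<nu> \<or> ht \<kappa> < ht \<nu>" "N \<noteq> A"
proof -
  obtain n where n: "K.kdim (N \<inter> Wt \<kappa>) n" using kdim_Wt[OF factorD(1)[OF f]] by blast
  have "N \<inter> Wt \<kappa> \<noteq> A \<inter> Wt \<kappa>"
  proof
    assume "N \<inter> Wt \<kappa> = A \<inter> Wt \<kappa>"
    with factor_dim[OF f \<kappa> n] have "K.kdim (N \<inter> Wt \<kappa>) (n + dw_dim \<nu> \<kappa>)" by metis
    from K.kdim_unique[OF this n] show False using d by simp
  qed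
  thus "N \<noteq> A" by blast
  obtain x where x: "x \<in> A" "x \<in> Wt \<kappa>" "x \<notin> N" using \<open>N \<inter> Wt \<kappa> \<noteq> A \<inter> Wt \<kappa>\<close> factorD(5)[OF f] by blast
  show "\<kappa> = \<nu> \<or> ht \<kappa> < ht \<nu>" using factor_weights[OF f x(1,2) \<kappa> x(3)] by blast
qed

lemma dw_dim_self:
  assumes f: "factor N A \<nu> \<xi>" and ne: "N \<noteq> A"
  shows "dw_dim \<nu> \<nu> = 1"
proof -
  note A = factorD(2)[OF f] and N = factorD(1)[OF f]
  obtain n where n: "K.kdim (N \<inter> Wt \<nu>) n" using kdim_Wt[OF N] by blast
  obtain y where y: "y \<in> A" "y \<in> Wt \<nu>" "\<xi> y \<noteq> 0"
    using factor_socle[OF f A subset_refl] ne factorD(5)[OF f] by blast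
  have yN: "y \<notin> N \<inter> Wt \<nu>" using factor_zero[OF f] y by blast
  have kN: "K.ksub (N \<inter> Wt \<nu>)" "K.ksub (A \<inter> Wt \<nu>)" using K.ksub_Int[OF sub_ksub Wt_ksub] N A by auto
  have yc: "y \<in> carrier T" using y WtD(1) by blast
  have "A \<inter> Wt \<nu> = K.adjoin (N \<inter> Wt \<nu>) y"
  proof
    show "K.adjoin (N \<inter> Wt \<nu>) y \<subseteq> A \<inter> Wt \<nu>" using factorD(5)[OF f] y by (intro K.adjoin_least[OF kN(2)]) auto
    show "A \<inter> Wt \<nu> \<subseteq> K.adjoin (N \<inter> Wt \<nu>) y"
    proof
      fix x assume x: "x \<in> A \<inter> Wt \<nu>"
      let ?c = "\<xi> x / \<xi> y" let ?z = "x \<ominus> sc ?c y"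
      have cy: "sc ?c y \<in> A \<inter> Wt \<nu>" using K.ksubD(4)[OF kN(2)] y by blast
      have z: "?z \<in> A \<inter> Wt \<nu>" using K.ksubD(6)[OF kN(2) x cy] .
      have "\<xi> ?z = 0"
        using K.klin_minus[OF sub_ksub[OF A] factorD(8)[OF f], of x "sc ?c y"] K.klinD(2)[OF factorD(8)[OF f] y(1)] x cy y
        by simp
      hence "?z \<in> N \<inter> Wt \<nu>" using factor_top_line[OF f] z by blast
      moreover have "x = ?z \<oplus> sc ?c y" using x WtD(1) yc by (auto simp: a_minus_def M.a_assoc M.l_neg)
      ultimately show "x \<in> K.adjoin (N \<inter> Wt \<nu>) y" unfolding K.adjoin_def by blast
    qed
  qed
  hence "K.kdim (A \<inter> Wt \<nu>) (Suc n)" using K.kdim_Suc[OF n yc yN] by simp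
  hence "n + dw_dim \<nu> \<nu> = Suc n" using factor_dim[OF f factorD(3)[OF f] n] K.kdim_unique by blast
  thus ?thesis by simp
qed

lemma filt_dim:
  assumes F: "filt k N \<nu> \<xi>" and \<kappa>: "\<kappa> \<in> weights \<alpha>"
  shows "K.kdim (Wt \<kappa>) (\<Sum>j<k. dw_dim (\<nu> j) \<kappa>)"
proof -
  have "K.kdim (N j \<inter> Wt \<kappa>) (\<Sum>i<j. dw_dim (\<nu> i) \<kappa>)" if "j \<le> k" for j
    using that
  proof (induction j)
    case 0
    have "N 0 \<inter> Wt \<kappa> = {\<zero>}" using F by (auto simp: filt_def)
    thus ?case using K.kdim_zero by simp
  next
    case (Suc j)
    hence "factor (N j) (N (Suc j)) (\<nu> j) (\<xi> j)" using F by (simp add: filt_def)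
    from factor_dim[OF this \<kappa>] show ?case using Suc by simp
  qed
  from this[of k] have "K.kdim (carrier T \<inter> Wt \<kappa>) (\<Sum>j<k. dw_dim (\<nu> j) \<kappa>)" using F by (simp add: filt_def)
  moreover have "carrier T \<inter> Wt \<kappa> = Wt \<kappa>" using WtD(1) by blast
  ultimately show ?thesis by simp
qed

definition mult_label :: "nat \<Rightarrow> (nat \<Rightarrow> 'm set) \<Rightarrow> (nat \<Rightarrow> 'e) \<Rightarrow> 'e \<Rightarrow> nat" where
  "mult_label k N \<nu> \<kappa> = card {j. j < k \<and> N j \<noteq> N (Suc j) \<and> \<nu> j = \<kappa>}"

lemma mult_label_pos: "mult_label k N \<nu> \<kappa> > 0 \<longleftrightarrow> \<kappa> \<in> labels k N \<nu>"
proof -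
  have "finite {j. j < k \<and> N j \<noteq> N (Suc j) \<and> \<nu> j = \<kappa>}" by simp
  thus ?thesis unfolding mult_label_def labels_def card_gt_0_iff by blast
qed

lemma filt_dim_labels:
  assumes F: "filt k N \<nu> \<xi>" and \<kappa>: "\<kappa> \<in> weights \<alpha>" and L: "finite L" "labels k N \<nu> \<subseteq> L"
  shows "(\<Sum>j<k. dw_dim (\<nu> j) \<kappa>) = (\<Sum>la\<in>L. mult_label k N \<nu> la * dw_dim la \<kappa>)"
proof -
  let ?J = "{j. j < k \<and> N j \<noteq> N (Suc j)}"
  have "(\<Sum>j<k. dw_dim (\<nu> j) \<kappa>) = (\<Sum>j\<in>?J. dw_dim (\<nu> j) \<kappa>)"
  proof (rule sum.mono_neutral_right)
    show "\<forall>j\<in>{..<k} - ?J. dw_dim (\<nu> j) \<kappa> = 0"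
    proof
      fix j assume j: "j \<in> {..<k} - ?J"
      hence "factor (N j) (N (Suc j)) (\<nu> j) (\<xi> j)" using F unfolding filt_def by blast
      from dw_dim_bound(2)[OF this \<kappa>] show "dw_dim (\<nu> j) \<kappa> = 0" using j by blast
    qed
  qed auto
  also have "\<dots> = (\<Sum>la\<in>L. \<Sum>j\<in>{j\<in>?J. \<nu> j = la}. dw_dim (\<nu> j) \<kappa>)"
    by (rule sum.group[symmetric]) (use L in \<open>auto simp: labels_def\<close>)
  also have "\<dots> = (\<Sum>la\<in>L. mult_label k N \<nu> la * dw_dim la \<kappa>)"
    by (intro sum.cong refl) (simp add: mult_label_def conj_assoc)
  finally show ?thesis .
qed

lemma labels_facts:
  assumes F: "filt k N \<nu> \<xi>" and l: "la \<in> labels k N \<nu>"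
  shows "la \<in> weights \<alpha>" "dw_dim la la = 1" "\<And>\<kappa>. \<kappa> \<in> weights \<alpha> \<Longrightarrow> dw_dim la \<kappa> \<noteq> 0 \<Longrightarrow> \<kappa> = la \<or> ht \<kappa> < ht la"
proof -
  obtain j where j: "j < k" "N j \<noteq> N (Suc j)" "la = \<nu> j" using l by (auto simp: labels_def)
  have f: "factor (N j) (N (Suc j)) la (\<xi> j)" using F j by (simp add: filt_def)
  show "la \<in> weights \<alpha>" "dw_dim la la = 1" "\<And>\<kappa>. \<kappa> \<in> weights \<alpha> \<Longrightarrow> dw_dim la \<kappa> \<noteq> 0 \<Longrightarrow> \<kappa> = la \<or> ht \<kappa> < ht la"
    using factorD(3)[OF f] dw_dim_self[OF f j(2)] dw_dim_bound(1)[OF f] by blast+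
qed

end

text \<open>The characters of the dual Weyl modules are unitriangular with respect to height, so the
  multiplicities can be read off from the dimensions of the weight spaces.\<close>

lemma labels_determined:
  assumes M: "fd_module \<Phi> \<alpha> q M" and S: "fd_module \<Phi> \<alpha> q S"
    and F: "fd_module.filt \<alpha> q M k N \<nu> \<xi>" and F': "fd_module.filt \<alpha> q S k' N' \<nu>' \<xi>'"
    and dim: "\<And>\<kappa> n n'. \<kappa> \<in> weights \<alpha> \<Longrightarrow>
       kspace.kdim M (\<lambda>c x. uq_scalar \<alpha> q c \<odot>\<^bsub>M\<^esub> x) (weight_space \<alpha> q M \<kappa>) n \<Longrightarrow>
       kspace.kdim S (\<lambda>c x. uq_scalar \<alpha> q c \<odot>\<^bsub>S\<^esub> x) (weight_space \<alpha> q S \<kappa>) n' \<Longrightarrow> n = n'"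
  shows "fd_module.labels k N \<nu> = fd_module.labels k' N' \<nu>'"
proof -
  interpret M: fd_module \<Phi> \<alpha> q M by (rule M)
  interpret S: fd_module \<Phi> \<alpha> q S by (rule S)
  let ?m = "M.mult_label k N \<nu>" and ?m' = "S.mult_label k' N' \<nu>'"
  let ?L = "M.labels k N \<nu> \<union> S.labels k' N' \<nu>'"
  have fin: "finite ?L" unfolding M.labels_def S.labels_def by auto
  have L: "la \<in> weights \<alpha>" "M.dw_dim la la = 1" "\<And>\<kappa>. \<kappa> \<in> weights \<alpha> \<Longrightarrow> M.dw_dim la \<kappa> \<noteq> 0 \<Longrightarrow> \<kappa> = la \<or> M.ht \<kappa> < M.ht la"
    if "la \<in> ?L" for la
    using that M.labels_facts[OF F] S.labels_facts[OF F'] by blast+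
  have eq: "(\<Sum>la\<in>?L. ?m la * M.dw_dim la \<kappa>) = (\<Sum>la\<in>?L. ?m' la * M.dw_dim la \<kappa>)" if "\<kappa> \<in> weights \<alpha>" for \<kappa>
    using M.filt_dim_labels[OF F that fin] S.filt_dim_labels[OF F' that fin]
      dim[OF that M.filt_dim[OF F that] S.filt_dim[OF F' that]] by simp
  (* At a label of greatest height among those with different multiplicities, the other labels that
     contribute to the weight space are higher, so their multiplicities agree. *)
  have "?m la = ?m' la" if "la \<in> ?L" for la
  proof (rule ccontr)
    assume "?m la \<noteq> ?m' la"

    let ?D = "{la\<in>?L. ?m la \<noteq> ?m' la}"
    have D: "finite (M.ht ` ?D)" "M.ht ` ?D \<noteq> {}" using fin that \<open>?m la \<noteq> ?m' la\<close> by auto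
    from Max_in[OF D] obtain \<kappa> where "Max (M.ht ` ?D) = M.ht \<kappa>" "\<kappa> \<in> ?D" by (rule imageE)
    hence \<kappa>: "\<kappa> \<in> ?L" "?m \<kappa> \<noteq> ?m' \<kappa>"
      and max: "\<And>la. la \<in> ?L \<Longrightarrow> ?m la \<noteq> ?m' la \<Longrightarrow> M.ht la \<le> M.ht \<kappa>"
      using Max_ge[OF D(1)] by auto
    have \<kappa>w: "\<kappa> \<in> weights \<alpha>" using L(1)[OF \<kappa>(1)] .
    have split: "(\<Sum>la\<in>?L. f la * M.dw_dim la \<kappa>) = f \<kappa> + (\<Sum>la\<in>?L - {\<kappa>}. f la * M.dw_dim la \<kappa>)" for f :: "'a \<Rightarrow> nat"
      using sum.remove[OF fin \<kappa>(1), of "\<lambda>la. f la * M.dw_dim la \<kappa>"] L(2)[OF \<kappa>(1)] by simp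
    have "(\<Sum>la\<in>?L - {\<kappa>}. ?m la * M.dw_dim la \<kappa>) = (\<Sum>la\<in>?L - {\<kappa>}. ?m' la * M.dw_dim la \<kappa>)"
    proof (rule sum.cong[OF refl])
      fix la assume la: "la \<in> ?L - {\<kappa>}"
      show "?m la * M.dw_dim la \<kappa> = ?m' la * M.dw_dim la \<kappa>"
      proof (cases "M.dw_dim la \<kappa> = 0")
        case False
        hence "M.ht \<kappa> < M.ht la" using L(3)[of la \<kappa>] la \<kappa>w by blast
        hence "?m la = ?m' la" using max[of la] la by fastforce
        thus ?thesis by simp
      qed simp
    qed
    thus False using eq[OF \<kappa>w] split[of ?m] split[of ?m'] \<kappa>(2) by simp
  qed
  hence "la \<in> M.labels k N \<nu> \<longleftrightarrow> la \<in> S.labels k' N' \<nu>'" if "la \<in> ?L" for la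
    using that M.mult_label_pos[of k N \<nu> la] S.mult_label_pos[of k' N' \<nu>' la] by simp
  thus ?thesis by blast
qed

section \<open>Semisimple modules\<close>

text \<open>The definitions of simple and semisimple modules concern module records that are not
  extended.\<close>

locale plain_module = left_module R M
  for M :: "('r, 'm) module" (structure) and R :: "('r, 's) ring_scheme" (structure)
begin

definition ssum :: "'m set set \<Rightarrow> 'm set" where
  "ssum S = {x. \<exists>f. (\<forall>N\<in>S. f N \<in> N) \<and> x = (\<Oplus>N\<in>S. f N)}"

definition indep :: "'m set set \<Rightarrow> bool" where
  "indep S \<longleftrightarrow> (\<forall>f. (\<forall>N\<in>S. f N \<in> N) \<and> (\<Oplus>N\<in>S. f N) = \<zero> \<longrightarrow> (\<forall>N\<in>S. f N = \<zero>))"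

abbreviation subm where "subm N \<equiv> submodule N R M"

lemma ssum_empty [simp]: "ssum {} = {\<zero>}"
  by (auto simp: ssum_def)

lemma ssum_insert:
  assumes S: "finite S" "N \<notin> S" and sub: "\<And>L. L \<in> insert N S \<Longrightarrow> subm L"
  shows "ssum (insert N S) = {x \<oplus> y | x y. x \<in> N \<and> y \<in> ssum S}"
proof -
  have sum: "(\<Oplus>L\<in>insert N S. f L) = f N \<oplus> (\<Oplus>L\<in>S. f L)" if "\<forall>L\<in>insert N S. f L \<in> L" for f
  proof -
    have "f \<in> S \<rightarrow> carrier M" "f N \<in> carrier M" using that sub submoduleD(1) by blast+
    thus ?thesis using S by (simp add: M.finsum_insert)
  qed
  show ?thesis
  proof (intro equalityI subsetI)
    fix x assume "x \<in> ssum (insert N S)"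
    then obtain f where f: "\<forall>L\<in>insert N S. f L \<in> L" "x = (\<Oplus>L\<in>insert N S. f L)" unfolding ssum_def by blast
    thus "x \<in> {x \<oplus> y | x y. x \<in> N \<and> y \<in> ssum S}" using sum[OF f(1)] unfolding ssum_def by blast
  next
    fix z assume "z \<in> {x \<oplus> y | x y. x \<in> N \<and> y \<in> ssum S}"
    then obtain x f where x: "x \<in> N" "\<forall>L\<in>S. f L \<in> L" "z = x \<oplus> (\<Oplus>L\<in>S. f L)" unfolding ssum_def by blast
    let ?f = "f(N := x)"
    have f: "\<forall>L\<in>insert N S. ?f L \<in> L" using x by auto
    have "f \<in> S \<rightarrow> carrier M" using x sub submoduleD(1) by blast
    hence "(\<Oplus>L\<in>S. ?f L) = (\<Oplus>L\<in>S. f L)" using S(2) by (intro M.finsum_cong') auto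
    hence "z = (\<Oplus>L\<in>insert N S. ?f L)" using sum[OF f] x by simp
    thus "z \<in> ssum (insert N S)" using f unfolding ssum_def by blast
  qed
qed

lemma subm_plus:
  assumes "subm A" "subm B" shows "subm {x \<oplus> y | x y. x \<in> A \<and> y \<in> B}"
proof (rule submoduleI)
  show "\<zero> \<in> {x \<oplus> y | x y. x \<in> A \<and> y \<in> B}"
    using submoduleD(2)[OF assms(1)] submoduleD(2)[OF assms(2)] M.l_zero[OF M.zero_closed, symmetric] by blast
next
  fix u v assume "u \<in> {x \<oplus> y | x y. x \<in> A \<and> y \<in> B}" "v \<in> {x \<oplus> y | x y. x \<in> A \<and> y \<in> B}"
  then obtain x y x' y' where *: "x \<in> A" "y \<in> B" "u = x \<oplus> y" "x' \<in> A" "y' \<in> B" "v = x' \<oplus> y'" by blast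
  hence "u \<oplus> v = (x \<oplus> x') \<oplus> (y \<oplus> y')"
    using submoduleD(1)[OF assms(1)] submoduleD(1)[OF assms(2)] by (simp add: M.a_ac)
  thus "u \<oplus> v \<in> {x \<oplus> y | x y. x \<in> A \<and> y \<in> B}"
    using * submoduleD(3)[OF assms(1)] submoduleD(3)[OF assms(2)] by blast
next
  fix a u assume a: "a \<in> carrier R" and "u \<in> {x \<oplus> y | x y. x \<in> A \<and> y \<in> B}"
  then obtain x y where *: "x \<in> A" "y \<in> B" "u = x \<oplus> y" by blast
  hence "a \<odot> u = a \<odot> x \<oplus> a \<odot> y"
    using a submoduleD(1)[OF assms(1)] submoduleD(1)[OF assms(2)] by (simp add: smult_r_distr)
  thus "a \<odot> u \<in> {x \<oplus> y | x y. x \<in> A \<and> y \<in> B}"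
    using * a submoduleD(6)[OF assms(1)] submoduleD(6)[OF assms(2)] by blast
qed (use submoduleD(1)[OF assms(1)] submoduleD(1)[OF assms(2)] in auto)

lemma ssum_subm: "finite S \<Longrightarrow> (\<And>L. L \<in> S \<Longrightarrow> subm L) \<Longrightarrow> subm (ssum S)"
proof (induction S rule: finite_induct)
  case empty
  show ?case by (simp, rule submoduleI) auto
next
  case (insert N S)
  have "subm {x \<oplus> y | x y. x \<in> N \<and> y \<in> ssum S}" by (rule subm_plus) (use insert in auto)
  thus ?case using ssum_insert[OF insert.hyps insert.prems] by simp
qed

lemma ssum_least: "finite S \<Longrightarrow> subm X \<Longrightarrow> (\<And>L. L \<in> S \<Longrightarrow> L \<subseteq> X) \<Longrightarrow> ssum S \<subseteq> X"
  unfolding ssum_def using finsum_in_submodule[of X S] by blast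

lemma ssum_mem: assumes S: "finite S" "\<And>L. L \<in> S \<Longrightarrow> subm L" "N \<in> S" shows "N \<subseteq> ssum S"
proof -
  have "S = insert N (S - {N})" using S by blast
  hence eq: "ssum S = {x \<oplus> y | x y. x \<in> N \<and> y \<in> ssum (S - {N})}"
    using ssum_insert[of "S - {N}" N] S by simp
  have "subm (ssum (S - {N}))" by (rule ssum_subm) (use S in auto)
  hence "\<zero> \<in> ssum (S - {N})" by (rule submoduleD(2))
  thus ?thesis unfolding eq using submoduleD(1)[OF S(2)[OF S(3)]] by (auto intro!: exI[of _ "\<zero>"] exI)
qed

lemma simple_subm: "simple_submodule R M N \<Longrightarrow> subm N"
  by (simp add: simple_submodule_def)

text \<open>Take a maximal subfamily that is independent and whose sum meets the submodule trivially. A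
  simple submodule outside the sum of both could be added to it.\<close>

lemma semisimple_complement:
  assumes S: "finite S" "\<And>N. N \<in> S \<Longrightarrow> simple_submodule R M N" "ssum S = carrier M" and N0: "subm N0"
  obtains S' where "S' \<subseteq> S" "indep S'" "N0 \<inter> ssum S' = {\<zero>}"
    "\<And>x. x \<in> carrier M \<Longrightarrow> \<exists>n\<in>N0. \<exists>y\<in>ssum S'. x = n \<oplus> y"
proof -
  let ?P = "\<lambda>S'. S' \<subseteq> S \<and> indep S' \<and> N0 \<inter> ssum S' = {\<zero>}"
  have "?P {}" using submoduleD(2)[OF N0] by (auto simp: indep_def)
  moreover have bound: "\<And>S'. ?P S' \<Longrightarrow> card S' \<le> card S" using S(1) by (simp add: card_mono)
  ultimately obtain S' where S': "?P S'" and max: "\<And>S''. ?P S'' \<Longrightarrow> card S'' \<le> card S'"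
    using ex_has_greatest_nat[of ?P "{}" card "Suc (card S)"] by (metis le_imp_less_Suc)
  have fin: "finite S'" using S' S(1) finite_subset by blast
  have sub: "\<And>L. L \<in> S' \<Longrightarrow> subm L" using S' S(2) simple_subm by blast
  have sS': "subm (ssum S')" by (rule ssum_subm[OF fin sub])
  let ?X = "{n \<oplus> y | n y. n \<in> N0 \<and> y \<in> ssum S'}"
  have X: "subm ?X" by (rule subm_plus[OF N0 sS'])
  have "N \<subseteq> ?X" if N: "N \<in> S" for N
  proof (rule ccontr)
    assume nX: "\<not> N \<subseteq> ?X"
    have sN: "subm N" using N S(2) simple_subm by blast
    have yX: "y \<in> ?X" if "y \<in> ssum S'" for y
    proof -
      have "y = \<zero> \<oplus> y" using submoduleD(1)[OF sS' that] by simp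
      thus ?thesis using that submoduleD(2)[OF N0] by blast
    qed
    have nS': "N \<notin> S'" using nX ssum_mem[OF fin sub] yX by blast
    have "subm (N \<inter> ?X)" by (rule submoduleI) (use submoduleD[OF sN] submoduleD[OF X] in auto)
    hence "N \<inter> ?X = {\<zero>} \<or> N \<inter> ?X = N"
      using S(2)[OF N] unfolding simple_submodule_def by blast
    hence zero: "N \<inter> ?X = {\<zero>}" using nX by blast
    have ins: "ssum (insert N S') = {x \<oplus> y | x y. x \<in> N \<and> y \<in> ssum S'}"
      using ssum_insert[OF fin nS'] sN sub by blast
    have "indep (insert N S')"
      unfolding indep_def
    proof (intro allI impI)
      fix f assume f: "(\<forall>L\<in>insert N S'. f L \<in> L) \<and> (\<Oplus>L\<in>insert N S'. f L) = \<zero>"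
      have c: "f \<in> S' \<rightarrow> carrier M" "f N \<in> carrier M" using f sN sub submoduleD(1) by blast+
      let ?y = "\<Oplus>L\<in>S'. f L"
      have y: "?y \<in> ssum S'" using f unfolding ssum_def by blast
      have s: "f N \<oplus> ?y = \<zero>" using f c fin nS' by (simp add: M.finsum_insert)
      hence "f N = \<ominus> ?y" using c M.minus_equality[of "f N" ?y] by simp
      hence "f N \<in> N \<inter> ?X" using f yX[OF submoduleD(4)[OF sS' y]] by simp
      hence fN: "f N = \<zero>" using zero by blast
      hence "?y = \<zero>" using s c by simp
      hence "\<forall>L\<in>S'. f L = \<zero>" using S' f unfolding indep_def by blast
      thus "\<forall>L\<in>insert N S'. f L = \<zero>" using fN by blast
    qed
    moreover have "N0 \<inter> ssum (insert N S') = {\<zero>}"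
    proof -
      have "z = \<zero>" if z: "z \<in> N0" "z \<in> ssum (insert N S')" for z
      proof -
        obtain x y where xy: "x \<in> N" "y \<in> ssum S'" "z = x \<oplus> y" using z(2) ins by blast
        have c: "x \<in> carrier M" "y \<in> carrier M" using xy submoduleD(1)[OF sN] submoduleD(1)[OF sS'] by auto
        have "x = z \<oplus> \<ominus> y" using xy c by (simp add: M.a_assoc M.r_neg)
        moreover have "z \<oplus> \<ominus> y \<in> ?X" using z(1) submoduleD(4)[OF sS' xy(2)] by blast
        ultimately have "x = \<zero>" using zero xy(1) by blast
        hence "z = y" using xy c by simp
        thus ?thesis using S' z(1) xy(2) by blast
      qed
      moreover have "\<zero> \<in> ssum (insert N S')"
        using submoduleD(2)[OF ssum_subm[of "insert N S'"]] fin sub sN by blast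
      ultimately show ?thesis using submoduleD(2)[OF N0] by blast
    qed
    ultimately have "card (insert N S') \<le> card S'" using max[of "insert N S'"] S' N by blast
    thus False using fin nS' by simp
  qed
  hence "carrier M \<subseteq> ?X" using ssum_least[OF S(1) X] S(3) by blast
  thus ?thesis using that[of S'] S' by blast
qed

text \<open>Discard summands until the sum is direct; this is the complement of the zero submodule.\<close>

lemma semisimpleI:
  assumes S: "finite S" "\<And>N. N \<in> S \<Longrightarrow> simple_submodule R M N" "ssum S = carrier M"
  shows "semisimple_module R M"
proof -
  have "subm {\<zero>}" by (rule submoduleI) auto
  from semisimple_complement[OF S this] obtain S' where S': "S' \<subseteq> S" "indep S'"
    "\<And>x. x \<in> carrier M \<Longrightarrow> \<exists>n\<in>{\<zero>}. \<exists>y\<in>ssum S'. x = n \<oplus> y" by metis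
  have fin: "finite S'" using S' S(1) finite_subset by blast
  have sub: "\<And>L. L \<in> S' \<Longrightarrow> subm L" using S' S(2) simple_subm by blast
  have supp: "(\<Oplus>N\<in>{N. f N \<noteq> \<zero>}. f N) = (\<Oplus>N\<in>S'. f N)"
    if "\<forall>N\<in>S'. f N \<in> N" "\<forall>N. N \<notin> S' \<longrightarrow> f N = \<zero>" for f
  proof (rule M.add.finprod_mono_neutral_cong_left)
    show "f \<in> S' \<rightarrow> carrier M" using that(1) sub submoduleD(1) by blast
  qed (use that fin in auto)
  have "\<exists>!f. (\<forall>N\<in>S'. f N \<in> N) \<and> (\<forall>N. N \<notin> S' \<longrightarrow> f N = \<zero>) \<and>
        finite {N. f N \<noteq> \<zero>} \<and> m = (\<Oplus>N\<in>{N. f N \<noteq> \<zero>}. f N)" if m: "m \<in> carrier M" for m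
  proof (rule ex_ex1I)
    have "m \<in> ssum S'" using S'(3)[OF m] submoduleD(1)[OF ssum_subm[OF fin sub]] by auto
    then obtain f where f: "\<forall>N\<in>S'. f N \<in> N" "m = (\<Oplus>N\<in>S'. f N)" unfolding ssum_def by blast
    let ?f = "\<lambda>N. if N \<in> S' then f N else \<zero>"
    have "f \<in> S' \<rightarrow> carrier M" using f(1) sub submoduleD(1) by blast
    hence "(\<Oplus>N\<in>S'. ?f N) = m" unfolding f(2) by (intro M.finsum_cong') auto
    moreover have "finite {N. ?f N \<noteq> \<zero>}" by (rule finite_subset[OF _ fin]) auto
    ultimately show "\<exists>f. (\<forall>N\<in>S'. f N \<in> N) \<and> (\<forall>N. N \<notin> S' \<longrightarrow> f N = \<zero>) \<and>
        finite {N. f N \<noteq> \<zero>} \<and> m = (\<Oplus>N\<in>{N. f N \<noteq> \<zero>}. f N)"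
      using supp[of ?f] f(1) by (intro exI[of _ ?f]) auto
  next
    fix f g
    assume f: "(\<forall>N\<in>S'. f N \<in> N) \<and> (\<forall>N. N \<notin> S' \<longrightarrow> f N = \<zero>) \<and>
        finite {N. f N \<noteq> \<zero>} \<and> m = (\<Oplus>N\<in>{N. f N \<noteq> \<zero>}. f N)"
      and g: "(\<forall>N\<in>S'. g N \<in> N) \<and> (\<forall>N. N \<notin> S' \<longrightarrow> g N = \<zero>) \<and>
        finite {N. g N \<noteq> \<zero>} \<and> m = (\<Oplus>N\<in>{N. g N \<noteq> \<zero>}. g N)"
    have "f N \<in> carrier M \<and> g N \<in> carrier M" if "N \<in> S'" for N
      using that f g submoduleD(1)[OF sub[OF that]] by blast
    hence c: "f \<in> S' \<rightarrow> carrier M" "g \<in> S' \<rightarrow> carrier M" "(\<lambda>N. \<ominus> g N) \<in> S' \<rightarrow> carrier M"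
      by auto
    have sf: "m = (\<Oplus>N\<in>S'. f N)" and sg: "m = (\<Oplus>N\<in>S'. g N)" using supp f g by auto
    have neg: "(\<Oplus>N\<in>S'. \<ominus> g N) = (\<ominus>\<^bsub>R\<^esub> \<one>\<^bsub>R\<^esub>) \<odot> m"
      unfolding sg using smult_finsum_right[OF fin c(2), of "\<ominus>\<^bsub>R\<^esub> \<one>\<^bsub>R\<^esub>"] c(2)
      by (simp, intro M.finsum_cong') (auto simp: smult_uminus_left smult_one Pi_iff)
    have "(\<Oplus>N\<in>S'. f N \<oplus> \<ominus> g N) = m \<oplus> \<ominus> m"
      using M.finsum_addf[OF c(1) c(3)] sf neg m by (simp add: smult_uminus_left smult_one)
    also have "\<dots> = \<zero>" using m by (simp add: M.r_neg)
    finally have z: "(\<Oplus>N\<in>S'. f N \<oplus> \<ominus> g N) = \<zero>" .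
    have "\<forall>N\<in>S'. f N \<oplus> \<ominus> g N \<in> N"
    proof
      fix N assume N: "N \<in> S'"
      show "f N \<oplus> \<ominus> g N \<in> N"
        by (rule submoduleD(3)[OF sub[OF N] _ submoduleD(4)[OF sub[OF N]]]) (use f g N in auto)
    qed
    hence d: "\<forall>N\<in>S'. f N \<oplus> \<ominus> g N = \<zero>"
      using S'(2)[unfolded indep_def, rule_format, of "\<lambda>N. f N \<oplus> \<ominus> g N"] z by blast
    show "f = g"
    proof
      fix N
      show "f N = g N"
      proof (cases "N \<in> S'")
        case True
        have fg: "f N \<in> carrier M" "g N \<in> carrier M" using c True by auto
        hence "f N = (f N \<oplus> \<ominus> g N) \<oplus> g N" by (simp add: M.a_assoc M.l_neg)
        thus ?thesis using bspec[OF d True] fg by simp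
      next
        case False
        have "f N = \<zero>" using f False by blast
        moreover have "g N = \<zero>" using g False by blast
        ultimately show ?thesis by simp
      qed
    qed
  qed
  moreover have "\<forall>N\<in>S'. subgroup N (add_monoid M)" using sub by (simp add: submodule_def)
  ultimately have "internal_direct_sum M S' (\<lambda>N. N)" unfolding internal_direct_sum_def by simp
  moreover have "\<forall>N\<in>S'. simple_submodule R M N" using S S' by blast
  ultimately show ?thesis unfolding semisimple_module_def by blast
qed

text \<open>A finite generating set involves only finitely many of the simple summands.\<close>

lemma semisimpleE:
  assumes ss: "semisimple_module R M" and gen: "finite B" "B \<subseteq> carrier M"
    "\<And>X. subm X \<Longrightarrow> B \<subseteq> X \<Longrightarrow> X = carrier M"
  obtains S where "finite S" "\<And>N. N \<in> S \<Longrightarrow> simple_submodule R M N" "ssum S = carrier M"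
proof -
  obtain S where S: "\<forall>N\<in>S. simple_submodule R M N" "internal_direct_sum M S (\<lambda>N. N)"
    using ss unfolding semisimple_module_def by blast
  have "\<exists>F. finite F \<and> F \<subseteq> S \<and> b \<in> ssum F" if b: "b \<in> carrier M" for b
  proof -
    have "\<exists>!f. (\<forall>N\<in>S. f N \<in> N) \<and> (\<forall>N. N \<notin> S \<longrightarrow> f N = \<zero>) \<and>
        finite {N. f N \<noteq> \<zero>} \<and> b = (\<Oplus>N\<in>{N. f N \<noteq> \<zero>}. f N)"
      using S(2) b unfolding internal_direct_sum_def by blast
    then obtain f where f: "\<forall>N\<in>S. f N \<in> N" "\<forall>N. N \<notin> S \<longrightarrow> f N = \<zero>" "finite {N. f N \<noteq> \<zero>}"
      "b = (\<Oplus>N\<in>{N. f N \<noteq> \<zero>}. f N)" by (elim ex1E conjE)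
    have sS: "{N. f N \<noteq> \<zero>} \<subseteq> S" using f(2) by blast
    hence "b \<in> ssum {N. f N \<noteq> \<zero>}" unfolding ssum_def using f(1,4) by (intro CollectI exI[of _ f]) auto
    thus ?thesis using f(3) sS by blast
  qed
  then obtain F where F: "\<And>b. b \<in> carrier M \<Longrightarrow> finite (F b) \<and> F b \<subseteq> S \<and> b \<in> ssum (F b)" by metis
  let ?F = "\<Union>b\<in>B. F b"
  have fin: "finite ?F" "?F \<subseteq> S" using gen F by blast+
  have sub: "\<And>L. L \<in> ?F \<Longrightarrow> subm L" using fin S(1) simple_subm by blast
  have sF: "subm (ssum ?F)" by (rule ssum_subm[OF fin(1) sub])
  have "B \<subseteq> ssum ?F"
  proof
    fix b assume b: "b \<in> B"
    have "ssum (F b) \<subseteq> ssum ?F"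
      by (rule ssum_least[OF _ sF]) (use F gen b ssum_mem[OF fin(1) sub] in blast)+
    thus "b \<in> ssum ?F" using F gen b by blast
  qed
  thus ?thesis using that[of ?F] gen(3)[OF sF] fin S(1) by blast
qed

definition complement :: "'m set \<Rightarrow> 'm set \<Rightarrow> bool" where
  "complement A C \<longleftrightarrow> subm A \<and> subm C \<and> A \<inter> C = {\<zero>} \<and> (\<forall>x\<in>carrier M. \<exists>a\<in>A. \<exists>c\<in>C. x = a \<oplus> c)"

lemma complement_unique:
  assumes AC: "complement A C" and "a \<in> A" "c \<in> C" "a' \<in> A" "c' \<in> C" "a \<oplus> c = a' \<oplus> c'"
  shows "a = a'" "c = c'"
proof -
  have A: "subm A" and C: "subm C" and z: "A \<inter> C = {\<zero>}" using AC by (auto simp: complement_def)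
  have cs: "a \<in> carrier M" "c \<in> carrier M" "a' \<in> carrier M" "c' \<in> carrier M"
    using assms submoduleD(1)[OF A] submoduleD(1)[OF C] by auto
  have "a = (a \<oplus> c) \<ominus> c" using cs by (simp add: M.a_assoc M.r_neg a_minus_def)
  also have "\<dots> = (c' \<ominus> c) \<oplus> a'"
    unfolding assms(6) using cs by (simp add: M.a_ac a_minus_def)
  finally have "a \<ominus> a' = ((c' \<ominus> c) \<oplus> a') \<ominus> a'" by simp
  hence eq: "a \<ominus> a' = c' \<ominus> c" using cs by (simp add: M.a_assoc M.r_neg a_minus_def)
  have "a \<ominus> a' \<in> A" "c' \<ominus> c \<in> C" using assms submoduleD(5)[OF A] submoduleD(5)[OF C] by auto
  hence "a \<ominus> a' \<in> A \<inter> C" using eq by simp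
  hence "a \<ominus> a' = \<zero>" using z by blast
  hence "(a \<ominus> a') \<oplus> a' = a'" using cs by simp
  thus a: "a = a'" using cs by (simp add: a_minus_def M.a_assoc M.l_neg)
  thus "c = c'" using assms cs by simp
qed

lemma extend_by_zero:
  assumes AC: "complement A C" and g: "\<And>x. x \<in> A \<Longrightarrow> g x \<in> carrier M"
    "\<And>x y. x \<in> A \<Longrightarrow> y \<in> A \<Longrightarrow> g (x \<oplus> y) = g x \<oplus> g y"
    "\<And>a x. a \<in> carrier R \<Longrightarrow> x \<in> A \<Longrightarrow> g (a \<odot> x) = a \<odot> g x"
  obtains \<phi> where "\<phi> \<in> module_hom_set R M M" "\<And>x c. x \<in> A \<Longrightarrow> c \<in> C \<Longrightarrow> \<phi> (x \<oplus> c) = g x"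
proof -
  have A: "subm A" and C: "subm C" using AC by (auto simp: complement_def)
  define p where "p x = (SOME a. a \<in> A \<and> (\<exists>c\<in>C. x = a \<oplus> c))" for x
  have p: "p (a \<oplus> c) = a" if "a \<in> A" "c \<in> C" for a c
  proof -
    have "p (a \<oplus> c) \<in> A \<and> (\<exists>c'\<in>C. a \<oplus> c = p (a \<oplus> c) \<oplus> c')"
      unfolding p_def by (rule someI[of _ a]) (use that in blast)
    thus ?thesis using complement_unique(1)[OF AC] that by metis
  qed
  define \<phi> where "\<phi> = (\<lambda>x\<in>carrier M. g (p x))"
  have v: "\<phi> (a \<oplus> c) = g a" if "a \<in> A" "c \<in> C" for a c
    using that p submoduleD(1)[OF A] submoduleD(1)[OF C] by (simp add: \<phi>_def)
  have dec: "\<exists>a\<in>A. \<exists>c\<in>C. x = a \<oplus> c" if "x \<in> carrier M" for x using AC that by (auto simp: complement_def)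
  have "\<phi> \<in> module_hom_set R M M"
    unfolding module_hom_set_def
  proof (intro CollectI conjI ballI)
    show "\<phi> \<in> carrier M \<rightarrow>\<^sub>E carrier M"
    proof (rule PiE_I)
      fix x assume "x \<in> carrier M"
      thus "\<phi> x \<in> carrier M" using dec v g(1) by metis
    qed (simp add: \<phi>_def)
  next
    fix x y assume "x \<in> carrier M" "y \<in> carrier M"
    then obtain a c a' c' where *: "a \<in> A" "c \<in> C" "x = a \<oplus> c" "a' \<in> A" "c' \<in> C" "y = a' \<oplus> c'" using dec by metis
    hence "x \<oplus> y = (a \<oplus> a') \<oplus> (c \<oplus> c')"
      using submoduleD(1)[OF A] submoduleD(1)[OF C] by (simp add: M.a_ac)
    thus "\<phi> (x \<oplus> y) = \<phi> x \<oplus> \<phi> y"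
      using * v g(2) submoduleD(3)[OF A] submoduleD(3)[OF C] by simp
  next
    fix r x assume r: "r \<in> carrier R" and "x \<in> carrier M"
    then obtain a c where *: "a \<in> A" "c \<in> C" "x = a \<oplus> c" using dec by metis
    hence "r \<odot> x = r \<odot> a \<oplus> r \<odot> c"
      using r submoduleD(1)[OF A] submoduleD(1)[OF C] by (simp add: smult_r_distr)
    thus "\<phi> (r \<odot> x) = r \<odot> \<phi> x"
      using * r v g(3) submoduleD(6)[OF A] submoduleD(6)[OF C] by simp
  qed
  thus ?thesis using that v by blast
qed

section \<open>Endomorphism rings\<close>

abbreviation End where "End \<equiv> endomorphism_ring R M"

lemma homD:
  assumes "\<phi> \<in> module_hom_set R M M"
  shows "x \<in> carrier M \<Longrightarrow> \<phi> x \<in> carrier M" "x \<in> carrier M \<Longrightarrow> y \<in> carrier M \<Longrightarrow> \<phi> (x \<oplus> y) = \<phi> x \<oplus> \<phi> y"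
    "a \<in> carrier R \<Longrightarrow> x \<in> carrier M \<Longrightarrow> \<phi> (a \<odot> x) = a \<odot> \<phi> x" "x \<notin> carrier M \<Longrightarrow> \<phi> x = undefined"
    "\<phi> \<zero> = \<zero>" "x \<in> carrier M \<Longrightarrow> \<phi> (\<ominus> x) = \<ominus> \<phi> x"
    "x \<in> carrier M \<Longrightarrow> y \<in> carrier M \<Longrightarrow> \<phi> (x \<ominus> y) = \<phi> x \<ominus> \<phi> y"
proof -
  show c: "x \<in> carrier M \<Longrightarrow> \<phi> x \<in> carrier M" for x using assms by (auto simp: module_hom_set_def)
  show a: "x \<in> carrier M \<Longrightarrow> y \<in> carrier M \<Longrightarrow> \<phi> (x \<oplus> y) = \<phi> x \<oplus> \<phi> y" for x y
    using assms by (auto simp: module_hom_set_def)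
  show s: "a \<in> carrier R \<Longrightarrow> x \<in> carrier M \<Longrightarrow> \<phi> (a \<odot> x) = a \<odot> \<phi> x" for a x
    using assms by (auto simp: module_hom_set_def)
  show "x \<notin> carrier M \<Longrightarrow> \<phi> x = undefined" using assms by (auto simp: module_hom_set_def PiE_def extensional_def)
  show "\<phi> \<zero> = \<zero>" using s[of "\<zero>\<^bsub>R\<^esub>" "\<zero>"] c[of "\<zero>"] by simp
  show m: "x \<in> carrier M \<Longrightarrow> \<phi> (\<ominus> x) = \<ominus> \<phi> x" for x
    using s[of "\<ominus>\<^bsub>R\<^esub> \<one>\<^bsub>R\<^esub>" x] c[of x] by (simp add: smult_uminus_left smult_one)
  show "x \<in> carrier M \<Longrightarrow> y \<in> carrier M \<Longrightarrow> \<phi> (x \<ominus> y) = \<phi> x \<ominus> \<phi> y"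
    using a[of x "\<ominus> y"] m[of y] by (simp add: a_minus_def)
qed

lemma hom_eqI:
  assumes "\<phi> \<in> module_hom_set R M M" "\<psi> \<in> module_hom_set R M M" "\<And>x. x \<in> carrier M \<Longrightarrow> \<phi> x = \<psi> x"
  shows "\<phi> = \<psi>"
  using assms homD(4) by (metis ext)

lemma End_simps:
  "carrier End = module_hom_set R M M" "mult End \<phi> \<psi> = compose (carrier M) \<phi> \<psi>"
  "one End = (\<lambda>x\<in>carrier M. x)" "zero End = (\<lambda>x\<in>carrier M. \<zero>)"
  "add End \<phi> \<psi> = (\<lambda>x\<in>carrier M. \<phi> x \<oplus> \<psi> x)"
  by (simp_all add: endomorphism_ring_def)

lemma hom_closed:
  assumes p: "\<phi> \<in> module_hom_set R M M" and s: "\<psi> \<in> module_hom_set R M M"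
  shows "compose (carrier M) \<phi> \<psi> \<in> module_hom_set R M M"
    "(\<lambda>x\<in>carrier M. \<phi> x \<oplus> \<psi> x) \<in> module_hom_set R M M"
    "(\<lambda>x\<in>carrier M. \<ominus> \<phi> x) \<in> module_hom_set R M M"
  unfolding module_hom_set_def
  using homD[OF p] homD[OF s] smult_closed
  by (auto simp: compose_def smult_r_distr smult_uminus_right M.minus_add M.a_ac)

lemma hom_id_zero:
  "(\<lambda>x\<in>carrier M. x) \<in> module_hom_set R M M" "(\<lambda>x\<in>carrier M. \<zero>) \<in> module_hom_set R M M"
  unfolding module_hom_set_def by (auto simp: smult_closed)

lemma End_ring: "ring End"
proof (rule ringI)
  show "abelian_group End"
  proof (rule abelian_groupI)
    fix \<phi> assume p: "\<phi> \<in> carrier End"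
    show "\<exists>\<psi>\<in>carrier End. \<psi> \<oplus>\<^bsub>End\<^esub> \<phi> = \<zero>\<^bsub>End\<^esub>"
      using p hom_closed(3)[of \<phi> \<phi>] homD(1)[of \<phi>] unfolding End_simps
      by (intro bexI[of _ "\<lambda>x\<in>carrier M. \<ominus> \<phi> x"]) (auto simp: M.l_neg fun_eq_iff)
  qed (use hom_closed hom_id_zero homD(1) in \<open>auto simp: End_simps M.a_ac fun_eq_iff homD(4)\<close>)
  show "Group.monoid End"
  proof (rule Group.monoidI)
    show "\<phi> \<otimes>\<^bsub>End\<^esub> \<psi> \<otimes>\<^bsub>End\<^esub> \<chi> = \<phi> \<otimes>\<^bsub>End\<^esub> (\<psi> \<otimes>\<^bsub>End\<^esub> \<chi>)"
      if "\<phi> \<in> carrier End" "\<psi> \<in> carrier End" "\<chi> \<in> carrier End" for \<phi> \<psi> \<chi>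
      using that homD(1) unfolding End_simps by (auto simp: compose_def fun_eq_iff)
  qed (use hom_closed hom_id_zero homD(1) in \<open>auto simp: End_simps compose_def fun_eq_iff homD(4)\<close>)
qed (use homD in \<open>auto simp: End_simps compose_def fun_eq_iff\<close>)

end

lemma regular_left_module: assumes "ring A" shows "left_module A (regular_module A)"
proof -
  interpret ring A by (rule assms)
  have "abelian_group (regular_module A)"
  proof (rule abelian_groupI)
    fix x assume "x \<in> carrier (regular_module A)"
    thus "\<exists>y\<in>carrier (regular_module A). y \<oplus>\<^bsub>regular_module A\<^esub> x = \<zero>\<^bsub>regular_module A\<^esub>"
      by (intro bexI[of _ "\<ominus>\<^bsub>A\<^esub> x"]) (auto simp: regular_module_def l_neg)
  qed (auto simp: regular_module_def a_ac)
  thus ?thesis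
    by (intro left_module.intro left_module_axioms.intro assms) (auto simp: regular_module_def l_distr r_distr m_assoc)
qed

text \<open>The unit is \<open>a \<phi> + c\<close> with \<open>c\<close> in a complement of the left ideal
  generated by \<open>\<phi>\<close>. Then \<open>\<phi> c = \<phi> - \<phi> a \<phi>\<close> lies in the
  left ideal and in its complement, so it vanishes.\<close>

lemma semisimple_ring_regular:
  fixes A :: "'r ring" (structure)
  assumes A: "ring A" and ss: "semisimple_ring A" and \<phi>: "\<phi> \<in> carrier A"
  obtains \<psi> where "\<psi> \<in> carrier A" "\<phi> \<otimes> \<psi> \<otimes> \<phi> = \<phi>"
proof -
  interpret ring A by (rule A)
  let ?M = "regular_module A"
  interpret L: plain_module ?M A by (intro plain_module.intro regular_left_module[OF A])
  have rs [simp]: "carrier ?M = carrier A" "add ?M = add A" "zero ?M = zero A" "smult ?M = mult A"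
    by (simp_all add: regular_module_def)
  have gen: "X = carrier ?M" if "submodule X A ?M" "{\<one>} \<subseteq> X" for X
  proof
    show "carrier ?M \<subseteq> X"
    proof
      fix x assume "x \<in> carrier ?M"
      thus "x \<in> X" using L.submoduleD(6)[OF that(1), of x "\<one>"] that(2) by simp
    qed
  qed (use L.submoduleD(1)[OF that(1)] in auto)
  obtain S where S: "finite S" "\<And>N. N \<in> S \<Longrightarrow> simple_submodule A ?M N" "L.ssum S = carrier ?M"
    using L.semisimpleE[of "{\<one>}"] ss gen unfolding semisimple_ring_def by auto
  let ?N = "(\<lambda>a. a \<otimes> \<phi>) ` carrier A"
  have N: "submodule ?N A ?M"
  proof (rule L.submoduleI)
    show "\<zero>\<^bsub>?M\<^esub> \<in> ?N" using \<phi> by (auto intro!: image_eqI[of _ _ "\<zero>"])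
    show "x \<oplus>\<^bsub>?M\<^esub> y \<in> ?N" if "x \<in> ?N" "y \<in> ?N" for x y
      using that \<phi> by (auto simp: l_distr[symmetric])
    show "a \<odot>\<^bsub>?M\<^esub> x \<in> ?N" if "a \<in> carrier A" "x \<in> ?N" for a x
      using that \<phi> by (auto simp: m_assoc[symmetric])
  qed (use \<phi> in auto)
  obtain S' where S': "S' \<subseteq> S" "?N \<inter> L.ssum S' = {\<zero>\<^bsub>?M\<^esub>}"
    "\<And>x. x \<in> carrier ?M \<Longrightarrow> \<exists>n\<in>?N. \<exists>y\<in>L.ssum S'. x = n \<oplus>\<^bsub>?M\<^esub> y"
    using L.semisimple_complement[OF S N] by metis
  have sS': "submodule (L.ssum S') A ?M"
    using S S' L.simple_subm by (intro L.ssum_subm finite_subset[OF S'(1) S(1)]) blast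
  obtain a c where a: "a \<in> carrier A" "c \<in> L.ssum S'" "\<one> = a \<otimes> \<phi> \<oplus> c"
    using S'(3)[of "\<one>"] by auto
  have cc: "c \<in> carrier A" using L.submoduleD(1)[OF sS' a(2)] by simp
  have "\<phi> = \<phi> \<otimes> (a \<otimes> \<phi> \<oplus> c)" using r_one[OF \<phi>] a(3) by metis
  hence eq: "\<phi> = \<phi> \<otimes> a \<otimes> \<phi> \<oplus> \<phi> \<otimes> c" using \<phi> a cc by (simp add: r_distr m_assoc)
  have "\<phi> \<otimes> c = (\<one> \<ominus> \<phi> \<otimes> a) \<otimes> \<phi>"
  proof -
    have "(\<one> \<ominus> \<phi> \<otimes> a) \<otimes> \<phi> = \<phi> \<ominus> \<phi> \<otimes> a \<otimes> \<phi>"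
      using \<phi> a(1) by (simp add: a_minus_def l_distr l_minus)
    also have "\<dots> = (\<phi> \<otimes> a \<otimes> \<phi> \<oplus> \<phi> \<otimes> c) \<ominus> \<phi> \<otimes> a \<otimes> \<phi>" using eq by simp
    also have "\<dots> = \<phi> \<otimes> c" using \<phi> a(1) cc by (simp add: a_minus_def a_ac r_neg r_neg1 r_neg2)
    finally show ?thesis by simp
  qed
  hence "\<phi> \<otimes> c \<in> ?N"
    by (rule image_eqI) (use \<phi> a(1) in simp)
  moreover have "\<phi> \<otimes> c \<in> L.ssum S'" using L.submoduleD(6)[OF sS' _ a(2), of \<phi>] \<phi> by simp
  ultimately have "\<phi> \<otimes> c = \<zero>" using S'(2) by auto
  hence "\<phi> = \<phi> \<otimes> a \<otimes> \<phi>" using eq \<phi> a by simp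
  thus ?thesis using that[of a] a by simp
qed

section \<open>The contravariant dual\<close>

lemma (in kspace) klin_finsum:
  assumes V: "ksub V" and l: "klin V \<xi>" and S: "finite S" "\<And>i. i \<in> S \<Longrightarrow> g i \<in> V"
  shows "\<xi> (\<Oplus>i\<in>S. g i) = (\<Sum>i\<in>S. \<xi> (g i))"
  using S
proof (induction S rule: finite_induct)
  case (insert i S)
  hence "g \<in> S \<rightarrow> carrier M" "g i \<in> carrier M" using ksubD(1)[OF V] by auto
  thus ?case using insert klinD(1)[OF l] finsum_ksub[OF V, of S g] by (simp add: finsum_insert)
qed (use klin_zero[OF V l] in simp)

context weight_module
begin

text \<open>Since weight vectors of distinct weights are independent, a module is of type one as soon as
  its weight spaces span it.\<close>

lemma type_oneI:
  assumes span: "\<And>m. m \<in> carrier T \<Longrightarrow> \<exists>S. finite S \<and> S \<subseteq> weights \<alpha> \<and> m \<in> wsum S"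
  shows "type_one \<alpha> q T"
proof -
  let ?P = "\<lambda>m f. (\<forall>j\<in>weights \<alpha>. f j \<in> Wt j) \<and> (\<forall>j. j \<notin> weights \<alpha> \<longrightarrow> f j = \<zero>) \<and>
        finite {j. f j \<noteq> \<zero>} \<and> m = (\<Oplus>j\<in>{j. f j \<noteq> \<zero>}. f j)"
  have supp: "(\<Oplus>j\<in>{j. f j \<noteq> \<zero>}. f j) = (\<Oplus>j\<in>S. f j)"
    if "finite S" "{j. f j \<noteq> \<zero>} \<subseteq> S" "\<And>j. f j \<in> carrier T" for f S
    by (rule M.add.finprod_mono_neutral_cong_left) (use that in auto)
  have "\<exists>!f. ?P m f" if m: "m \<in> carrier T" for m
  proof (rule ex_ex1I)
    obtain S f where S: "finite S" "S \<subseteq> weights \<alpha>" and f: "\<forall>\<kappa>\<in>S. f \<kappa> \<in> Wt \<kappa>" "m = (\<Oplus>\<kappa>\<in>S. f \<kappa>)"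
      using span[OF m] unfolding wsum_def by blast
    let ?f = "\<lambda>\<kappa>. if \<kappa> \<in> S then f \<kappa> else \<zero>"
    have fc: "?f j \<in> carrier T" for j using f(1) WtD(1) by auto
    have "m = (\<Oplus>\<kappa>\<in>S. ?f \<kappa>)" unfolding f(2) by (rule M.finsum_cong') (use f(1) WtD(1) in auto)
    moreover have s: "{j. ?f j \<noteq> \<zero>} \<subseteq> S" by auto
    ultimately have "m = (\<Oplus>j\<in>{j. ?f j \<noteq> \<zero>}. ?f j)" using supp[of S ?f] S(1) fc by simp
    moreover have "finite {j. ?f j \<noteq> \<zero>}" using s S(1) by (rule finite_subset)
    ultimately show "\<exists>f. ?P m f" using f(1) S(2) by (intro exI[of _ ?f]) auto
  next
    fix f g assume f: "?P m f" and g: "?P m g"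
    have wt: "f j \<in> Wt j" "g j \<in> Wt j" for j using f g by (cases "j \<in> weights \<alpha>"; simp)+
    have c: "f j \<in> carrier T" "g j \<in> carrier T" for j using wt WtD(1) by blast+
    let ?S = "{j. f j \<noteq> \<zero>} \<union> {j. g j \<noteq> \<zero>}"
    have fin: "finite ?S" using f g by simp
    have Sw: "?S \<subseteq> weights \<alpha>" using f g by blast
    have mf: "m = (\<Oplus>j\<in>?S. f j)" and mg: "m = (\<Oplus>j\<in>?S. g j)"
      using f g supp[OF fin, of f] supp[OF fin, of g] c by auto
    let ?d = "\<lambda>j. f j \<oplus> sc (- 1) (g j)"
    have "(\<Oplus>j\<in>?S. ?d j) = m \<oplus> (\<Oplus>j\<in>?S. sc (- 1) (g j))"
      unfolding mf by (rule M.finsum_addf) (use c in auto)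
    also have "(\<Oplus>j\<in>?S. sc (- 1) (g j)) = sc (- 1) m"
      using smult_finsum_right[OF fin, of g "uq_scalar \<alpha> q (- 1)"] mg c by auto
    also have "m \<oplus> sc (- 1) m = \<zero>" using m by (simp add: K.sc_uminus M.r_neg)
    finally have z: "(\<Oplus>j\<in>?S. ?d j) = \<zero>" .
    have "f j = g j" for j
    proof (cases "j \<in> ?S")
      case True
      have "?d j \<in> {\<zero>}"
        by (rule weight_graded[OF sub_zero fin Sw, of ?d j]) (use wt Wt_add Wt_sc z True in auto)
      hence "f j \<ominus> g j = \<zero>" using c by (simp add: K.sc_uminus a_minus_def)
      thus ?thesis using K.minus_zero_eq c by blast
    qed simp
    thus "f = g" by blast
  qed
  moreover have "subgroup (Wt j) (add_monoid T)" for j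
    by (rule M.add.subgroupI) (use K.ksubD[OF Wt_ksub[of j]] in auto)
  ultimately show ?thesis unfolding type_one_def internal_direct_sum_def by blast
qed

abbreviation Td where "Td \<equiv> contravariant_dual \<alpha> q T"

lemma dual_ops [simp]:
  "zero Td = (\<lambda>x. 0)" "add Td f g = (\<lambda>x. f x + g x)"
  "smult Td u f = (\<lambda>x. if x \<in> carrier T then f (uq_tau u \<star> x) else 0)"
  by (simp_all add: contravariant_dual_def)

lemma dualD:
  assumes "f \<in> carrier Td"
  shows "x \<notin> carrier T \<Longrightarrow> f x = 0" "x \<in> carrier T \<Longrightarrow> y \<in> carrier T \<Longrightarrow> f (x \<oplus> y) = f x + f y"
    "x \<in> carrier T \<Longrightarrow> f (sc c x) = c * f x" "K.klin (carrier T) f"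
  using assms by (auto simp: contravariant_dual_def K.klin_def)

lemma dual_carrier: "carrier Td = K.dual (carrier T)"
  by (auto simp: contravariant_dual_def K.dual_def K.klin_def)

lemma dualI: "K.klin (carrier T) f \<Longrightarrow> (\<And>x. x \<notin> carrier T \<Longrightarrow> f x = 0) \<Longrightarrow> f \<in> carrier Td"
  by (simp add: dual_carrier K.dual_def)

lemma dual_zero: "f \<in> carrier Td \<Longrightarrow> f \<zero> = 0"
  by (rule K.klin_zero[OF K.ksub_carrier dualD(4)])

lemma dual_abelian: "abelian_group Td"
proof (rule abelian_groupI)
  fix f assume "f \<in> carrier Td"
  thus "\<exists>g\<in>carrier Td. g \<oplus>\<^bsub>Td\<^esub> f = \<zero>\<^bsub>Td\<^esub>"
    by (intro bexI[of _ "\<lambda>x. - f x"]) (auto simp: contravariant_dual_def)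
qed (auto simp: contravariant_dual_def algebra_simps)

lemma dual_weight_module: "weight_module \<Phi> \<alpha> q Td"
proof -
  interpret D: abelian_group Td by (rule dual_abelian)
  have "left_module U Td"
  proof (intro left_module.intro left_module_axioms.intro U_ring dual_abelian)
    fix a f assume a: "a \<in> carrier U" and f: "f \<in> carrier Td"
    have ta: "uq_tau a \<in> carrier U" using a by (rule W.Th_closed)
    show "a \<odot>\<^bsub>Td\<^esub> f \<in> carrier Td"
      by (rule dualI) (use ta dualD(2,3)[OF f] in \<open>auto simp: K.klin_def smult_r_distr act_sc\<close>)
    fix b assume b: "b \<in> carrier U"
    have tb: "uq_tau b \<in> carrier U" using b by (rule W.Th_closed)
    show "(a \<oplus>\<^bsub>U\<^esub> b) \<odot>\<^bsub>Td\<^esub> f = a \<odot>\<^bsub>Td\<^esub> f \<oplus>\<^bsub>Td\<^esub> b \<odot>\<^bsub>Td\<^esub> f"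
      using a b ta tb dualD(2)[OF f] by (auto simp: W.Th_add smult_l_distr)
    show "(a \<otimes>\<^bsub>U\<^esub> b) \<odot>\<^bsub>Td\<^esub> f = a \<odot>\<^bsub>Td\<^esub> (b \<odot>\<^bsub>Td\<^esub> f)"
      using a b ta tb by (auto simp: W.Th_mult smult_assoc)
  next
    fix f assume f: "f \<in> carrier Td"
    have "uq_tau \<one>\<^bsub>U\<^esub> = \<one>\<^bsub>U\<^esub>" using W.Th_scalar[of 1] by (simp add: W.Q.scalar_one)
    thus "\<one>\<^bsub>U\<^esub> \<odot>\<^bsub>Td\<^esub> f = f" using dualD(1)[OF f] by (auto simp: smult_one)
  qed auto
  thus ?thesis by (intro weight_module.intro quantum_data_axioms)
qed

lemma dual_scalar: "f \<in> carrier Td \<Longrightarrow> uq_scalar \<alpha> q c \<odot>\<^bsub>Td\<^esub> f = (\<lambda>x. c * f x)"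
  using dualD(1,3)[of f] by (auto simp: W.Th_scalar fun_eq_iff)

definition ann :: "'m set \<Rightarrow> ('m \<Rightarrow> 'k) set" where
  "ann N = {f \<in> carrier Td. \<forall>x\<in>N. f x = 0}"

lemma ann_submodule: assumes N: "sub N" shows "submodule (ann N) U Td"
proof -
  interpret D: weight_module \<Phi> \<alpha> q Td by (rule dual_weight_module)
  show ?thesis
  proof (rule D.submoduleI)
    show "f \<oplus>\<^bsub>Td\<^esub> g \<in> ann N" if "f \<in> ann N" "g \<in> ann N" for f g
      using that D.M.a_closed[of f g] by (simp add: ann_def)
    show "u \<odot>\<^bsub>Td\<^esub> f \<in> ann N" if "u \<in> carrier U" "f \<in> ann N" for u f
      using that D.smult_closed[of u f] submoduleD(6)[OF N W.Th_closed[of u]] by (simp add: ann_def)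
  qed (use D.M.zero_closed in \<open>auto simp: ann_def\<close>)
qed

end

context fd_module
begin

interpretation S: weight_module \<Phi> \<alpha> q Td by (rule dual_weight_module)

text \<open>The anti-involution fixes \<open>U\<^sup>0\<close>, so a functional has weight
  \<open>\<kappa>\<close> if and only if it lives on the weight space of weight \<open>\<kappa>\<close>. In
  particular duality preserves characters.\<close>

lemma dual_weight_space:
  assumes f: "f \<in> carrier Td" and \<kappa>: "\<kappa> \<in> weights \<alpha>"
  shows "f \<in> weight_space \<alpha> q Td \<kappa> \<longleftrightarrow> (\<forall>\<mu>\<in>weights \<alpha>. \<mu> \<noteq> \<kappa> \<longrightarrow> (\<forall>x\<in>Wt \<mu>. f x = 0))"
proof (intro iffI ballI impI)
  fix \<mu> x assume fw: "f \<in> S.Wt \<kappa>" and \<mu>: "\<mu> \<in> weights \<alpha>" "\<mu> \<noteq> \<kappa>" and x: "x \<in> Wt \<mu>"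
  have xc: "x \<in> carrier T" using WtD(1)[OF x] .
  have K: "K_value \<alpha> q \<mu> i * f x = K_value \<alpha> q \<kappa> i * f x" for i
    using fun_cong[OF S.WtD(2)[OF fw, of i], of x] xc WtD(2)[OF x] dualD(3)[OF f xc]
    unfolding dual_scalar[OF f] by simp
  have B: "chi i (weight_coeff \<alpha> \<mu> i) t * f x = chi i (weight_coeff \<alpha> \<kappa> i) t * f x" for i t
    using fun_cong[OF S.WtD(4)[OF fw, of i t], of x] xc WtD(4)[OF x] dualD(3)[OF f xc]
    unfolding dual_scalar[OF f] by simp
  show "f x = 0"
  proof (rule ccontr)
    assume "f x \<noteq> 0"
    hence "weight_coeff \<alpha> \<mu> i = weight_coeff \<alpha> \<kappa> i" for i
      using K B by (intro chi_inj) (auto simp: K_value_def)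
    thus False using weights_eqI[OF \<mu>(1) \<kappa>] \<mu>(2) by auto
  qed
next
  assume z: "\<forall>\<mu>\<in>weights \<alpha>. \<mu> \<noteq> \<kappa> \<longrightarrow> (\<forall>x\<in>Wt \<mu>. f x = 0)"
  have gen: "h \<odot>\<^bsub>Td\<^esub> f = S.sc (e \<kappa>) f"
    if h: "h \<in> carrier U" "uq_tau h = h" and e: "\<And>\<mu> x. x \<in> Wt \<mu> \<Longrightarrow> h \<star> x = sc (e \<mu>) x" for h e
  proof -
    have "f (h \<star> x) = e \<kappa> * f x" if "x \<in> carrier T" for x
      using that
    proof (induction rule: weight_induct)
      case (add x y)
      thus ?case using h dualD(2)[OF f] by (simp add: smult_r_distr algebra_simps)
    next
      case (weight x \<mu>)
      hence "x \<in> carrier T" using WtD(1) by blast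
      thus ?case using weight e[of x \<mu>] dualD(3)[OF f, of x] z by (cases "\<mu> = \<kappa>") auto
    qed
    thus ?thesis unfolding dual_scalar[OF f] using h dualD(1)[OF f] by (auto simp: fun_eq_iff)
  qed
  show "f \<in> S.Wt \<kappa>"
    by (rule S.WtI[OF f]; rule gen) (use WtD(2,4) in auto)
qed

lemma dual_component:
  assumes f: "f \<in> carrier Td" and \<kappa>: "\<kappa> \<in> weights \<alpha>"
  shows "(\<lambda>x. if x \<in> carrier T then f (pr x \<kappa>) else 0) \<in> weight_space \<alpha> q Td \<kappa>"
proof -
  let ?g = "\<lambda>x. if x \<in> carrier T then f (pr x \<kappa>) else 0"
  have g: "?g \<in> carrier Td"
    by (rule dualI) (use dualD(2,3)[OF f] in \<open>auto simp: K.klin_def pr_add pr_sc\<close>)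
  show ?thesis
    unfolding dual_weight_space[OF g \<kappa>] using pr_weight dual_zero[OF f] by auto
qed

lemma dual_finsum:
  assumes "finite S" "\<And>i. i \<in> S \<Longrightarrow> g i \<in> carrier Td"
  shows "(\<Oplus>\<^bsub>Td\<^esub>i\<in>S. g i) = (\<lambda>x. \<Sum>i\<in>S. g i x)"
  using assms
proof (induction S rule: finite_induct)
  case (insert i S)
  hence "g \<in> S \<rightarrow> carrier Td" "g i \<in> carrier Td" by auto
  thus ?case using insert by (simp add: S.M.finsum_insert)
qed simp

text \<open>Spaces of functionals are compared with the dual space of \<open>V\<close> through restriction
  \<open>g\<close> to \<open>V\<close>.\<close>

lemma dual_kdim: assumes "K.kdim V n" "g ` W = K.dual V" "S.K.ksub W"
    "\<And>f x. f \<in> W \<Longrightarrow> g f x = (if x \<in> V then f x else 0)" "\<And>f. f \<in> W \<Longrightarrow> (\<forall>x\<in>V. f x = 0) \<Longrightarrow> f = (\<lambda>_. 0)"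
  shows "S.K.kdim W n"
proof -
  have gf: "g f = (\<lambda>x. if x \<in> V then f x else 0)" if "f \<in> W" for f using assms(4)[OF that] by blast
  have Wc: "f \<in> carrier Td" if "f \<in> W" for f using S.K.ksubD(1)[OF assms(3) that] .
  have "S.K.kdim {f\<in>W. g f \<in> K.dual V} (0 + n)"
  proof (rule kdim_preimage[OF S.K.kspace_axioms kspace_function_space assms(3)])
    show "g (f \<oplus>\<^bsub>Td\<^esub> f') = g f \<oplus>\<^bsub>function_space\<^esub> g f'" if "f \<in> W" "f' \<in> W" for f f'
      using gf[OF that(1)] gf[OF that(2)] gf[OF S.K.ksubD(3)[OF assms(3) that]]
      by (auto simp: function_space_simps)
    show "g (S.sc c f) = (\<lambda>x. c * g f x)" if "f \<in> W" for f c
      using gf[OF that] gf[OF S.K.ksubD(4)[OF assms(3) that]] unfolding dual_scalar[OF Wc[OF that]] by auto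
    have "{f \<in> W. g f = \<zero>\<^bsub>function_space\<^esub>} = {\<zero>\<^bsub>Td\<^esub>}"
    proof (intro equalityI subsetI)
      fix f assume "f \<in> {f \<in> W. g f = \<zero>\<^bsub>function_space\<^esub>}"
      hence f: "f \<in> W" "g f = (\<lambda>_. 0)" by (auto simp: function_space_simps)
      have "\<forall>x\<in>V. f x = 0" using fun_cong[OF f(2)] assms(4)[OF f(1)] by metis
      thus "f \<in> {\<zero>\<^bsub>Td\<^esub>}" using assms(5)[OF f(1)] by simp
    next
      fix f assume "f \<in> {\<zero>\<^bsub>Td\<^esub>}"
      hence f: "f = (\<lambda>_. 0)" "f \<in> W" using S.K.ksubD(2)[OF assms(3)] by auto
      thus "f \<in> {f \<in> W. g f = \<zero>\<^bsub>function_space\<^esub>}" using gf[OF f(2)] by (auto simp: function_space_simps)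
    qed
    thus "S.K.kdim {f \<in> W. g f = \<zero>\<^bsub>function_space\<^esub>} 0" using S.K.kdim_zero by simp
    show "kspace.kdim function_space (\<lambda>c f x. c * f x) (K.dual V) n" by (rule K.kdim_dual[OF assms(1)])
  qed (use assms(2) in \<open>auto simp: function_space_simps\<close>)
  moreover have "{f\<in>W. g f \<in> K.dual V} = W" using assms(2) by blast
  ultimately show ?thesis by simp
qed

lemma dual_fd_module: "fd_module \<Phi> \<alpha> q Td"
proof (intro fd_module.intro dual_weight_module fd_module_axioms.intro)
  obtain n where n: "K.kdim (carrier T) n" using kdim_T by blast
  have "S.K.kdim (carrier Td) n"
  proof (rule dual_kdim[OF n, of "\<lambda>f. f"])
    show "(\<lambda>f. f) ` carrier Td = K.dual (carrier T)" by (simp add: dual_carrier)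
    show "f x = (if x \<in> carrier T then f x else 0)" if "f \<in> carrier Td" for f x using dualD(1)[OF that] by simp
    show "f = (\<lambda>_. 0)" if "f \<in> carrier Td" "\<forall>x\<in>carrier T. f x = 0" for f using dualD(1)[OF that(1)] that(2) by blast
  qed (rule S.K.ksub_carrier)
  from S.K.kdim_spanning_set[OF this] show "finite_dimensional \<alpha> q Td" unfolding finite_dimensional_def .
  show "type_one \<alpha> q Td"
  proof (rule S.type_oneI)
    fix f assume f: "f \<in> carrier Td"
    let ?g = "\<lambda>\<kappa> x. if x \<in> carrier T then f (pr x \<kappa>) else 0"
    have g: "?g \<kappa> \<in> S.Wt \<kappa>" if "\<kappa> \<in> Om" for \<kappa> using dual_component[OF f] that Om(2) by blast
    have "(\<Oplus>\<^bsub>Td\<^esub>\<kappa>\<in>Om. ?g \<kappa>) = (\<lambda>x. \<Sum>\<kappa>\<in>Om. ?g \<kappa> x)"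
      by (rule dual_finsum[OF Om(1)]) (rule S.WtD(1)[OF g])
    also have "\<dots> = f"
    proof
      fix x
      show "(\<Sum>\<kappa>\<in>Om. ?g \<kappa> x) = f x"
      proof (cases "x \<in> carrier T")
        case True
        have "f (\<Oplus>\<kappa>\<in>Om. pr x \<kappa>) = (\<Sum>\<kappa>\<in>Om. f (pr x \<kappa>))"
          by (rule K.klin_finsum[OF K.ksub_carrier dualD(4)[OF f] Om(1)]) (use True in auto)
        thus ?thesis using True pr(3) by simp
      qed (use dualD(1)[OF f] in simp)
    qed
    finally have "f \<in> S.wsum Om" unfolding S.wsum_def using g by (intro CollectI exI[of _ ?g]) auto
    thus "\<exists>S. finite S \<and> S \<subseteq> weights \<alpha> \<and> f \<in> S.wsum S" using Om by blast
  qed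
qed

lemma dual_weight_dim:
  assumes \<kappa>: "\<kappa> \<in> weights \<alpha>" and n: "K.kdim (Wt \<kappa>) n"
  shows "S.K.kdim (S.Wt \<kappa>) n"
proof (rule dual_kdim[OF n])
  let ?g = "\<lambda>f x. if x \<in> Wt \<kappa> then f x else 0"
  show "?g ` S.Wt \<kappa> = K.dual (Wt \<kappa>)"
  proof (intro equalityI subsetI)
    fix h assume "h \<in> ?g ` S.Wt \<kappa>"
    then obtain f where f: "f \<in> S.Wt \<kappa>" "h = ?g f" by blast
    have "f \<in> carrier Td" using S.WtD(1)[OF f(1)] .
    thus "h \<in> K.dual (Wt \<kappa>)"
      unfolding f(2) K.dual_def K.klin_def using dualD(2,3)[of f] Wt_add Wt_sc WtD(1) by simp
  next
    fix h assume h: "h \<in> K.dual (Wt \<kappa>)"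
    let ?f = "\<lambda>x. if x \<in> carrier T then h (pr x \<kappa>) else 0"
    have kl: "K.klin (Wt \<kappa>) h" and off: "\<And>x. x \<notin> Wt \<kappa> \<Longrightarrow> h x = 0" using h by (auto simp: K.dual_def)
    have f: "?f \<in> carrier Td"
      by (rule dualI) (use K.klinD[OF kl] pr(1) in \<open>auto simp: K.klin_def pr_add pr_sc\<close>)
    have "?f \<in> S.Wt \<kappa>"
      unfolding dual_weight_space[OF f \<kappa>] using pr_weight K.klin_zero[OF Wt_ksub kl] by auto
    moreover have "h = ?g ?f" using off pr_weight[OF _ \<kappa>] WtD(1) by (auto simp: fun_eq_iff)
    ultimately show "h \<in> ?g ` S.Wt \<kappa>" by (intro image_eqI[where x = ?f])
  qed
  show "f = (\<lambda>_. 0)" if f: "f \<in> S.Wt \<kappa>" "\<forall>x\<in>Wt \<kappa>. f x = 0" for f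
  proof
    fix x
    have fc: "f \<in> carrier Td" using S.WtD(1)[OF f(1)] .
    show "f x = 0"
    proof (cases "x \<in> carrier T")
      case True
      thus ?thesis
      proof (induction rule: weight_induct)
        case (add x y)
        thus ?case using dualD(2)[OF fc] by simp
      next
        case (weight x \<mu>)
        thus ?case using dual_weight_space[OF fc \<kappa>] f by (cases "\<mu> = \<kappa>") blast+
      qed
    qed (rule dualD(1)[OF fc])
  qed
qed (rule S.Wt_ksub, rule refl)

end

section \<open>Weyl modules\<close>

context quantum_data
begin

lemma dual_weyl_ksub:
  "kspace.ksub (coinduced_module \<alpha> q \<nu>) (\<lambda>c f. uq_scalar \<alpha> q c \<odot>\<^bsub>coinduced_module \<alpha> q \<nu>\<^esub> f)
     (carrier (dual_weyl \<alpha> q \<nu>))"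
proof -
  let ?C = "coinduced_module \<alpha> q \<nu>" and ?V = "carrier (dual_weyl \<alpha> q \<nu>)"
  interpret C: weight_module \<Phi> \<alpha> q ?C by (rule coinduced_weight_module)
  have mem: "f \<in> ?V \<longleftrightarrow> f \<in> carrier ?C \<and> (\<exists>S. finite S \<and> S \<subseteq> weights \<alpha> \<and> f \<in> C.wsum S) \<and>
     (\<forall>i. \<exists>r0. \<forall>r\<ge>r0. C.Ea i r f = \<zero>\<^bsub>?C\<^esub> \<and> C.Fa i r f = \<zero>\<^bsub>?C\<^esub>)" for f
  proof -
    have "\<And>X. carrier (?C\<lparr>carrier := X\<rparr>) = X" by simp
    hence "f \<in> ?V \<longleftrightarrow> f \<in> carrier ?C \<and>
      (\<exists>S g. finite S \<and> S \<subseteq> weights \<alpha> \<and> (\<forall>\<mu>\<in>S. g \<mu> \<in> C.Wt \<mu>) \<and> f = (\<Oplus>\<^bsub>?C\<^esub>\<mu>\<in>S. g \<mu>)) \<and>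
      (\<forall>i. \<exists>r0. \<forall>r\<ge>r0. C.Ea i r f = \<zero>\<^bsub>?C\<^esub> \<and> C.Fa i r f = \<zero>\<^bsub>?C\<^esub>)"
      unfolding dual_weyl_def integrable_part_def by (simp only: mem_Collect_eq)
    thus ?thesis unfolding C.wsum_def by (simp only: mem_Collect_eq ex_simps)
  qed
  show ?thesis
    unfolding C.K.ksub_def
  proof (intro conjI ballI allI)
    show "?V \<subseteq> carrier ?C" using dual_weyl_coinduced by blast
    have "\<zero>\<^bsub>?C\<^esub> \<in> C.wsum {}" using C.K.ksubD(2)[OF C.wsum_ksub] by blast
    thus "\<zero>\<^bsub>?C\<^esub> \<in> ?V"
      unfolding mem by (intro conjI exI[of _ "{}"] allI) (auto simp del: coinduced_simps simp: C.smult_zero_right)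
  next
    fix f g assume f: "f \<in> ?V" and g: "g \<in> ?V"
    have fc: "f \<in> carrier ?C" "g \<in> carrier ?C" using f g dual_weyl_coinduced by auto
    obtain S S' where S: "finite S" "S \<subseteq> weights \<alpha>" "f \<in> C.wsum S" "finite S'" "S' \<subseteq> weights \<alpha>" "g \<in> C.wsum S'"
      using f g unfolding mem by blast
    have fin: "finite (S \<union> S')" using S by simp
    have "f \<oplus>\<^bsub>?C\<^esub> g \<in> C.wsum (S \<union> S')"
      using C.K.ksubD(3)[OF C.wsum_ksub[OF fin]] C.wsum_mono[OF fin, of S] C.wsum_mono[OF fin, of S'] S by blast
    hence w: "\<exists>S. finite S \<and> S \<subseteq> weights \<alpha> \<and> f \<oplus>\<^bsub>?C\<^esub> g \<in> C.wsum S"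
      using fin S by (intro exI[of _ "S \<union> S'"]) auto
    have "\<exists>r0. \<forall>r\<ge>r0. C.Ea i r (f \<oplus>\<^bsub>?C\<^esub> g) = \<zero>\<^bsub>?C\<^esub> \<and> C.Fa i r (f \<oplus>\<^bsub>?C\<^esub> g) = \<zero>\<^bsub>?C\<^esub>" for i
    proof -
      obtain a b where "\<forall>r\<ge>a. C.Ea i r f = \<zero>\<^bsub>?C\<^esub> \<and> C.Fa i r f = \<zero>\<^bsub>?C\<^esub>" "\<forall>r\<ge>b. C.Ea i r g = \<zero>\<^bsub>?C\<^esub> \<and> C.Fa i r g = \<zero>\<^bsub>?C\<^esub>"
        using f g unfolding mem by blast
      thus ?thesis using fc by (intro exI[of _ "max a b"]) (simp del: coinduced_simps add: C.smult_r_distr)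
    qed
    thus "f \<oplus>\<^bsub>?C\<^esub> g \<in> ?V" using w fc unfolding mem by (simp del: coinduced_simps)
  next
    fix f c assume f: "f \<in> ?V"
    have fc: "f \<in> carrier ?C" using f dual_weyl_coinduced by auto
    obtain S where S: "finite S" "S \<subseteq> weights \<alpha>" "f \<in> C.wsum S" using f unfolding mem by blast
    have "C.sc c f \<in> C.wsum S" using C.K.ksubD(4)[OF C.wsum_ksub[OF S(1)] S(3)] .
    hence w: "\<exists>S. finite S \<and> S \<subseteq> weights \<alpha> \<and> C.sc c f \<in> C.wsum S" using S by blast
    have "\<exists>r0. \<forall>r\<ge>r0. C.Ea i r (C.sc c f) = \<zero>\<^bsub>?C\<^esub> \<and> C.Fa i r (C.sc c f) = \<zero>\<^bsub>?C\<^esub>" for i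
    proof -
      obtain a where "\<forall>r\<ge>a. C.Ea i r f = \<zero>\<^bsub>?C\<^esub> \<and> C.Fa i r f = \<zero>\<^bsub>?C\<^esub>" using f unfolding mem by blast
      thus ?thesis using fc by (intro exI[of _ a]) (simp del: coinduced_simps add: C.act_sc_gens C.smult_zero_right)
    qed
    thus "C.sc c f \<in> ?V" using w fc unfolding mem by (simp del: coinduced_simps)
  qed
qed

lemma weyl_mem:
  "\<theta> \<in> carrier (weyl \<alpha> q \<nu>) \<longleftrightarrow> (\<forall>f. f \<notin> carrier (dual_weyl \<alpha> q \<nu>) \<longrightarrow> \<theta> f = 0) \<and>
     kspace.klin (coinduced_module \<alpha> q \<nu>) (\<lambda>c f. uq_scalar \<alpha> q c \<odot>\<^bsub>coinduced_module \<alpha> q \<nu>\<^esub> f)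
       (carrier (dual_weyl \<alpha> q \<nu>)) \<theta>"
proof -
  interpret C: weight_module \<Phi> \<alpha> q "coinduced_module \<alpha> q \<nu>" by (rule coinduced_weight_module)
  show ?thesis unfolding C.K.klin_def
    by (auto simp: weyl_def contravariant_dual_def)
qed

lemma weyl_ops:
  "zero (weyl \<alpha> q \<nu>) = (\<lambda>f. 0)" "add (weyl \<alpha> q \<nu>) \<theta> \<theta>' = (\<lambda>f. \<theta> f + \<theta>' f)"
  "smult (weyl \<alpha> q \<nu>) u \<theta> = (\<lambda>f. if f \<in> carrier (dual_weyl \<alpha> q \<nu>)
     then \<theta> (uq_tau u \<odot>\<^bsub>coinduced_module \<alpha> q \<nu>\<^esub> f) else 0)"
  by (auto simp: weyl_def contravariant_dual_def fun_eq_iff)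

end

context fd_module
begin

interpretation S: fd_module \<Phi> \<alpha> q Td by (rule dual_fd_module)

text \<open>Let \<open>n\<close> be a preimage of the functional \<open>f \<mapsto> f(1)\<close> on the dual
  Weyl module; evaluation at \<open>n\<close> is the covector that realizes the dual of the subquotient.
  That \<open>n\<close> generates the subquotient follows by double annihilators in the finite-dimensional
  space. Stability of the dual Weyl module under the
  algebra follows from the existence of the action on functionals: if \<open>w
  f\<close> were outside it, functionals \<open>\<theta>\<close> on it would satisfy \<open>\<tau>(w)
  \<theta> = 0\<close> and \<open>(1 + \<tau>(w)) \<theta> = 0\<close> at \<open>f\<close>, because
  functionals are extended by zero; so all of them would vanish at \<open>f\<close>.\<close>

lemma factor_dual:
  assumes N: "sub N" and A: "sub A" and NA: "N \<subseteq> A" and \<mu>: "\<mu> \<in> weights \<alpha>"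
    and iso: "isomorphic_modules U (quotient_module (T\<lparr>carrier := A\<rparr>) N) (weyl \<alpha> q \<mu>)"
  shows "\<exists>\<xi>. S.factor (ann A) (ann N) \<mu> \<xi>"
proof -
  let ?C = "coinduced_module \<alpha> q \<mu>" and ?D = "weyl \<alpha> q \<mu>" and ?V = "carrier (dual_weyl \<alpha> q \<mu>)"
  interpret C: weight_module \<Phi> \<alpha> q ?C by (rule coinduced_weight_module)
  have V: "C.K.ksub ?V" by (rule dual_weyl_ksub)
  note Vc = dual_weyl_coinduced
  obtain h where h: "h \<in> module_hom_set U (quotient_module (T\<lparr>carrier := A\<rparr>) N) ?D"
      "bij_betw h (carrier (quotient_module (T\<lparr>carrier := A\<rparr>) N)) (carrier ?D)"
    using iso unfolding isomorphic_modules_def by blast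
  obtain g where g: "\<And>x. x \<in> A \<Longrightarrow> g x \<in> carrier ?D"
      "\<And>x y. x \<in> A \<Longrightarrow> y \<in> A \<Longrightarrow> g (x \<oplus> y) = g x \<oplus>\<^bsub>?D\<^esub> g y"
      "\<And>u x. u \<in> carrier U \<Longrightarrow> x \<in> A \<Longrightarrow> g (u \<star> x) = u \<odot>\<^bsub>?D\<^esub> g x"
      "\<And>w. w \<in> carrier ?D \<Longrightarrow> \<exists>x\<in>A. g x = w"
      "\<And>x y. x \<in> A \<Longrightarrow> y \<in> A \<Longrightarrow> g x = g y \<longleftrightarrow> x \<ominus> y \<in> N"
    using quotient_hom[OF left_module_axioms N A NA h] by blast
  have Ac: "x \<in> carrier T" if "x \<in> A" for x using submoduleD(1)[OF A that] .
  have gV: "g x f = 0" if "x \<in> A" "f \<notin> ?V" for x f using g(1)[OF that(1)] that(2) unfolding weyl_mem by blast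
  have glin: "C.K.klin ?V (g x)" if "x \<in> A" for x using g(1)[OF that] unfolding weyl_mem by blast
  have gadd: "g (x \<oplus> y) f = g x f + g y f" if "x \<in> A" "y \<in> A" for x y f
    using g(2)[OF that] by (simp add: weyl_ops)
  have gact: "g (u \<star> x) f = g x (uq_tau u \<odot>\<^bsub>?C\<^esub> f)" if "u \<in> carrier U" "x \<in> A" "f \<in> ?V" for u x f
    using g(3)[OF that(1,2)] that(3) by (simp add: weyl_ops)
  have gsc: "g (sc c x) f = c * g x f" if "x \<in> A" "f \<in> ?V" for c x f
    using gact[OF U_closed(7) that] C.K.klinD(2)[OF glin[OF that(1)] that(2)] by (simp add: W.Th_scalar)
  have ev: "(\<lambda>f. if f \<in> ?V then f x else 0) \<in> carrier ?D" if "x \<in> carrier U" for x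
  proof -
    have "f \<oplus>\<^bsub>?C\<^esub> f' \<in> ?V" "C.sc c f \<in> ?V" if "f \<in> ?V" "f' \<in> ?V" for f f' c
      using that C.K.ksubD(3,4)[OF V] by auto
    thus ?thesis
      unfolding weyl_mem C.K.klin_def using coinduced_scalar[OF Vc] by auto
  qed
  have stable: "w \<odot>\<^bsub>?C\<^esub> f \<in> ?V" if w: "w \<in> carrier U" and f: "f \<in> ?V" for w f
  proof (rule ccontr)
    assume nV: "w \<odot>\<^bsub>?C\<^esub> f \<notin> ?V"
    let ?wf = "w \<odot>\<^bsub>?C\<^esub> f"
    have wf: "?wf \<in> carrier ?C" using w Vc[OF f] by (rule C.smult_closed)
    have fwf: "f \<oplus>\<^bsub>?C\<^esub> ?wf \<notin> ?V"
    proof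
      assume "f \<oplus>\<^bsub>?C\<^esub> ?wf \<in> ?V"
      hence "(f \<oplus>\<^bsub>?C\<^esub> ?wf) \<oplus>\<^bsub>?C\<^esub> C.sc (- 1) f \<in> ?V" using C.K.ksubD(3,4)[OF V] f by blast
      moreover have "(f \<oplus>\<^bsub>?C\<^esub> ?wf) \<oplus>\<^bsub>?C\<^esub> C.sc (- 1) f = ?wf"
        unfolding coinduced_scalar[OF Vc[OF f]] by (auto simp: fun_eq_iff)
      ultimately show False using nV by simp
    qed
    let ?u = "uq_tau w"
    have u: "?u \<in> carrier U" "uq_tau ?u = w" using w by (rule W.Th_closed, rule W.Th_Th)
    have one: "uq_tau \<one>\<^bsub>U\<^esub> = \<one>\<^bsub>U\<^esub>" using W.Th_scalar[of 1] by (simp add: W.Q.scalar_one)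
    have zero: "g y f = 0" if y: "y \<in> A" for y
    proof -
      have uy: "?u \<star> y \<in> A" using submoduleD(6)[OF A u(1) y] .
      have "(\<one>\<^bsub>U\<^esub> \<oplus>\<^bsub>U\<^esub> ?u) \<star> y = y \<oplus> ?u \<star> y" using u Ac[OF y] by (simp add: smult_l_distr smult_one)
      moreover have "g ((\<one>\<^bsub>U\<^esub> \<oplus>\<^bsub>U\<^esub> ?u) \<star> y) f = g y (uq_tau (\<one>\<^bsub>U\<^esub> \<oplus>\<^bsub>U\<^esub> ?u) \<odot>\<^bsub>?C\<^esub> f)"
        using u by (intro gact y f) simp
      moreover have "uq_tau (\<one>\<^bsub>U\<^esub> \<oplus>\<^bsub>U\<^esub> ?u) \<odot>\<^bsub>?C\<^esub> f = f \<oplus>\<^bsub>?C\<^esub> ?wf"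
        using u w Vc[OF f] by (simp add: W.Th_add one C.smult_l_distr C.smult_one del: coinduced_simps)
      ultimately have "g y f + g (?u \<star> y) f = 0" using gadd[OF y uy, of f] gV[OF y fwf] by simp
      thus ?thesis using gact[OF u(1) y f] gV[OF y nV] u(2) by simp
    qed
    have "f x = 0" if x: "x \<in> carrier U" for x
    proof -
      obtain y where "y \<in> A" "g y = (\<lambda>f. if f \<in> ?V then f x else 0)" using g(4)[OF ev[OF x]] by blast
      thus ?thesis using zero[of y] f by simp
    qed
    hence "f = \<zero>\<^bsub>?C\<^esub>" using coinducedD(1)[OF Vc[OF f]] by (auto simp: fun_eq_iff)
    hence "?wf = \<zero>\<^bsub>?C\<^esub>" using w by (simp add: C.smult_zero_right del: coinduced_simps)
    thus False using nV C.K.ksubD(2)[OF V] by simp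
  qed
  obtain n where n: "n \<in> A" "g n = (\<lambda>f. if f \<in> ?V then f \<one>\<^bsub>U\<^esub> else 0)" using g(4)[OF ev] by blast
  have gn: "g (u \<star> n) f = f (uq_tau u)" if u: "u \<in> carrier U" and f: "f \<in> ?V" for u f
    using gact[OF u n(1) f] stable[OF W.Th_closed[OF u] f] W.Th_closed[OF u] by (simp add: n(2))
  have un: "u \<star> n \<in> A" if "u \<in> carrier U" for u using submoduleD(6)[OF A that n(1)] .
  have kA: "K.ksub A" using sub_ksub[OF A] .
  have nc: "n \<in> carrier T" using Ac[OF n(1)] .
  (* The functionals g (u n) on the dual Weyl module are f \<mapsto> f (\<tau> u), which have no common zero;
     so every functional g y is one of them. *)
  have gen: "\<exists>u\<in>carrier U. y \<ominus> u \<star> n \<in> N" if y: "y \<in> A" for y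
  proof -
    let ?E = "(\<lambda>u. u \<star> n) ` carrier U"
    have kE: "K.ksub ?E" unfolding K.ksub_def
    proof (intro conjI ballI allI)
      show "?E \<subseteq> carrier T" using nc by auto
      show "\<zero> \<in> ?E" using nc by (intro image_eqI[of _ _ "\<zero>\<^bsub>U\<^esub>"]) auto
      show "x \<oplus> x' \<in> ?E" if "x \<in> ?E" "x' \<in> ?E" for x x'
      proof -
        from that(1) obtain u where u: "x = u \<star> n" "u \<in> carrier U" by (rule imageE)
        from that(2) obtain u' where u': "x' = u' \<star> n" "u' \<in> carrier U" by (rule imageE)
        show ?thesis using u u' nc by (intro image_eqI[of _ _ "u \<oplus>\<^bsub>U\<^esub> u'"]) (auto simp: smult_l_distr)
      qed
      show "sc c x \<in> ?E" if "x \<in> ?E" for x c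
      proof -
        from that obtain u where u: "x = u \<star> n" "u \<in> carrier U" by (rule imageE)
        show ?thesis using u nc by (intro image_eqI[of _ _ "uq_scalar \<alpha> q c \<otimes>\<^bsub>U\<^esub> u"]) (auto simp: smult_assoc)
      qed
    qed
    obtain t where t: "K.kdim (carrier T) t" using kdim_T by blast
    obtain d where d: "K.kdim ?E d" using K.kdim_subspace[OF t kE] nc by auto
    have "\<exists>\<delta>\<in>?E. \<forall>f\<in>?V. g y f = g \<delta> f"
    proof (rule C.K.functional_in_span[OF K.kspace_axioms kA d _ glin gadd gsc V subset_refl glin[OF y]])
      show "?E \<subseteq> A" using un by blast
      fix f assume f: "f \<in> ?V" and z: "\<forall>\<delta>\<in>?E. g \<delta> f = 0"
      have "f x = 0" for x
      proof (cases "x \<in> carrier U")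
        case True
        have "g (uq_tau x \<star> n) f = 0" using z W.Th_closed[OF True] by blast
        thus ?thesis using gn[OF W.Th_closed[OF True] f] W.Th_Th[OF True] by simp
      qed (rule coinducedD(1)[OF Vc[OF f]])
      hence "f = \<zero>\<^bsub>?C\<^esub>" by (simp add: fun_eq_iff)
      thus "g y f = 0" using C.K.klin_zero[OF V glin[OF y]] by simp
    qed
    then obtain u where u: "u \<in> carrier U" "\<forall>f\<in>?V. g y f = g (u \<star> n) f" by blast
    have "g y = g (u \<star> n)"
    proof
      fix f show "g y f = g (u \<star> n) f" using u gV[OF y, of f] gV[OF un[OF u(1)], of f] by (cases "f \<in> ?V") auto
    qed
    thus ?thesis using g(5)[OF y un[OF u(1)]] u(1) by blast
  qed
  let ?\<xi> = "\<lambda>\<eta> :: 'm \<Rightarrow> 'k. \<eta> n"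
  have annc: "\<eta> \<in> carrier Td" "\<And>x. x \<in> N \<Longrightarrow> \<eta> x = 0" if "\<eta> \<in> ann N" for \<eta> using that by (auto simp: ann_def)
  have diff: "\<eta> x = \<eta> y" if "\<eta> \<in> ann N" "x \<ominus> y \<in> N" "x \<in> carrier T" "y \<in> carrier T" for \<eta> x y
    using K.klin_minus[OF K.ksub_carrier dualD(4)[OF annc(1)[OF that(1)]] that(3,4)] annc(2)[OF that(1,2)] by simp
  have eig: "\<eta> (h \<star> n) = c * \<eta> n"
    if h: "h \<in> carrier U" and e: "\<And>f. f \<in> ?V \<Longrightarrow> f (uq_tau h) = c * f \<one>\<^bsub>U\<^esub>" and \<eta>: "\<eta> \<in> ann N" for h c \<eta>
  proof -
    have "g (h \<star> n) = g (sc c n)"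
    proof
      fix f show "g (h \<star> n) f = g (sc c n) f"
        using gn[OF h, of f] gsc[OF n(1), of f c] e[of f] gV[OF un[OF h], of f] gV[OF un[OF U_closed(7)], of f c]
        by (cases "f \<in> ?V") (auto simp: n(2))
    qed
    hence "h \<star> n \<ominus> sc c n \<in> N" using g(5)[OF un[OF h] un[OF U_closed(7)]] by blast
    from diff[OF \<eta> this] show ?thesis using h nc dualD(3)[OF annc(1)[OF \<eta>] nc] by simp
  qed
  have co: "f (h \<otimes>\<^bsub>U\<^esub> \<one>\<^bsub>U\<^esub>) = f h" if "h \<in> carrier U" for f :: "('i, 'k) uq_elem \<Rightarrow> 'k" and h using that by simp
  have "S.factor (ann A) (ann N) \<mu> ?\<xi>"
    unfolding S.factor_def
  proof (intro conjI ballI)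
    show "S.covec (ann N) \<mu> ?\<xi>"
      unfolding S.covec_def
    proof (intro conjI ballI allI impI)
      show "S.K.klin (ann N) ?\<xi>" unfolding S.K.klin_def using dual_scalar annc(1) by simp
      fix \<eta> i assume \<eta>: "\<eta> \<in> ann N"
      show "(uq_F \<alpha> q i r \<odot>\<^bsub>Td\<^esub> \<eta>) n = 0" if "r > 0" for r
        using eig[OF U_closed(1)[of i r] _ \<eta>, of 0] coinducedD(4)[OF Vc, of _ \<mu> "\<one>\<^bsub>U\<^esub>" r i] that nc by simp
      show "(uq_K \<alpha> q i \<odot>\<^bsub>Td\<^esub> \<eta>) n = K_value \<alpha> q \<mu> i * \<eta> n"
        using eig[OF U_closed(3)[of i] _ \<eta>, of "K_value \<alpha> q \<mu> i"] coinducedD(5)[OF Vc, of _ \<mu> "\<one>\<^bsub>U\<^esub>" i] nc by simp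
      show "(uq_Kinv \<alpha> q i \<odot>\<^bsub>Td\<^esub> \<eta>) n = inverse (K_value \<alpha> q \<mu> i) * \<eta> n"
        using eig[OF U_closed(4)[of i] _ \<eta>, of "inverse (K_value \<alpha> q \<mu> i)"] coinducedD(6)[OF Vc, of _ \<mu> "\<one>\<^bsub>U\<^esub>" i] nc by simp
      show "(uq_Kbinom \<alpha> q i t \<odot>\<^bsub>Td\<^esub> \<eta>) n = Kbinom_value \<alpha> q \<mu> i t * \<eta> n" for t
        using eig[OF U_closed(5)[of i t] _ \<eta>, of "Kbinom_value \<alpha> q \<mu> i t"] coinducedD(7)[OF Vc, of _ \<mu> "\<one>\<^bsub>U\<^esub>" i t] nc by simp
    qed
    show "ann A = {\<eta> \<in> ann N. \<forall>u\<in>carrier U. (u \<odot>\<^bsub>Td\<^esub> \<eta>) n = 0}"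
    proof (intro equalityI subsetI)
      fix \<eta> assume "\<eta> \<in> ann A"
      thus "\<eta> \<in> {\<eta> \<in> ann N. \<forall>u\<in>carrier U. (u \<odot>\<^bsub>Td\<^esub> \<eta>) n = 0}"
        using NA un[OF W.Th_closed] nc by (auto simp: ann_def)
    next
      fix \<eta> assume "\<eta> \<in> {\<eta> \<in> ann N. \<forall>u\<in>carrier U. (u \<odot>\<^bsub>Td\<^esub> \<eta>) n = 0}"
      hence \<eta>: "\<eta> \<in> ann N" "\<And>u. u \<in> carrier U \<Longrightarrow> \<eta> (uq_tau u \<star> n) = 0" using nc by auto
      have "\<eta> y = 0" if y: "y \<in> A" for y
      proof -
        obtain u where u: "u \<in> carrier U" "y \<ominus> u \<star> n \<in> N" using gen[OF y] by blast
        have "\<eta> y = \<eta> (u \<star> n)" using diff[OF \<eta>(1) u(2)] Ac[OF y] nc u by simp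
        thus ?thesis using \<eta>(2)[OF W.Th_closed[OF u(1)]] W.Th_Th[OF u(1)] by simp
      qed
      thus "\<eta> \<in> ann A" using annc(1)[OF \<eta>(1)] by (simp add: ann_def)
    qed
    fix f assume f: "f \<in> ?V"
    obtain t where t: "K.kdim (carrier T) t" using kdim_T by blast
    have "K.klin A (\<lambda>y. g y f)" unfolding K.klin_def using gadd gsc[OF _ f] by blast
    then obtain \<eta>' where \<eta>': "K.klin (carrier T) \<eta>'" "\<forall>y\<in>A. \<eta>' y = g y f"
      using K.klin_extend[OF t kA, of "\<lambda>y. g y f"] Ac by blast
    let ?\<eta> = "\<lambda>x. if x \<in> carrier T then \<eta>' x else 0"
    have "?\<eta> \<in> carrier Td" by (rule dualI) (use K.klinD[OF \<eta>'(1)] in \<open>auto simp: K.klin_def\<close>)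
    moreover have "?\<eta> x = 0" if x: "x \<in> N" for x
    proof -
      have xA: "x \<in> A" using x NA by blast
      have "x \<ominus> \<zero> = x" using Ac[OF xA] by (simp add: a_minus_def K.sc_uminus[symmetric])
      hence "g x = g \<zero>" using g(5)[OF xA submoduleD(2)[OF A]] x by simp
      moreover have "g \<zero> f = 0" using gsc[OF submoduleD(2)[OF A] f, of 0] by simp
      ultimately show ?thesis using \<eta>'(2) xA by simp
    qed
    ultimately have \<eta>: "?\<eta> \<in> ann N" by (simp add: ann_def)
    have "f = S.rep ?\<xi> ?\<eta>"
    proof
      fix u
      show "f u = S.rep ?\<xi> ?\<eta> u"
        using coinducedD(1)[OF Vc[OF f], of u] gn[OF W.Th_closed f, of u] W.Th_Th[of u] \<eta>'(2) un[OF W.Th_closed, of u] nc W.Th_closed[of u]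
        by (simp add: S.rep_def)
    qed
    thus "\<exists>\<eta>\<in>ann N. f = S.rep ?\<xi> \<eta>" using \<eta> by blast
  qed (use \<mu> ann_submodule[OF A] ann_submodule[OF N] in auto)
  thus ?thesis by blast
qed

text \<open>Annihilators of the steps of the filtration, in reverse order, filter the dual.\<close>

lemma weyl_filtration:
  assumes "has_filtration U T (\<lambda>Q. \<exists>\<mu>\<in>dominant_weights \<alpha>. isomorphic_modules U Q (weyl \<alpha> q \<mu>))"
  obtains k N \<nu> \<xi> where "fd_module.filt \<alpha> q Td k N \<nu> \<xi>"
proof -
  obtain k N where N: "N 0 = {\<zero>}" "N k = carrier T" "\<forall>j\<le>k. sub (N j)"
    "\<forall>j<k. N j \<subseteq> N (Suc j) \<and> (\<exists>\<mu>\<in>dominant_weights \<alpha>.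
       isomorphic_modules U (quotient_module (T\<lparr>carrier := N (Suc j)\<rparr>) (N j)) (weyl \<alpha> q \<mu>))"
    using assms unfolding has_filtration_def by blast
  let ?N = "\<lambda>j. ann (N (k - j))"
  have "\<exists>\<mu> \<xi>. S.factor (?N j) (?N (Suc j)) \<mu> \<xi>" if j: "j < k" for j
  proof -
    let ?i = "k - Suc j"
    have i: "?i < k" "Suc ?i = k - j" using j by auto
    obtain \<mu> where \<mu>: "\<mu> \<in> dominant_weights \<alpha>"
      "isomorphic_modules U (quotient_module (T\<lparr>carrier := N (Suc ?i)\<rparr>) (N ?i)) (weyl \<alpha> q \<mu>)"
      and sb: "N ?i \<subseteq> N (Suc ?i)" using N(4) i(1) by blast
    have "\<mu> \<in> weights \<alpha>" using \<mu>(1) by (simp add: dominant_weights_def)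
    from factor_dual[OF _ _ sb this \<mu>(2)] N(3) i show ?thesis by auto
  qed
  then obtain \<nu> \<xi> where f: "\<And>j. j < k \<Longrightarrow> S.factor (?N j) (?N (Suc j)) (\<nu> j) (\<xi> j)" by metis
  have "ann (carrier T) = {\<zero>\<^bsub>Td\<^esub>}"
  proof (intro equalityI subsetI)
    fix f assume "f \<in> ann (carrier T)"
    hence "f x = 0" for x using dualD(1)[of f x] by (cases "x \<in> carrier T") (auto simp: ann_def)
    thus "f \<in> {\<zero>\<^bsub>Td\<^esub>}" by (simp add: fun_eq_iff)
  next
    fix f assume "f \<in> {\<zero>\<^bsub>Td\<^esub>}"
    thus "f \<in> ann (carrier T)" using S.M.zero_closed by (simp add: ann_def)
  qed
  moreover have "ann {\<zero>} = carrier Td" using dual_zero by (auto simp: ann_def)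
  ultimately have "S.filt k ?N \<nu> \<xi>" using N(1,2) f by (simp add: S.filt_def)
  thus ?thesis by (rule that)
qed

text \<open>Duality preserves the dimensions of weight spaces, and these determine the labels.\<close>

lemma dual_labels:
  assumes F: "filt k N \<nu> \<xi>" and F': "fd_module.filt \<alpha> q Td k' N' \<nu>' \<xi>'"
  shows "fd_module.labels k' N' \<nu>' = labels k N \<nu>"
proof -
  have "n = n'" if "\<kappa> \<in> weights \<alpha>" "K.kdim (Wt \<kappa>) n" "S.K.kdim (S.Wt \<kappa>) n'" for \<kappa> n n'
    using dual_weight_dim[OF that(1,2)] that(3) S.K.kdim_unique by blast
  from labels_determined[OF fd_module_axioms dual_fd_module F F' this] show ?thesis by simp
qed

end

section \<open>Endomorphism rings of semisimple modules\<close>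

context plain_module
begin

lemma indep_complement:
  assumes S: "finite S" "\<And>L. L \<in> S \<Longrightarrow> subm L" "indep S" "ssum S = carrier M" and N: "N \<in> S"
  shows "complement N (ssum (S - {N}))"
proof -
  have fin: "finite (S - {N})" using S by simp
  have sR: "subm (ssum (S - {N}))" by (rule ssum_subm[OF fin]) (use S in auto)
  have sN: "subm N" using S(2)[OF N] .
  have ins: "insert N (S - {N}) = S" using N by blast
  have "x = \<zero>" if x: "x \<in> N" "x \<in> ssum (S - {N})" for x
  proof -
    have xc: "x \<in> carrier M" using submoduleD(1)[OF sN x(1)] .
    obtain f where f: "\<forall>L\<in>S - {N}. f L \<in> L" "x = (\<Oplus>L\<in>S - {N}. f L)" using x(2) unfolding ssum_def by blast
    have fc: "f \<in> (S - {N}) \<rightarrow> carrier M" using f(1) S(2) submoduleD(1) by blast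
    let ?f = "f(N := \<ominus> x)"
    have "(\<Oplus>L\<in>S - {N}. ?f L) = x" unfolding f(2) by (rule M.finsum_cong') (use fc in auto)
    moreover have "?f \<in> (S - {N}) \<rightarrow> carrier M" using fc by auto
    ultimately have "(\<Oplus>L\<in>insert N (S - {N}). ?f L) = \<ominus> x \<oplus> x"
      using fin xc by (subst M.finsum_insert) (auto simp: fun_upd_same simp del: fun_upd_apply)
    hence "(\<Oplus>L\<in>S. ?f L) = \<zero>" unfolding ins using xc by (simp add: M.l_neg)
    moreover have "\<forall>L\<in>S. ?f L \<in> L" using f(1) submoduleD(4)[OF sN x(1)] by auto
    ultimately have "?f N = \<zero>" using S(3) N unfolding indep_def by blast
    thus ?thesis using xc by simp
  qed
  moreover have "\<exists>a\<in>N. \<exists>c\<in>ssum (S - {N}). x = a \<oplus> c" if "x \<in> carrier M" for x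
    using that ssum_insert[OF fin, of N] S(2,4) N unfolding ins by auto
  ultimately show ?thesis
    unfolding complement_def using sN sR submoduleD(2)[OF sN] submoduleD(2)[OF sR] by blast
qed

text \<open>If the module is a direct sum of simple modules \<open>N\<close> with projections \<open>p\<^sub>N\<close>, then its endomorphism ring
  is the sum of the left ideals generated by the \<open>p\<^sub>N\<close>. Such an ideal is simple: a nonzero \<open>\<phi>\<close> in it is
  injective on \<open>N\<close>, and every other \<open>\<chi>\<close> in it factors through \<open>\<phi>\<close>, because \<open>\<phi> N\<close> has a complement.\<close>

lemma semisimple_End:
  assumes S: "finite S" "\<And>N. N \<in> S \<Longrightarrow> simple_submodule R M N" "ssum S = carrier M"
  shows "semisimple_ring End"
proof -
  have z: "subm {\<zero>}" by (rule submoduleI) auto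
  obtain S0 where S0: "S0 \<subseteq> S" "indep S0"
    "\<And>x. x \<in> carrier M \<Longrightarrow> \<exists>n\<in>{\<zero>}. \<exists>y\<in>ssum S0. x = n \<oplus> y"
    using semisimple_complement[OF S z] by metis
  have fin: "finite S0" using S0(1) S(1) finite_subset by blast
  have sub: "subm L" if "L \<in> S0" for L using that S0(1) S(2) simple_subm by blast
  have sS0: "subm (ssum S0)" by (rule ssum_subm[OF fin sub])
  have full: "ssum S0 = carrier M"
  proof
    show "carrier M \<subseteq> ssum S0"
    proof
      fix x assume x: "x \<in> carrier M"
      obtain y where "y \<in> ssum S0" "x = \<zero> \<oplus> y" using S0(3)[OF x] by blast
      thus "x \<in> ssum S0" using submoduleD(1)[OF sS0] by simp
    qed
  qed (use submoduleD(1)[OF sS0] in blast)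
  have compl: "complement N (ssum (S0 - {N}))" if "N \<in> S0" for N
    by (rule indep_complement[OF fin sub S0(2) full that])
  have "\<exists>p. p \<in> module_hom_set R M M \<and> (\<forall>x\<in>N. \<forall>c\<in>ssum (S0 - {N}). p (x \<oplus> c) = x)" if N: "N \<in> S0" for N
  proof -
    obtain p where "p \<in> module_hom_set R M M" "\<And>x c. x \<in> N \<Longrightarrow> c \<in> ssum (S0 - {N}) \<Longrightarrow> p (x \<oplus> c) = x"
      using extend_by_zero[OF compl[OF N], of "\<lambda>x. x"] submoduleD(1)[OF sub[OF N]] by blast
    thus ?thesis by blast
  qed
  then obtain p where p: "\<And>N. N \<in> S0 \<Longrightarrow> p N \<in> module_hom_set R M M"
    "\<And>N x c. N \<in> S0 \<Longrightarrow> x \<in> N \<Longrightarrow> c \<in> ssum (S0 - {N}) \<Longrightarrow> p N (x \<oplus> c) = x" by metis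
  have sR: "subm (ssum (S0 - {N}))" for N by (rule ssum_subm) (use fin sub in auto)
  have pN: "p N x = x" if "N \<in> S0" "x \<in> N" for N x
    using p(2)[OF that submoduleD(2)[OF sR]] submoduleD(1)[OF sub[OF that(1)] that(2)] by simp
  have p0: "p N x = \<zero>" if "N \<in> S0" "x \<in> ssum (S0 - {N})" for N x
    using p(2)[OF that(1) submoduleD(2)[OF sub[OF that(1)]] that(2)] submoduleD(1)[OF sR that(2)] by simp
  have pin: "p N x \<in> N" if N: "N \<in> S0" and x: "x \<in> carrier M" for N x
  proof -
    obtain a c where "a \<in> N" "c \<in> ssum (S0 - {N})" "x = a \<oplus> c"
      using compl[OF N] x unfolding complement_def by blast
    thus ?thesis using p(2)[OF N] by simp
  qed
  let ?E = "regular_module End"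
  interpret E: plain_module ?E End by (intro plain_module.intro regular_left_module End_ring)
  have Es [simp]: "carrier ?E = module_hom_set R M M" "add ?E = add End" "zero ?E = zero End" "smult ?E = mult End"
    by (simp_all add: regular_module_def End_simps)
  define L where "L N = {\<phi> \<in> module_hom_set R M M. \<forall>x\<in>carrier M. \<phi> x = \<phi> (p N x)}" for N
  have pc: "p N x \<in> carrier M" if "N \<in> S0" "x \<in> carrier M" for N x using homD(1)[OF p(1)[OF that(1)] that(2)] .
  have sL: "E.subm (L N)" if N: "N \<in> S0" for N
  proof (rule E.submoduleI)
    show "\<zero>\<^bsub>?E\<^esub> \<in> L N" using hom_id_zero pc[OF N] by (simp add: L_def End_simps)
    show "\<phi> \<oplus>\<^bsub>?E\<^esub> \<psi> \<in> L N" if "\<phi> \<in> L N" "\<psi> \<in> L N" for \<phi> \<psi>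
      using that hom_closed(2)[of \<phi> \<psi>] pc[OF N] by (simp add: L_def End_simps)
    show "\<phi> \<odot>\<^bsub>?E\<^esub> \<psi> \<in> L N" if "\<phi> \<in> carrier End" "\<psi> \<in> L N" for \<phi> \<psi>
      using that hom_closed(1)[of \<phi> \<psi>] pc[OF N] by (simp add: L_def End_simps compose_def)
  qed (auto simp: L_def)
  have pp: "p N (p N x) = p N x" if "N \<in> S0" "x \<in> carrier M" for N x using pN[OF that(1) pin[OF that]] .
  have pL: "p N \<in> L N" if "N \<in> S0" for N using p(1) pp that by (simp add: L_def)
  have simple: "simple_submodule End ?E (L N)" if N: "N \<in> S0" for N
    unfolding simple_submodule_def
  proof (intro conjI allI impI sL[OF N])
    have sN: "subm N" and siN: "simple_submodule R M N" using sub N S0(1) S(2) by auto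
    obtain a where a: "a \<in> N" "a \<noteq> \<zero>" using siN submoduleD(2)[OF sN] unfolding simple_submodule_def by blast
    have ac: "a \<in> carrier M" using submoduleD(1)[OF sN a(1)] .
    have "p N \<noteq> zero End"
    proof
      assume "p N = zero End"
      hence "p N a = \<zero>" using ac by (simp add: End_simps)
      thus False using pN[OF N a(1)] a(2) by simp
    qed
    thus "L N \<noteq> {\<zero>\<^bsub>?E\<^esub>}" using pL[OF N] by auto
    fix L' assume L': "E.subm L' \<and> L' \<subseteq> L N"
    show "L' = {\<zero>\<^bsub>?E\<^esub>} \<or> L' = L N"
    proof (cases "L' = {\<zero>\<^bsub>?E\<^esub>}")
      case False
      then obtain \<phi> where \<phi>: "\<phi> \<in> L'" "\<phi> \<noteq> zero End" using E.submoduleD(2)[of L'] L' by auto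
      have \<phi>h: "\<phi> \<in> module_hom_set R M M" and \<phi>p: "\<And>x. x \<in> carrier M \<Longrightarrow> \<phi> x = \<phi> (p N x)"
        using \<phi>(1) L' by (auto simp: L_def)
      note hD = homD[OF \<phi>h]
      have Nc: "x \<in> carrier M" if "x \<in> N" for x using submoduleD(1)[OF sN that] .
      let ?K = "{x \<in> N. \<phi> x = \<zero>}"
      have sK: "subm ?K"
        by (rule submoduleI) (use submoduleD[OF sN] hD Nc in auto)
      have "?K \<noteq> N"
      proof
        assume K: "?K = N"
        have "\<phi> x = zero End x" for x
        proof (cases "x \<in> carrier M")
          case True
          have "p N x \<in> ?K" using pin[OF N True] K by simp
          thus ?thesis using \<phi>p[OF True] True by (simp add: End_simps)
        qed (simp add: End_simps hD(4))
        thus False using \<phi>(2) by blast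
      qed
      hence K: "?K = {\<zero>}" using siN sK unfolding simple_submodule_def by blast
      have inj: "x = y" if "x \<in> N" "y \<in> N" "\<phi> x = \<phi> y" for x y
      proof -
        have "\<phi> (x \<ominus> y) = \<zero>" using hD(7)[OF Nc[OF that(1)] Nc[OF that(2)]] that hD(1)[OF Nc[OF that(2)]]
          by (simp add: a_minus_def M.r_neg)
        hence "x \<ominus> y \<in> ?K" using submoduleD(5)[OF sN that(1,2)] by simp
        hence "x \<ominus> y = \<zero>" using K by blast
        hence "(x \<ominus> y) \<oplus> y = y" using Nc[OF that(2)] by simp
        thus ?thesis using Nc[OF that(1)] Nc[OF that(2)] by (simp add: a_minus_def M.a_assoc M.l_neg)
      qed
      have sI: "subm (\<phi> ` N)"
      proof (rule submoduleI)
        show "\<zero> \<in> \<phi> ` N" using hD(5) submoduleD(2)[OF sN] by (intro image_eqI[of _ _ "\<zero>"]) auto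
        show "x \<oplus> y \<in> \<phi> ` N" if x: "x \<in> \<phi> ` N" and y: "y \<in> \<phi> ` N" for x y
        proof -
          from x obtain x' where x': "x = \<phi> x'" "x' \<in> N" by (rule imageE)
          from y obtain y' where y': "y = \<phi> y'" "y' \<in> N" by (rule imageE)
          show ?thesis using x' y' hD(2)[OF Nc[OF x'(2)] Nc[OF y'(2)]] submoduleD(3)[OF sN x'(2) y'(2)]
            by (intro image_eqI[of _ _ "x' \<oplus> y'"]) auto
        qed
        show "r \<odot> x \<in> \<phi> ` N" if r: "r \<in> carrier R" and x: "x \<in> \<phi> ` N" for r x
        proof -
          from x obtain x' where x': "x = \<phi> x'" "x' \<in> N" by (rule imageE)
          show ?thesis using x' hD(3)[OF r Nc[OF x'(2)]] submoduleD(6)[OF sN r x'(2)]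
            by (intro image_eqI[of _ _ "r \<odot> x'"]) auto
        qed
      qed (use hD(1) Nc in auto)
      obtain S' where S': "S' \<subseteq> S" "\<phi> ` N \<inter> ssum S' = {\<zero>}"
        "\<And>x. x \<in> carrier M \<Longrightarrow> \<exists>n\<in>\<phi> ` N. \<exists>y\<in>ssum S'. x = n \<oplus> y"
        using semisimple_complement[OF S sI] by metis
      have sS': "subm (ssum S')"
        by (rule ssum_subm) (use S'(1) S(1) finite_subset S(2) simple_subm in blast)+
      have cI: "complement (\<phi> ` N) (ssum S')"
        unfolding complement_def using sI sS' S'(2,3) by blast
      have "\<chi> \<in> L'" if \<chi>: "\<chi> \<in> L N" for \<chi>
      proof -
        have \<chi>h: "\<chi> \<in> module_hom_set R M M" and \<chi>p: "\<And>x. x \<in> carrier M \<Longrightarrow> \<chi> x = \<chi> (p N x)"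
          using \<chi> by (auto simp: L_def)
        note cD = homD[OF \<chi>h]
        define g where "g y = \<chi> (THE x. x \<in> N \<and> \<phi> x = y)" for y
        have g: "g (\<phi> x) = \<chi> x" if x: "x \<in> N" for x
        proof -
          have "(THE x'. x' \<in> N \<and> \<phi> x' = \<phi> x) = x" by (rule the_equality) (use x inj in auto)
          thus ?thesis by (simp add: g_def)
        qed
        obtain \<omega> where \<omega>: "\<omega> \<in> module_hom_set R M M" "\<And>x c. x \<in> \<phi> ` N \<Longrightarrow> c \<in> ssum S' \<Longrightarrow> \<omega> (x \<oplus> c) = g x"
        proof (rule extend_by_zero[OF cI, of g])
          show "g x \<in> carrier M" if x: "x \<in> \<phi> ` N" for x
          proof -
            from x obtain x' where x': "x = \<phi> x'" "x' \<in> N" by (rule imageE)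
            show ?thesis using x' g cD(1) Nc by simp
          qed
          show "g (x \<oplus> y) = g x \<oplus> g y" if x: "x \<in> \<phi> ` N" and y: "y \<in> \<phi> ` N" for x y
          proof -
            from x obtain x' where x': "x = \<phi> x'" "x' \<in> N" by (rule imageE)
            from y obtain y' where y': "y = \<phi> y'" "y' \<in> N" by (rule imageE)
            have "x \<oplus> y = \<phi> (x' \<oplus> y')" using x' y' hD(2) Nc by simp
            thus ?thesis using x' y' g submoduleD(3)[OF sN] cD(2) Nc by simp
          qed
          show "g (r \<odot> x) = r \<odot> g x" if r: "r \<in> carrier R" and x: "x \<in> \<phi> ` N" for r x
          proof -
            from x obtain x' where x': "x = \<phi> x'" "x' \<in> N" by (rule imageE)
            have "r \<odot> x = \<phi> (r \<odot> x')" using x' r hD(3) Nc by simp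
            thus ?thesis using x' r g submoduleD(6)[OF sN] cD(3) Nc by simp
          qed
        qed (use that in blast)
        have "\<omega> (\<phi> x) = \<chi> x" if x: "x \<in> carrier M" for x
        proof -
          have xN: "p N x \<in> N" using pin[OF N x] .
          have "\<omega> (\<phi> (p N x) \<oplus> \<zero>) = g (\<phi> (p N x))"
            by (rule \<omega>(2)) (use xN submoduleD(2)[OF sS'] in auto)
          thus ?thesis using g[OF xN] \<phi>p[OF x] \<chi>p[OF x] hD(1)[OF x] by simp
        qed
        hence "\<omega> \<otimes>\<^bsub>End\<^esub> \<phi> = \<chi>"
          using cD(4) by (intro ext) (auto simp: End_simps compose_def)
        thus ?thesis using E.submoduleD(6)[of L' \<omega> \<phi>] L' \<omega>(1) \<phi>(1) by (simp add: End_simps)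
      qed
      thus ?thesis using L' by blast
    qed simp
  qed
  let ?X = "E.ssum (L ` S0)"
  have finL: "finite (L ` S0)" using fin by simp
  have subL: "E.subm K" if "K \<in> L ` S0" for K using that sL by blast
  have X: "E.subm ?X" by (rule E.ssum_subm[OF finL subL])
  have "\<phi> \<in> ?X" if \<phi>: "\<phi> \<in> module_hom_set R M M" for \<phi>
  proof -
    note hD = homD[OF \<phi>]
    (* The sum of the \<phi> p N over N in S1, described without sums by its values. *)
    have "\<exists>\<chi>\<in>?X. (\<forall>x\<in>ssum S1. \<chi> x = \<phi> x) \<and> (\<forall>K\<in>S0 - S1. \<forall>a\<in>K. \<chi> a = \<zero>)"
      if "finite S1" "S1 \<subseteq> S0" for S1
      using that
    proof (induction S1 rule: finite_induct)
      case empty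
      have "zero End \<in> ?X" using E.submoduleD(2)[OF X] by simp
      thus ?case using hD(5) sub submoduleD(1) by (intro bexI[of _ "zero End"]) (auto simp: End_simps)
    next
      case (insert N S1)
      then obtain \<chi> where \<chi>: "\<chi> \<in> ?X" "\<forall>x\<in>ssum S1. \<chi> x = \<phi> x" "\<forall>K\<in>S0 - S1. \<forall>a\<in>K. \<chi> a = \<zero>" by auto
      have N: "N \<in> S0" "N \<notin> S1" using insert by auto
      have \<chi>h: "\<chi> \<in> module_hom_set R M M" using E.submoduleD(1)[OF X \<chi>(1)] by simp
      let ?f = "\<phi> \<otimes>\<^bsub>End\<^esub> p N"
      have "?f \<in> L N" using E.submoduleD(6)[OF sL[OF N(1)] _ pL[OF N(1)], of \<phi>] \<phi> by (simp add: End_simps)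
      hence f: "?f \<in> ?X" using E.ssum_mem[OF finL subL, of "L N"] N(1) by blast
      have fx: "?f x = \<phi> (p N x)" if "x \<in> carrier M" for x using that by (simp add: End_simps compose_def)
      let ?g = "\<chi> \<oplus>\<^bsub>End\<^esub> ?f"
      have g: "?g \<in> ?X" using E.submoduleD(3)[OF X \<chi>(1) f] by simp
      have gx: "?g x = \<chi> x \<oplus> \<phi> (p N x)" if "x \<in> carrier M" for x using fx that by (simp add: End_simps)
      have s1: "subm L" if "L \<in> insert N S1" for L using that insert sub by auto
      have "?g x = \<phi> x" if x: "x \<in> ssum (insert N S1)" for x
      proof -
        obtain a y where ay: "a \<in> N" "y \<in> ssum S1" "x = a \<oplus> y"
          using x ssum_insert[OF insert.hyps s1] by blast
        have "ssum S1 \<subseteq> ssum (S0 - {N})"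
        proof (rule ssum_least[OF insert.hyps(1) sR])
          fix K assume "K \<in> S1"
          hence "K \<in> S0 - {N}" using insert.prems N(2) by blast
          thus "K \<subseteq> ssum (S0 - {N})" using fin sub by (intro ssum_mem) auto
        qed
        hence yR: "y \<in> ssum (S0 - {N})" using ay by blast
        have c: "a \<in> carrier M" "y \<in> carrier M" using submoduleD(1)[OF sub[OF N(1)] ay(1)] submoduleD(1)[OF sR yR] by auto
        have "\<chi> x = \<phi> y" using homD(2)[OF \<chi>h c] homD(1)[OF \<phi> c(2)] \<chi>(2,3) ay N by simp
        moreover have "p N x = a" using p(2)[OF N(1) ay(1) yR] ay(3) by simp
        ultimately show ?thesis using gx[of x] c ay(3) hD(1)[OF c(1)] hD(1)[OF c(2)] hD(2)[OF c] by (simp add: M.a_comm)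
      qed
      moreover have "?g a = \<zero>" if K: "K \<in> S0 - insert N S1" and a: "a \<in> K" for K a
      proof -
        have ac: "a \<in> carrier M" using submoduleD(1)[OF sub a] K by blast
        have "K \<subseteq> ssum (S0 - {N})" using K fin sub by (intro ssum_mem) auto
        hence "p N a = \<zero>" using p0[OF N(1)] a by blast
        moreover have "\<chi> a = \<zero>" using \<chi>(3) K a by blast
        ultimately show ?thesis using gx[OF ac] hD(5) by simp
      qed
      ultimately show ?case using g by blast
    qed
    from this[OF fin subset_refl] obtain \<chi> where \<chi>: "\<chi> \<in> ?X" "\<forall>x\<in>ssum S0. \<chi> x = \<phi> x" by blast
    have "\<chi> = \<phi>" using E.submoduleD(1)[OF X \<chi>(1)] \<chi>(2) full by (intro hom_eqI[OF _ \<phi>]) auto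
    thus ?thesis using \<chi>(1) by simp
  qed
  hence "?X = carrier ?E" using E.submoduleD(1)[OF X] by auto
  from E.semisimpleI[OF finL _ this] show ?thesis
    unfolding semisimple_ring_def using simple by blast
qed

end

sublocale weight_module \<subseteq> P: plain_module T "uq \<alpha> q"
  by (intro plain_module.intro left_module_axioms)

section \<open>Splitting the filtration\<close>

context fd_module
begin

text \<open>The anti-involution exchanges \<open>E\<close>'s and \<open>F\<close>'s, so being killed by the
  \<open>E\<close>'s in the dual means vanishing on the images of the \<open>F\<close>'s.\<close>

lemma covec_of_dual:
  assumes "\<zeta> \<in> weight_space \<alpha> q Td \<kappa>" and E: "\<And>i r. r > 0 \<Longrightarrow> uq_E \<alpha> q i r \<odot>\<^bsub>Td\<^esub> \<zeta> = \<zero>\<^bsub>Td\<^esub>"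
  shows "covec (carrier T) \<kappa> \<zeta>"
proof -
  interpret S: fd_module \<Phi> \<alpha> q Td by (rule dual_fd_module)
  note w = S.WtD[OF assms(1)]
  note sc = dual_scalar[OF w(1)]
  show ?thesis unfolding covec_def
  proof (intro conjI ballI allI impI dualD(4)[OF w(1)])
    fix x i assume x: "x \<in> carrier T"
    show "\<zeta> (Fa i r x) = 0" if "r > 0" for r using fun_cong[OF E[OF that, of i], of x] x by simp
    show "\<zeta> (uq_K \<alpha> q i \<star> x) = K_value \<alpha> q \<kappa> i * \<zeta> x"
      using fun_cong[OF w(2)[of i], of x] x unfolding sc by simp
    show "\<zeta> (uq_Kinv \<alpha> q i \<star> x) = inverse (K_value \<alpha> q \<kappa> i) * \<zeta> x"
      using fun_cong[OF w(3)[of i], of x] x unfolding sc by simp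
    show "\<zeta> (uq_Kbinom \<alpha> q i t \<star> x) = Kbinom_value \<alpha> q \<kappa> i t * \<zeta> x" for t
      using fun_cong[OF w(4)[of i t], of x] x unfolding sc by (simp add: Kbinom_value_def chi_def)
  qed
qed

lemma covec_to_dual:
  assumes c: "covec (carrier T) \<kappa> \<zeta>"
  shows "(\<lambda>x. if x \<in> carrier T then \<zeta> x else 0) \<in> weight_space \<alpha> q Td \<kappa>" (is "?z \<in> _")
    "\<And>i r. r > 0 \<Longrightarrow> uq_E \<alpha> q i r \<odot>\<^bsub>Td\<^esub> (\<lambda>x. if x \<in> carrier T then \<zeta> x else 0) = \<zero>\<^bsub>Td\<^esub>"
proof -
  interpret S: fd_module \<Phi> \<alpha> q Td by (rule dual_fd_module)
  have z: "?z \<in> carrier Td" by (rule dualI) (use K.klinD[OF covecD(1)[OF c]] in \<open>auto simp: K.klin_def\<close>)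
  show "?z \<in> S.Wt \<kappa>"
  proof (rule S.WtI[OF z])
    show "uq_K \<alpha> q i \<odot>\<^bsub>Td\<^esub> ?z = S.sc (K_value \<alpha> q \<kappa> i) ?z" for i
      unfolding dual_scalar[OF z] using covecD(3)[OF c] by auto
    show "uq_Kbinom \<alpha> q i t \<odot>\<^bsub>Td\<^esub> ?z = S.sc (chi i (weight_coeff \<alpha> \<kappa> i) t) ?z" for i t
      unfolding dual_scalar[OF z] using covecD(5)[OF c] by (auto simp: Kbinom_value_def chi_def)
  qed
  show "uq_E \<alpha> q i r \<odot>\<^bsub>Td\<^esub> ?z = \<zero>\<^bsub>Td\<^esub>" if "r > 0" for i r
    using covecD(2)[OF c _ that] by auto
qed

text \<open>By Frobenius reciprocity a covector is a homomorphism to a dual Weyl module; if a subquotient of the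
  filtration splits off, the homomorphism lands in the module itself.\<close>

lemma split_factor:
  assumes f: "factor N A \<nu> \<xi>" and AC: "P.complement N C"
  shows "\<And>g. g \<in> carrier (dual_weyl \<alpha> q \<nu>) \<Longrightarrow> \<exists>c\<in>C \<inter> A. rep \<xi> c = g"
    "\<And>c c'. c \<in> C \<inter> A \<Longrightarrow> c' \<in> C \<inter> A \<Longrightarrow> rep \<xi> c = rep \<xi> c' \<Longrightarrow> c = c'"
proof -
  note A = factorD(2)[OF f] and N = factorD(1)[OF f]
  have C: "sub C" and z: "N \<inter> C = {\<zero>}" and dec: "\<And>x. x \<in> carrier T \<Longrightarrow> \<exists>n\<in>N. \<exists>c\<in>C. x = n \<oplus> c"
    using AC by (auto simp: P.complement_def)
  show "\<exists>c\<in>C \<inter> A. rep \<xi> c = g" if g: "g \<in> carrier (dual_weyl \<alpha> q \<nu>)" for g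
  proof -
    obtain x where x: "x \<in> A" "g = rep \<xi> x" using factorD(7)[OF f g] by blast
    have xc: "x \<in> carrier T" using submoduleD(1)[OF A x(1)] .
    obtain n c where nc: "n \<in> N" "c \<in> C" "x = n \<oplus> c" using dec[OF xc] by blast
    have cs: "n \<in> carrier T" "c \<in> carrier T" using nc submoduleD(1)[OF N] submoduleD(1)[OF C] by auto
    have nA: "n \<in> A" using nc factorD(5)[OF f] by blast
    have "c = x \<ominus> n" using nc(3) cs by (simp add: a_minus_def M.a_ac M.r_neg)
    hence cA: "c \<in> A" using submoduleD(5)[OF A x(1) nA] by simp
    have "rep \<xi> n = (\<lambda>_. 0)" using factorD(6)[OF f nA] nc(1) by (auto simp: rep_def)
    hence "rep \<xi> x = rep \<xi> c" unfolding nc(3) using rep_add[OF A factorD(4)[OF f] nA cA] by simp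
    thus ?thesis using nc cA x by auto
  qed
  show "c = c'" if c: "c \<in> C \<inter> A" "c' \<in> C \<inter> A" "rep \<xi> c = rep \<xi> c'" for c c'
  proof -
    have "\<xi> (u \<star> c) = \<xi> (u \<star> c')" if "u \<in> carrier U" for u
      using fun_cong[OF c(3), of u] that by (simp add: rep_def)
    hence "c \<ominus> c' \<in> N" using factor_equal[OF f] c by blast
    moreover have "c \<ominus> c' \<in> C" using submoduleD(5)[OF C] c by blast
    ultimately have "c \<ominus> c' = \<zero>" using z by blast
    thus ?thesis using K.minus_zero_eq[of c c'] c submoduleD(1)[OF A] by blast
  qed
qed

lemma section_hom:
  assumes f: "factor N A \<nu> \<xi>" and AC: "P.complement N C" and c: "covec (carrier T) \<nu> \<zeta>"
  obtains \<phi> where "\<phi> \<in> module_hom_set U T T" "\<And>t. t \<in> carrier T \<Longrightarrow> \<phi> t \<in> C \<inter> A"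
    "\<And>u t. u \<in> carrier U \<Longrightarrow> t \<in> carrier T \<Longrightarrow> \<xi> (u \<star> \<phi> t) = \<zeta> (u \<star> t)"
proof -
  note A = factorD(2)[OF f]
  have C: "sub C" using AC by (simp add: P.complement_def)
  have "\<exists>x\<in>C \<inter> A. rep \<xi> x = rep \<zeta> t" if "t \<in> carrier T" for t
    using split_factor(1)[OF f AC] rep_dual_weyl[OF sub_carrier c that] by blast
  then obtain h where h: "\<And>t. t \<in> carrier T \<Longrightarrow> h t \<in> C \<inter> A" "\<And>t. t \<in> carrier T \<Longrightarrow> rep \<xi> (h t) = rep \<zeta> t" by metis
  have hc: "h t \<in> carrier T" if "t \<in> carrier T" for t using h(1)[OF that] submoduleD(1)[OF A] by blast
  define \<phi> where "\<phi> = (\<lambda>t\<in>carrier T. h t)"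
  have "\<phi> \<in> module_hom_set U T T"
    unfolding module_hom_set_def
  proof (intro CollectI conjI ballI)
    show "\<phi> \<in> carrier T \<rightarrow>\<^sub>E carrier T" using hc by (simp add: \<phi>_def)
    fix x y assume x: "x \<in> carrier T" and y: "y \<in> carrier T"
    have "rep \<xi> (h (x \<oplus> y)) = rep \<xi> (h x \<oplus> h y)"
      using rep_add[OF A factorD(4)[OF f], of "h x" "h y"] rep_add[OF sub_carrier c x y] h x y by simp
    hence "h (x \<oplus> y) = h x \<oplus> h y"
      using h(1) x y submoduleD(3)[OF C] submoduleD(3)[OF A] by (intro split_factor(2)[OF f AC]) auto
    thus "\<phi> (x \<oplus> y) = \<phi> x \<oplus> \<phi> y" using x y by (simp add: \<phi>_def)
  next
    fix a x assume a: "a \<in> carrier U" and x: "x \<in> carrier T"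
    have "rep \<xi> (h (a \<star> x)) = rep \<xi> (a \<star> h x)"
      using rep_act[OF x a, of \<nu> \<zeta>] rep_act[OF hc[OF x] a, of \<nu> \<xi>] h a x by simp
    hence "h (a \<star> x) = a \<star> h x"
      using h(1) a x submoduleD(6)[OF C a] submoduleD(6)[OF A a] by (intro split_factor(2)[OF f AC]) auto
    thus "\<phi> (a \<star> x) = a \<star> \<phi> x" using a x by (simp add: \<phi>_def)
  qed
  moreover have "\<xi> (u \<star> \<phi> t) = \<zeta> (u \<star> t)" if "u \<in> carrier U" "t \<in> carrier T" for u t
    using fun_cong[OF h(2)[OF that(2)], of u] that by (simp add: rep_def \<phi>_def)
  moreover have "\<phi> t \<in> C \<inter> A" if "t \<in> carrier T" for t using h(1) that by (simp add: \<phi>_def)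
  ultimately show ?thesis using that by blast
qed

text \<open>The top weight space of a split subquotient is a line contained in every nonzero submodule, so
  two submodules cannot be independent.\<close>

lemma split_indecomposable:
  assumes f: "factor N A \<nu> \<xi>" and AC: "P.complement N C"
    and B: "sub B" "B \<subseteq> C \<inter> A" "B \<noteq> {\<zero>}" and B': "sub B'" "B' \<subseteq> C \<inter> A" "B' \<noteq> {\<zero>}"
  obtains x where "x \<in> B" "x \<in> B'" "x \<noteq> \<zero>"
proof -
  note A = factorD(2)[OF f]
  have C: "sub C" and z: "N \<inter> C = {\<zero>}" using AC by (auto simp: P.complement_def)
  have nN: "\<not> X \<subseteq> N" if "sub X" "X \<subseteq> C \<inter> A" "X \<noteq> {\<zero>}" for X
    using that z submoduleD(2)[OF that(1)] by blast
  obtain y where y: "y \<in> B" "y \<in> Wt \<nu>" "\<xi> y \<noteq> 0" using factor_socle[OF f B(1) _ nN[OF B]] B(2) by blast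
  obtain y' where y': "y' \<in> B'" "y' \<in> Wt \<nu>" "\<xi> y' \<noteq> 0" using factor_socle[OF f B'(1) _ nN[OF B']] B'(2) by blast
  let ?c = "\<xi> y / \<xi> y'"
  have yc: "y \<in> carrier T" "y' \<in> carrier T" using WtD(1) y y' by blast+
  have yA: "y \<in> A" "y' \<in> A" "y \<in> C" "y' \<in> C" using y y' B B' by auto
  have sy: "sc ?c y' \<in> A" "sc ?c y' \<in> C" "sc ?c y' \<in> Wt \<nu>" "sc ?c y' \<in> B'"
    using submoduleD(6)[OF A U_closed(7) yA(2)] submoduleD(6)[OF C U_closed(7) yA(4)] Wt_sc[OF y'(2)]
      submoduleD(6)[OF B'(1) U_closed(7) y'(1)] by auto
  have "\<xi> (y \<ominus> sc ?c y') = 0"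
    using K.klin_minus[OF sub_ksub[OF A] factorD(8)[OF f] yA(1) sy(1)] K.klinD(2)[OF factorD(8)[OF f] yA(2)] y'(3) by simp
  moreover have "y \<ominus> sc ?c y' \<in> A" using submoduleD(5)[OF A yA(1) sy(1)] .
  moreover have "y \<ominus> sc ?c y' \<in> Wt \<nu>" using K.ksubD(6)[OF Wt_ksub y(2) sy(3)] .
  ultimately have "y \<ominus> sc ?c y' \<in> N" using factor_top_line[OF f] by blast
  moreover have "y \<ominus> sc ?c y' \<in> C" using submoduleD(5)[OF C yA(3) sy(2)] .
  ultimately have "y \<ominus> sc ?c y' = \<zero>" using z by blast
  hence eq: "y = sc ?c y'" using K.minus_zero_eq[of y "sc ?c y'"] yc by blast
  have "y \<in> B'" using sy(4) eq by simp
  moreover have "y \<noteq> \<zero>" using y(3) K.klin_zero[OF sub_ksub[OF A] factorD(8)[OF f]] by auto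
  ultimately show ?thesis using that y(1) by blast
qed

end

text \<open>What the converse direction uses: a filtration by dual Weyl modules, nonzero covectors exactly
  at its labels, and quasi-inverses in the endomorphism ring.\<close>

locale regular_filtered = fd_module +
  fixes k N \<nu> \<xi>
  assumes F: "filt k N \<nu> \<xi>"
    and label_covec: "\<kappa> \<in> labels k N \<nu> \<Longrightarrow> \<exists>\<zeta>. covec (carrier T) \<kappa> \<zeta> \<and> (\<exists>x\<in>carrier T. \<zeta> x \<noteq> 0)"
    and covec_label: "covec (carrier T) \<kappa> \<zeta> \<Longrightarrow> \<kappa> \<in> weights \<alpha> \<Longrightarrow> x \<in> carrier T \<Longrightarrow> \<zeta> x \<noteq> 0 \<Longrightarrow> \<kappa> \<in> labels k N \<nu>"
    and regular: "\<phi> \<in> module_hom_set (uq \<alpha> q) T T \<Longrightarrow> \<exists>\<psi>\<in>module_hom_set (uq \<alpha> q) T T. \<forall>x\<in>carrier T. \<phi> (\<psi> (\<phi> x)) = \<phi> x"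
begin

lemma factor_j: "j < k \<Longrightarrow> factor (N j) (N (Suc j)) (\<nu> j) (\<xi> j)"
  using F unfolding filt_def by blast

text \<open>A quasi-inverse of a nonzero homomorphism to a split subquotient gives a projection onto it.\<close>

lemma split_projection:
  assumes j: "j < k" and ne: "N j \<noteq> N (Suc j)" and C: "P.complement (N j) C"
  obtains e where "e \<in> module_hom_set U T T" "\<And>t. t \<in> carrier T \<Longrightarrow> e t \<in> C \<inter> N (Suc j)"
    "\<And>d. d \<in> C \<inter> N (Suc j) \<Longrightarrow> e d = d"
proof -
  note f = factor_j[OF j]
  let ?D = "C \<inter> N (Suc j)"
  have sC: "sub C" using C by (simp add: P.complement_def)
  have D: "sub ?D" by (rule sub_Int[OF sC factorD(2)[OF f]])
  have Dc: "d \<in> carrier T" if "d \<in> ?D" for d using submoduleD(1)[OF D that] .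
  obtain \<zeta> x where \<zeta>: "covec (carrier T) (\<nu> j) \<zeta>" "x \<in> carrier T" "\<zeta> x \<noteq> 0"
    using label_covec[of "\<nu> j"] j ne unfolding labels_def by blast
  obtain \<phi> where \<phi>: "\<phi> \<in> module_hom_set U T T" "\<And>t. t \<in> carrier T \<Longrightarrow> \<phi> t \<in> ?D"
    "\<And>u t. u \<in> carrier U \<Longrightarrow> t \<in> carrier T \<Longrightarrow> \<xi> j (u \<star> \<phi> t) = \<zeta> (u \<star> t)"
    using section_hom[OF f C \<zeta>(1)] by blast
  obtain \<psi> where \<psi>: "\<psi> \<in> module_hom_set U T T" "\<And>x. x \<in> carrier T \<Longrightarrow> \<phi> (\<psi> (\<phi> x)) = \<phi> x"
    using regular[OF \<phi>(1)] by blast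
  (* The values of this idempotent are values of \<phi>, hence lie in the split subquotient. *)
  define e where "e = compose (carrier T) \<phi> \<psi>"
  have e: "e \<in> module_hom_set U T T" unfolding e_def by (rule P.hom_closed(1)[OF \<phi>(1) \<psi>(1)])
  note eD = P.homD[OF e]
  have ev: "e t = \<phi> (\<psi> t)" if "t \<in> carrier T" for t using that by (simp add: e_def compose_def)
  have eDD: "e t \<in> ?D" if "t \<in> carrier T" for t using ev[OF that] \<phi>(2)[OF P.homD(1)[OF \<psi>(1) that]] by simp
  have ee: "e (e t) = e t" if "t \<in> carrier T" for t
    using ev[OF that] ev[OF Dc[OF eDD[OF that]]] \<psi>(2)[OF P.homD(1)[OF \<psi>(1) that]] by simp
  have "\<phi> x \<noteq> \<zero>"
  proof
    assume "\<phi> x = \<zero>"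
    hence "\<zeta> x = \<xi> j \<zero>" using \<phi>(3)[of "\<one>\<^bsub>U\<^esub>" x] \<zeta>(2) by (simp add: smult_one)
    also have "\<dots> = 0" by (rule K.klin_zero[OF sub_ksub[OF factorD(2)[OF f]] factorD(8)[OF f]])
    finally show False using \<zeta>(3) by simp
  qed
  moreover have "e (\<phi> x) = \<phi> x" using ev[OF Dc[OF \<phi>(2)[OF \<zeta>(2)]]] \<psi>(2)[OF \<zeta>(2)] by simp
  ultimately have I: "\<phi> x \<in> {d \<in> ?D. e d = d}" "\<phi> x \<noteq> \<zero>" using \<phi>(2)[OF \<zeta>(2)] by auto
  let ?I = "{d \<in> ?D. e d = d}" and ?Z = "{d \<in> ?D. e d = \<zero>}"
  have sI: "sub ?I" by (rule submoduleI) (use submoduleD[OF D] eD Dc in auto)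
  have sZ: "sub ?Z" by (rule submoduleI) (use submoduleD[OF D] eD Dc in auto)
  have Z: "?Z = {\<zero>}"
  proof (rule ccontr)
    assume Z: "?Z \<noteq> {\<zero>}"
    have I0: "?I \<noteq> {\<zero>}" using I by blast
    obtain y where "y \<in> ?I" "y \<in> ?Z" "y \<noteq> \<zero>"
      by (rule split_indecomposable[OF f C sI _ I0 sZ _ Z]) auto
    thus False by simp
  qed
  have "e d = d" if d: "d \<in> ?D" for d
  proof -
    have dc: "d \<in> carrier T" using Dc[OF d] .
    have "e (d \<ominus> e d) = \<zero>" using eD(7)[OF dc eD(1)[OF dc]] ee[OF dc] eD(1)[OF dc] by (simp add: a_minus_def M.r_neg)
    hence "d \<ominus> e d \<in> ?Z" using submoduleD(5)[OF D d eDD[OF dc]] by simp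
    hence "d \<ominus> e d = \<zero>" using Z by blast
    thus ?thesis using K.minus_zero_eq[OF dc eD(1)[OF dc]] by simp
  qed
  thus ?thesis using that[OF e] eDD by blast
qed

lemma filtration_splits: "j \<le> k \<Longrightarrow> \<exists>C. P.complement (N j) C"
proof (induction j)
  case 0
  have "P.complement {\<zero>} (carrier T)"
    unfolding P.complement_def using sub_zero sub_carrier by auto
  thus ?case using F by (auto simp: filt_def)
next
  case (Suc j)
  then obtain C where C: "P.complement (N j) C" by auto
  have j: "j < k" using Suc by simp
  show ?case
  proof (cases "N j = N (Suc j)")
    case False
    note f = factor_j[OF j]
    note A = factorD(2)[OF f] and N0 = factorD(1)[OF f]
    obtain e where e: "e \<in> module_hom_set U T T" "\<And>t. t \<in> carrier T \<Longrightarrow> e t \<in> C \<inter> N (Suc j)"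
      "\<And>d. d \<in> C \<inter> N (Suc j) \<Longrightarrow> e d = d" using split_projection[OF j False C] by blast
    note eD = P.homD[OF e(1)]
    have sC: "sub C" and dec: "\<And>x. x \<in> carrier T \<Longrightarrow> \<exists>n\<in>N j. \<exists>c\<in>C. x = n \<oplus> c"
      using C by (auto simp: P.complement_def)
    have Cc: "c \<in> carrier T" if "c \<in> C" for c using submoduleD(1)[OF sC that] .
    let ?C = "{c \<in> C. e c = \<zero>}"
    have C': "sub ?C" by (rule submoduleI) (use submoduleD[OF sC] eD Cc in auto)
    have "N (Suc j) \<inter> ?C = {\<zero>}"
    proof (intro equalityI subsetI)
      fix x assume "x \<in> N (Suc j) \<inter> ?C"
      hence "x \<in> C \<inter> N (Suc j)" "e x = \<zero>" by auto
      thus "x \<in> {\<zero>}" using e(3)[of x] by simp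
    qed (use submoduleD(2)[OF A] submoduleD(2)[OF C'] in auto)
    moreover have "\<exists>a\<in>N (Suc j). \<exists>c\<in>?C. x = a \<oplus> c" if x: "x \<in> carrier T" for x
    proof -
      obtain n c where nc: "n \<in> N j" "c \<in> C" "x = n \<oplus> c" using dec[OF x] by blast
      have cc: "n \<in> carrier T" "c \<in> carrier T" "e c \<in> carrier T"
        using nc submoduleD(1)[OF N0] Cc eD(1) by auto
      have "n \<oplus> e c \<in> N (Suc j)"
        using submoduleD(3)[OF A] nc(1) factorD(5)[OF f] e(2)[OF cc(2)] by blast
      moreover have "c \<ominus> e c \<in> ?C"
        using submoduleD(5)[OF sC nc(2)] e(2)[OF cc(2)] eD(7)[OF cc(2,3)] e(3)[OF e(2)[OF cc(2)]] cc
        by (simp add: a_minus_def M.r_neg)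
      moreover have "x = (n \<oplus> e c) \<oplus> (c \<ominus> e c)"
        unfolding nc(3) a_minus_def using cc by (simp add: M.a_ac M.r_neg M.r_neg1 M.r_neg2)
      ultimately show ?thesis by blast
    qed
    ultimately have "P.complement (N (Suc j)) ?C" unfolding P.complement_def using A C' by blast
    thus ?thesis by blast
  qed (use C in auto)
qed

text \<open>If \<open>B\<close> were a proper nonzero submodule of the split subquotient \<open>D\<close>, a functional
  on a weight space of \<open>D\<close> that is highest among those not contained in \<open>B\<close> would be a covector of
  weight \<open>\<kappa>\<close> that vanishes on \<open>B\<close>. Its weight is then a label, so it gives a homomorphism to some split subquotient,
  and a quasi-inverse yields a nonzero idempotent endomorphism of \<open>D\<close> that kills \<open>B\<close>.\<close>

lemma split_simple:
  assumes j: "j < k" and C: "P.complement (N j) C" and ne: "C \<inter> N (Suc j) \<noteq> {\<zero>}"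
  shows "simple_submodule U T (C \<inter> N (Suc j))"
proof (rule ccontr)
  let ?D = "C \<inter> N (Suc j)"
  note f = factor_j[OF j]
  have sC: "sub C" and NC: "N j \<inter> C = {\<zero>}" using C by (auto simp: P.complement_def)
  have D: "sub ?D" by (rule sub_Int[OF sC factorD(2)[OF f]])
  have Dc: "d \<in> carrier T" if "d \<in> ?D" for d using submoduleD(1)[OF D that] .
  have neN: "N j \<noteq> N (Suc j)" using ne NC by blast
  obtain e where e: "e \<in> module_hom_set U T T" "\<And>t. t \<in> carrier T \<Longrightarrow> e t \<in> ?D" "\<And>d. d \<in> ?D \<Longrightarrow> e d = d"
    using split_projection[OF j neN C] by blast
  note eD = P.homD[OF e(1)]
  assume "\<not> simple_submodule U T ?D"
  then obtain B where B: "sub B" "B \<subseteq> ?D" "B \<noteq> {\<zero>}" "B \<noteq> ?D"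
    unfolding simple_submodule_def using D ne by blast
  have Bc: "b \<in> carrier T" if "b \<in> B" for b using submoduleD(1)[OF B(1) that] .
  (* A functional on a weight space of greatest height among those not inside B is a covector:
     the F's reach this weight space only from weight spaces inside B. *)
  let ?W = "{\<kappa> \<in> Om. \<not> ?D \<inter> Wt \<kappa> \<subseteq> B}"
  have "?W \<noteq> {}"
  proof
    assume W: "?W = {}"
    have "d \<in> B" if d: "d \<in> ?D" for d
    proof -
      have "pr d \<kappa> \<in> B" if "\<kappa> \<in> Om" for \<kappa>
        using W that pr_sub[OF D d, of \<kappa>] pr(1)[OF Dc[OF d], of \<kappa>] by blast
      hence "(\<Oplus>\<kappa>\<in>Om. pr d \<kappa>) \<in> B" by (rule finsum_in_submodule[OF B(1) Om(1)])
      thus ?thesis using pr(3)[OF Dc[OF d]] by simp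
    qed
    thus False using B by blast
  qed
  hence HW: "finite (ht ` ?W)" "ht ` ?W \<noteq> {}" using Om(1) by auto
  from Max_in[OF HW] obtain \<kappa> where "Max (ht ` ?W) = ht \<kappa>" "\<kappa> \<in> ?W" by (rule imageE)
  hence \<kappa>: "\<kappa> \<in> Om" "\<not> ?D \<inter> Wt \<kappa> \<subseteq> B" and max: "\<And>\<mu>. \<mu> \<in> ?W \<Longrightarrow> ht \<mu> \<le> ht \<kappa>"
    using Max_ge[OF HW(1)] by auto
  have \<kappa>w: "\<kappa> \<in> weights \<alpha>" using \<kappa>(1) Om(2) by blast
  obtain v where v: "v \<in> ?D" "v \<in> Wt \<kappa>" "v \<notin> B" using \<kappa>(2) by blast
  have vc: "v \<in> carrier T" using Dc[OF v(1)] .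
  obtain n where n: "K.kdim (carrier T) n" using kdim_T by blast
  obtain \<eta> where \<eta>: "K.klin (carrier T) \<eta>" "\<And>y. y \<in> B \<Longrightarrow> \<eta> y = 0" "\<eta> v = 1"
    using K.klin_separate[OF n sub_ksub[OF B(1)] vc v(3)] by blast
  define \<theta> where "\<theta> d = \<eta> (pr d \<kappa>)" for d
  have \<theta>lin: "K.klin ?D \<theta>"
    unfolding K.klin_def \<theta>_def using K.klinD[OF \<eta>(1)] Dc pr_add pr_sc pr_carrier by auto
  have \<theta>B: "\<theta> b = 0" if "b \<in> B" for b unfolding \<theta>_def by (rule \<eta>(2)[OF pr_sub[OF B(1) that]])
  have c\<theta>: "covec ?D \<kappa> \<theta>"
  proof (rule covecI[OF D \<theta>lin \<kappa>w])
    show "\<theta> x = 0" if "x \<in> ?D" "x \<in> Wt \<mu>" "\<mu> \<in> weights \<alpha>" "\<mu> \<noteq> \<kappa>" for x \<mu>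
      using pr_weight[OF that(2,3), of \<kappa>] that(4) K.klin_zero[OF K.ksub_carrier \<eta>(1)] by (simp add: \<theta>_def)
    show "\<theta> (Fa i r x) = 0" if x: "x \<in> ?D" and r: "r > 0" and w: "x \<in> Wt (\<kappa> + real r *\<^sub>R \<alpha> i)" for x i r
    proof -
      let ?k = "\<kappa> + real r *\<^sub>R \<alpha> i"
      have "x \<in> B"
      proof (rule ccontr)
        assume xB: "x \<notin> B"
        hence "x \<noteq> \<zero>" using submoduleD(2)[OF B(1)] by blast
        moreover have "?k \<in> weights \<alpha>" using weight_shift'[OF \<kappa>w] by blast
        ultimately have "?k \<in> Om" using weight_Om[OF w] by blast
        hence "?k \<in> ?W" using x w xB by blast
        from max[OF this] show False using r by simp
      qed
      thus ?thesis using \<theta>B submoduleD(6)[OF B(1) U_closed(2)] by blast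
    qed
  qed
  define \<zeta> where "\<zeta> t = \<theta> (e t)" for t
  have c\<zeta>: "covec (carrier T) \<kappa> \<zeta>"
    unfolding covec_def K.klin_def \<zeta>_def
    using K.klinD[OF \<theta>lin] covecD(2-5)[OF c\<theta>] e(2) eD(2) eD(3) by simp
  have "\<zeta> v = 1" using e(3)[OF v(1)] pr_weight[OF v(2) \<kappa>w, of \<kappa>] \<eta>(3) by (simp add: \<zeta>_def \<theta>_def)
  hence "\<kappa> \<in> labels k N \<nu>" using covec_label[OF c\<zeta> \<kappa>w vc] by simp
  then obtain i where i: "i < k" "\<nu> i = \<kappa>" unfolding labels_def by blast
  note fi = factor_j[OF i(1), unfolded i(2)]
  obtain C' where C': "P.complement (N i) C'" using filtration_splits[of i] i(1) by auto
  obtain \<phi> where \<phi>: "\<phi> \<in> module_hom_set U T T" "\<And>t. t \<in> carrier T \<Longrightarrow> \<phi> t \<in> C' \<inter> N (Suc i)"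
    "\<And>u t. u \<in> carrier U \<Longrightarrow> t \<in> carrier T \<Longrightarrow> \<xi> i (u \<star> \<phi> t) = \<zeta> (u \<star> t)"
    using section_hom[OF fi C' c\<zeta>] by blast
  note pD = P.homD[OF \<phi>(1)]
  have \<phi>eq: "\<phi> s = \<phi> t" if "s \<in> carrier T" "t \<in> carrier T" "\<And>u. u \<in> carrier U \<Longrightarrow> \<zeta> (u \<star> s) = \<zeta> (u \<star> t)" for s t
    by (rule split_factor(2)[OF fi C' \<phi>(2)[OF that(1)] \<phi>(2)[OF that(2)]])
      (use that \<phi>(3) in \<open>auto simp: rep_def\<close>)
  have \<zeta>B: "\<zeta> b = 0" if "b \<in> B" for b
    using e(3)[OF subsetD[OF B(2) that]] \<theta>B[OF that] by (simp add: \<zeta>_def)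
  have \<phi>B: "\<phi> b = \<zero>" if b: "b \<in> B" for b
  proof -
    have "\<zeta> (u \<star> b) = \<zeta> (u \<star> \<zero>)" if "u \<in> carrier U" for u
      using \<zeta>B[OF submoduleD(6)[OF B(1) that b]] \<zeta>B[OF submoduleD(2)[OF B(1)]] that by simp
    from \<phi>eq[OF Bc[OF b] M.zero_closed this] show ?thesis using pD(5) by simp
  qed
  (* So \<phi> factors through the projection e, and e \<psi> \<phi> is idempotent. *)
  have \<phi>e: "\<phi> (e t) = \<phi> t" if t: "t \<in> carrier T" for t
  proof (rule \<phi>eq[OF eD(1)[OF t] t])
    fix u assume u: "u \<in> carrier U"
    have "e (u \<star> e t) = u \<star> e t" by (rule e(3)[OF submoduleD(6)[OF D u e(2)[OF t]]])
    thus "\<zeta> (u \<star> e t) = \<zeta> (u \<star> t)" using eD(3)[OF u t] by (simp add: \<zeta>_def)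
  qed
  obtain \<psi> where \<psi>: "\<psi> \<in> module_hom_set U T T" "\<And>x. x \<in> carrier T \<Longrightarrow> \<phi> (\<psi> (\<phi> x)) = \<phi> x"
    using regular[OF \<phi>(1)] by blast
  note sD = P.homD[OF \<psi>(1)]
  define \<epsilon> where "\<epsilon> = compose (carrier T) e (compose (carrier T) \<psi> \<phi>)"
  have eps: "\<epsilon> \<in> module_hom_set U T T" unfolding \<epsilon>_def by (intro P.hom_closed(1) e(1) \<psi>(1) \<phi>(1))
  note epD = P.homD[OF eps]
  have ev: "\<epsilon> t = e (\<psi> (\<phi> t))" if "t \<in> carrier T" for t using that by (simp add: \<epsilon>_def compose_def)
  have epsD: "\<epsilon> t \<in> ?D" if "t \<in> carrier T" for t unfolding ev[OF that] by (rule e(2)[OF sD(1)[OF pD(1)[OF that]]])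
  have \<phi>eps: "\<phi> (\<epsilon> t) = \<phi> t" if "t \<in> carrier T" for t
    using ev[OF that] \<phi>e[OF sD(1)[OF pD(1)[OF that]]] \<psi>(2)[OF that] by simp
  have ee: "\<epsilon> (\<epsilon> t) = \<epsilon> t" if "t \<in> carrier T" for t
    using ev[OF epD(1)[OF that]] \<phi>eps[OF that] ev[OF that] by simp
  let ?I = "{d \<in> ?D. \<epsilon> d = d}"
  have sI: "sub ?I" by (rule submoduleI) (use submoduleD[OF D] epD Dc in auto)
  have "\<epsilon> v \<noteq> \<zero>"
  proof
    assume "\<epsilon> v = \<zero>"
    hence "\<phi> v = \<zero>" using \<phi>eps[OF vc] pD(5) by simp
    hence "\<zeta> v = \<xi> i \<zero>" using \<phi>(3)[of "\<one>\<^bsub>U\<^esub>" v] vc by (simp add: smult_one)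
    also have "\<dots> = 0" by (rule K.klin_zero[OF sub_ksub[OF factorD(2)[OF fi]] factorD(8)[OF fi]])
    finally show False using \<open>\<zeta> v = 1\<close> by simp
  qed
  hence I0: "?I \<noteq> {\<zero>}" using epsD[OF vc] ee[OF vc] by blast
  obtain x where x: "x \<in> B" "x \<in> ?I" "x \<noteq> \<zero>"
    by (rule split_indecomposable[OF f C B(1,2,3) sI _ I0]) auto
  have "\<epsilon> x = \<zero>" using ev[OF Bc[OF x(1)]] \<phi>B[OF x(1)] sD(5) eD(5) by simp
  thus False using x by simp
qed

text \<open>The split subquotients add up to \<open>T\<close>, and those that are not zero are
  simple.\<close>

lemma semisimple_T: "semisimple_module U T"
proof -
  obtain C where C: "\<And>j. j < k \<Longrightarrow> P.complement (N j) (C j)" using filtration_splits by (metis less_imp_le)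
  let ?D = "\<lambda>j. C j \<inter> N (Suc j)"
  let ?S = "{?D j | j. j < k \<and> ?D j \<noteq> {\<zero>}}"
  have fin: "finite ?S" by simp
  have simple: "simple_submodule U T L" if "L \<in> ?S" for L using that split_simple C by blast
  have sub: "sub L" if "L \<in> ?S" for L using simple[OF that] by (rule P.simple_subm)
  have X: "sub (P.ssum ?S)" by (rule P.ssum_subm[OF fin sub])
  have "N j \<subseteq> P.ssum ?S" if "j \<le> k" for j
    using that
  proof (induction j)
    case 0
    thus ?case using F submoduleD(2)[OF X] by (simp add: filt_def)
  next
    case (Suc j)
    hence j: "j < k" by simp
    note f = factor_j[OF j]
    note A = factorD(2)[OF f] and N0 = factorD(1)[OF f]
    have sC: "sub (C j)" and dec: "\<And>x. x \<in> carrier T \<Longrightarrow> \<exists>n\<in>N j. \<exists>c\<in>C j. x = n \<oplus> c"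
      using C[OF j] by (auto simp: P.complement_def)
    have DX: "?D j \<subseteq> P.ssum ?S"
    proof (cases "?D j = {\<zero>}")
      case False
      hence "?D j \<in> ?S" using j by blast
      thus ?thesis by (intro P.ssum_mem[OF fin sub])
    qed (use submoduleD(2)[OF X] in simp)
    show ?case
    proof
      fix x assume x: "x \<in> N (Suc j)"
      obtain n c where nc: "n \<in> N j" "c \<in> C j" "x = n \<oplus> c" using dec[OF submoduleD(1)[OF A x]] by blast
      have cs: "n \<in> carrier T" "c \<in> carrier T" using nc submoduleD(1)[OF N0] submoduleD(1)[OF sC] by auto
      have "c = x \<ominus> n" using nc(3) cs by (simp add: a_minus_def M.a_ac M.r_neg)
      moreover have "n \<in> N (Suc j)" using nc(1) factorD(5)[OF f] by blast
      ultimately have "c \<in> N (Suc j)" using submoduleD(5)[OF A x] by metis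
      hence "c \<in> ?D j" using nc(2) by simp
      thus "x \<in> P.ssum ?S" using nc Suc.IH j DX submoduleD(3)[OF X] by auto
    qed
  qed
  from this[of k] have "P.ssum ?S = carrier T" using F submoduleD(1)[OF X] by (auto simp: filt_def)
  from P.semisimpleI[OF fin simple this] show ?thesis .
qed

end

section \<open>Tilting modules\<close>

theorem theorem4p13:
  fixes \<Phi> :: "'e::euclidean_space set"
    and \<alpha> :: "'i::finite \<Rightarrow> 'e"
    and q :: "'k::field"
    and T :: "('i, 'k, 'm) uq_module"
  assumes "root_system \<Phi>"
    and "simple_roots \<Phi> \<alpha>"
    and "admissible_parameter \<alpha> q"
    and "tilting_module \<alpha> q T"
  shows "semisimple_ring (endomorphism_ring (uq \<alpha> q) T) \<longleftrightarrow> semisimple_module (uq \<alpha> q) T"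
proof -
  have q: "q \<noteq> 0" using assms(3) by (simp add: admissible_parameter_def)
  note t = assms(4)[unfolded tilting_module_def]
  interpret quantum_data \<Phi> \<alpha> q by (intro quantum_data.intro assms(1,2) q)
  interpret fd_module \<Phi> \<alpha> q T
    using t by (intro fd_module.intro weight_module.intro fd_module_axioms.intro quantum_data_axioms) auto
  interpret S: fd_module \<Phi> \<alpha> q Td by (rule dual_fd_module)
  show ?thesis
  proof
    assume ss: "semisimple_ring (endomorphism_ring U T)"
    obtain k N \<nu> \<xi> where F: "filt k N \<nu> \<xi>" using nabla_filtration t by metis
    obtain k' N' \<nu>' \<xi>' where F': "S.filt k' N' \<nu>' \<xi>'" using weyl_filtration t by metis
    have labels: "S.labels k' N' \<nu>' = labels k N \<nu>" by (rule dual_labels[OF F F'])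
    have "regular_filtered \<Phi> \<alpha> q T k N \<nu> \<xi>"
    proof (intro regular_filtered.intro fd_module_axioms regular_filtered_axioms.intro F)
      fix \<kappa> assume "\<kappa> \<in> labels k N \<nu>"
      hence "\<kappa> \<in> S.labels k' N' \<nu>'" unfolding labels .
      then obtain \<zeta> where \<zeta>: "\<zeta> \<in> S.Wt \<kappa>" "\<zeta> \<noteq> \<zero>\<^bsub>Td\<^esub>" "\<And>i r. r > 0 \<Longrightarrow> uq_E \<alpha> q i r \<odot>\<^bsub>Td\<^esub> \<zeta> = \<zero>\<^bsub>Td\<^esub>"
        using S.label_highest_weight[OF F'] by blast
      have "\<exists>x\<in>carrier T. \<zeta> x \<noteq> 0"
      proof (rule ccontr)
        assume "\<not> ?thesis"
        hence "\<zeta> x = 0" for x using dualD(1)[OF S.WtD(1)[OF \<zeta>(1)], of x] by blast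
        thus False using \<zeta>(2) by (simp add: fun_eq_iff)
      qed
      thus "\<exists>\<zeta>. covec (carrier T) \<kappa> \<zeta> \<and> (\<exists>x\<in>carrier T. \<zeta> x \<noteq> 0)"
        using covec_of_dual[OF \<zeta>(1,3)] by blast
    next
      fix \<kappa> \<zeta> x assume c: "covec (carrier T) \<kappa> \<zeta>" and \<kappa>: "\<kappa> \<in> weights \<alpha>" and x: "x \<in> carrier T" "\<zeta> x \<noteq> 0"
      let ?z = "\<lambda>x. if x \<in> carrier T then \<zeta> x else 0"
      have "?z x \<noteq> 0" using x by simp
      hence "?z \<noteq> \<zero>\<^bsub>Td\<^esub>" unfolding dual_ops by meson
      from S.highest_weight_label[OF F' covec_to_dual(1)[OF c] \<kappa> this covec_to_dual(2)[OF c]]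
      show "\<kappa> \<in> labels k N \<nu>" unfolding labels .
    next
      fix \<phi> assume \<phi>: "\<phi> \<in> module_hom_set U T T"
      obtain \<psi> where \<psi>: "\<psi> \<in> carrier P.End" "\<phi> \<otimes>\<^bsub>P.End\<^esub> \<psi> \<otimes>\<^bsub>P.End\<^esub> \<phi> = \<phi>"
        using semisimple_ring_regular[OF P.End_ring ss, of \<phi>] \<phi> by (auto simp: P.End_simps)
      have "\<phi> (\<psi> (\<phi> x)) = \<phi> x" if "x \<in> carrier T" for x
        using fun_cong[OF \<psi>(2), of x] that P.homD(1)[OF \<phi> that] by (simp add: P.End_simps compose_def)
      thus "\<exists>\<psi>\<in>module_hom_set U T T. \<forall>x\<in>carrier T. \<phi> (\<psi> (\<phi> x)) = \<phi> x"
        using \<psi>(1) by (auto simp: P.End_simps)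
    qed
    thus "semisimple_module U T" by (rule regular_filtered.semisimple_T)
  next
    assume ss: "semisimple_module U T"
    obtain B where B: "finite B" "B \<subseteq> carrier T" "\<And>m. m \<in> carrier T \<Longrightarrow> \<exists>c. m = (\<Oplus>\<^bsub>T\<^esub>b\<in>B. sc (c b) b)"
      using fd unfolding finite_dimensional_def by blast
    have gen: "X = carrier T" if X: "sub X" "B \<subseteq> X" for X
    proof
      show "carrier T \<subseteq> X"
      proof
        fix m assume "m \<in> carrier T"
        then obtain c where "m = (\<Oplus>\<^bsub>T\<^esub>b\<in>B. sc (c b) b)" using B(3) by blast
        moreover have "(\<Oplus>\<^bsub>T\<^esub>b\<in>B. sc (c b) b) \<in> X"
          by (rule finsum_in_submodule[OF X(1) B(1)]) (use submoduleD(6)[OF X(1) U_closed(7)] X(2) in blast)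
        ultimately show "m \<in> X" by simp
      qed
    qed (use submoduleD(1)[OF X(1)] in blast)
    obtain S where "finite S" "\<And>N. N \<in> S \<Longrightarrow> simple_submodule U T N" "P.ssum S = carrier T"
      using P.semisimpleE[OF ss B(1,2) gen] by metis
    thus "semisimple_ring (endomorphism_ring U T)" by (rule P.semisimple_End)
  qed
qed

end
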